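(* Let $G$ be a simple $6$-regular triangulation of the torus. Suppose one of the following holds: (1) $G$ is isomorphic to $T(r,s,t)$ for some $r\ge 4$ (and some $s\ge1$, $0\le t\le s-1$); (2) $G$ is isomorphic to $T(1,s,2)$ for some $s\ge 9$ with $s\neq 11$; (3) $G$ is isomorphic to $T(2,s,t)$ for some $s$ and $t$ both even; (4) $G$ is $3$-chromatic (i.e. $\chi(G)=3$). Then $G$ is $5$-choosable. Moreover, in each of these cases there is an algorithm which, given $G$ and any assignment of lists of size $5$ to its vertices, outputs a proper coloring of $G$ from these lists in time linear in $|V(G)|$. Furthermore, none of these graphs $G$ is $3$-choosable. Hence $\mathrm{ch}(G)\in\{4,5\}$ whenever any of the cases (1)–(4) holds.
   Context: Graph $T(r,s,t)$: for integers $r\ge1$, $s\ge1$, $0\le t\le s-1$, the vertex set is $\{(i,j):1\le i\le r,\ 1\le j\le s\}$, with the first coordinate taken modulo $r$ and the second modulo $s$, and edges as follows. For $1<i<r$, $(i,j)$ is adjacent to $(i,j\pm1)$, $(i\pm1,j)$ and $(i\pm1,j\mp1)$. If $r>1$, $(1,j)$ is adjacent to $(1,j\pm1)$, $(2,j)$, $(2,j-1)$, $(r,j+t+1)$, $(r,j+t)$; and $(r,j)$ is adjacent to $(r,j\pm1)$, $(r-1,j+1)$, $(r-1,j)$, $(1,j-t)$, $(1,j-t-1)$. If $r=1$, $(1,j)$ is adjacent to $(1,j\pm1)$, $(1,j\pm t)$, $(1,j\pm(t+1))$. (In general $T(r,s,t)$ may have loops or multiple edges; "simple" means it has neither.) Each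 $T(r,s,t)$ is a $6$-regular triangulation of the torus. List coloring: a list assignment $\mathcal L$ on a graph $G$ assigns to each vertex $v$ a set $L(v)\subset\mathbb N$; $G$ is $\mathcal L$-choosable if there is a proper coloring $c$ with $c(v)\in L(v)$ for all $v$. $G$ is $k$-choosable if it is $\mathcal L$-choosable for every list assignment with all lists of size at least $k$; $\mathrm{ch}(G)$ is the least such $k$; $\chi(G)$ is the chromatic number. *)

theory Defs
  imports Complex_Main "HOL-Library.Multiset"
begin

section \<open>Finite simple graphs and list colouring\<close>

definition simple_graph :: "'a set \<Rightarrow> ('a \<Rightarrow> 'a \<Rightarrow> bool) \<Rightarrow> bool" where
  "simple_graph V E \<longleftrightarrow>
     finite V \<and> (\<forall>x y. E x y \<longrightarrow> x \<in> V \<and> y \<in> V \<and> x \<noteq> y \<and> E y x)"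

definition nbhd :: "('a \<Rightarrow> 'a \<Rightarrow> bool) \<Rightarrow> 'a \<Rightarrow> 'a set" where
  "nbhd E v = {w. E v w}"

definition regular_graph :: "nat \<Rightarrow> 'a set \<Rightarrow> ('a \<Rightarrow> 'a \<Rightarrow> bool) \<Rightarrow> bool" where
  "regular_graph d V E \<longleftrightarrow> (\<forall>v\<in>V. card (nbhd E v) = d)"

definition connected_graph :: "'a set \<Rightarrow> ('a \<Rightarrow> 'a \<Rightarrow> bool) \<Rightarrow> bool" where
  "connected_graph V E \<longleftrightarrow> V \<noteq> {} \<and> (\<forall>x\<in>V. \<forall>y\<in>V. E\<^sup>*\<^sup>* x y)"

definition edges :: "('a \<Rightarrow> 'a \<Rightarrow> bool) \<Rightarrow> 'a set set" where
  "edges E = {{x, y} | x y. E x y}"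

definition proper_colouring :: "'a set \<Rightarrow> ('a \<Rightarrow> 'a \<Rightarrow> bool) \<Rightarrow> ('a \<Rightarrow> nat) \<Rightarrow> bool" where
  "proper_colouring V E c \<longleftrightarrow> (\<forall>x\<in>V. \<forall>y\<in>V. E x y \<longrightarrow> c x \<noteq> c y)"

definition chromatic_number :: "'a set \<Rightarrow> ('a \<Rightarrow> 'a \<Rightarrow> bool) \<Rightarrow> nat" where
  "chromatic_number V E = (LEAST k. \<exists>c. proper_colouring V E c \<and> c ` V \<subseteq> {..<k})"

definition list_colouring ::
    "'a set \<Rightarrow> ('a \<Rightarrow> 'a \<Rightarrow> bool) \<Rightarrow> ('a \<Rightarrow> nat set) \<Rightarrow> ('a \<Rightarrow> nat) \<Rightarrow> bool" where
  "list_colouring V E L c \<longleftrightarrow> proper_colouring V E c \<and> (\<forall>v\<in>V. c v \<in> L v)"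

text \<open>Lists are arbitrary sets of naturals; an infinite list counts as having size at
  least \<open>k\<close> (its \<^const>\<open>card\<close> is \<open>0\<close>).\<close>

definition choosable :: "nat \<Rightarrow> 'a set \<Rightarrow> ('a \<Rightarrow> 'a \<Rightarrow> bool) \<Rightarrow> bool" where
  "choosable k V E \<longleftrightarrow>
     (\<forall>L. (\<forall>v\<in>V. infinite (L v) \<or> k \<le> card (L v)) \<longrightarrow> (\<exists>c. list_colouring V E L c))"

definition choice_number :: "'a set \<Rightarrow> ('a \<Rightarrow> 'a \<Rightarrow> bool) \<Rightarrow> nat" where
  "choice_number V E = (LEAST k. choosable k V E)"


section \<open>Triangulations of the torus\<close>

text \<open>A cellular embedding of a connected graph in a closed orientable surface is given, up to
  orientation-preserving homeomorphism, by a rotation system: a cyclic ordering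
  \<open>rot v\<close> of the neighbours of every vertex \<open>v\<close>.  The faces are traced by the orbits of
  \<open>(u, v) \<mapsto> (v, rot v u)\<close> on the directed edges (so the cardinality of such an orbit is the
  length of the boundary walk of the face), and the surface is the torus iff the
  Euler characteristic vanishes.\<close>

definition rotation_system :: "'a set \<Rightarrow> ('a \<Rightarrow> 'a \<Rightarrow> bool) \<Rightarrow> ('a \<Rightarrow> 'a \<Rightarrow> 'a) \<Rightarrow> bool" where
  "rotation_system V E rot \<longleftrightarrow>
     (\<forall>v\<in>V. bij_betw (rot v) (nbhd E v) (nbhd E v) \<and>
        (\<forall>x\<in>nbhd E v. \<forall>y\<in>nbhd E v. \<exists>k. (rot v ^^ k) x = y))"

fun face_step :: "('a \<Rightarrow> 'a \<Rightarrow> 'a) \<Rightarrow> 'a \<times> 'a \<Rightarrow> 'a \<times> 'a" where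
  "face_step rot (u, v) = (v, rot v u)"

definition faces :: "('a \<Rightarrow> 'a \<Rightarrow> bool) \<Rightarrow> ('a \<Rightarrow> 'a \<Rightarrow> 'a) \<Rightarrow> ('a \<times> 'a) set set" where
  "faces E rot = {{(face_step rot ^^ k) (u, v) | k. True} | u v. E u v}"

definition torus_embedding :: "'a set \<Rightarrow> ('a \<Rightarrow> 'a \<Rightarrow> bool) \<Rightarrow> ('a \<Rightarrow> 'a \<Rightarrow> 'a) \<Rightarrow> bool" where
  "torus_embedding V E rot \<longleftrightarrow>
     connected_graph V E \<and> rotation_system V E rot \<and>
     int (card V) - int (card (edges E)) + int (card (faces E rot)) = 0"

definition torus_triangulation :: "'a set \<Rightarrow> ('a \<Rightarrow> 'a \<Rightarrow> bool) \<Rightarrow> bool" where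
  "torus_triangulation V E \<longleftrightarrow>
     (\<exists>rot. torus_embedding V E rot \<and> (\<forall>f\<in>faces E rot. card f = 3))"

definition simple_6_regular_torus_triangulation ::
    "'a set \<Rightarrow> ('a \<Rightarrow> 'a \<Rightarrow> bool) \<Rightarrow> bool" where
  "simple_6_regular_torus_triangulation V E \<longleftrightarrow>
     simple_graph V E \<and> regular_graph 6 V E \<and> torus_triangulation V E"


section \<open>The graphs \<open>T(r,s,t)\<close>\<close>

text \<open>\<open>T(r,s,t)\<close> may have loops and parallel edges, so its adjacencies are recorded as the
  multiset of the six neighbours of each vertex (a loop contributes two entries).\<close>

definition T_verts :: "int \<Rightarrow> int \<Rightarrow> (int \<times> int) set" where
  "T_verts r s = {1..r} \<times> {1..s}"

text \<open>The second coordinate modulo \<open>s\<close>, with representatives \<open>1, \<dots>, s\<close>.  In the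
  formulas below the first coordinate never leaves \<open>{1..r}\<close>.\<close>

definition wrap :: "int \<Rightarrow> int \<times> int \<Rightarrow> int \<times> int" where
  "wrap s = (\<lambda>(i, j). (i, (j - 1) mod s + 1))"

definition T_nbrs :: "int \<Rightarrow> int \<Rightarrow> int \<Rightarrow> int \<times> int \<Rightarrow> (int \<times> int) multiset" where
  "T_nbrs r s t = (\<lambda>(i, j). image_mset (wrap s)
     (if r = 1 then
        {#(1, j + 1), (1, j - 1), (1, j + t), (1, j - t), (1, j + (t + 1)), (1, j - (t + 1))#}
      else if i = 1 then
        {#(1, j + 1), (1, j - 1), (2, j), (2, j - 1), (r, j + t + 1), (r, j + t)#}
      else if i = r then
        {#(r, j + 1), (r, j - 1), (r - 1, j + 1), (r - 1, j), (1, j - t), (1, j - t - 1)#}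
      else
        {#(i, j + 1), (i, j - 1), (i + 1, j), (i - 1, j), (i + 1, j - 1), (i - 1, j + 1)#}))"

text \<open>Isomorphism, as multigraphs, of a simple graph with \<open>T(r,s,t)\<close>; in particular this
  forces \<open>T(r,s,t)\<close> to be simple.\<close>

definition iso_T :: "'a set \<Rightarrow> ('a \<Rightarrow> 'a \<Rightarrow> bool) \<Rightarrow> int \<Rightarrow> int \<Rightarrow> int \<Rightarrow> bool" where
  "iso_T V E r s t \<longleftrightarrow>
     r \<ge> 1 \<and> s \<ge> 1 \<and> 0 \<le> t \<and> t \<le> s - 1 \<and>
     (\<exists>f. bij_betw f V (T_verts r s) \<and>
        (\<forall>v\<in>V. image_mset f (mset_set (nbhd E v)) = T_nbrs r s t (f v)))"

definition case1 :: "'a set \<Rightarrow> ('a \<Rightarrow> 'a \<Rightarrow> bool) \<Rightarrow> bool" where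
  "case1 V E \<longleftrightarrow> (\<exists>r s t. r \<ge> 4 \<and> iso_T V E r s t)"

definition case2 :: "'a set \<Rightarrow> ('a \<Rightarrow> 'a \<Rightarrow> bool) \<Rightarrow> bool" where
  "case2 V E \<longleftrightarrow> (\<exists>s. s \<ge> 9 \<and> s \<noteq> 11 \<and> iso_T V E 1 s 2)"

definition case3 :: "'a set \<Rightarrow> ('a \<Rightarrow> 'a \<Rightarrow> bool) \<Rightarrow> bool" where
  "case3 V E \<longleftrightarrow> (\<exists>s t. even s \<and> even t \<and> iso_T V E 2 s t)"

definition case4 :: "'a set \<Rightarrow> ('a \<Rightarrow> 'a \<Rightarrow> bool) \<Rightarrow> bool" where
  "case4 V E \<longleftrightarrow> chromatic_number V E = 3"


section \<open>Linear-time algorithms\<close>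

text \<open>The machine model is the uniform-cost random access machine with addition and truncated
  subtraction, programmed by structured commands.  The memory consists of arrays of natural
  numbers; scalar variables are cells with a constant index.  One time unit is charged per
  executed command or test: the expressions of a fixed program have bounded size, so this is the
  number of elementary operations up to a constant factor depending only on the program.\<close>

type_synonym memory = "string \<Rightarrow> nat \<Rightarrow> nat"

datatype aexp =
    Const nat
  | Cell string aexp
  | Plus aexp aexp
  | Minus aexp aexp

datatype bexp =
    Less aexp aexp
  | Equal aexp aexp
  | Neg bexp
  | Conj bexp bexp

datatype com =
    Skip
  | Assign string aexp aexp
  | Seq com com
  | Cond bexp com com
  | While bexp com

primrec aval :: "aexp \<Rightarrow> memory \<Rightarrow> nat" where
  "aval (Const k) m = k"
| "aval (Cell a i) m = m a (aval i m)"
| "aval (Plus x y) m = aval x m + aval y m"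
| "aval (Minus x y) m = aval x m - aval y m"

primrec bval :: "bexp \<Rightarrow> memory \<Rightarrow> bool" where
  "bval (Less x y) m \<longleftrightarrow> aval x m < aval y m"
| "bval (Equal x y) m \<longleftrightarrow> aval x m = aval y m"
| "bval (Neg b) m \<longleftrightarrow> \<not> bval b m"
| "bval (Conj b c) m \<longleftrightarrow> bval b m \<and> bval c m"

text \<open>\<open>exec p m n m'\<close>: started in memory \<open>m\<close>, the program \<open>p\<close> halts after exactly \<open>n\<close>
  steps in memory \<open>m'\<close>.  \<open>Assign a i x\<close> stores the value of \<open>x\<close> in cell \<open>i\<close> of array \<open>a\<close>.\<close>

inductive exec :: "com \<Rightarrow> memory \<Rightarrow> nat \<Rightarrow> memory \<Rightarrow> bool" where
  exec_Skip: "exec Skip m 1 m"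
| exec_Assign: "exec (Assign a i x) m 1 (m(a := (m a)(aval i m := aval x m)))"
| exec_Seq: "exec p m k m' \<Longrightarrow> exec q m' l m'' \<Longrightarrow> exec (Seq p q) m (k + l) m''"
| exec_Cond_True: "bval b m \<Longrightarrow> exec p m k m' \<Longrightarrow> exec (Cond b p q) m (k + 1) m'"
| exec_Cond_False: "\<not> bval b m \<Longrightarrow> exec q m k m' \<Longrightarrow> exec (Cond b p q) m (k + 1) m'"
| exec_While_False: "\<not> bval b m \<Longrightarrow> exec (While b p) m 1 m"
| exec_While_True: "bval b m \<Longrightarrow> exec p m k m' \<Longrightarrow> exec (While b p) m' l m'' \<Longrightarrow>
    exec (While b p) m (k + l + 1) m''"

text \<open>\<open>encodes e V E L m\<close>: the memory \<open>m\<close> presents the 6-regular graph \<open>(V, E)\<close> by adjacency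
  lists and the list assignment \<open>L\<close> with lists of size 5, the vertices being numbered
  \<open>0, \<dots>, card V - 1\<close> by \<open>e\<close>.  Numbering, order of each adjacency list and order of each colour
  list are arbitrary.  All remaining cells are zero.\<close>

definition encodes ::
    "(nat \<Rightarrow> 'a) \<Rightarrow> 'a set \<Rightarrow> ('a \<Rightarrow> 'a \<Rightarrow> bool) \<Rightarrow> ('a \<Rightarrow> nat set) \<Rightarrow> memory \<Rightarrow> bool" where
  "encodes e V E L m \<longleftrightarrow>
     bij_betw e {..<card V} V \<and>
     m ''size'' 0 = card V \<and>
     (\<forall>i<card V. bij_betw (\<lambda>k. e (m ''nbr'' (6 * i + k))) {..<6} (nbhd E (e i)) \<and>
        (\<forall>k<6. m ''nbr'' (6 * i + k) < card V)) \<and>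
     (\<forall>i<card V. bij_betw (\<lambda>k. m ''col'' (5 * i + k)) {..<5} (L (e i))) \<and>
     (\<forall>a i. a \<notin> {''size'', ''nbr'', ''col''} \<longrightarrow> m a i = 0) \<and>
     (\<forall>i\<ge>1. m ''size'' i = 0) \<and>
     (\<forall>i\<ge>6 * card V. m ''nbr'' i = 0) \<and>
     (\<forall>i\<ge>5 * card V. m ''col'' i = 0)"

text \<open>One program and one constant have to serve all graphs of the class \<open>K\<close> and all lists of
  size 5; the colour of vertex number \<open>i\<close> is returned in cell \<open>i\<close> of the array \<open>out\<close>.\<close>

definition linear_time_5_list_colouring ::
    "('a set \<Rightarrow> ('a \<Rightarrow> 'a \<Rightarrow> bool) \<Rightarrow> bool) \<Rightarrow> bool" where
  "linear_time_5_list_colouring K \<longleftrightarrow>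
     (\<exists>p C. \<forall>V E L e m.
        K V E \<and> (\<forall>v\<in>V. finite (L v) \<and> card (L v) = 5) \<and> encodes e V E L m \<longrightarrow>
        (\<exists>n m' c. exec p m n m' \<and> n \<le> C * card V \<and>
           list_colouring V E L c \<and> (\<forall>i<card V. m' ''out'' i = c (e i))))"

end

theory Submission
  imports Defs
begin

text \<open>
  Call a vertex of a partially coloured graph peelable if it has more colours left than
  uncoloured neighbours that have not been peeled before. Once every uncoloured vertex has been
  peeled, the colouring extends greedily in the reverse order. In a 6-regular graph with lists of
  size 5, a vertex is peelable after two of its neighbours, so a few precoloured vertices that save
  colours at well chosen places start an avalanche. Each of the graphs is a quotient of the
  triangular lattice (for a 3-chromatic triangulation, because translations act on the directed
  edges and preserve the colour classes), and in every case at most twelve precoloured vertices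
  near any given vertex suffice.

  An algorithm therefore tries all ways to precolour at most twelve vertices around vertex 0 and runs
  the peeling with a queue; the number of attempts does not depend on the graph.

  A triangulation that is 3-choosable is 3-chromatic, and its 3-colouring is rigid. Lists that
  replace a colour by a fourth one on a few vertices, so that two adjacent vertices are
  both forced to take the fourth colour whatever the permutation of the colours is, give a contradiction.
\<close>

section \<open>Peeling a partially coloured graph\<close>

text \<open>If colouring the neighbours of a vertex has cost it i colours fewer than there are
  coloured neighbours, the vertex is peelable after 2 - i peeled neighbours. An avalanche therefore
  needs one vertex with two savings, then neighbours with one saving each, until pairs of peeled
  neighbours carry it on. A saving comes from two nonadjacent neighbours: they share a free colour,
  or together they have more free colours than a list of size 5 can hold. The obstacle is that in a
  thin quotient the precoloured vertices meet or become adjacent. Hence the separate treatment of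
  rows of three vertices, of two rows, of levels with two vertices and of K_{3,3,3}; the cubes of
  the cycles of length 9 and 10 are precoloured completely by a Hall argument. For a 3-chromatic
  triangulation the quotient has to be constructed: a translated directed edge might return to its
  vertex turned. The colours leave only turns by 120 or 240 degrees, and such a turn combined with a
  translation would fix a lattice vertex together with a directed edge there that it turns.\<close>

locale list_graph =
  fixes V :: "'a set" and E :: "'a \<Rightarrow> 'a \<Rightarrow> bool" and L :: "'a \<Rightarrow> nat set"
  assumes graph: "simple_graph V E" and regular: "regular_graph 6 V E"
    and lists: "v \<in> V \<Longrightarrow> finite (L v) \<and> card (L v) = 5"
begin

abbreviation N :: "'a \<Rightarrow> 'a set" where "N v \<equiv> nbhd E v"

lemma finite_V: "finite V"
  and E_V: "E x y \<Longrightarrow> x \<in> V" "E x y \<Longrightarrow> y \<in> V"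
  and E_irrefl: "\<not> E x x"
  and E_sym: "E x y \<Longrightarrow> E y x"
  using graph by (auto simp: simple_graph_def)

lemma N_iff: "w \<in> N v \<longleftrightarrow> E v w"
  by (simp add: nbhd_def)

lemma N_subset: "N v \<subseteq> V"
  using E_V by (auto simp: nbhd_def)

lemma finite_N: "finite (N v)"
  using N_subset finite_V finite_subset by blast

lemma card_N: "v \<in> V \<Longrightarrow> card (N v) = 6"
  using regular by (simp add: regular_graph_def)

definition pcol :: "'a set \<Rightarrow> ('a \<Rightarrow> nat) \<Rightarrow> bool" where
  "pcol P c \<longleftrightarrow> P \<subseteq> V \<and> (\<forall>v\<in>P. c v \<in> L v) \<and> (\<forall>u\<in>P. \<forall>v\<in>P. E u v \<longrightarrow> c u \<noteq> c v)"

definition avail :: "'a set \<Rightarrow> ('a \<Rightarrow> nat) \<Rightarrow> 'a \<Rightarrow> nat set" where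
  "avail P c v = L v - c ` (N v \<inter> P)"

text \<open>\<open>sv P c i v\<close>: colouring \<open>P\<close> has cost the list of \<open>v\<close> at least \<open>i\<close> colours fewer than
  the number of coloured neighbours of \<open>v\<close>.\<close>

definition sv :: "'a set \<Rightarrow> ('a \<Rightarrow> nat) \<Rightarrow> nat \<Rightarrow> 'a \<Rightarrow> bool" where
  "sv P c i v \<longleftrightarrow> 5 + i \<le> card (N v \<inter> P) + card (avail P c v)"

text \<open>A peeled vertex keeps a colour even after all its neighbours outside \<open>P\<close>
  and \<open>Q\<close> have been coloured, and those in \<open>Q\<close> are coloured later.
  Allowing any set \<open>Q\<close> of peeled vertices makes the result independent of the order of
  peeling.\<close>

inductive_set peel :: "'a set \<Rightarrow> ('a \<Rightarrow> nat) \<Rightarrow> 'a set" for P c where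
  peelI: "v \<in> V \<Longrightarrow> v \<notin> P \<Longrightarrow> (\<And>u. u \<in> Q \<Longrightarrow> u \<in> peel P c) \<Longrightarrow>
    card (N v - P - Q) < card (avail P c v) \<Longrightarrow> v \<in> peel P c"

lemma peel_subset: "peel P c \<subseteq> V - P"
  by (auto elim: peel.cases)

lemma finite_avail: "v \<in> V \<Longrightarrow> finite (avail P c v)"
  using lists by (auto simp: avail_def)

lemma card_avail_ge:
  assumes "v \<in> V"
  shows "5 \<le> card (N v \<inter> P) + card (avail P c v)"
proof -
  have "card (L v) - card (c ` (N v \<inter> P)) \<le> card (avail P c v)"
    unfolding avail_def using finite_N[of v] by (intro diff_card_le_card_Diff) auto
  moreover have "card (c ` (N v \<inter> P)) \<le> card (N v \<inter> P)"
    using finite_N[of v] by (intro card_image_le) auto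
  ultimately show ?thesis using lists[OF assms] by linarith
qed

lemma sv_0: "v \<in> V \<Longrightarrow> sv P c 0 v"
  using card_avail_ge by (simp add: sv_def)

text \<open>At most 6 - |N v \<inter> P| - |Q| neighbours compete for at least 5 + i - |N v \<inter>
  P| colours, so i + |Q| = 2 is just enough.\<close>

lemma sv_peel:
  assumes "sv P c i v" "v \<in> V" "v \<notin> P" "Q \<subseteq> N v" "Q \<subseteq> peel P c" "2 \<le> i + card Q"
  shows "v \<in> peel P c"
proof (rule peelI[of v P Q])
  have fQ: "finite Q" using assms(4) finite_N finite_subset by blast
  have d: "Q \<inter> P = {}" using assms(5) peel_subset by blast
  have "card (N v) = card (N v \<inter> P) + card (N v - P)"
    using finite_N[of v] by (metis card_Int_Diff)
  moreover have "card (N v - P - Q) = card (N v - P) - card Q"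
    using fQ d assms(4) by (intro card_Diff_subset) auto
  moreover have "card Q \<le> card (N v - P)"
    using finite_N d assms(4) by (intro card_mono) auto
  ultimately show "card (N v - P - Q) < card (avail P c v)"
    using assms(1,6) card_N[OF assms(2)] unfolding sv_def by linarith
qed (use assms in auto)

lemma peel_two:
  assumes "u \<in> peel P c" "w \<in> peel P c" "E v u" "E v w" "u \<noteq> w" "v \<notin> P"
  shows "v \<in> peel P c"
  using assms E_V by (intro sv_peel[of P c 0 v "{u, w}"]) (auto simp: sv_0 nbhd_def)

lemma peel_one:
  assumes "u \<in> peel P c" "E v u" "sv P c 1 v" "v \<notin> P"
  shows "v \<in> peel P c"
  using assms E_V by (intro sv_peel[of P c 1 v "{u}"]) (auto simp: nbhd_def)

lemma peel_none:
  assumes "v \<in> V" "sv P c 2 v" "v \<notin> P"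
  shows "v \<in> peel P c"
  using assms by (intro sv_peel[of P c 2 v "{}"]) auto

section \<open>Extending a precolouring so that chosen vertices save colours\<close>

definition extends :: "'a set \<Rightarrow> ('a \<Rightarrow> nat) \<Rightarrow> 'a set \<Rightarrow> ('a \<Rightarrow> nat) \<Rightarrow> bool" where
  "extends P c P' c' \<longleftrightarrow> P \<subseteq> P' \<and> (\<forall>v\<in>P. c' v = c v)"

text \<open>Each further coloured neighbour costs at most one colour, so a saving survives every
  extension. This is what allows savings to be arranged one after the other.\<close>

lemma sv_mono:
  assumes "extends P c P' c'" "sv P c i v" "v \<in> V"
  shows "sv P' c' i v"
proof -
  let ?D = "N v \<inter> P' - P"
  have sub: "P \<subseteq> P'" and eq: "\<And>v. v \<in> P \<Longrightarrow> c' v = c v"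
    using assms(1) by (auto simp: extends_def)
  have h: "card (N v \<inter> P') = card (N v \<inter> P) + card ?D"
  proof -
    have "N v \<inter> P' = (N v \<inter> P) \<union> ?D" using sub by auto
    moreover have "card ((N v \<inter> P) \<union> ?D) = card (N v \<inter> P) + card ?D"
      using finite_N[of v] by (intro card_Un_disjoint) auto
    ultimately show ?thesis by simp
  qed
  have "avail P c v - c' ` ?D \<subseteq> avail P' c' v"
    using sub eq by (auto simp: avail_def image_iff)
  then have "card (avail P c v - c' ` ?D) \<le> card (avail P' c' v)"
    using finite_avail[OF assms(3)] by (intro card_mono)
  moreover have "card (avail P c v) - card (c' ` ?D) \<le> card (avail P c v - c' ` ?D)"
    using finite_N[of v] by (intro diff_card_le_card_Diff) auto
  moreover have "card (c' ` ?D) \<le> card ?D"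
    using finite_N[of v] by (intro card_image_le) auto
  ultimately show ?thesis using assms(2) h unfolding sv_def by linarith
qed

lemma extends_trans: "extends P c P' c' \<Longrightarrow> extends P' c' P'' c'' \<Longrightarrow> extends P c P'' c''"
  by (auto simp: extends_def)

lemma extends_upd: "k \<notin> P \<Longrightarrow> extends P c (insert k P) (c(k := a))"
  by (auto simp: extends_def)

lemma pcol_upd:
  assumes "pcol P c" "k \<in> V" "k \<notin> P" "a \<in> avail P c k"
  shows "pcol (insert k P) (c(k := a))"
proof -
  have "c u \<noteq> a" if "u \<in> P" "E u k \<or> E k u" for u
    using assms(4) that E_sym by (auto simp: avail_def nbhd_def)
  then show ?thesis
    using assms E_irrefl[of k] by (auto simp: pcol_def avail_def)
qed

lemma avail_upd:
  assumes "k \<notin> P"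
  shows "avail (insert k P) (c(k := a)) v = (if E v k then avail P c v - {a} else avail P c v)"
proof -
  have "(c(k := a)) ` (N v \<inter> P) = c ` (N v \<inter> P)" using assms by (intro image_cong) auto
  then show ?thesis by (auto simp: avail_def N_iff Int_insert_right)
qed

lemma card_N_insert:
  assumes "k \<notin> P"
  shows "card (N v \<inter> insert k P) = (if E v k then Suc (card (N v \<inter> P)) else card (N v \<inter> P))"
  using assms finite_N[of v] by (auto simp: N_iff Int_insert_right)

lemma sv_upd_out:
  assumes "sv P c i v" "E v k" "k \<notin> P" "a \<notin> avail P c v"
  shows "sv (insert k P) (c(k := a)) (Suc i) v"
  using assms by (simp add: sv_def avail_upd card_N_insert)

text \<open>A colour that is free at \<open>k\<close> but not at \<open>e\<close> costs
  \<open>e\<close> nothing. If there is none, all colours free at \<open>k\<close> are free at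
  \<open>e\<close>, and the numerical hypothesis says that \<open>e\<close> has the additional
  saving already.\<close>

lemma ext_single:
  assumes "pcol P c" "k \<notin> P" "E e k" "sv P c i e"
    and "6 + i \<le> card (avail P c k) + card (N e \<inter> P)"
  shows "\<exists>c'. extends P c (insert k P) c' \<and> pcol (insert k P) c' \<and>
    sv (insert k P) c' (Suc i) e"
proof -
  have V: "k \<in> V" "e \<in> V" using assms(3) E_V by auto
  have ne: "\<exists>a. a \<in> avail P c k \<and> sv (insert k P) (c(k := a)) (Suc i) e"
  proof (cases "avail P c k \<subseteq> avail P c e")
    case False
    then obtain a where "a \<in> avail P c k" "a \<notin> avail P c e" by blast
    then have "sv (insert k P) (c(k := a)) (Suc i) e"
      using sv_upd_out[OF assms(4) assms(3) assms(2)] by metis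
    show ?thesis by (intro exI conjI) fact+
  next
    case True
    have "card (N e \<inter> P) < 6"
    proof -
      have "k \<in> N e" using assms(3) by (simp add: N_iff)
      then have "N e \<inter> P \<subset> N e" using assms(2) by blast
      then have "card (N e \<inter> P) < card (N e)" by (rule psubset_card_mono[OF finite_N])
      then show ?thesis using card_N[OF V(2)] by simp
    qed
    then have "avail P c k \<noteq> {}" using assms(5) by auto
    then obtain a where a: "a \<in> avail P c k" by blast
    have "card (avail P c k) \<le> card (avail P c e)"
      using True finite_avail[OF V(2)] by (intro card_mono)
    then have "sv P c (Suc i) e" using assms(5) by (simp add: sv_def)
    then show ?thesis
      using a sv_mono[OF extends_upd[OF assms(2)] _ V(2)] by metis
  qed
  then obtain a where "a \<in> avail P c k" "sv (insert k P) (c(k := a)) (Suc i) e" by blast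
  then show ?thesis using pcol_upd[OF assms(1) V(1) assms(2)] extends_upd[OF assms(2)] by metis
qed

lemma two_upd:
  assumes "pcol P c" "p \<in> V" "q \<in> V" "p \<notin> P" "q \<notin> P" "p \<noteq> q" "\<not> E p q"
    "a \<in> avail P c p" "b \<in> avail P c q"
  shows "extends P c (insert q (insert p P)) (c(p := a, q := b))"
    "pcol (insert q (insert p P)) (c(p := a, q := b))"
proof -
  have nqp: "\<not> E q p" using assms(7) E_sym by blast
  show "extends P c (insert q (insert p P)) (c(p := a, q := b))"
    using assms by (auto simp: extends_def)
  show "pcol (insert q (insert p P)) (c(p := a, q := b))"
    using assms nqp by (intro pcol_upd) (auto simp: avail_upd)
qed

lemma sv_two_same:
  assumes "sv P c i u" "E u p" "E u q" "p \<notin> P" "q \<notin> P" "p \<noteq> q"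
  shows "sv (insert q (insert p P)) (c(p := a, q := a)) (Suc i) u"
proof -
  have u: "u \<in> V" using assms(2) E_V by blast
  have "sv (insert p P) (c(p := a)) i u"
    using sv_mono[OF extends_upd assms(1)] assms(4) u by blast
  moreover have "a \<notin> avail (insert p P) (c(p := a)) u"
    using assms by (simp add: avail_upd)
  ultimately show ?thesis using assms by (intro sv_upd_out) auto
qed

lemma sv_two_out:
  assumes "sv P c i u" "E u p" "E u q" "p \<notin> P" "q \<notin> P" "p \<noteq> q"
    "a \<notin> avail P c u \<or> b \<notin> avail P c u"
  shows "sv (insert q (insert p P)) (c(p := a, q := b)) (Suc i) u"
proof -
  have u: "u \<in> V" using assms(2) E_V by blast
  show ?thesis
  proof (cases "a \<in> avail P c u")
    case True
    then have "b \<notin> avail (insert p P) (c(p := a)) u" using assms by (simp add: avail_upd)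
    moreover have "sv (insert p P) (c(p := a)) i u"
      using sv_mono[OF extends_upd assms(1)] assms(4) u by blast
    ultimately show ?thesis using assms by (intro sv_upd_out) auto
  next
    case False
    then have "sv (insert p P) (c(p := a)) (Suc i) u" using assms by (intro sv_upd_out) auto
    moreover have "extends (insert p P) (c(p := a)) (insert q (insert p P)) (c(p := a, q := b))"
      using assms by (auto simp: extends_def)
    ultimately show ?thesis using sv_mono u by blast
  qed
qed

lemma card_avail_le: "v \<in> V \<Longrightarrow> card (avail P c v) \<le> 5"
  using lists card_mono[of "L v" "avail P c v"] by (fastforce simp: avail_def)

text \<open>Use a common colour of \<open>p\<close> and \<open>q\<close> if there is one. Otherwise
  their free colours number at least 6 together, more than can be free at \<open>u\<close>, so one
  of them costs \<open>u\<close> nothing.\<close>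

lemma ext_pair:
  assumes "pcol P c" "p \<notin> P" "q \<notin> P" "p \<noteq> q" "\<not> E p q" "E u p" "E u q" "sv P c i u"
    and "6 \<le> card (avail P c p) + card (avail P c q)"
  shows "\<exists>c'. extends P c (insert q (insert p P)) c' \<and> pcol (insert q (insert p P)) c' \<and>
    sv (insert q (insert p P)) c' (Suc i) u"
proof -
  have V: "p \<in> V" "q \<in> V" "u \<in> V" using assms(6,7) E_V by auto
  note le = card_avail_le[OF V(1), of P c] card_avail_le[OF V(2), of P c]
    card_avail_le[OF V(3), of P c]
  note upd = two_upd[OF assms(1) V(1,2) assms(2-5)]
  have ne: "avail P c p \<noteq> {}" "avail P c q \<noteq> {}" using assms(9) le by auto
  show ?thesis
  proof (cases "avail P c p \<inter> avail P c q = {}")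
    case False
    then obtain a where a: "a \<in> avail P c p" "a \<in> avail P c q" by blast
    show ?thesis using upd[OF a] sv_two_same[OF assms(8,6,7,2,3,4), of a] by metis
  next
    case True
    have "card (avail P c p \<union> avail P c q) = card (avail P c p) + card (avail P c q)"
      using True V by (intro card_Un_disjoint) (auto simp: finite_avail)
    then have "\<not> avail P c p \<union> avail P c q \<subseteq> avail P c u"
      using assms(9) le card_mono[OF finite_avail[OF V(3)], of "avail P c p \<union> avail P c q" P c]
      by linarith
    then obtain a b where ab: "a \<in> avail P c p" "b \<in> avail P c q"
      "a \<notin> avail P c u \<or> b \<notin> avail P c u" using ne by blast
    show ?thesis using upd[OF ab(1,2)] sv_two_out[OF assms(8,6,7,2,3,4) ab(3)] by metis
  qed
qed

text \<open>Serves two common neighbours without a common free colour: their two colours must not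
  both be free at \<open>u\<close>, nor both at \<open>w\<close>. A set of at most 5 elements that
  contains \<open>A\<close> has room for at most one element of \<open>B\<close>, and vice versa, so
  each containment leaves enough choice on the other side.\<close>

lemma disjoint_escape:
  fixes A B X Y :: "nat set"
  assumes "A \<inter> B = {}" "finite X" "finite Y" "finite A" "finite B"
    and c: "4 \<le> card A" "4 \<le> card B" "card X \<le> 5" "card Y \<le> 5"
  shows "\<exists>a\<in>A. \<exists>b\<in>B. (a \<notin> X \<or> b \<notin> X) \<and> (a \<notin> Y \<or> b \<notin> Y)"
proof -
  have few: "card (B \<inter> Z) \<le> 1" if "A \<subseteq> Z" "finite Z" "card Z \<le> 5" "A \<inter> B = {}" "4 \<le> card A"
    for A B Z :: "nat set"
  proof -
    have "card (A \<union> (B \<inter> Z)) = card A + card (B \<inter> Z)"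
      using that by (intro card_Un_disjoint) (auto dest: finite_subset)
    moreover have "card (A \<union> (B \<inter> Z)) \<le> card Z" using that by (intro card_mono) auto
    ultimately show ?thesis using that by linarith
  qed
  have both: "\<exists>b\<in>B. b \<notin> X \<and> b \<notin> Y"
    if "A \<subseteq> X" "A \<subseteq> Y" "A \<inter> B = {}" "4 \<le> card A" "4 \<le> card B" "finite B" for A B :: "nat set"
  proof (rule ccontr)
    assume "\<not> ?thesis"
    then have "B \<subseteq> (B \<inter> X) \<union> (B \<inter> Y)" by blast
    then have "card B \<le> card ((B \<inter> X) \<union> (B \<inter> Y))" using that(6) by (intro card_mono) auto
    also have "\<dots> \<le> card (B \<inter> X) + card (B \<inter> Y)" by (rule card_Un_le)
    finally show False
      using few[OF that(1) assms(2) c(3) that(3,4)] few[OF that(2) assms(3) c(4) that(3,4)] that(5)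
      by linarith
  qed
  have AX: "\<not> (A \<subseteq> X \<and> B \<subseteq> X)"
  proof
    assume "A \<subseteq> X \<and> B \<subseteq> X"
    then have "B \<inter> X = B" "A \<subseteq> X" by auto
    then show False using few[OF _ assms(2) c(3) assms(1) c(1)] c(2) by fastforce
  qed
  have AY: "\<not> (A \<subseteq> Y \<and> B \<subseteq> Y)"
  proof
    assume "A \<subseteq> Y \<and> B \<subseteq> Y"
    then have "B \<inter> Y = B" "A \<subseteq> Y" by auto
    then show False using few[OF _ assms(3) c(4) assms(1) c(1)] c(2) by fastforce
  qed
  have ne: "A \<noteq> {}" "B \<noteq> {}" using c by auto
  show ?thesis
  proof (cases "A \<subseteq> X")
    case True
    then have B: "\<not> B \<subseteq> X" using AX by blast
    show ?thesis
    proof (cases "A \<subseteq> Y")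
      case True
      then show ?thesis using both[OF \<open>A \<subseteq> X\<close> True assms(1) c(1,2) assms(5)] ne by blast
    qed (use B in blast)
  next
    case False
    show ?thesis
    proof (cases "B \<subseteq> Y")
      case True
      then have "\<not> A \<subseteq> Y" using AY by blast
      show ?thesis
      proof (cases "B \<subseteq> X")
        case True
        have "B \<inter> A = {}" using assms(1) by blast
        then show ?thesis using both[OF True \<open>B \<subseteq> Y\<close> _ c(2,1) assms(4)] ne by blast
      qed (use \<open>\<not> A \<subseteq> Y\<close> in blast)
    qed (use False in blast)
  qed
qed

text \<open>Typically \<open>u\<close> and \<open>w\<close> are adjacent and \<open>p\<close>,
  \<open>q\<close> are the third vertices of the two triangles on the edge \<open>u w\<close>; one
  precoloured pair then saves at both ends.\<close>

lemma ext_pair_two: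
  assumes "pcol P c" "p \<notin> P" "q \<notin> P" "p \<noteq> q" "\<not> E p q" "E u p" "E u q" "sv P c i u"
    and "E w p" "E w q" "sv P c j w"
    and "4 \<le> card (avail P c p)" "4 \<le> card (avail P c q)"
  shows "\<exists>c'. extends P c (insert q (insert p P)) c' \<and> pcol (insert q (insert p P)) c' \<and>
    sv (insert q (insert p P)) c' (Suc i) u \<and> sv (insert q (insert p P)) c' (Suc j) w"
proof -
  have V: "p \<in> V" "q \<in> V" "u \<in> V" "w \<in> V" using assms(6,7,9) E_V by auto
  note upd = two_upd[OF assms(1) V(1,2) assms(2-5)]
  show ?thesis
  proof (cases "avail P c p \<inter> avail P c q = {}")
    case False
    then obtain a where a: "a \<in> avail P c p" "a \<in> avail P c q" by blast
    show ?thesis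
      using upd[OF a] sv_two_same[OF assms(8,6,7,2,3,4), of a] sv_two_same[OF assms(11,9,10,2,3,4), of a]
      by metis
  next
    case True
    have "\<exists>a\<in>avail P c p. \<exists>b\<in>avail P c q. (a \<notin> avail P c u \<or> b \<notin> avail P c u) \<and>
        (a \<notin> avail P c w \<or> b \<notin> avail P c w)"
      by (rule disjoint_escape[OF True]) (use assms V in \<open>auto simp: finite_avail card_avail_le\<close>)
    then obtain a b where ab: "a \<in> avail P c p" "b \<in> avail P c q"
      "a \<notin> avail P c u \<or> b \<notin> avail P c u" "a \<notin> avail P c w \<or> b \<notin> avail P c w" by blast
    show ?thesis
      using upd[OF ab(1,2)] sv_two_out[OF assms(8,6,7,2,3,4) ab(3)]
        sv_two_out[OF assms(11,9,10,2,3,4) ab(4)] by metis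
  qed
qed

primrec ball :: "'a \<Rightarrow> nat \<Rightarrow> 'a set" where
  "ball x 0 = {x}"
| "ball x (Suc r) = ball x r \<union> (\<Union>y\<in>ball x r. N y)"

text \<open>The bounds are uniform, so that one finite collection of attempts serves all graphs.
  They leave room for precolouring the whole cube of a cycle of length 9 or 10; the other plans use
  at most five vertices.\<close>

definition plan :: "'a \<Rightarrow> bool" where
  "plan x \<longleftrightarrow> (\<exists>P c. pcol P c \<and> P \<subseteq> ball x 10 \<and> card P \<le> 12 \<and> V - P \<subseteq> peel P c)"

end

section \<open>Lattice covers\<close>

text \<open>The six shortest vectors of the triangular lattice, for basis vectors at an angle of 60
  degrees.\<close>

definition units :: "(int \<times> int) set" where
  "units = {(1, 0), (-1, 0), (0, 1), (0, -1), (-1, 1), (1, -1)}"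

text \<open>The graph as a quotient of the triangular lattice, with \<open>\<Lambda>\<close> as the
  lattice of periods. Simplicity and degree 6 become statements about the absence of short
  periods.\<close>

locale lattice_cover =
  fixes V :: "'a set" and E :: "'a \<Rightarrow> 'a \<Rightarrow> bool" and \<phi> :: "int \<Rightarrow> int \<Rightarrow> 'a"
    and \<Lambda> :: "int \<Rightarrow> int \<Rightarrow> bool"
  assumes simple: "simple_graph V E" and six_regular: "regular_graph 6 V E"
    and V_eq: "V = range (\<lambda>(x, y). \<phi> x y)"
    and per: "\<phi> x y = \<phi> x' y' \<longleftrightarrow> \<Lambda> (x - x') (y - y')"
    and nb: "nbhd E (\<phi> x y) = {\<phi> (x + 1) y, \<phi> (x - 1) y, \<phi> x (y + 1), \<phi> x (y - 1),
      \<phi> (x - 1) (y + 1), \<phi> (x + 1) (y - 1)}"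
begin

lemma in_V [simp]: "\<phi> x y \<in> V"
  by (auto simp: V_eq)

lemma V_cases: "v \<in> V \<Longrightarrow> (\<And>x y. v = \<phi> x y \<Longrightarrow> P) \<Longrightarrow> P"
  by (auto simp: V_eq)

lemma lat_0 [simp]: "\<Lambda> 0 0"
  using per[of 0 0 0 0] by simp

lemma lat_uminus [simp]: "\<Lambda> (- a) (- b) = \<Lambda> a b"
  using per[of 0 0 a b] per[of a b 0 0] by auto

lemma lat_add: "\<Lambda> a b \<Longrightarrow> \<Lambda> a' b' \<Longrightarrow> \<Lambda> (a + a') (b + b')"
  using per[of 0 0 "-a" "-b"] per[of "-a" "-b" "-a - a'" "- b - b'"] per[of 0 0 "-a - a'" "- b - b'"]
  by (simp add: algebra_simps)

lemma lat_diff: "\<Lambda> a b \<Longrightarrow> \<Lambda> a' b' \<Longrightarrow> \<Lambda> (a - a') (b - b')"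
  using lat_add[of a b "-a'" "-b'"] by simp

lemma lat_mult: "\<Lambda> a b \<Longrightarrow> \<Lambda> (k * a) (k * b)"
proof -
  assume ab: "\<Lambda> a b"
  have pos: "\<Lambda> (int n * a) (int n * b)" for n
    by (induction n) (use ab lat_add in \<open>auto simp: algebra_simps\<close>)
  show ?thesis
  proof (cases "0 \<le> k")
    case True
    then show ?thesis using pos[of "nat k"] by simp
  next
    case False
    then show ?thesis using pos[of "nat (- k)"] lat_uminus[of "k * a" "k * b"] by simp
  qed
qed

lemma adj_iff: "E (\<phi> x y) (\<phi> x' y') \<longleftrightarrow> (\<exists>(a, b)\<in>units. \<Lambda> (x' - x - a) (y' - y - b))"
proof -
  have "E (\<phi> x y) (\<phi> x' y') \<longleftrightarrow> \<phi> x' y' \<in> nbhd E (\<phi> x y)" by (simp add: nbhd_def)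
  also have "\<dots> \<longleftrightarrow> (\<exists>(a, b)\<in>units. \<phi> x' y' = \<phi> (x + a) (y + b))"
    by (simp add: nb units_def)
  finally show ?thesis by (simp add: per algebra_simps)
qed

lemma adj_unit: "(x' - x, y' - y) \<in> units \<Longrightarrow> E (\<phi> x y) (\<phi> x' y')"
  unfolding adj_iff by (rule bexI[of _ "(x' - x, y' - y)"]) auto

lemma units_distinct:
  assumes "(a, b) \<in> units" "(a', b') \<in> units" "\<phi> (x + a) (y + b) = \<phi> (x + a') (y + b')"
  shows "a = a' \<and> b = b'"
proof -
  have im: "nbhd E (\<phi> x y) = (\<lambda>(a, b). \<phi> (x + a) (y + b)) ` units"
    by (simp add: nb units_def)
  have "card units = 6" by (simp add: units_def)
  moreover have "card (nbhd E (\<phi> x y)) = 6" using six_regular by (simp add: regular_graph_def)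
  ultimately have "inj_on (\<lambda>(a, b). \<phi> (x + a) (y + b)) units"
    unfolding im by (intro eq_card_imp_inj_on) (auto simp: units_def)
  then have "(a, b) = (a', b')" by (rule inj_onD) (use assms in auto)
  then show ?thesis by simp
qed

lemma lat_not_unit: "(a, b) \<in> units \<Longrightarrow> \<not> \<Lambda> a b"
proof
  assume u: "(a, b) \<in> units" and "\<Lambda> a b"
  then have "\<phi> a b = \<phi> 0 0" by (simp add: per)
  moreover have "E (\<phi> 0 0) (\<phi> a b)" using u by (intro adj_unit) simp
  ultimately show False using simple by (auto simp: simple_graph_def)
qed

text \<open>Since the degree is 6, different directions lead to different neighbours. This rules out
  (2,0), (1,1), (2,-1) and their images under the symmetries of the lattice as periods.\<close>

lemma lat_not_unit_diff:
  assumes "(a, b) \<in> units" "(a', b') \<in> units" "\<Lambda> (a - a') (b - b')"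
  shows "a = a' \<and> b = b'"
  using units_distinct[of a b a' b' 0 0] assms by (simp add: per)

lemma shift: "lattice_cover V E (\<lambda>x y. \<phi> (x + a) (y + b)) \<Lambda>"
proof
  have "range (\<lambda>(x, y). \<phi> (x + a) (y + b)) = range (\<lambda>(x, y). \<phi> x y)"
  proof -
    have "\<phi> x y \<in> range (\<lambda>(x, y). \<phi> (x + a) (y + b))" for x y
      by (rule range_eqI[of _ _ "(x - a, y - b)"]) simp
    then show ?thesis by auto
  qed
  then show "V = range (\<lambda>(x, y). \<phi> (x + a) (y + b))" by (simp add: V_eq)
qed (use simple six_regular nb per in \<open>simp_all add: algebra_simps\<close>)

text \<open>The reflection that maps every row to itself. It is used to replace one twist between
  the rows by another.\<close>

lemma mirror: "lattice_cover V E (\<lambda>x y. \<phi> (- x - y) y) (\<lambda>x y. \<Lambda> (- x - y) y)"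
proof
  have "\<phi> x y \<in> range (\<lambda>(x, y). \<phi> (- x - y) y)" for x y
    by (rule range_eqI[of _ _ "(- x - y, y)"]) simp
  then show "V = range (\<lambda>(x, y). \<phi> (- x - y) y)" by (auto simp: V_eq)
  show "nbhd E (\<phi> (- x - y) y) = {\<phi> (- (x + 1) - y) y, \<phi> (- (x - 1) - y) y,
      \<phi> (- x - (y + 1)) (y + 1), \<phi> (- x - (y - 1)) (y - 1),
      \<phi> (- (x - 1) - (y + 1)) (y + 1), \<phi> (- (x + 1) - (y - 1)) (y - 1)}" for x y
  proof -
    have e: "- (x + 1) - y = - x - y - 1" "- (x - 1) - y = - x - y + 1"
      "- x - (y + 1) = - x - y - 1" "- x - (y - 1) = - x - y + 1"
      "- (x - 1) - (y + 1) = - x - y" "- (x + 1) - (y - 1) = - x - y" by simp_all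
    show ?thesis unfolding nb e by blast
  qed
qed (use simple six_regular in \<open>simp_all add: per algebra_simps\<close>)

text \<open>Rotation by 60 degrees. It lets one treatment of a short period serve its three
  directions.\<close>

lemma rotate: "lattice_cover V E (\<lambda>x y. \<phi> (- y) (x + y)) (\<lambda>x y. \<Lambda> (- y) (x + y))"
proof
  have "\<phi> x y \<in> range (\<lambda>(x, y). \<phi> (- y) (x + y))" for x y
    by (rule range_eqI[of _ _ "(x + y, - x)"]) simp
  then show "V = range (\<lambda>(x, y). \<phi> (- y) (x + y))" by (auto simp: V_eq)
  show "nbhd E (\<phi> (- y) (x + y)) = {\<phi> (- y) (x + 1 + y), \<phi> (- y) (x - 1 + y),
      \<phi> (- (y + 1)) (x + (y + 1)), \<phi> (- (y - 1)) (x + (y - 1)),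
      \<phi> (- (y + 1)) (x - 1 + (y + 1)), \<phi> (- (y - 1)) (x + 1 + (y - 1))}" for x y
  proof -
    have e: "x + 1 + y = x + y + 1" "x - 1 + y = x + y - 1" "- (y + 1) = - y - 1" "- (y - 1) = - y + 1"
      "x + (y + 1) = x + y + 1" "x + (y - 1) = x + y - 1"
      "x - 1 + (y + 1) = x + y" "x + 1 + (y - 1) = x + y" by simp_all
    show ?thesis unfolding nb e by blast
  qed
qed (use simple six_regular in \<open>simp_all add: per algebra_simps\<close>)

end

locale cover_lists = lattice_cover V E \<phi> \<Lambda> + list_graph V E L
  for V :: "'a set" and E :: "'a \<Rightarrow> 'a \<Rightarrow> bool" and \<phi> :: "int \<Rightarrow> int \<Rightarrow> 'a"
    and \<Lambda> :: "int \<Rightarrow> int \<Rightarrow> bool" and L :: "'a \<Rightarrow> nat set"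
begin

lemma peel_lattice:
  assumes "\<phi> x1 y1 \<in> peel P c" "\<phi> x2 y2 \<in> peel P c" "(x1 - x, y1 - y) \<in> units"
    "(x2 - x, y2 - y) \<in> units" "x1 \<noteq> x2 \<or> y1 \<noteq> y2" "\<phi> x y \<notin> P"
  shows "\<phi> x y \<in> peel P c"
proof (rule peel_two[OF assms(1,2) _ _ _ assms(6)])
  show "\<phi> x1 y1 \<noteq> \<phi> x2 y2"
    using units_distinct[OF assms(3,4), of x y] assms(5) by auto
qed (use assms in \<open>auto intro: adj_unit\<close>)

lemma in_ball: "\<bar>a\<bar> + \<bar>b\<bar> \<le> int r \<Longrightarrow> \<phi> (x + a) (y + b) \<in> ball (\<phi> x y) r"
proof (induction r arbitrary: a b)
  case (Suc r)
  show ?case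
  proof (cases "\<bar>a\<bar> + \<bar>b\<bar> \<le> int r")
    case True
    then show ?thesis using Suc.IH by simp
  next
    case False
    have step: "\<phi> (x + a) (y + b) \<in> ball (\<phi> x y) (Suc r)"
      if "\<bar>a'\<bar> + \<bar>b'\<bar> \<le> int r" "(a - a', b - b') \<in> units" for a' b'
      using Suc.IH[OF that(1)] adj_unit[of "x + a" "x + a'" "y + b" "y + b'"] that(2)
      by (auto simp: N_iff)
    consider "a > 0" | "a < 0" | "b > 0" | "b < 0" using False by linarith
    then show ?thesis
    proof cases
      case 1
      show ?thesis by (rule step[of "a - 1" b]) (use 1 Suc.prems in \<open>auto simp: units_def\<close>)
    next
      case 2
      show ?thesis by (rule step[of "a + 1" b]) (use 2 Suc.prems in \<open>auto simp: units_def\<close>)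
    next
      case 3
      show ?thesis by (rule step[of a "b - 1"]) (use 3 Suc.prems in \<open>auto simp: units_def\<close>)
    next
      case 4
      show ?thesis by (rule step[of a "b + 1"]) (use 4 Suc.prems in \<open>auto simp: units_def\<close>)
    qed
  qed
next
  case 0
  then have "a = 0" "b = 0" by linarith+
  then show ?case by simp
qed

lemma in_ball_0: "\<bar>a\<bar> + \<bar>b\<bar> \<le> 10 \<Longrightarrow> \<phi> a b \<in> ball (\<phi> 0 0) 10"
  using in_ball[of a b 10 0 0] by simp

lemma planI:
  assumes "pcol P c" "P \<subseteq> ball (\<phi> 0 0) 10" "card P \<le> 12"
    "\<And>x y. \<phi> x y \<in> P \<or> \<phi> x y \<in> peel P c"
  shows "plan (\<phi> 0 0)"
  unfolding plan_def using assms V_cases by (metis DiffE subsetI)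

lemma avail_ge:
  assumes "v \<in> V" "N v \<inter> P \<subseteq> Q" "finite Q"
  shows "5 - card Q \<le> card (avail P c v)"
  using card_avail_ge[OF assms(1), of P c] card_mono[OF assms(3,2)] by linarith

lemma card_avail_empty: "v \<in> V \<Longrightarrow> card (avail {} c v) = 5"
  using lists by (simp add: avail_def)

lemma pcol_empty: "pcol {} c" by (simp add: pcol_def)

text \<open>In the lattice, (0,1) and (1,-1) are the common neighbours of (0,0) and (1,0) and save
  at both. Then (2,1), with all five colours still free, saves at (1,1), which has the coloured
  neighbour (0,1) already. Finally (-1,1) and (0,-1) give (0,0) its second saving. So (0,0), (1,0),
  (1,1) can be peeled in this order.\<close>

lemma seed:
  assumes box: "\<And>a b. \<Lambda> a b \<Longrightarrow> \<bar>a\<bar> \<le> 3 \<Longrightarrow> \<bar>b\<bar> \<le> 3 \<Longrightarrow> a = 0 \<and> b = 0"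
  shows "\<exists>c. pcol {\<phi> 0 1, \<phi> 1 (-1), \<phi> 2 1, \<phi> (-1) 1, \<phi> 0 (-1)} c \<and>
    sv {\<phi> 0 1, \<phi> 1 (-1), \<phi> 2 1, \<phi> (-1) 1, \<phi> 0 (-1)} c 2 (\<phi> 0 0) \<and>
    sv {\<phi> 0 1, \<phi> 1 (-1), \<phi> 2 1, \<phi> (-1) 1, \<phi> 0 (-1)} c 1 (\<phi> 1 0) \<and>
    sv {\<phi> 0 1, \<phi> 1 (-1), \<phi> 2 1, \<phi> (-1) 1, \<phi> 0 (-1)} c 1 (\<phi> 1 1)"
proof -
  have lat: "\<Lambda> a b \<longleftrightarrow> a = 0 \<and> b = 0" if "\<bar>a\<bar> \<le> 3" "\<bar>b\<bar> \<le> 3" for a b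
    using box[OF _ that] by auto
  note dec = per adj_iff units_def lat
  let ?P1 = "{\<phi> 1 (-1), \<phi> 0 1}"
  let ?P2 = "{\<phi> 2 1, \<phi> 1 (-1), \<phi> 0 1}"
  let ?P3 = "{\<phi> 0 (-1), \<phi> (-1) 1, \<phi> 2 1, \<phi> 1 (-1), \<phi> 0 1}"
  obtain c1 where c1: "pcol ?P1 c1" "sv ?P1 c1 1 (\<phi> 0 0)" "sv ?P1 c1 1 (\<phi> 1 0)"
    using ext_pair_two[of "{}" "\<lambda>_. 0" "\<phi> 0 1" "\<phi> 1 (-1)" "\<phi> 0 0" 0 "\<phi> 1 0" 0]
    by (auto simp: dec pcol_empty sv_0 card_avail_empty)
  have "5 \<le> card (avail ?P1 c1 (\<phi> 2 1))"
    using avail_ge[of "\<phi> 2 1" ?P1 "{}"] by (auto simp: dec N_iff)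
  moreover have "1 \<le> card (N (\<phi> 1 1) \<inter> ?P1)"
    using finite_N by (auto simp: Suc_le_eq card_gt_0_iff N_iff dec)
  ultimately obtain c2 where e2: "extends ?P1 c1 ?P2 c2" and c2: "pcol ?P2 c2" "sv ?P2 c2 1 (\<phi> 1 1)"
    using ext_single[OF c1(1), of "\<phi> 2 1" "\<phi> 1 1" 0] by (auto simp: dec sv_0)
  have "N (\<phi> (-1) 1) \<inter> ?P2 \<subseteq> {\<phi> 0 1, \<phi> 2 1}"
    "N (\<phi> 0 (-1)) \<inter> ?P2 \<subseteq> {\<phi> 1 (-1), \<phi> 2 1}" by (auto simp: dec N_iff)
  then have "3 \<le> card (avail ?P2 c2 (\<phi> (-1) 1))" "3 \<le> card (avail ?P2 c2 (\<phi> 0 (-1)))"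
    using avail_ge[of "\<phi> (-1) 1" ?P2 "{\<phi> 0 1, \<phi> 2 1}" c2]
      avail_ge[of "\<phi> 0 (-1)" ?P2 "{\<phi> 1 (-1), \<phi> 2 1}" c2] by (auto simp: dec)
  moreover have "sv ?P2 c2 1 (\<phi> 0 0)" using sv_mono[OF e2 c1(2)] by simp
  ultimately obtain c3 where e3: "extends ?P2 c2 ?P3 c3" and c3: "pcol ?P3 c3" "sv ?P3 c3 2 (\<phi> 0 0)"
    using ext_pair[OF c2(1), of "\<phi> (-1) 1" "\<phi> 0 (-1)" "\<phi> 0 0" 1]
    by (auto simp: dec numeral_2_eq_2)
  have "sv ?P3 c3 1 (\<phi> 1 0)" using sv_mono[OF extends_trans[OF e2 e3] c1(3)] by simp
  moreover have "sv ?P3 c3 1 (\<phi> 1 1)" using sv_mono[OF e3 c2(2)] by simp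
  moreover have "?P3 = {\<phi> 0 1, \<phi> 1 (-1), \<phi> 2 1, \<phi> (-1) 1, \<phi> 0 (-1)}" by auto
  ultimately show ?thesis using c3 by metis
qed

end

section \<open>Covers whose period lattice is in Hermite normal form\<close>

lemma small_dvd: "\<bar>a\<bar> < l \<Longrightarrow> l dvd a \<longleftrightarrow> a = (0::int)"
  using dvd_imp_le_int[of a l] by auto

text \<open>The periods are generated by (\<open>w\<close>, 0) and (\<open>\<tau>\<close>,
  \<open>R\<close>): there are \<open>R\<close> rows, each a closed walk of \<open>w\<close>
  vertices, and the last row is glued to the first with the twist \<open>\<tau>\<close>.\<close>

locale based_cover = lattice_cover +
  fixes w R \<tau> :: int
  assumes basis: "\<Lambda> a b \<longleftrightarrow> (\<exists>k. b = R * k \<and> w dvd (a - \<tau> * k))"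
    and R_pos: "0 < R" and w_pos: "0 < w"
begin

lemma lat_row: "\<Lambda> a 0 \<longleftrightarrow> w dvd a"
  using R_pos by (auto simp: basis)

lemma lat_short: "\<bar>b\<bar> < R \<Longrightarrow> \<Lambda> a b \<longleftrightarrow> b = 0 \<and> w dvd a"
proof -
  assume b: "\<bar>b\<bar> < R"
  have "b = 0" if "\<Lambda> a b"
  proof -
    have "R dvd b" using that by (auto simp: basis)
    then show ?thesis using b by (simp add: small_dvd)
  qed
  then show ?thesis using lat_row by auto
qed

lemma row_mod: "\<phi> (m mod w) y = \<phi> m y"
  unfolding per by (simp add: lat_row mod_eq_dvd_iff[symmetric])

lemma row_shift: "\<phi> (x + \<tau>) (y + R) = \<phi> x y"
proof -
  have "\<Lambda> \<tau> R" unfolding basis by (rule exI[of _ 1]) simp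
  then show ?thesis by (simp add: per)
qed

lemma all_rows:
  assumes "\<And>x y. y0 \<le> y \<Longrightarrow> y < y0 + R \<Longrightarrow> Q (\<phi> x y)"
  shows "Q (\<phi> x y)"
proof -
  define k where "k = (y - y0) div R"
  have "\<phi> x y = \<phi> (x - \<tau> * k) (y - R * k)"
    unfolding per basis by (rule exI[of _ k]) simp
  moreover have "y - R * k = y0 + (y - y0) mod R"
    unfolding k_def by (simp add: minus_mult_div_eq_mod[symmetric] algebra_simps)
  ultimately show ?thesis using assms[of "y - R * k"] R_pos by simp
qed

end

locale based_lists = based_cover V E \<phi> \<Lambda> w R \<tau> + cover_lists V E \<phi> \<Lambda> L
  for V :: "'a set" and E :: "'a \<Rightarrow> 'a \<Rightarrow> bool" and \<phi> :: "int \<Rightarrow> int \<Rightarrow> 'a"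
    and \<Lambda> :: "int \<Rightarrow> int \<Rightarrow> bool" and L :: "'a \<Rightarrow> nat set" and w R \<tau> :: int
begin

text \<open>The seed colours vertices of rows 1 and -1 only. The avalanche fills row 0 and the rest
  of row -1 side by side, then row -2 and the rows below it, down to row 1 - \<open>R\<close>, which
  is row 1 again with its coloured vertices.\<close>

lemma plan_four_rows:
  assumes R: "4 \<le> R" and w: "4 \<le> w"
  shows "plan (\<phi> 0 0)"
proof -
  let ?P = "{\<phi> 0 1, \<phi> 1 (-1), \<phi> 2 1, \<phi> (-1) 1, \<phi> 0 (-1)}"
  have "\<Lambda> a b \<longleftrightarrow> b = 0 \<and> a = 0" if "\<bar>a\<bar> \<le> 3" "\<bar>b\<bar> \<le> 3" for a b
    using that R w by (auto simp: lat_short small_dvd)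
  then obtain c where c: "pcol ?P c" "sv ?P c 2 (\<phi> 0 0)" "sv ?P c 1 (\<phi> 1 0)" "sv ?P c 1 (\<phi> 1 1)"
    using seed by blast
  let ?X = "peel ?P c"
  have nP0: "\<phi> m 0 \<notin> ?P" for m using R by (auto simp: per lat_short)
  have P1: "\<phi> m (-1) \<in> ?P \<longleftrightarrow> w dvd m \<or> w dvd (m - 1)" for m
    using R by (auto simp: per lat_short)
  have nP2: "\<phi> m y \<notin> ?P" if "y \<le> -2" "2 - R \<le> y" for m y using that R by (auto simp: per lat_short)
  have X0: "\<phi> 0 0 \<in> ?X" using c(2) nP0 by (intro peel_none) auto
  have X1: "\<phi> 1 0 \<in> ?X"
    using c(3) nP0 by (intro peel_one[OF X0]) (auto intro!: adj_unit simp: units_def)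
  have nP11: "\<phi> 1 1 \<notin> ?P" using R w by (auto simp: per lat_short small_dvd)
  have X11: "\<phi> 1 1 \<in> ?X"
    using c(4) nP11 by (intro peel_one[OF X1]) (auto intro!: adj_unit simp: units_def)
  have X2: "\<phi> 2 0 \<in> ?X"
    using nP0 by (intro peel_lattice[OF X1 X11]) (auto simp: units_def)
  \<comment> \<open>Two rows advance together: (m + 1, -1) is adjacent to (m, 0) and (m, -1), and (m
    + 1, 0) to (m, 0) and (m + 1, -1).\<close>
  have right: "\<phi> m 0 \<in> ?X \<and> \<phi> m (-1) \<in> ?X" if "2 \<le> m" "m < w" for m
    using that
  proof (induction m rule: int_ge_induct)
    case base
    have "\<phi> 2 (-1) \<notin> ?P" using P1[of 2] w by (simp add: small_dvd)
    then have "\<phi> 2 (-1) \<in> ?X" by (intro peel_lattice[OF X1 X2]) (auto simp: units_def)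
    then show ?case using X2 by simp
  next
    case (step i)
    then have X: "\<phi> i 0 \<in> ?X" "\<phi> i (-1) \<in> ?X" by auto
    have "\<phi> (i + 1) (-1) \<notin> ?P" using P1[of "i + 1"] step by (simp add: small_dvd)
    then have X': "\<phi> (i + 1) (-1) \<in> ?X"
      by (intro peel_lattice[OF X]) (auto simp: units_def)
    show ?case using X' nP0 by (auto intro!: peel_lattice[OF X(1) X'] simp: units_def)
  qed
  have row0: "\<phi> m 0 \<in> ?X" for m
  proof -
    have "m mod w = 0 \<or> m mod w = 1 \<or> 2 \<le> m mod w"
      using pos_mod_sign[OF w_pos, of m] by linarith
    then have "\<phi> (m mod w) 0 \<in> ?X"
      using right[of "m mod w"] X0 X1 pos_mod_bound[OF w_pos, of m] by (elim disjE) simp_all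
    then show ?thesis by (simp add: row_mod)
  qed
  have row1: "\<phi> m (-1) \<in> ?X" if "2 \<le> m mod w" for m
    using right[of "m mod w"] that w_pos by (simp add: row_mod)
  \<comment> \<open>Row -2 starts below pairs of adjacent peeled vertices of row -1. The three
    places left near the coloured vertices of row -1 are then closed from both ends.\<close>
  have ge3: "\<phi> m (-2) \<in> ?X" if "3 \<le> m" "m < w" for m
  proof -
    have "\<phi> m (-1) \<in> ?X" "\<phi> (m - 1) (-1) \<in> ?X" using right[of m] right[of "m - 1"] that by auto
    moreover have "\<phi> m (-2) \<notin> ?P" by (rule nP2) (use R in auto)
    ultimately show ?thesis by - (rule peel_lattice[of m "-1" _ _ "m - 1" "-1"], auto simp: units_def)
  qed
  have Xl: "\<phi> (-1) (-2) \<in> ?X" "\<phi> (-1) (-1) \<in> ?X"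
  proof -
    have "-1 mod w = w - 1" using w by (simp add: zmod_minus1)
    then have "\<phi> (-1) y = \<phi> (w - 1) y" for y by (metis row_mod)
    then show "\<phi> (-1) (-2) \<in> ?X" "\<phi> (-1) (-1) \<in> ?X"
      using ge3[of "w - 1"] right[of "w - 1"] w by auto
  qed
  have nP2': "\<phi> m (-2) \<notin> ?P" for m by (rule nP2) (use R in auto)
  have X02: "\<phi> 0 (-2) \<in> ?X"
    by (rule peel_lattice[OF Xl _ _ _ nP2']) (auto simp: units_def)
  have X22: "\<phi> 2 (-2) \<in> ?X"
    using right[of 2] ge3[of 3] w
    by - (rule peel_lattice[of 3 "-2" _ _ 2 "-1", OF _ _ _ _ _ nP2'], auto simp: units_def)
  have X12: "\<phi> 1 (-2) \<in> ?X"
    by (rule peel_lattice[OF X02 X22 _ _ _ nP2']) (auto simp: units_def)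
  have row2: "\<phi> m (-2) \<in> ?X" for m
  proof -
    have "\<phi> (m mod w) (-2) \<in> ?X"
    proof (cases "3 \<le> m mod w")
      case True
      then show ?thesis using ge3[of "m mod w"] w_pos by simp
    next
      case False
      then have "m mod w \<in> {0, 1, 2}" using pos_mod_sign[OF w_pos, of m] by auto
      then show ?thesis using X02 X12 X22 by auto
    qed
    then show ?thesis by (simp add: row_mod)
  qed
  have down: "\<phi> m (- int j) \<in> ?X" if "2 \<le> j" "int j \<le> R - 2" for j m
    using that
  proof (induction j arbitrary: m rule: nat_induct_at_least)
    case (Suc j)
    then have "\<phi> m (- int j) \<in> ?X" "\<phi> (m - 1) (- int j) \<in> ?X" by auto
    moreover have "\<phi> m (- int (Suc j)) \<notin> ?P" by (rule nP2) (use Suc in auto)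
    ultimately show ?case
      by - (rule peel_lattice[of m "- int j" _ _ "m - 1" "- int j"], auto simp: units_def)
  qed (use row2 in simp)
  have cover: "\<phi> x y \<in> ?P \<or> \<phi> x y \<in> ?X" if "1 - R \<le> y" "y < 1 - R + R" for x y
  proof -
    have "y = 0 \<or> y = -1 \<or> 2 - R \<le> y \<and> y \<le> -2 \<or> y = 1 - R" using that by auto
    then consider "y = 0" | "y = -1" | "2 - R \<le> y" "y \<le> -2" | "y = 1 - R" by blast
    then show ?thesis
    proof cases
      case 1
      then show ?thesis using row0 by simp
    next
      case 2
      have "x mod w = 0 \<or> x mod w = 1 mod w \<or> 2 \<le> x mod w"
      proof -
        have "0 \<le> x mod w" "1 mod w = 1" using w by auto
        then show ?thesis by linarith
      qed
      then have "w dvd x \<or> w dvd x - 1 \<or> 2 \<le> x mod w"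
        unfolding mod_eq_dvd_iff dvd_eq_mod_eq_0 by simp
      then show ?thesis using 2 row1 P1 by blast
    next
      case 3
      then show ?thesis using down[of "nat (- y)" x] by simp
    next
      case 4
      have X: "\<phi> m (2 - R) \<in> ?X" for m using down[of "nat (R - 2)" m] R by simp
      have "\<phi> x (1 - R) \<in> ?X" if "\<phi> x (1 - R) \<notin> ?P"
        by (rule peel_lattice[OF X[of x] X[of "x - 1"] _ _ _ that]) (auto simp: units_def)
      then show ?thesis using 4 by blast
    qed
  qed
  show ?thesis
  proof (rule planI[OF c(1)])
    show "?P \<subseteq> ball (\<phi> 0 0) 10" by (auto intro!: in_ball_0)
    show "card ?P \<le> 12" using card_length[of "[\<phi> 0 1, \<phi> 1 (-1), \<phi> 2 1, \<phi> (-1) 1, \<phi> 0 (-1)]"] by simp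
    show "\<phi> x y \<in> ?P \<or> \<phi> x y \<in> ?X" for x y
      using all_rows[of "1 - R" "\<lambda>v. v \<in> ?P \<or> v \<in> ?X" x y] cover by blast
  qed
qed

end

section \<open>Rows of three vertices, and covers with two rows\<close>

context based_lists begin

lemma three_cases:
  assumes "w = 3" "Q (\<phi> m y)" "Q (\<phi> (m + 1) y)" "Q (\<phi> (m + 2) y)"
  shows "Q (\<phi> x y)"
proof -
  have "(x - m) mod 3 \<in> {0, 1, 2}" by auto
  moreover have "\<phi> x y = \<phi> (m + (x - m) mod 3) y"
    unfolding per using assms(1) by (simp add: lat_row algebra_simps mod_eq_dvd_iff[symmetric] mod_simps)
  ultimately show ?thesis using assms by auto
qed

lemma wrap3: "w = 3 \<Longrightarrow> \<phi> (x + 3) y = \<phi> x y"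
  by (simp add: per lat_row)

text \<open>Here the seed vertices (2,1) and (-1,1) coincide. Rows are triangles, so two peeled
  vertices of a row give the third; this replaces the saving at (1,1).\<close>

lemma plan_triangles_4:
  assumes R: "R = 4" and w: "w = 3"
  shows "plan (\<phi> 0 0)"
proof -
  let ?P1 = "{\<phi> 1 (-1), \<phi> 0 1}"
  let ?P = "{\<phi> 0 (-1), \<phi> (-1) 1, \<phi> 1 (-1), \<phi> 0 1}"
  note dec = per adj_iff units_def lat_short[unfolded R w] N_iff
  obtain c1 where c1: "pcol ?P1 c1" "sv ?P1 c1 1 (\<phi> 0 0)" "sv ?P1 c1 1 (\<phi> 1 0)"
    using ext_pair_two[of "{}" "\<lambda>_. 0" "\<phi> 0 1" "\<phi> 1 (-1)" "\<phi> 0 0" 0 "\<phi> 1 0" 0]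
    by (auto simp: dec pcol_empty sv_0 card_avail_empty)
  have "N (\<phi> (-1) 1) \<inter> ?P1 \<subseteq> {\<phi> 0 1}" "N (\<phi> 0 (-1)) \<inter> ?P1 \<subseteq> {\<phi> 1 (-1)}" by (auto simp: dec)
  then have "4 \<le> card (avail ?P1 c1 (\<phi> (-1) 1))" "4 \<le> card (avail ?P1 c1 (\<phi> 0 (-1)))"
    using avail_ge[of "\<phi> (-1) 1" ?P1 "{\<phi> 0 1}" c1] avail_ge[of "\<phi> 0 (-1)" ?P1 "{\<phi> 1 (-1)}" c1]
    by auto
  then obtain c where e: "extends ?P1 c1 ?P c" and c: "pcol ?P c" "sv ?P c 2 (\<phi> 0 0)"
    using ext_pair[OF c1(1), of "\<phi> (-1) 1" "\<phi> 0 (-1)" "\<phi> 0 0" 1] c1(2)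
    by (auto simp: dec numeral_2_eq_2)
  have c': "sv ?P c 1 (\<phi> 1 0)" using sv_mono[OF e c1(3)] by simp
  let ?X = "peel ?P c"
  have nP0: "\<phi> m 0 \<notin> ?P" and nP2: "\<phi> m 2 \<notin> ?P" for m by (auto simp: dec)
  have nP1: "\<phi> 1 1 \<notin> ?P" "\<phi> 2 (-1) \<notin> ?P" by (auto simp: dec)
  have X0: "\<phi> 0 0 \<in> ?X" using c(2) nP0 by (intro peel_none) auto
  have X1: "\<phi> 1 0 \<in> ?X"
    using c' nP0 by (intro peel_one[OF X0]) (auto intro!: adj_unit simp: units_def)
  have X3: "\<phi> 3 0 \<in> ?X" using X0 wrap3[OF w, of 0] by simp
  have X2: "\<phi> 2 0 \<in> ?X" by (rule peel_lattice[OF X1 X3 _ _ _ nP0]) (auto simp: units_def)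
  have X11: "\<phi> 1 1 \<in> ?X" by (rule peel_lattice[OF X1 X2 _ _ _ nP1(1)]) (auto simp: units_def)
  have Y2: "\<phi> 2 (-1) \<in> ?X" by (rule peel_lattice[OF X1 X2 _ _ _ nP1(2)]) (auto simp: units_def)
  have sh: "\<phi> x 3 = \<phi> (x - \<tau>) (-1)" for x using row_shift[of "x - \<tau>" "-1"] R by simp
  have up: "\<phi> m 2 \<in> ?X" if "\<phi> a b \<in> ?X" "(a - m, b - 2) \<in> units" "a' - m = -1 \<or> a' - m = 0"
    "3 dvd a' - \<tau> - 2" "(a' - m, 3 - 2) \<noteq> (a - m, b - 2)" for m a b a'
  proof -
    have "\<phi> a' 3 = \<phi> 2 (-1)" using that(4) by (simp add: sh per lat_row w)
    then have Y: "\<phi> a' 3 \<in> ?X" using Y2 by simp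
    show ?thesis
      by (rule peel_lattice[OF that(1) Y _ _ _ nP2]) (use that(2,3,5) in \<open>auto simp: units_def\<close>)
  qed
  have X02: "\<phi> 0 2 \<in> ?X" if "\<phi> 1 2 \<in> ?X"
    by (rule peel_lattice[OF X11 that _ _ _ nP2]) (auto simp: units_def)
  have X12: "\<phi> 1 2 \<in> ?X" if "\<phi> 0 2 \<in> ?X"
    by (rule peel_lattice[OF X11 that _ _ _ nP2]) (auto simp: units_def)
  \<comment> \<open>The peeled vertex (1,1) has two neighbours in row 2, and so has the peeled
    vertex of row 3, which is row -1 after the twist. Two pairs among three vertices meet, so some
    vertex of row 2 has two peeled neighbours; the residue of \<open>\<tau>\<close> tells
    which.\<close>
  have "\<tau> mod 3 = 0 \<or> \<tau> mod 3 = 1 \<or> \<tau> mod 3 = 2" by auto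
  moreover have "\<phi> 0 2 \<in> ?X" if "\<tau> mod 3 = 0"
  proof -
    have "3 dvd -1 - \<tau> - 2" using that by presburger
    then show ?thesis by (intro up[OF X11, of _ "-1"]) (auto simp: units_def)
  qed
  moreover have "\<phi> 0 2 \<in> ?X" if "\<tau> mod 3 = 1"
  proof -
    have "3 dvd 0 - \<tau> - 2" using that by presburger
    then show ?thesis by (intro up[OF X11, of _ 0]) (auto simp: units_def)
  qed
  moreover have "\<phi> 1 2 \<in> ?X" if "\<tau> mod 3 = 2"
  proof -
    have "3 dvd 1 - \<tau> - 2" using that by presburger
    then show ?thesis by (intro up[OF X11, of _ 1]) (auto simp: units_def)
  qed
  ultimately have "\<phi> 0 2 \<in> ?X \<or> \<phi> 1 2 \<in> ?X" by metis
  then have X02: "\<phi> 0 2 \<in> ?X" and X12: "\<phi> 1 2 \<in> ?X" using X02 X12 by metis+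
  have X32: "\<phi> 3 2 \<in> ?X" using X02 wrap3[OF w, of 0] by simp
  have X22: "\<phi> 2 2 \<in> ?X" by (rule peel_lattice[OF X12 X32 _ _ _ nP2]) (auto simp: units_def)
  have X22': "\<phi> (-1) 2 \<in> ?X" using X22 wrap3[OF w, of "-1"] by simp
  have cover: "\<phi> x y \<in> ?P \<or> \<phi> x y \<in> ?X" if "-1 \<le> y" "y < -1 + R" for x y
  proof -
    have "y = -1 \<or> y = 0 \<or> y = 1 \<or> y = 2" using that R by auto
    moreover have "\<phi> x 0 \<in> ?X" by (rule three_cases[OF w, of _ 0]) (simp_all add: X0 X1 X2)
    moreover have "\<phi> x 2 \<in> ?X" by (rule three_cases[OF w, of _ 0]) (simp_all add: X02 X12 X22)
    moreover have "\<phi> x (-1) \<in> ?P \<or> \<phi> x (-1) \<in> ?X"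
      by (rule three_cases[OF w, of _ 0]) (simp_all add: Y2)
    moreover have "\<phi> x 1 \<in> ?P \<or> \<phi> x 1 \<in> ?X"
      by (rule three_cases[OF w, of _ "-1"]) (simp_all add: X11)
    ultimately show ?thesis by blast
  qed
  show ?thesis
  proof (rule planI[OF c(1)])
    show "?P \<subseteq> ball (\<phi> 0 0) 10" by (auto intro!: in_ball_0)
    show "card ?P \<le> 12" using card_length[of "[\<phi> 0 (-1), \<phi> (-1) 1, \<phi> 1 (-1), \<phi> 0 1]"] by simp
    show "\<phi> x y \<in> ?P \<or> \<phi> x y \<in> ?X" for x y
      using all_rows[of "-1" "\<lambda>v. v \<in> ?P \<or> v \<in> ?X" x y] cover by blast
  qed
qed

text \<open>A coloured vertex in row 3 carries the avalanche into row 2: it saves at (0,2), which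
  has the coloured neighbour (0,1), so that (1,1) alone makes (0,2) peelable. The two values of
  \<open>\<kappa>\<close> give the neighbours of (0,2) in row 3, and \<open>far\<close> keeps all
  five colours free there.\<close>

lemma plan_triangles_5:
  assumes R: "5 \<le> R" and w: "w = 3" and \<kappa>: "\<kappa> = 0 \<or> \<kappa> = -1" and far: "\<not> E (\<phi> \<kappa> 3) (\<phi> 1 (-1))"
  shows "plan (\<phi> 0 0)"
proof -
  let ?P1 = "{\<phi> 1 (-1), \<phi> 0 1}"
  let ?P2 = "{\<phi> \<kappa> 3, \<phi> 1 (-1), \<phi> 0 1}"
  let ?P = "{\<phi> 0 (-1), \<phi> (-1) 1, \<phi> \<kappa> 3, \<phi> 1 (-1), \<phi> 0 1}"
  have lat: "\<Lambda> a b \<longleftrightarrow> b = 0 \<and> 3 dvd a" if "\<bar>b\<bar> \<le> 4" for a b using lat_short R w that by simp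
  note dec = per adj_iff units_def lat N_iff
  obtain c1 where c1: "pcol ?P1 c1" "sv ?P1 c1 1 (\<phi> 0 0)" "sv ?P1 c1 1 (\<phi> 1 0)"
    using ext_pair_two[of "{}" "\<lambda>_. 0" "\<phi> 0 1" "\<phi> 1 (-1)" "\<phi> 0 0" 0 "\<phi> 1 0" 0]
    by (auto simp: dec pcol_empty sv_0 card_avail_empty)
  have "\<not> E (\<phi> \<kappa> 3) (\<phi> 0 1)" "\<phi> \<kappa> 3 \<notin> ?P1" "E (\<phi> 0 2) (\<phi> \<kappa> 3)" using \<kappa> by (auto simp: dec)
  moreover have "N (\<phi> \<kappa> 3) \<inter> ?P1 \<subseteq> {}" using far calculation by (auto simp: N_iff)
  then have "5 \<le> card (avail ?P1 c1 (\<phi> \<kappa> 3))" using avail_ge[of "\<phi> \<kappa> 3" ?P1 "{}" c1] by simp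
  moreover have "\<phi> 0 1 \<in> N (\<phi> 0 2) \<inter> ?P1" by (auto simp: dec)
  then have "1 \<le> card (N (\<phi> 0 2) \<inter> ?P1)"
    using finite_N by (auto simp: Suc_le_eq card_gt_0_iff)
  ultimately obtain c2 where e2: "extends ?P1 c1 ?P2 c2" and c2: "pcol ?P2 c2" "sv ?P2 c2 1 (\<phi> 0 2)"
    using ext_single[OF c1(1), of "\<phi> \<kappa> 3" "\<phi> 0 2" 0] by (auto simp: sv_0)
  have "N (\<phi> (-1) 1) \<inter> ?P2 \<subseteq> {\<phi> 0 1, \<phi> \<kappa> 3}" "N (\<phi> 0 (-1)) \<inter> ?P2 \<subseteq> {\<phi> 1 (-1), \<phi> \<kappa> 3}"
    by (auto simp: dec)
  then have "3 \<le> card (avail ?P2 c2 (\<phi> (-1) 1))" "3 \<le> card (avail ?P2 c2 (\<phi> 0 (-1)))"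
    using avail_ge[of "\<phi> (-1) 1" ?P2 "{\<phi> 0 1, \<phi> \<kappa> 3}" c2]
      avail_ge[of "\<phi> 0 (-1)" ?P2 "{\<phi> 1 (-1), \<phi> \<kappa> 3}" c2] by (auto simp: dec)
  moreover have "sv ?P2 c2 1 (\<phi> 0 0)" using sv_mono[OF e2 c1(2)] by simp
  moreover have "\<not> E (\<phi> (-1) 1) (\<phi> 0 (-1))" "E (\<phi> 0 0) (\<phi> (-1) 1)" "E (\<phi> 0 0) (\<phi> 0 (-1))"
    "\<phi> (-1) 1 \<noteq> \<phi> 0 (-1)" "\<phi> (-1) 1 \<notin> ?P2" "\<phi> 0 (-1) \<notin> ?P2" by (auto simp: dec)
  ultimately obtain c where e3: "extends ?P2 c2 ?P c" and c: "pcol ?P c" "sv ?P c 2 (\<phi> 0 0)"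
    using ext_pair[OF c2(1), of "\<phi> (-1) 1" "\<phi> 0 (-1)" "\<phi> 0 0" 1] by (auto simp: numeral_2_eq_2)
  have c': "sv ?P c 1 (\<phi> 1 0)" using sv_mono[OF extends_trans[OF e2 e3] c1(3)] by simp
  have c'': "sv ?P c 1 (\<phi> 0 2)" using sv_mono[OF e3 c2(2)] by simp
  let ?X = "peel ?P c"
  have nP: "\<phi> m y \<notin> ?P" if "y = 0 \<or> y = 2 \<or> 4 \<le> y \<and> y \<le> R - 2" for m y
    using that R w by (auto simp: per lat_short)
  have nP0: "\<phi> m 0 \<notin> ?P" and nP2: "\<phi> m 2 \<notin> ?P" for m by (rule nP, simp)+
  have nP1: "\<phi> 1 1 \<notin> ?P" "\<phi> 2 (-1) \<notin> ?P" by (auto simp: dec)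
  have X0: "\<phi> 0 0 \<in> ?X" using c(2) nP0 by (intro peel_none) auto
  have X1: "\<phi> 1 0 \<in> ?X"
    using c' nP0 by (intro peel_one[OF X0]) (auto intro!: adj_unit simp: units_def)
  have X3: "\<phi> 3 0 \<in> ?X" using X0 wrap3[OF w, of 0] by simp
  have X2: "\<phi> 2 0 \<in> ?X" by (rule peel_lattice[OF X1 X3 _ _ _ nP0]) (auto simp: units_def)
  have X11: "\<phi> 1 1 \<in> ?X" by (rule peel_lattice[OF X1 X2 _ _ _ nP1(1)]) (auto simp: units_def)
  have Y2: "\<phi> 2 (-1) \<in> ?X" by (rule peel_lattice[OF X1 X2 _ _ _ nP1(2)]) (auto simp: units_def)
  have X02: "\<phi> 0 2 \<in> ?X"
    using c'' nP2 by (intro peel_one[OF X11]) (auto intro!: adj_unit simp: units_def)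
  have X12: "\<phi> 1 2 \<in> ?X" by (rule peel_lattice[OF X11 X02 _ _ _ nP2]) (auto simp: units_def)
  have X32: "\<phi> 3 2 \<in> ?X" using X02 wrap3[OF w, of 0] by simp
  have X22: "\<phi> 2 2 \<in> ?X" by (rule peel_lattice[OF X12 X32 _ _ _ nP2]) (auto simp: units_def)
  have row2: "\<phi> m 2 \<in> ?X" for m by (rule three_cases[OF w, of _ 0]) (simp_all add: X02 X12 X22)
  have row3: "\<phi> m 3 \<in> ?P \<or> \<phi> m 3 \<in> ?X" for m
  proof -
    have "\<phi> m 3 \<in> ?X" if "\<phi> m 3 \<notin> ?P"
      by (rule peel_lattice[OF row2[of m] row2[of "m + 1"] _ _ _ that]) (auto simp: units_def)
    then show ?thesis by blast
  qed
  have row: "\<phi> m (4 + int j) \<in> ?X" if "4 + int j \<le> R - 2" for j m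
    using that
  proof (induction j arbitrary: m)
    case 0
    have "\<phi> (\<kappa> + 1) 3 \<notin> ?P" "\<phi> (\<kappa> + 2) 3 \<notin> ?P" using R w 0 by (auto simp: per lat_short)
    then have K: "\<phi> (\<kappa> + 1) 3 \<in> ?X" "\<phi> (\<kappa> + 2) 3 \<in> ?X" using row3 by blast+
    have nP4: "\<phi> m 4 \<notin> ?P" for m by (rule nP) (use 0 in auto)
    have K1: "\<phi> (\<kappa> + 1) 4 \<in> ?X" by (rule peel_lattice[OF K _ _ _ nP4]) (auto simp: units_def)
    have K2: "\<phi> (\<kappa> + 2) 4 \<in> ?X" by (rule peel_lattice[OF K(2) K1 _ _ _ nP4]) (auto simp: units_def)
    have "\<phi> (\<kappa> + 1 + 3) 4 \<in> ?X" using K1 by (simp only: wrap3[OF w])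
    then have K3: "\<phi> (\<kappa> + 3) 4 \<in> ?X"
      by - (rule peel_lattice[OF K2 _ _ _ _ nP4, of "\<kappa> + 1 + 3" 4], auto simp: units_def)
    have "\<phi> m 4 \<in> ?X" by (rule three_cases[OF w, of _ "\<kappa> + 1"]) (simp_all add: K1 K2 K3 add.assoc)
    then show ?case by simp
  next
    case (Suc j)
    have "\<phi> m (4 + int j) \<in> ?X" "\<phi> (m + 1) (4 + int j) \<in> ?X" by (rule Suc.IH, use Suc.prems in simp)+
    moreover have "\<phi> m (4 + int (Suc j)) \<notin> ?P" by (rule nP) (use Suc.prems in auto)
    ultimately show ?case
      by - (rule peel_lattice[of m "4 + int j" _ _ "m + 1" "4 + int j"], auto simp: units_def)
  qed
  have cover: "\<phi> x y \<in> ?P \<or> \<phi> x y \<in> ?X" if "-1 \<le> y" "y < -1 + R" for x y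
  proof -
    have "y = -1 \<or> y = 0 \<or> y = 1 \<or> y = 2 \<or> y = 3 \<or> 4 \<le> y \<and> y \<le> R - 2" using that by auto
    moreover have "\<phi> x 0 \<in> ?X" by (rule three_cases[OF w, of _ 0]) (simp_all add: X0 X1 X2)
    moreover have "\<phi> x (-1) \<in> ?P \<or> \<phi> x (-1) \<in> ?X"
      by (rule three_cases[OF w, of _ 0]) (simp_all add: Y2)
    moreover have "\<phi> x 1 \<in> ?P \<or> \<phi> x 1 \<in> ?X"
      by (rule three_cases[OF w, of _ "-1"]) (simp_all add: X11)
    moreover have "\<phi> x y \<in> ?X" if "4 \<le> y \<and> y \<le> R - 2" using row[of "nat (y - 4)" x] that by simp
    ultimately show ?thesis using row2 row3 by blast
  qed
  show ?thesis
  proof (rule planI[OF c(1)])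
    show "?P \<subseteq> ball (\<phi> 0 0) 10" using \<kappa> by (auto intro!: in_ball_0)
    show "card ?P \<le> 12"
      using card_length[of "[\<phi> 0 (-1), \<phi> (-1) 1, \<phi> \<kappa> 3, \<phi> 1 (-1), \<phi> 0 1]"] by simp
    show "\<phi> x y \<in> ?P \<or> \<phi> x y \<in> ?X" for x y
      using all_rows[of "-1" "\<lambda>v. v \<in> ?P \<or> v \<in> ?X" x y] cover by blast
  qed
qed

text \<open>Row -1 is row 1 moved by \<open>\<tau>\<close>, so the seed occupies the places 0, 2,
  -1, \<open>\<tau>\<close> and \<open>\<tau> + 1\<close> of row 1 and leaves row 0 uncoloured. The
  avalanche runs to the right until row -1 reaches the coloured place -1 of row 1, then to the left
  from the origin. Three vertices of row 0 remain for the end.\<close>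

lemma plan_two_rows:
  assumes R: "R = 2" and \<tau>: "4 \<le> \<tau>" "\<tau> \<le> w - 4"
  shows "plan (\<phi> 0 0)"
proof -
  let ?P = "{\<phi> 0 1, \<phi> 1 (-1), \<phi> 2 1, \<phi> (-1) 1, \<phi> 0 (-1)}"
  have lat2: "\<Lambda> a 2 \<longleftrightarrow> w dvd a - \<tau>" and lat_odd: "odd b \<Longrightarrow> \<not> \<Lambda> a b" for a b
  proof -
    show "\<Lambda> a 2 \<longleftrightarrow> w dvd a - \<tau>" using R by (auto simp: basis)
    show "\<not> \<Lambda> a b" if "odd b" using that R by (auto simp: basis)
  qed
  have latm2: "\<Lambda> a (-2) \<longleftrightarrow> w dvd a + \<tau>" for a
  proof -
    have "\<Lambda> a (-2) \<longleftrightarrow> \<Lambda> (- a) 2" using lat_uminus[of a "-2"] by simp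
    also have "\<dots> \<longleftrightarrow> w dvd - (a + \<tau>)" by (simp add: lat2)
    finally show ?thesis by (simp only: dvd_minus_iff)
  qed
  have box: "\<Lambda> a b \<longleftrightarrow> b = 0 \<and> a = 0" if "\<bar>a\<bar> \<le> 3" "\<bar>b\<bar> \<le> 3" for a b
  proof -
    have "b = 0 \<or> b = 2 \<or> b = -2 \<or> odd b" using that(2) by presburger
    then show ?thesis
      using that(1) \<tau> small_dvd[of a w] small_dvd[of "a - \<tau>" w] small_dvd[of "a + \<tau>" w]
      by (elim disjE) (auto simp: lat_row lat2 latm2 lat_odd)
  qed
  then obtain c where c: "pcol ?P c" "sv ?P c 2 (\<phi> 0 0)" "sv ?P c 1 (\<phi> 1 0)" "sv ?P c 1 (\<phi> 1 1)"
    using seed by blast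
  let ?X = "peel ?P c"
  have nP0: "\<phi> m 0 \<notin> ?P" for m by (auto simp: per lat_odd)
  have low: "\<phi> m (-1) = \<phi> (m + \<tau>) 1" for m using row_shift[of m "-1"] R by simp
  have neg: "\<phi> m y = \<phi> (w + m) y" for m y by (simp add: per lat_row)
  have P1: "\<phi> m 1 \<in> ?P \<longleftrightarrow> m \<in> {0, 2, w - 1, \<tau>, \<tau> + 1}" if "0 \<le> m" "m < w" for m
  proof -
    have "w dvd m + 1 \<longleftrightarrow> m = w - 1"
    proof
      assume "w dvd m + 1"
      then show "m = w - 1" using zdvd_imp_le[of w "m + 1"] that by auto
    qed simp
    then show ?thesis
      using that \<tau> small_dvd[of m w] small_dvd[of "m - 2" w] small_dvd[of "m - \<tau>" w] small_dvd[of "m - \<tau> - 1" w]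
      by (auto simp: low per lat_row algebra_simps)
  qed
  have X0: "\<phi> 0 0 \<in> ?X" using c(2) nP0 by (intro peel_none) auto
  have X1: "\<phi> 1 0 \<in> ?X"
    using c(3) nP0 by (intro peel_one[OF X0]) (auto intro!: adj_unit simp: units_def)
  have X11: "\<phi> 1 1 \<in> ?X"
    using c(4) P1[of 1] \<tau> by (intro peel_one[OF X1]) (auto intro!: adj_unit simp: units_def)
  have X2: "\<phi> 2 0 \<in> ?X" by (rule peel_lattice[OF X1 X11 _ _ _ nP0]) (auto simp: units_def)
  have nPl: "\<phi> m (-1) \<notin> ?P" if "0 \<le> m + \<tau>" "m + \<tau> \<notin> {0, 2, w - 1, \<tau>, \<tau> + 1}" "m + \<tau> < w" for m
    using P1[of "m + \<tau>"] that by (simp add: low)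
  have right: "\<phi> m 0 \<in> ?X \<and> \<phi> m (-1) \<in> ?X" if "2 \<le> m" "m \<le> w - 2 - \<tau>" for m
    using that
  proof (induction m rule: int_ge_induct)
    case base
    have "\<phi> 2 (-1) \<notin> ?P" by (rule nPl) (use \<tau> in auto)
    then have "\<phi> 2 (-1) \<in> ?X" by (rule peel_lattice[OF X1 X2, rotated 3]) (auto simp: units_def)
    then show ?case using X2 by simp
  next
    case (step i)
    then have X: "\<phi> i 0 \<in> ?X" "\<phi> i (-1) \<in> ?X" by auto
    have "\<phi> (i + 1) (-1) \<notin> ?P" by (rule nPl) (use step \<tau> in auto)
    then have X': "\<phi> (i + 1) (-1) \<in> ?X"
      by (rule peel_lattice[OF X, rotated 3]) (auto simp: units_def)
    have "\<phi> (i + 1) 0 \<in> ?X" by (rule peel_lattice[OF X(1) X' _ _ _ nP0]) (auto simp: units_def)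
    then show ?case using X' by simp
  qed
  \<comment> \<open>The last vertex that the run to the right reaches in row -1 is (-2,1). Together
    with (0,0) it starts the run to the left.\<close>
  have Z: "\<phi> (-2) 1 \<in> ?X" using right[of "w - 2 - \<tau>"] \<tau> neg[of "-2" 1] by (simp add: low)
  have Xm1: "\<phi> (-1) 0 \<in> ?X" by (rule peel_lattice[OF X0 Z _ _ _ nP0]) (auto simp: units_def)
  have Xm2: "\<phi> (-2) 0 \<in> ?X" by (rule peel_lattice[OF Xm1 Z _ _ _ nP0]) (auto simp: units_def)
  have left: "\<phi> (- j) (-1) \<in> ?X \<and> \<phi> (- j - 1) 0 \<in> ?X" if "1 \<le> j" "j \<le> \<tau> - 3" for j
    using that
  proof (induction j rule: int_ge_induct)
    case base
    have "\<phi> (-1) (-1) \<notin> ?P" by (rule nPl) (use \<tau> in auto)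
    then have "\<phi> (-1) (-1) \<in> ?X" by (rule peel_lattice[OF Xm1 Xm2, rotated 3]) (auto simp: units_def)
    then show ?case using Xm2 by simp
  next
    case (step i)
    then have X: "\<phi> (- i) (-1) \<in> ?X" "\<phi> (- i - 1) 0 \<in> ?X" by auto
    have "\<phi> (- (i + 1)) (-1) \<notin> ?P" by (rule nPl) (use step \<tau> in auto)
    then have X': "\<phi> (- (i + 1)) (-1) \<in> ?X"
      by (rule peel_lattice[OF X, rotated 3]) (auto simp: units_def)
    have "\<phi> (- (i + 1) - 1) 0 \<in> ?X"
      by (rule peel_lattice[OF X(2) X' _ _ _ nP0]) (auto simp: units_def)
    then show ?case using X' by simp
  qed
  have row1: "\<phi> m 1 \<in> ?P \<or> \<phi> m 1 \<in> ?X" if "0 \<le> m" "m < w" for m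
  proof -
    have "m \<in> {0, 2, w - 1, \<tau>, \<tau> + 1} \<or> m = 1 \<or> 3 \<le> m \<and> m \<le> \<tau> - 1 \<or> \<tau> + 2 \<le> m \<and> m \<le> w - 2"
      using that by auto
    moreover have "\<phi> m 1 \<in> ?X" if "3 \<le> m \<and> m \<le> \<tau> - 1"
      using left[of "\<tau> - m"] that low[of "m - \<tau>"] by simp
    moreover have "\<phi> m 1 \<in> ?X" if "\<tau> + 2 \<le> m \<and> m \<le> w - 2"
      using right[of "m - \<tau>"] that low[of "m - \<tau>"] by simp
    ultimately show ?thesis using X11 P1[OF that] by blast
  qed
  have row0: "\<phi> m 0 \<in> ?X" if "0 \<le> m" "m < w" "m \<notin> {w - 1 - \<tau>, w - \<tau>, w - \<tau> + 1}" for m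
  proof -
    have "m = 0 \<or> m = 1 \<or> 2 \<le> m \<and> m \<le> w - 2 - \<tau> \<or> w - \<tau> + 2 \<le> m \<and> m \<le> w - 2 \<or> m = w - 1"
      using that by auto
    moreover have "\<phi> m 0 \<in> ?X" if "w - \<tau> + 2 \<le> m \<and> m \<le> w - 2"
      using left[of "w - 1 - m"] that neg[of "m - w" 0] by simp
    moreover have "\<phi> m 0 \<in> ?X" if "m = w - 1" using Xm1 neg[of "-1" 0] that by simp
    ultimately show ?thesis using X0 X1 right by blast
  qed
  have S1: "\<phi> m 1 \<in> ?X" if "0 \<le> m" "m < w" "m \<notin> {0, 2, w - 1, \<tau>, \<tau> + 1}" for m
    using row1[OF that(1,2)] P1[OF that(1,2)] that(3) by blast
  have fill: "\<phi> m 0 \<in> ?X"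
    if "\<phi> a 0 \<in> ?X" "a = m + 1 \<or> a = m - 1" "\<phi> b 1 \<in> ?X" "b = m \<or> b = m - 1" for m a b
    using that(2,4) by - (rule peel_lattice[OF that(1,3) _ _ _ nP0], auto simp: units_def)
  have mid: "\<phi> m 0 \<in> ?X" if "\<phi> (m - 1) 0 \<in> ?X" "\<phi> (m + 1) 0 \<in> ?X" for m
    by (rule peel_lattice[OF that _ _ _ nP0]) (auto simp: units_def)
  \<comment> \<open>Each end of the gap has a peeled neighbour in row 0. Both of its neighbours in
    row 1 are coloured only if they are the places \<open>\<tau>\<close> and
    \<open>\<tau> + 1\<close>, which means \<open>w = 2 * \<tau> + 2\<close> at this end and
    \<open>w = 2 * \<tau>\<close> at the other. So at least one end can be peeled, and the gap
    closes from there.\<close>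
  have l: "\<phi> (w - 1 - \<tau>) 0 \<in> ?X" if "w \<noteq> 2 * \<tau> + 2"
  proof -
    have "\<phi> (w - 2 - \<tau>) 0 \<in> ?X" by (rule row0) (use \<tau> in auto)
    moreover have "\<phi> (w - 1 - \<tau>) 1 \<in> ?X \<or> \<phi> (w - 2 - \<tau>) 1 \<in> ?X"
    proof (cases "w - 1 - \<tau> \<in> {0, 2, w - 1, \<tau>, \<tau> + 1}")
      case True
      have "\<phi> (w - 2 - \<tau>) 1 \<in> ?X" by (rule S1) (use True that \<tau> in auto)
      then show ?thesis ..
    next
      case False
      have "\<phi> (w - 1 - \<tau>) 1 \<in> ?X" by (rule S1) (use False \<tau> in auto)
      then show ?thesis ..
    qed
    ultimately show ?thesis using fill[of "w - 2 - \<tau>" "w - 1 - \<tau>"] by fastforce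
  qed
  have r: "\<phi> (w - \<tau> + 1) 0 \<in> ?X" if "w \<noteq> 2 * \<tau>"
  proof -
    have "\<phi> (w - \<tau> + 2) 0 \<in> ?X" by (rule row0) (use \<tau> in auto)
    moreover have "\<phi> (w - \<tau> + 1) 1 \<in> ?X \<or> \<phi> (w - \<tau>) 1 \<in> ?X"
    proof (cases "w - \<tau> \<in> {0, 2, w - 1, \<tau>, \<tau> + 1}")
      case True
      have "\<phi> (w - \<tau> + 1) 1 \<in> ?X" by (rule S1) (use True that \<tau> in auto)
      then show ?thesis ..
    next
      case False
      have "\<phi> (w - \<tau>) 1 \<in> ?X" by (rule S1) (use False \<tau> in auto)
      then show ?thesis ..
    qed
    ultimately show ?thesis using fill[of "w - \<tau> + 2" "w - \<tau> + 1"] by fastforce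
  qed
  have gap: "\<phi> (w - 1 - \<tau>) 0 \<in> ?X \<and> \<phi> (w - \<tau>) 0 \<in> ?X \<and> \<phi> (w - \<tau> + 1) 0 \<in> ?X"
  proof (cases "w = 2 * \<tau> + 2")
    case True
    have 1: "\<phi> (w - \<tau> + 1) 0 \<in> ?X" using r True by simp
    have "\<phi> (w - \<tau>) 1 \<in> ?X" by (rule S1) (use True \<tau> in auto)
    then have 2: "\<phi> (w - \<tau>) 0 \<in> ?X" by (intro fill[OF 1]) auto
    have "\<phi> (w - 1 - \<tau> - 1) 0 \<in> ?X" by (rule row0) (use \<tau> in auto)
    moreover have "\<phi> (w - 1 - \<tau> + 1) 0 \<in> ?X" using 2 by simp
    ultimately show ?thesis using 1 2 mid by blast
  next
    case False
    note 1 = l[OF False]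
    show ?thesis
    proof (cases "w = 2 * \<tau>")
      case True
      have "\<phi> (w - \<tau> - 1) 1 \<in> ?X" by (rule S1) (use True \<tau> in auto)
      then have 2: "\<phi> (w - \<tau>) 0 \<in> ?X" by (intro fill[OF 1]) auto
      have "\<phi> (w - \<tau> + 1 + 1) 0 \<in> ?X" by (rule row0) (use \<tau> in auto)
      moreover have "\<phi> (w - \<tau> + 1 - 1) 0 \<in> ?X" using 2 by simp
      ultimately show ?thesis using 1 2 mid by blast
    next
      case False
      have "\<phi> (w - \<tau> - 1) 0 \<in> ?X" using 1 by (simp add: algebra_simps)
      then show ?thesis using 1 r[OF False] mid by blast
    qed
  qed
  have cover: "\<phi> x y \<in> ?P \<or> \<phi> x y \<in> ?X" if "0 \<le> y" "y < 0 + R" for x y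
  proof -
    have m: "0 \<le> x mod w" "x mod w < w" using w_pos by auto
    have r0: "\<phi> (x mod w) 0 \<in> ?X"
    proof (cases "x mod w \<in> {w - 1 - \<tau>, w - \<tau>, w - \<tau> + 1}")
      case True
      then consider "x mod w = w - 1 - \<tau>" | "x mod w = w - \<tau>" | "x mod w = w - \<tau> + 1" by blast
      then show ?thesis using gap by cases simp_all
    qed (rule row0[OF m])
    have "y = 0 \<or> y = 1" using that R by auto
    then have "\<phi> (x mod w) y \<in> ?P \<or> \<phi> (x mod w) y \<in> ?X"
      using row1[OF m] r0 by (elim disjE) simp_all
    then show ?thesis by (simp only: row_mod)
  qed
  show ?thesis
  proof (rule planI[OF c(1)])
    show "?P \<subseteq> ball (\<phi> 0 0) 10" by (auto intro!: in_ball_0)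
    show "card ?P \<le> 12" using card_length[of "[\<phi> 0 1, \<phi> 1 (-1), \<phi> 2 1, \<phi> (-1) 1, \<phi> 0 (-1)]"] by simp
    show "\<phi> x y \<in> ?P \<or> \<phi> x y \<in> ?X" for x y
      using all_rows[of 0 "\<lambda>v. v \<in> ?P \<or> v \<in> ?X" x y] cover by blast
  qed
qed

end

section \<open>The graph K_{3,3,3}\<close>

context based_lists begin

text \<open>The nine vertices form a complete tripartite graph with classes x - y modulo 3. Two
  precoloured pairs, each inside one class, give a vertex of the third class two savings.\<close>

lemma plan_K333:
  assumes R: "R = 3" and w: "w = 3" and \<tau>: "3 dvd \<tau>"
  shows "plan (\<phi> 0 0)"
proof -
  have lat: "\<Lambda> a b \<longleftrightarrow> 3 dvd a \<and> 3 dvd b" for a b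
  proof
    assume "\<Lambda> a b"
    then obtain k where "b = 3 * k" "3 dvd a - \<tau> * k" by (auto simp: basis R w)
    then show "3 dvd a \<and> 3 dvd b" using \<tau> dvd_add[of 3 "a - \<tau> * k" "\<tau> * k"] by simp
  next
    assume "3 dvd a \<and> 3 dvd b"
    then show "\<Lambda> a b" using \<tau> by (auto simp: basis R w)
  qed
  let ?P1 = "{\<phi> (-1) 1, \<phi> 1 0}"
  let ?P = "{\<phi> 1 (-1), \<phi> (-1) 0, \<phi> (-1) 1, \<phi> 1 0}"
  note dec = per adj_iff units_def lat N_iff
  obtain c1 where c1: "pcol ?P1 c1" "sv ?P1 c1 1 (\<phi> 0 0)" "sv ?P1 c1 1 (\<phi> 0 1)"
    using ext_pair_two[of "{}" "\<lambda>_. 0" "\<phi> 1 0" "\<phi> (-1) 1" "\<phi> 0 0" 0 "\<phi> 0 1" 0]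
    by (auto simp: dec pcol_empty sv_0 card_avail_empty)
  have "3 \<le> card (avail ?P1 c1 (\<phi> (-1) 0))" "3 \<le> card (avail ?P1 c1 (\<phi> 1 (-1)))"
    using avail_ge[of "\<phi> (-1) 0" ?P1 ?P1 c1] avail_ge[of "\<phi> 1 (-1)" ?P1 ?P1 c1] by (auto simp: dec)
  then obtain c where e: "extends ?P1 c1 ?P c" and c: "pcol ?P c" "sv ?P c 2 (\<phi> 0 0)"
    using ext_pair[OF c1(1), of "\<phi> (-1) 0" "\<phi> 1 (-1)" "\<phi> 0 0" 1] c1(2)
    by (auto simp: dec numeral_2_eq_2)
  have c': "sv ?P c 1 (\<phi> 0 1)" using sv_mono[OF e c1(3)] by simp
  let ?X = "peel ?P c"
  have nP: "\<phi> 0 0 \<notin> ?P" "\<phi> 0 1 \<notin> ?P" "\<phi> 0 2 \<notin> ?P" "\<phi> 1 1 \<notin> ?P" "\<phi> 2 2 \<notin> ?P" by (auto simp: dec)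
  have X0: "\<phi> 0 0 \<in> ?X" using c(2) nP by (intro peel_none) auto
  have X1: "\<phi> 0 1 \<in> ?X" using c' nP by (intro peel_one[OF X0]) (auto simp: dec)
  have X2: "\<phi> 0 2 \<in> ?X" by (rule peel_two[OF X0 X1 _ _ _ nP(3)]) (auto simp: dec)
  have X11: "\<phi> 1 1 \<in> ?X" by (rule peel_two[OF X1 X2 _ _ _ nP(4)]) (auto simp: dec)
  have X22: "\<phi> 2 2 \<in> ?X" by (rule peel_two[OF X1 X2 _ _ _ nP(5)]) (auto simp: dec)
  show ?thesis
  proof (rule planI[OF c(1)])
    show "?P \<subseteq> ball (\<phi> 0 0) 10" by (auto intro!: in_ball_0)
    show "card ?P \<le> 12" using card_length[of "[\<phi> 1 (-1), \<phi> (-1) 0, \<phi> (-1) 1, \<phi> 1 0]"] by simp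
    show "\<phi> x y \<in> ?P \<or> \<phi> x y \<in> ?X" for x y
    proof -
      have red: "\<phi> x y = \<phi> a b" if "x mod 3 = a mod 3" "y mod 3 = b mod 3" for a b
        using that by (simp add: per lat mod_eq_dvd_iff)
      have "x mod 3 \<in> {0, 1, 2}" "y mod 3 \<in> {0, 1, 2}" by auto
      then show ?thesis
        using red[of 0 0] red[of 0 1] red[of 0 2] red[of 1 0] red[of 1 1] red[of 1 "-1"] red[of "-1" 0]
          red[of "-1" 1] red[of 2 2] X0 X1 X2 X11 X22 by (simp, elim disjE, simp_all)
    qed
  qed
qed

end

section \<open>Covers with the period (2,2)\<close>

context cover_lists begin

text \<open>The period (2,2) leaves two nonadjacent vertices on each level x - y, told apart by the
  parity of y. Each is adjacent to all vertices one level away and to those of the other parity two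
  levels away. Colouring the levels 1 and -1 gives (0,0) two savings and peels vertices on levels 2
  and -2. If \<open>H\<close> is 6, these two meet at level 3; otherwise (5,1) on level 4 is
  coloured as well and saves at (3,0).\<close>

lemma plan_levels:
  assumes two: "\<Lambda> 2 2" and lev: "\<And>a b. \<Lambda> a b \<Longrightarrow> H dvd a - b"
    and H: "\<Lambda> ha hb" "ha - hb = H" "H = 6 \<or> 9 \<le> H"
  shows "plan (\<phi> 0 0)"
proof -
  have same: "\<phi> x y = \<phi> x' y'" if "x - y = x' - y'" "even (y - y')" for x y x' y'
  proof -
    obtain k where "y - y' = 2 * k" using \<open>even (y - y')\<close> by (elim evenE)
    moreover have "x - x' = y - y'" using that by linarith
    ultimately show ?thesis using lat_mult[OF two, of k] by (simp add: per mult.commute)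
  qed
  have lat: "\<Lambda> a b \<longleftrightarrow> a = b \<and> even a" if "\<bar>a - b\<bar> < H" for a b
  proof
    assume ab: "\<Lambda> a b"
    then have "a = b" using lev[OF ab] that by (simp add: small_dvd)
    moreover have "even a"
    proof (rule ccontr)
      assume "odd a"
      then have "\<phi> a a = \<phi> 1 1" by (intro same) auto
      then have "\<Lambda> 1 1" using ab \<open>a = b\<close> per[of a a 0 0] per[of 1 1 0 0] by simp
      then show False using lat_not_unit_diff[of 1 0 0 "-1"] by (auto simp: units_def)
    qed
    ultimately show "a = b \<and> even a" ..
  next
    assume "a = b \<and> even a"
    then have "even b" by auto
    then show "\<Lambda> a b" using same[of a b 0 0] \<open>a = b \<and> even a\<close> by (simp add: per)
  qed
  have differ: "\<phi> a b \<noteq> \<phi> a' b'"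
    if "a - b \<noteq> a' - b' \<or> odd (b - b')" "\<bar>(a - b) - (a' - b')\<bar> < H" for a b a' b'
  proof
    assume "\<phi> a b = \<phi> a' b'"
    then have "\<Lambda> (a - a') (b - b')" by (simp only: per)
    moreover have "\<bar>(a - a') - (b - b')\<bar> < H" using that(2) by (simp add: algebra_simps)
    ultimately have "a - a' = b - b' \<and> even (a - a')" using lat by blast
    then have "a - b = a' - b'" "even (b - b')" by presburger+
    then show False using that(1) by blast
  qed
  have H6: "6 \<le> H" using H(3) by auto
  have lat6: "\<Lambda> a b \<longleftrightarrow> a = b \<and> even a" if "\<bar>a - b\<bar> \<le> 5" for a b using lat H6 that by simp
  have adj1: "E (\<phi> x y) (\<phi> x' y')" if "x' - y' = x - y + 1 \<or> x' - y' = x - y - 1" for x y x' y'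
  proof (cases "even (y - y')")
    case True
    then have "\<phi> x' y' = \<phi> (x + (x' - y' - (x - y))) y" using that by (intro same) auto
    moreover have "E (\<phi> x y) (\<phi> (x + (x' - y' - (x - y))) y)"
      using that by (intro adj_unit) (auto simp: units_def)
    ultimately show ?thesis by simp
  next
    case False
    then have "\<phi> x' y' = \<phi> x (y - (x' - y' - (x - y)))" using that by (intro same) presburger+
    moreover have "E (\<phi> x y) (\<phi> x (y - (x' - y' - (x - y))))"
      using that by (intro adj_unit) (auto simp: units_def)
    ultimately show ?thesis by simp
  qed
  have adj2: "E (\<phi> x y) (\<phi> x' y')"
    if "x' - y' = x - y + 2 \<or> x' - y' = x - y - 2" "odd (y - y')" for x y x' y'
  proof -
    define s where "s = (x' - y' - (x - y)) div 2"
    have s: "s = 1 \<or> s = -1" "x' - y' = x - y + 2 * s" using that(1) unfolding s_def by presburger+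
    then have "\<phi> x' y' = \<phi> (x + s) (y - s)" using that(2) by (intro same) presburger+
    moreover have "E (\<phi> x y) (\<phi> (x + s) (y - s))" using s by (intro adj_unit) (auto simp: units_def)
    ultimately show ?thesis by simp
  qed
  have adj12: "E (\<phi> x y) (\<phi> x' y')"
    if "\<bar>(x' - y') - (x - y)\<bar> = 1 \<or> \<bar>(x' - y') - (x - y)\<bar> = 2 \<and> odd (y - y')" for x y x' y'
    using that adj1[of x' y' x y] adj2[of x' y' x y] by (auto simp: abs_if split: if_splits)
  note dec = per adj_iff units_def lat6 N_iff
  let ?P1 = "{\<phi> 2 1, \<phi> 1 0}"
  let ?P2 = "{\<phi> 0 1, \<phi> (-1) 0, \<phi> 2 1, \<phi> 1 0}"
  obtain c1 where c1: "pcol ?P1 c1" "sv ?P1 c1 1 (\<phi> 0 0)" "sv ?P1 c1 1 (\<phi> 3 1)"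
    using ext_pair_two[of "{}" "\<lambda>_. 0" "\<phi> 1 0" "\<phi> 2 1" "\<phi> 0 0" 0 "\<phi> 3 1" 0]
    by (auto simp: dec pcol_empty sv_0 card_avail_empty)
  have "N (\<phi> (-1) 0) \<inter> ?P1 \<subseteq> {\<phi> 2 1}" "N (\<phi> 0 1) \<inter> ?P1 \<subseteq> {\<phi> 1 0}" by (auto simp: dec)
  then have "4 \<le> card (avail ?P1 c1 (\<phi> (-1) 0))" "4 \<le> card (avail ?P1 c1 (\<phi> 0 1))"
    using avail_ge[of "\<phi> (-1) 0" ?P1 "{\<phi> 2 1}" c1] avail_ge[of "\<phi> 0 1" ?P1 "{\<phi> 1 0}" c1] by auto
  then obtain c2 where e2: "extends ?P1 c1 ?P2 c2"
    and c2: "pcol ?P2 c2" "sv ?P2 c2 2 (\<phi> 0 0)" "sv ?P2 c2 1 (\<phi> (-1) 1)"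
    using ext_pair_two[OF c1(1), of "\<phi> (-1) 0" "\<phi> 0 1" "\<phi> 0 0" 1 "\<phi> (-1) 1" 0] c1(2)
    by (auto simp: dec numeral_2_eq_2 sv_0)
  have c2': "sv ?P2 c2 1 (\<phi> 3 1)" using sv_mono[OF e2 c1(3)] by simp
  have period: "\<phi> x y = \<phi> (x + k * ha) (y + k * hb)" for x y k
    using lat_mult[OF H(1), of k] lat_uminus[of "k * ha" "k * hb"] by (simp add: per)
  have reduce: "Q (\<phi> x y)" if Q: "\<And>x y. -1 \<le> x - y \<Longrightarrow> x - y \<le> H - 2 \<Longrightarrow> Q (\<phi> x y)" for Q x y
  proof -
    define k where "k = - ((x - y + 1) div H)"
    have "k * ha - k * hb = - (H * ((x - y + 1) div H))"
      using H(2) by (metis k_def left_diff_distrib' mult.commute mult_minus_left right_diff_distrib')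
    moreover have "x - y + 1 - H * ((x - y + 1) div H) = (x - y + 1) mod H"
      by (rule minus_mult_div_eq_mod)
    ultimately have e: "(x + k * ha) - (y + k * hb) = (x - y + 1) mod H - 1" by linarith
    have "0 \<le> (x - y + 1) mod H" "(x - y + 1) mod H < H" using H6 by auto
    then have "Q (\<phi> (x + k * ha) (y + k * hb))" using e by (intro Q) linarith+
    then show ?thesis using period[of x y k] by simp
  qed
  show ?thesis
  proof (cases "H = 6")
    case True
    let ?X = "peel ?P2 c2"
    have P2: "\<phi> x y \<notin> ?P2" if "x - y \<noteq> 1" "x - y \<noteq> -1" "-1 \<le> x - y" "x - y \<le> H - 2" for x y
      using that True by (auto simp: per lat)
    have X0: "\<phi> 0 0 \<in> ?X" using c2(2) by (intro peel_none) (auto simp: dec)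
    have X2: "\<phi> 3 1 \<in> ?X" using c2' by (intro peel_one[OF X0]) (auto simp: dec)
    have Xm2: "\<phi> (-1) 1 \<in> ?X" using c2(3) by (intro peel_one[OF X0]) (auto simp: dec)
    have Xm2': "\<phi> (-1 + ha) (1 + hb) \<in> ?X" using Xm2 period[of "-1" 1 1] by simp
    have two_nb: "\<phi> x y \<in> ?X"
      if "\<phi> a b \<in> ?X" "\<phi> a' b' \<in> ?X" "E (\<phi> x y) (\<phi> a b)" "E (\<phi> x y) (\<phi> a' b')"
        "a - b \<noteq> a' - b' \<or> odd (b - b')" "\<bar>(a - b) - (a' - b')\<bar> < H" "x - y \<in> {0, 2, 3, 4}" for x y a b a' b'
    proof (rule peel_two[OF that(1-4)])
      show "\<phi> a b \<noteq> \<phi> a' b'" by (rule differ[OF that(5,6)])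
      show "\<phi> x y \<notin> ?P2" by (rule P2) (use that(7) True in auto)
    qed
    have L3: "\<phi> x y \<in> ?X" if "x - y = 3" for x y
      by (rule two_nb[OF X2 Xm2']) (use that H(2) True in \<open>auto intro!: adj1\<close>)
    have L3': "\<phi> 3 0 \<in> ?X" "\<phi> 4 1 \<in> ?X" by (rule L3, simp)+
    have L2: "\<phi> x y \<in> ?X" if "x - y = 2" for x y
      by (rule two_nb[OF L3']) (use that H(2) True in \<open>auto intro!: adj1\<close>)
    have L4: "\<phi> x y \<in> ?X" if "x - y = 4" for x y
      by (rule two_nb[OF L3']) (use that H(2) True in \<open>auto intro!: adj1\<close>)
    have Lm2: "\<phi> x y \<in> ?X" if "x - y = -2" for x y
      using L4[of "x + ha" "y + hb"] that H(2) True period[of x y 1] by simp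
    have L0: "\<phi> x y \<in> ?X" if "x - y = 0" for x y
      by (rule two_nb[OF L2[of "x + 1" "y - 1"] Lm2[of "x - 1" "y + 1"]])
        (use that True in \<open>auto intro!: adj2\<close>)
    show ?thesis
    proof (rule planI[OF c2(1)])
      show "?P2 \<subseteq> ball (\<phi> 0 0) 10" by (auto intro!: in_ball_0)
      show "card ?P2 \<le> 12" using card_length[of "[\<phi> 0 1, \<phi> (-1) 0, \<phi> 2 1, \<phi> 1 0]"] by simp
      show "\<phi> x y \<in> ?P2 \<or> \<phi> x y \<in> ?X" for x y
      proof (rule reduce[of "\<lambda>v. v \<in> ?P2 \<or> v \<in> ?X"])
        fix x y assume "-1 \<le> x - y" "x - y \<le> H - 2"
        then have "x - y = -1 \<or> x - y = 0 \<or> x - y = 1 \<or> x - y = 2 \<or> x - y = 3 \<or> x - y = 4"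
          using True by auto
        moreover have "\<phi> x y \<in> ?P2" if "x - y = 1"
          using same[of x y 1 0] same[of x y 2 1] that by (cases "even y") auto
        moreover have "\<phi> x y \<in> ?P2" if "x - y = -1"
          using same[of x y "-1" 0] same[of x y 0 1] that by (cases "even y") auto
        ultimately show "\<phi> x y \<in> ?P2 \<or> \<phi> x y \<in> ?X" using L0 L2 L3 L4 by blast
      qed
    qed
  next
    case False
    then have H9: "9 \<le> H" using H(3) by simp
    have lat8: "\<Lambda> a b \<longleftrightarrow> a = b \<and> even a" if "\<bar>a - b\<bar> \<le> 8" for a b using lat H9 that by simp
    note dec = per adj_iff units_def lat8 N_iff
    let ?P = "{\<phi> 5 1, \<phi> 0 1, \<phi> (-1) 0, \<phi> 2 1, \<phi> 1 0}"
    have "N (\<phi> 5 1) \<inter> ?P2 \<subseteq> {}" by (auto simp: dec)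
    then have "5 \<le> card (avail ?P2 c2 (\<phi> 5 1))" using avail_ge[of "\<phi> 5 1" ?P2 "{}" c2] by simp
    moreover have "\<phi> 2 1 \<in> N (\<phi> 3 0) \<inter> ?P2" by (auto simp: dec)
    then have "1 \<le> card (N (\<phi> 3 0) \<inter> ?P2)"
      using finite_N by (auto simp: Suc_le_eq card_gt_0_iff)
    ultimately obtain c where e: "extends ?P2 c2 ?P c" and c: "pcol ?P c" "sv ?P c 1 (\<phi> 3 0)"
      using ext_single[OF c2(1), of "\<phi> 5 1" "\<phi> 3 0" 0] by (auto simp: sv_0 dec)
    have c': "sv ?P c 2 (\<phi> 0 0)" "sv ?P c 1 (\<phi> 3 1)"
      using sv_mono[OF e c2(2)] sv_mono[OF e c2'] by auto
    let ?X = "peel ?P c"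
    have P: "\<phi> x y \<notin> ?P" if "x - y \<noteq> 1" "x - y \<noteq> -1" "-1 \<le> x - y" "x - y \<le> H - 2" "x - y = 4 \<Longrightarrow> even y"
      for x y using that H9 by (auto simp: per lat)
    have two_nb: "\<phi> x y \<in> ?X"
      if "\<phi> a b \<in> ?X" "\<phi> a' b' \<in> ?X" "E (\<phi> x y) (\<phi> a b)" "E (\<phi> x y) (\<phi> a' b')"
        "a - b \<noteq> a' - b' \<or> odd (b - b')" "\<bar>(a - b) - (a' - b')\<bar> < H" "x - y \<noteq> 1" "0 \<le> x - y" "x - y \<le> H - 2"
        "x - y = 4 \<Longrightarrow> even y" for x y a b a' b'
    proof (rule peel_two[OF that(1-4)])
      show "\<phi> a b \<noteq> \<phi> a' b'" by (rule differ[OF that(5,6)])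
      show "\<phi> x y \<notin> ?P" by (rule P) (use that(7-) in auto)
    qed
    have X0: "\<phi> 0 0 \<in> ?X" using c' by (intro peel_none) (auto simp: dec)
    have X2: "\<phi> 3 1 \<in> ?X" using c' by (intro peel_one[OF X0]) (auto simp: dec)
    have X3: "\<phi> 3 0 \<in> ?X" using c by (intro peel_one[OF X2]) (auto simp: dec)
    have X4: "\<phi> 4 0 \<in> ?X" by (rule two_nb[OF X2 X3]) (use H9 in \<open>auto intro!: adj12\<close>)
    have X31: "\<phi> 4 1 \<in> ?X" by (rule two_nb[OF X2 X4]) (use H9 in \<open>auto intro!: adj12\<close>)
    have L3: "\<phi> x y \<in> ?X" if "x - y = 3" for x y
      using X3 X31 same[of x y 3 0] same[of x y 4 1] that by (cases "even y") auto
    have L2: "\<phi> x y \<in> ?X" if "x - y = 2" for x y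
      by (rule two_nb[OF X3 X31]) (use that H9 in \<open>auto intro!: adj1\<close>)
    have L5: "\<phi> x y \<in> ?X" if "x - y = 5" for x y
      by (rule two_nb[OF X4 L3[of "x - 1" "y + 1"]]) (use that H9 in \<open>auto intro!: adj12\<close>)
    have up: "\<phi> x y \<in> ?X" if "5 + int j \<le> H - 2" "x - y = 5 + int j" for x y j
      using that
    proof (induction j arbitrary: x y)
      case (Suc j)
      have "\<phi> (x - 1) y \<in> ?X" "\<phi> x (y + 1) \<in> ?X" by (rule Suc.IH, use Suc.prems in auto)+
      then show ?case by (rule two_nb) (use Suc.prems H9 in \<open>auto intro!: adj1\<close>)
    qed (use L5 in simp)
    have Lm2: "\<phi> x y \<in> ?X" if "x - y = -2" for x y
      using up[of "nat (H - 7)" "x + ha" "y + hb"] that H(2) H9 period[of x y 1] by simp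
    have L0: "\<phi> x y \<in> ?X" if "x - y = 0" for x y
      by (rule two_nb[OF L2[of "x + 1" "y - 1"] Lm2[of "x - 1" "y + 1"]])
        (use that H9 in \<open>auto intro!: adj2\<close>)
    show ?thesis
    proof (rule planI[OF c(1)])
      show "?P \<subseteq> ball (\<phi> 0 0) 10" by (auto intro!: in_ball_0)
      show "card ?P \<le> 12" using card_length[of "[\<phi> 5 1, \<phi> 0 1, \<phi> (-1) 0, \<phi> 2 1, \<phi> 1 0]"] by simp
      show "\<phi> x y \<in> ?P \<or> \<phi> x y \<in> ?X" for x y
      proof (rule reduce[of "\<lambda>v. v \<in> ?P \<or> v \<in> ?X"])
        fix x y assume "-1 \<le> x - y" "x - y \<le> H - 2"
        then have "x - y = -1 \<or> x - y = 0 \<or> x - y = 1 \<or> x - y = 2 \<or> x - y = 3 \<or> x - y = 4 \<or>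
            5 \<le> x - y \<and> x - y \<le> H - 2" by auto
        moreover have "\<phi> x y \<in> ?P" if "x - y = 1"
          using same[of x y 1 0] same[of x y 2 1] that by (cases "even y") auto
        moreover have "\<phi> x y \<in> ?P" if "x - y = -1"
          using same[of x y "-1" 0] same[of x y 0 1] that by (cases "even y") auto
        moreover have "\<phi> x y \<in> ?P \<or> \<phi> x y \<in> ?X" if "x - y = 4"
          using same[of x y 4 0] same[of x y 5 1] that X4 by (cases "even y") auto
        moreover have "\<phi> x y \<in> ?X" if "5 \<le> x - y \<and> x - y \<le> H - 2"
          using up[of "nat (x - y - 5)" x y] that by simp
        ultimately show "\<phi> x y \<in> ?P \<or> \<phi> x y \<in> ?X"
          using L0[of x y] L2[of x y] L3[of x y] by argo
      qed
    qed
  qed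
qed

end

section \<open>Covers of 3-chromatic triangulations\<close>

text \<open>Hermite normal form of a subgroup of the plane lattice that meets both axes:
  \<open>w\<close> is its least positive element in row 0 and \<open>R\<close> its least positive
  height.\<close>

lemma lattice_basis:
  fixes G :: "int \<Rightarrow> int \<Rightarrow> bool"
  assumes diff: "\<And>a b a' b'. G a b \<Longrightarrow> G a' b' \<Longrightarrow> G (a - a') (b - b')"
    and N: "0 < N" "G N 0" "0 < M" "G 0 M"
  shows "\<exists>w R \<tau>. 0 < w \<and> 0 < R \<and> (\<forall>a b. G a b \<longleftrightarrow> (\<exists>k. b = R * k \<and> w dvd (a - \<tau> * k)))"
proof -
  have zero: "G 0 0" using diff[OF N(2) N(2)] by simp
  have neg: "G (- a) (- b)" if "G a b" for a b using diff[OF zero that] by simp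
  have add: "G (a + a') (b + b')" if "G a b" "G a' b'" for a b a' b' using diff[OF that(1) neg[OF that(2)]] by simp
  have mult: "G (k * a) (k * b)" if "G a b" for k a b
  proof -
    have pos: "G (int n * a) (int n * b)" for n
      by (induction n) (use zero add that in \<open>auto simp: algebra_simps\<close>)
    show ?thesis
    proof (cases "0 \<le> k")
      case True
      then show ?thesis using pos[of "nat k"] by simp
    next
      case False
      then show ?thesis using neg[OF pos[of "nat (- k)"]] by simp
    qed
  qed
  define w where "w = int (LEAST n. 0 < n \<and> G (int n) 0)"
  have w: "0 < w" "G w 0"
    using LeastI[of "\<lambda>n. 0 < n \<and> G (int n) 0" "nat N"] N by (auto simp: w_def)
  have w_dvd: "w dvd a" if "G a 0" for a
  proof -
    have "G (a mod w) 0"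
      using diff[OF that mult[OF w(2), of "a div w"]] by (simp add: minus_div_mult_eq_mod)
    moreover have "a mod w < w" "0 \<le> a mod w" using w by auto
    ultimately have "a mod w = 0"
      using Least_le[of "\<lambda>n. 0 < n \<and> G (int n) 0" "nat (a mod w)"] unfolding w_def by force
    then show ?thesis by (simp add: dvd_eq_mod_eq_0)
  qed
  define R where "R = int (LEAST n. 0 < n \<and> (\<exists>a. G a (int n)))"
  have "\<exists>a. G a (int (nat M))" using N(3,4) by (auto intro: exI[of _ 0])
  then have R: "0 < R" "\<exists>a. G a R"
    using LeastI[of "\<lambda>n. 0 < n \<and> (\<exists>a. G a (int n))" "nat M"] N(3) by (auto simp: R_def)
  have R_dvd: "R dvd b" if "G a b" for a b
  proof -
    obtain t where t: "G t R" using R by blast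
    have "G (a - b div R * t) (b mod R)"
      using diff[OF that mult[OF t, of "b div R"]] by (simp add: minus_div_mult_eq_mod)
    then have ex: "\<exists>a. G a (b mod R)" by blast
    have "b mod R < R" "0 \<le> b mod R" using R by auto
    then have "b mod R = 0"
      using Least_le[of "\<lambda>n. 0 < n \<and> (\<exists>a. G a (int n))" "nat (b mod R)"] ex unfolding R_def by force
    then show ?thesis by (simp add: dvd_eq_mod_eq_0)
  qed
  obtain \<tau> where \<tau>: "G \<tau> R" using R by blast
  have "G a b \<longleftrightarrow> (\<exists>k. b = R * k \<and> w dvd (a - \<tau> * k))" for a b
  proof
    assume ab: "G a b"
    then obtain k where k: "b = R * k" using R_dvd by blast
    then have "G (a - \<tau> * k) 0" using diff[OF ab mult[OF \<tau>, of k]] by (simp add: mult.commute)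
    then show "\<exists>k. b = R * k \<and> w dvd (a - \<tau> * k)" using k w_dvd by blast
  next
    assume "\<exists>k. b = R * k \<and> w dvd (a - \<tau> * k)"
    then obtain k j where "b = R * k" "a - \<tau> * k = w * j" by blast
    then show "G a b" using add[OF mult[OF \<tau>, of k] mult[OF w(2), of j]] by (simp add: algebra_simps)
  qed
  then show ?thesis using w R by blast
qed

text \<open>Pigeonhole: a finite graph cannot keep all integer multiples of a vector apart.\<close>

lemma (in lattice_cover) ex_axes: "\<exists>N M. 0 < N \<and> \<Lambda> N 0 \<and> 0 < M \<and> \<Lambda> 0 M"
proof -
  have fin: "finite V" using simple by (simp add: simple_graph_def)
  have *: "\<exists>N>0. \<Lambda> (N * a) (N * b)" for a b
  proof -
    have "range (\<lambda>i::int. \<phi> (i * a) (i * b)) \<subseteq> V" by auto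
    then have "finite (range (\<lambda>i::int. \<phi> (i * a) (i * b)))" using fin finite_subset by blast
    then have "\<not> inj (\<lambda>i::int. \<phi> (i * a) (i * b))" using finite_imageD infinite_UNIV_int by blast
    then obtain i j :: int where ij: "i \<noteq> j" "\<phi> (i * a) (i * b) = \<phi> (j * a) (j * b)" by (auto simp: inj_def)
    then have L: "\<Lambda> ((i - j) * a) ((i - j) * b)" by (simp add: per left_diff_distrib)
    show ?thesis
    proof (cases "i > j")
      case True
      then show ?thesis using L by (intro exI[of _ "i - j"]) simp
    next
      case False
      then have "j - i > 0" using ij by simp
      moreover have "\<Lambda> ((j - i) * a) ((j - i) * b)"
        using lat_uminus[of "(i - j) * a" "(i - j) * b"] L by (simp add: left_diff_distrib)
      ultimately show ?thesis by blast
    qed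
  qed
  show ?thesis using *[of 1 0] *[of 0 1] by auto
qed

lemma (in lattice_cover) based: "\<exists>w R \<tau>. based_cover V E \<phi> \<Lambda> w R \<tau>"
proof -
  obtain N M where "0 < N" "\<Lambda> N 0" "0 < M" "\<Lambda> 0 M" using ex_axes by blast
  then obtain w R \<tau> where "0 < w" "0 < R" "\<And>a b. \<Lambda> a b \<longleftrightarrow> (\<exists>k. b = R * k \<and> w dvd (a - \<tau> * k))"
    using lattice_basis[of \<Lambda> N M] lat_diff by metis
  then have "based_cover V E \<phi> \<Lambda> w R \<tau>" by unfold_locales auto
  then show ?thesis by blast
qed

text \<open>In the lattice, x - y modulo 3 is the proper 3-colouring, unique up to renaming colours;
  the assumption lets it descend to the quotient.\<close>

locale three_cover = lattice_cover +
  assumes three: "\<Lambda> a b \<Longrightarrow> 3 dvd a - b"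
begin

text \<open>The maximum of |a|, |b|, |a + b| is the hexagonal norm. Up to sign there are nine
  nonzero vectors of norm at most 4 with 3 dividing a - b: the three of norm 2, excluded by
  simplicity, and the six in the assumptions.\<close>

lemma lat_short_norm:
  assumes no3: "\<not> \<Lambda> 3 0" "\<not> \<Lambda> 0 3" "\<not> \<Lambda> 3 (-3)"
    and no2: "\<not> \<Lambda> 2 2" "\<not> \<Lambda> (-2) 4" "\<not> \<Lambda> 4 (-2)"
    and ab: "\<Lambda> a b" "\<bar>a\<bar> \<le> 4" "\<bar>b\<bar> \<le> 4" "\<bar>a + b\<bar> \<le> 4"
  shows "a = 0 \<and> b = 0"
proof (rule ccontr)
  assume nz: "\<not> (a = 0 \<and> b = 0)"
  have f: "\<not> \<Lambda> 1 1" "\<not> \<Lambda> (-1) 2" "\<not> \<Lambda> 2 (-1)"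
    using lat_not_unit_diff[of 1 0 0 "-1"] lat_not_unit_diff[of 0 1 1 "-1"] lat_not_unit_diff[of 1 0 "-1" 1]
    by (auto simp: units_def)
  have n: "\<not> \<Lambda> (-1) (-1)" "\<not> \<Lambda> 1 (-2)" "\<not> \<Lambda> (-2) 1" "\<not> \<Lambda> (-3) 0" "\<not> \<Lambda> 0 (-3)" "\<not> \<Lambda> (-3) 3"
    "\<not> \<Lambda> (-2) (-2)" "\<not> \<Lambda> 2 (-4)" "\<not> \<Lambda> (-4) 2"
    using f no3 no2 lat_uminus[of 1 1] lat_uminus[of "-1" 2] lat_uminus[of 2 "-1"] lat_uminus[of 3 0]
      lat_uminus[of 0 3] lat_uminus[of 3 "-3"] lat_uminus[of 2 2] lat_uminus[of "-2" 4]
      lat_uminus[of 4 "-2"] by simp_all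
  have "3 dvd a - b" using three ab by blast
  moreover have "a \<in> {-4, -3, -2, -1, 0, 1, 2, 3, 4}" using ab(2) by (simp add: abs_le_iff) presburger
  moreover have "b \<in> {-4, -3, -2, -1, 0, 1, 2, 3, 4}" using ab(3) by (simp add: abs_le_iff) presburger
  ultimately show False using ab(1,4) nz f n no3 no2 by (simp, elim disjE, simp_all)
qed

end

section \<open>Generic 3-chromatic covers: spreading along one colour class\<close>

locale three_cover_lists = three_cover V E \<phi> \<Lambda> + cover_lists V E \<phi> \<Lambda> L
  for V :: "'a set" and E :: "'a \<Rightarrow> 'a \<Rightarrow> bool" and \<phi> :: "int \<Rightarrow> int \<Rightarrow> 'a"
    and \<Lambda> :: "int \<Rightarrow> int \<Rightarrow> bool" and L :: "'a \<Rightarrow> nat set"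
begin

text \<open>All precoloured vertices lie in one colour class. A peeled vertex of that class has no
  precoloured neighbour, so peeling spreads to its whole link and from there to the vertices of
  the class at distance \<open>\<surd>3\<close>.\<close>

lemma plan_generic:
  assumes no3: "\<not> \<Lambda> 3 0" "\<not> \<Lambda> 0 3" "\<not> \<Lambda> 3 (-3)"
    and no2: "\<not> \<Lambda> 2 2" "\<not> \<Lambda> (-2) 4" "\<not> \<Lambda> 4 (-2)"
  shows "plan (\<phi> 0 0)"
proof -
  have lat: "\<Lambda> a b \<longleftrightarrow> b = 0 \<and> a = 0" if "\<bar>a\<bar> \<le> 4" "\<bar>b\<bar> \<le> 4" "\<bar>a + b\<bar> \<le> 4" for a b
    using lat_short_norm[OF no3 no2] that by auto
  note dec = per adj_iff units_def lat N_iff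
  let ?P1 = "{\<phi> (-1) 1, \<phi> 1 0}"
  let ?P2 = "{\<phi> 0 (-1), \<phi> (-1) 1, \<phi> 1 0}"
  let ?P = "{\<phi> 2 1, \<phi> 0 (-1), \<phi> (-1) 1, \<phi> 1 0}"
  obtain c1 where c1: "pcol ?P1 c1" "sv ?P1 c1 1 (\<phi> 0 0)" "sv ?P1 c1 1 (\<phi> 0 1)"
    using ext_pair_two[of "{}" "\<lambda>_. 0" "\<phi> 1 0" "\<phi> (-1) 1" "\<phi> 0 0" 0 "\<phi> 0 1" 0]
    by (auto simp: dec pcol_empty sv_0 card_avail_empty)
  have nadj: "\<not> E (\<phi> x y) (\<phi> x' y')" if "3 dvd (x - y) - (x' - y')" for x y x' y'
  proof
    assume "E (\<phi> x y) (\<phi> x' y')"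
    then obtain a b where "(a, b) \<in> units" "3 dvd (x' - x - a) - (y' - y - b)"
      using three by (auto simp: adj_iff)
    then show False using that unfolding units_def by auto presburger+
  qed
  have "N (\<phi> 0 (-1)) \<inter> ?P1 \<subseteq> {}" "N (\<phi> 2 1) \<inter> ?P2 \<subseteq> {}" by (auto simp: N_iff nadj)
  then have av: "5 \<le> card (avail ?P1 c1 (\<phi> 0 (-1)))" "5 \<le> card (avail ?P2 c (\<phi> 2 1))" for c
    using avail_ge[of "\<phi> 0 (-1)" ?P1 "{}" c1] avail_ge[of "\<phi> 2 1" ?P2 "{}" c] by simp_all
  have "N (\<phi> 0 0) \<inter> ?P1 = ?P1" by (auto simp: dec)
  then have "card (N (\<phi> 0 0) \<inter> ?P1) = 2" by (simp add: dec)
  then obtain c2 where e2: "extends ?P1 c1 ?P2 c2" and c2: "pcol ?P2 c2" "sv ?P2 c2 2 (\<phi> 0 0)"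
    using ext_single[OF c1(1), of "\<phi> 0 (-1)" "\<phi> 0 0" 1] c1(2) av(1) by (auto simp: dec numeral_2_eq_2)
  have "\<phi> 1 0 \<in> N (\<phi> 1 1) \<inter> ?P2" by (auto simp: dec)
  then have "1 \<le> card (N (\<phi> 1 1) \<inter> ?P2)" using finite_N by (auto simp: Suc_le_eq card_gt_0_iff)
  then obtain c where e3: "extends ?P2 c2 ?P c" and c: "pcol ?P c" "sv ?P c 1 (\<phi> 1 1)"
    using ext_single[OF c2(1), of "\<phi> 2 1" "\<phi> 1 1" 0] av(2)[of c2] by (auto simp: dec sv_0)
  have c': "sv ?P c 2 (\<phi> 0 0)" "sv ?P c 1 (\<phi> 0 1)"
    using sv_mono[OF e3 c2(2)] sv_mono[OF extends_trans[OF e2 e3] c1(3)] by auto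
  define P where "P = ?P"
  note c = c[folded P_def] and c' = c'[folded P_def]
  define X where "X = peel P c"
  have cardP: "card P \<le> 4" using card_length[of "[\<phi> 2 1, \<phi> 0 (-1), \<phi> (-1) 1, \<phi> 1 0]"] by (simp add: P_def)
  have clsP: "3 dvd x - y - 1" if "\<phi> x y \<in> P" for x y
  proof -
    have "\<Lambda> (x - 2) (y - 1) \<or> \<Lambda> x (y + 1) \<or> \<Lambda> (x + 1) (y - 1) \<or> \<Lambda> (x - 1) y"
      using that by (auto simp: P_def per)
    then have "3 dvd (x - 2) - (y - 1) \<or> 3 dvd x - (y + 1) \<or> 3 dvd (x + 1) - (y - 1) \<or> 3 dvd (x - 1) - y"
      using three by blast
    then show ?thesis by presburger
  qed
  have nP: "\<phi> 0 0 \<notin> P" "\<phi> 0 1 \<notin> P" "\<phi> 1 1 \<notin> P"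
    using clsP[of 0 0] clsP[of 0 1] clsP[of 1 1] by auto
  have X0: "\<phi> 0 0 \<in> X" unfolding X_def by (rule peel_none[OF _ c'(1) nP(1)]) simp
  have X1: "\<phi> 0 1 \<in> X"
    unfolding X_def by (rule peel_one[OF X0[unfolded X_def] _ c'(2) nP(2)]) (simp add: dec)
  have X2: "\<phi> 1 1 \<in> X"
    unfolding X_def by (rule peel_one[OF X1[unfolded X_def] _ c(2) nP(3)]) (simp add: dec)
  have nPz: "\<phi> 0 2 \<notin> P" by (auto simp: P_def dec)
  have Xz: "\<phi> 0 2 \<in> X"
    unfolding X_def by (rule peel_lattice[OF X1[unfolded X_def] X2[unfolded X_def] _ _ _ nPz]) (auto simp: units_def)
  define t where "t v \<longleftrightarrow> v \<in> X \<and> N v \<subseteq> X" for v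
  \<comment> \<open>A vertex of the coloured class and one of its neighbours peel the next neighbour
    in the rotation by 60 degrees, which is uncoloured because it lies in another class.\<close>
  have rot: "\<phi> (x - b) (y + a + b) \<in> X"
    if "\<phi> x y \<in> X" "3 dvd x - y - 1" "(a, b) \<in> units" "\<phi> (x + a) (y + b) \<in> X" for x y a b
  proof -
    have "\<phi> (x - b) (y + a + b) \<notin> P"
    proof
      assume "\<phi> (x - b) (y + a + b) \<in> P"
      then have "3 dvd (x - b) - (y + a + b) - 1" by (rule clsP)
      then show False using that(2,3) unfolding units_def by auto presburger+
    qed
    then show ?thesis
      using that(1,3,4) unfolding X_def by - (rule peel_lattice[of x y _ _ "x + a" "y + b"], auto simp: units_def)
  qed
  have link: "t (\<phi> x y)" if "\<phi> x y \<in> X" "3 dvd x - y - 1" "(a, b) \<in> units" "\<phi> (x + a) (y + b) \<in> X" for x y a b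
  proof -
    have r: "(- b, a + b) \<in> units \<and> \<phi> (x + (- b)) (y + (a + b)) \<in> X"
      if "(a, b) \<in> units \<and> \<phi> (x + a) (y + b) \<in> X" for a b
      using rot[OF \<open>\<phi> x y \<in> X\<close> \<open>3 dvd x - y - 1\<close>, of a b] that by (auto simp: units_def add.assoc)
    define S where "S = {(a, b). (a, b) \<in> units \<and> \<phi> (x + a) (y + b) \<in> X}"
    have step: "(a, b) \<in> S \<Longrightarrow> (- b, a + b) \<in> S" for a b using r[of a b] by (auto simp: S_def)
    have "(a, b) \<in> S" using that by (simp add: S_def)
    then have "(1, 0) \<in> S"
      using that(3) step[of 1 0] step[of 0 1] step[of "-1" 1] step[of "-1" 0] step[of 0 "-1"] step[of 1 "-1"]
      by (auto simp: units_def)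
    then have "units \<subseteq> S"
      using step[of 1 0] step[of 0 1] step[of "-1" 1] step[of "-1" 0] step[of 0 "-1"] step[of 1 "-1"]
      by (auto simp: units_def)
    then have "N (\<phi> x y) \<subseteq> X" unfolding nb by (auto simp: S_def units_def)
    then show ?thesis using that by (simp add: t_def)
  qed
  \<comment> \<open>The displacement is the sum of the unit (a, b) and its rotation (-b, a + b). It
    leads to a vertex of the same class that has the two intermediate vertices as common neighbours
    with the starting vertex.\<close>
  have spread: "\<phi> (x + a - b) (y + a + 2 * b) \<in> P \<or> t (\<phi> (x + a - b) (y + a + 2 * b))"
    if "t (\<phi> x y)" "3 dvd x - y - 1" "(a, b) \<in> units" for x y a b
  proof (cases "\<phi> (x + a - b) (y + a + 2 * b) \<in> P")
    case False
    have N: "\<phi> x' y' \<in> X" if "(x' - x, y' - y) \<in> units" for x' y'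
      using \<open>t (\<phi> x y)\<close> adj_unit[OF that] by (auto simp: t_def N_iff)
    have "\<phi> (x + a) (y + b) \<in> X" "\<phi> (x - b) (y + a + b) \<in> X"
      using that(3) by (auto intro!: N simp: units_def)
    then have "\<phi> (x + a - b) (y + a + 2 * b) \<in> X"
      using False that(3) unfolding X_def
      by - (rule peel_lattice[of "x + a" "y + b" _ _ "x - b" "y + a + b"], auto simp: units_def)
    moreover have "\<phi> (x + a - b + b) (y + a + 2 * b + (- a - b)) \<in> X"
      using \<open>\<phi> (x + a) (y + b) \<in> X\<close> by simp
    moreover have "3 dvd (x + a - b) - (y + a + 2 * b) - 1" using that(2) by presburger
    moreover have "(b, - a - b) \<in> units" using that(3) by (auto simp: units_def)
    ultimately show ?thesis using link by blast
  qed simp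
  \<comment> \<open>The class of (1,0) is itself a triangular lattice with basis (1,1), (-1,2). In
    these coordinates \<open>spread\<close> is motion along units, so the argument becomes one about
    paths that avoid four points.\<close>
  define \<beta> where "\<beta> i j = \<phi> (1 + i - j) (i + 2 * j)" for i j
  have spr: "\<beta> (i + a) (j + b) \<in> P \<or> t (\<beta> (i + a) (j + b))" if "t (\<beta> i j)" "(a, b) \<in> units" for i j a b
  proof -
    have e: "\<beta> (i + a) (j + b) = \<phi> (1 + i - j + a - b) (i + 2 * j + a + 2 * b)"
      by (simp add: \<beta>_def algebra_simps)
    have "3 dvd 1 + i - j - (i + 2 * j) - 1" by presburger
    then show ?thesis using spread[of "1 + i - j" "i + 2 * j" a b] that unfolding e by (simp add: \<beta>_def)
  qed
  have bz: "t (\<beta> 0 1)"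
    using link[of 0 2 0 "-1"] Xz X1 by (simp add: \<beta>_def units_def)
  have beq: "\<beta> i j = \<beta> i' j' \<longleftrightarrow> \<Lambda> ((i - i') - (j - j')) ((i - i') + 2 * (j - j'))" for i j i' j'
    by (simp add: \<beta>_def per algebra_simps)
  have P_beta: "P = {\<beta> 0 0, \<beta> (-1) 0, \<beta> 1 0, \<beta> (-1) 1}" by (auto simp: P_def \<beta>_def)
  define G where "G a b \<longleftrightarrow> \<Lambda> (a - b) (a + 2 * b)" for a b
  obtain N M where NM: "0 < N" "\<Lambda> N 0" "0 < M" "\<Lambda> 0 M" using ex_axes by blast
  have G0: "G (M * N) 0" "G 0 (M * N)"
    using lat_add[OF lat_mult[OF NM(2), of M] lat_mult[OF NM(4), of N]]
      lat_add[OF lat_mult[OF NM(2), of "-M"] lat_mult[OF NM(4), of "2 * N"]]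
    by (simp_all add: G_def ac_simps)
  have Gdiff: "G (a - a') (b - b')" if "G a b" "G a' b'" for a b a' b'
    using lat_diff[OF that[unfolded G_def]] by (simp add: G_def algebra_simps)
  have "0 < M * N" using NM by simp
  then obtain w R \<tau> where w: "0 < w" and R: "0 < R"
    and basis: "\<And>a b. G a b \<longleftrightarrow> (\<exists>k. b = R * k \<and> w dvd (a - \<tau> * k))"
    using lattice_basis[of G, OF Gdiff _ G0(1) _ G0(2)] by metis
  have beqG: "\<beta> i j = \<beta> i' j' \<longleftrightarrow> G (i - i') (j - j')" for i j i' j' by (simp add: beq G_def)
  have row: "G a 0 \<longleftrightarrow> w dvd a" for a using R by (auto simp: basis)
  have "\<not> G 1 0" "\<not> G 2 0" by (simp_all add: G_def lat)
  then have w3: "3 \<le> w" using w unfolding row by (cases "w = 1 \<or> w = 2") auto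
  have bmod: "\<beta> (m mod w) j = \<beta> m j" for m j unfolding beqG by (simp add: row mod_eq_dvd_iff[symmetric])
  have bshift: "\<beta> (m + \<tau> * k) (j + R * k) = \<beta> m j" for m j k unfolding beqG by (auto simp: basis)
  \<comment> \<open>With at least two rows, three coloured vertices lie in row 0 and one in row 1;
    the spreading starts at \<open>\<beta> 0 1\<close>, runs along row 1 and then upwards to row
    \<open>R\<close>, which is row 0. With a single row the class is one cycle, on which a step to
    the next row is a jump by \<open>\<sigma>\<close>.\<close>
  have all: "\<beta> i j \<in> P \<or> t (\<beta> i j)" for i j
  proof (cases "R = 1")
    case False
    then have R2: "2 \<le> R" using R by simp
    have short: "G a b \<longleftrightarrow> b = 0 \<and> w dvd a" if "\<bar>b\<bar> < R" for a b
    proof -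
      have "b = 0" if "G a b" using that \<open>\<bar>b\<bar> < R\<close> small_dvd[of b R] by (auto simp: basis)
      then show ?thesis using row by auto
    qed
    have row1: "t (\<beta> m 1)" if "0 \<le> m" "m \<le> w - 2" for m
      using that
    proof (induction m rule: int_ge_induct)
      case base
      then show ?case using bz by simp
    next
      case (step i)
      have "\<not> w dvd 2 + i" using step zdvd_imp_le[of w "2 + i"] by auto
      then have "\<beta> (i + 1) 1 \<notin> P" using R2 by (auto simp: P_beta beqG short)
      then show ?case using spr[of i 1 1 0] step by (simp add: units_def)
    qed
    have row1': "t (\<beta> m 1)" if "m mod w \<noteq> w - 1" for m
    proof -
      have "0 \<le> m mod w" "m mod w < w" using w by auto
      then have "t (\<beta> (m mod w) 1)" using that by (intro row1) auto
      then show ?thesis by (simp only: bmod)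
    qed
    have rows: "\<beta> m (2 + int j) \<in> P \<or> t (\<beta> m (2 + int j))" if "2 + int j \<le> R" for m j
      using that
    proof (induction j arbitrary: m)
      case 0
      show ?case
      proof (cases "m mod w = w - 1")
        case False
        then show ?thesis using spr[OF row1'[OF False], of 0 1] by (simp add: units_def)
      next
        case True
        have "(m + 1) mod w = (w - 1 + 1) mod w" by (metis True mod_add_left_eq)
        then have "(m + 1) mod w \<noteq> w - 1" using w3 by simp
        then show ?thesis using spr[OF row1', of "m + 1" "-1" 1] by (simp add: units_def)
      qed
    next
      case (Suc j)
      have "\<beta> m (2 + int j) \<notin> P" using Suc.prems by (auto simp: P_beta beqG short)
      then have "t (\<beta> m (2 + int j))" using Suc.IH[of m] Suc.prems by auto
      then show ?case using spr[of m "2 + int j" 0 1] by (simp add: units_def add.assoc add.commute)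
    qed
    show ?thesis
    proof -
      define k where "k = - ((j - 1) div R)"
      have e: "\<beta> i j = \<beta> (i + \<tau> * k) (j + R * k)" by (simp add: bshift)
      have "j - 1 + R * k = (j - 1) mod R" by (simp add: k_def minus_mult_div_eq_mod)
      moreover have "0 \<le> (j - 1) mod R" "(j - 1) mod R < R" using R by auto
      ultimately have j': "1 \<le> j + R * k" "j + R * k \<le> R" by linarith+
      define j' where "j' = j + R * k"
      define i' where "i' = i + \<tau> * k"
      have "\<beta> i' j' \<in> P \<or> t (\<beta> i' j')"
      proof (cases "j' = 1")
        case True
        show ?thesis
        proof (cases "i' mod w = w - 1")
          case True
          have "(i' + 1) mod w = (w - 1 + 1) mod w" by (metis True mod_add_left_eq)
          then have "w dvd i' - -1" by (simp add: dvd_eq_mod_eq_0)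
          then have "\<beta> i' 1 = \<beta> (-1) 1" by (simp add: beqG row)
          then show ?thesis using \<open>j' = 1\<close> by (simp add: P_beta)
        qed (use row1' \<open>j' = 1\<close> in simp)
      next
        case False
        then show ?thesis using rows[of "nat (j' - 2)" i'] j' by (simp add: j'_def)
      qed
      then show ?thesis by (simp add: e i'_def j'_def)
    qed
  next
    case True
    have G1: "G a b \<longleftrightarrow> w dvd a - \<tau> * b" for a b by (simp add: basis True)
    define \<sigma> where "\<sigma> = (- \<tau>) mod w"
    have \<sigma>: "0 \<le> \<sigma>" "\<sigma> < w" using w by (auto simp: \<sigma>_def)
    have s\<tau>: "w dvd \<sigma> + \<tau>"
    proof -
      have "w dvd (- \<tau>) mod w - (- \<tau>)" by (metis mod_eq_dvd_iff mod_mod_trivial)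
      then show ?thesis by (simp add: \<sigma>_def)
    qed
    have eq0: "\<beta> i j = \<beta> i' 0" if "w dvd i - i' + \<sigma> * j" for i j i'
    proof -
      have "w dvd (i - i' + \<sigma> * j) - (\<sigma> + \<tau>) * j" using that s\<tau> by (intro dvd_diff) auto
      then show ?thesis by (simp add: beqG G1 algebra_simps)
    qed
    have b0: "\<beta> m 0 = \<beta> m' 0 \<longleftrightarrow> w dvd m - m'" for m m' by (simp add: beqG row)
    have P0: "P = {\<beta> 0 0, \<beta> (-1) 0, \<beta> 1 0, \<beta> (\<sigma> - 1) 0}"
      using eq0[of "-1" "\<sigma> - 1" 1] by (simp add: P_beta)
    \<comment> \<open>The absence of short periods keeps the fourth coloured place
      \<open>\<sigma> - 1\<close> away from the coloured block -1, 0, 1 and from the place -2. The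
      cycle then splits into two arcs, which are entered separately.\<close>
    have nG: "\<not> G 0 1" "\<not> G (-1) 1" "\<not> G 2 (-1)" "\<not> G 1 1" using no3 by (simp_all add: G_def lat)
    have "\<sigma> \<noteq> 0" "\<sigma> \<noteq> 1" "\<sigma> \<noteq> 2" "\<sigma> \<noteq> w - 1"
    proof -
      have n: "\<not> w dvd \<tau>" "\<not> w dvd \<tau> + 1" "\<not> w dvd \<tau> + 2" "\<not> w dvd \<tau> - 1"
        using nG dvd_minus_iff[of w \<tau>] dvd_minus_iff[of w "\<tau> + 1"] dvd_minus_iff[of w "\<tau> - 1"]
        by (simp_all add: G1 add.commute)
      then show "\<sigma> \<noteq> 0" "\<sigma> \<noteq> 1" "\<sigma> \<noteq> 2" using s\<tau> by (auto simp: add.commute)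
      show "\<sigma> \<noteq> w - 1"
      proof
        assume "\<sigma> = w - 1"
        then have "w dvd w - 1 + \<tau> - w" using s\<tau> by (intro dvd_diff) auto
        then show False using n(4) by simp
      qed
    qed
    then have \<sigma>3: "3 \<le> \<sigma>" "\<sigma> \<le> w - 2" using \<sigma> by auto
    have P0_iff: "\<beta> m 0 \<in> P \<longleftrightarrow> m \<in> {0, 1, \<sigma> - 1, w - 1}" if "0 \<le> m" "m < w" for m
    proof -
      have "w dvd m + 1 \<longleftrightarrow> m = w - 1"
      proof
        assume "w dvd m + 1"
        then show "m = w - 1" using zdvd_imp_le[of w "m + 1"] that by auto
      qed simp
      then show ?thesis
        using that \<sigma>3 small_dvd[of m w] small_dvd[of "m - 1" w] small_dvd[of "m - (\<sigma> - 1)" w]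
        by (auto simp: P0 b0)
    qed
    have right: "t (\<beta> m 0)" if "\<sigma> \<le> m" "m \<le> w - 2" for m
      using that
    proof (induction m rule: int_ge_induct)
      case base
      then show ?case using bz eq0[of 0 \<sigma> 1] by simp
    next
      case (step i)
      have "\<beta> (i + 1) 0 \<notin> P" using P0_iff[of "i + 1"] step \<sigma>3 by auto
      then show ?case using spr[of i 0 1 0] step by (simp add: units_def)
    qed
    have left: "t (\<beta> m 0)" if "m \<le> \<sigma> - 2" "2 \<le> m" for m
      using that
    proof (induction m rule: int_le_induct)
      case base
      have "\<beta> (w - 2) 1 = \<beta> (\<sigma> - 2) 0" by (rule eq0) simp
      moreover have "\<beta> (\<sigma> - 2) 0 \<notin> P" using P0_iff[of "\<sigma> - 2"] base \<sigma>3 by auto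
      ultimately show ?case using spr[OF right, of "w - 2" 0 1] \<sigma>3 by (simp add: units_def)
    next
      case (step i)
      have "\<beta> (i - 1) 0 \<notin> P" using P0_iff[of "i - 1"] step \<sigma>3 by auto
      then show ?case using spr[of i 0 "-1" 0] step by (simp add: units_def)
    qed
    have "\<beta> m 0 \<in> P \<or> t (\<beta> m 0)" if "0 \<le> m" "m < w" for m
    proof -
      have "m \<in> {0, 1, \<sigma> - 1, w - 1} \<or> \<sigma> \<le> m \<and> m \<le> w - 2 \<or> m \<le> \<sigma> - 2 \<and> 2 \<le> m" using that by auto
      then show ?thesis using P0_iff[OF that] left right by blast
    qed
    from this[of "(i + \<sigma> * j) mod w"] have "\<beta> (i + \<sigma> * j) 0 \<in> P \<or> t (\<beta> (i + \<sigma> * j) 0)"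
      using w by (simp add: bmod)
    moreover have "\<beta> i j = \<beta> (i + \<sigma> * j) 0" by (rule eq0) simp
    ultimately show ?thesis by simp
  qed
  have class1: "\<phi> x y \<in> P \<or> t (\<phi> x y)" if cls: "3 dvd x - y - 1" for x y
  proof -
    obtain k where k: "x - y - 1 = 3 * k" using cls by blast
    then have "y = x - 1 - 3 * k" by simp
    then have "\<phi> x y = \<beta> (x - 1 - k) (- k)" by (simp add: \<beta>_def)
    then show ?thesis using all by simp
  qed
  \<comment> \<open>If such a vertex is not peeled, its three neighbours in the coloured class are
    not surrounded by peeled vertices, so they are coloured. At most one of its other neighbours is
    peeled, so at least two of the three class vertices straight behind them are coloured too. That
    makes five coloured vertices, but there are only four.\<close>
  have other: "\<phi> x y \<in> X" if s: "s = 1 \<or> s = -1" and cls: "3 dvd x - y + (s - 1)" for x y s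
  proof (rule ccontr)
    assume nX: "\<phi> x y \<notin> X"
    have nP: "\<phi> x y \<notin> P"
    proof
      assume "\<phi> x y \<in> P"
      then have "3 dvd x - y - 1" by (rule clsP)
      then show False using s cls by presburger
    qed
    have tX: "\<phi> x' y' \<in> X" if "t (\<phi> u v)" "(x' - u, y' - v) \<in> units" for x' y' u v
      using that(1) adj_unit[OF that(2)] by (auto simp: t_def N_iff)
    have near: "\<phi> (x + s * a) (y + s * b) \<in> P" if "(a, b) = (1, 0) \<or> (a, b) = (-1, 1) \<or> (a, b) = (0, -1)" for a b
    proof -
      have "3 dvd (a - b) - 1" using that by auto
      then have "3 dvd (x - y + (s - 1)) + s * ((a - b) - 1)" by (intro dvd_add[OF cls] dvd_mult)
      then have "3 dvd (x + s * a) - (y + s * b) - 1" by (simp add: algebra_simps)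
      moreover have "\<not> t (\<phi> (x + s * a) (y + s * b))"
        using nX tX[of "x + s * a" "y + s * b" x y] s that by (auto simp: units_def)
      ultimately show ?thesis using class1 by blast
    qed
    have far: "\<phi> (x + s * a) (y + s * b) \<in> X"
      if "(a, b) = (0, 1) \<or> (a, b) = (-1, 0) \<or> (a, b) = (1, -1)" "\<phi> (x + 2 * s * a) (y + 2 * s * b) \<notin> P" for a b
    proof -
      have "3 dvd (a - b) + 1" using that(1) by auto
      then have "3 dvd (x - y + (s - 1)) + 2 * s * ((a - b) + 1) - 3 * s"
        by (intro dvd_diff dvd_add[OF cls] dvd_mult[of 3 "(a - b) + 1"] dvd_triv_left)
      then have "3 dvd (x + 2 * s * a) - (y + 2 * s * b) - 1" by (simp add: algebra_simps)
      then have "t (\<phi> (x + 2 * s * a) (y + 2 * s * b))" using that(2) class1 by blast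
      then show ?thesis by (rule tX) (use s that(1) in \<open>auto simp: units_def\<close>)
    qed
    have su: "(s * p, s * q) \<in> units"
      if "(p, q) = (0, 1) \<or> (p, q) = (-1, 0) \<or> (p, q) = (1, -1)" for p q
      using s that by (elim disjE) (simp_all add: units_def)
    have two: "\<phi> (x + 2 * s * a) (y + 2 * s * b) \<in> P \<or> \<phi> (x + 2 * s * a') (y + 2 * s * b') \<in> P"
      if "(a, b) = (0, 1) \<or> (a, b) = (-1, 0) \<or> (a, b) = (1, -1)" "(a', b') = (0, 1) \<or> (a', b') = (-1, 0) \<or> (a', b') = (1, -1)"
        "(a, b) \<noteq> (a', b')" for a b a' b'
    proof (rule ccontr)
      assume n: "\<not> ?thesis"
      have "\<phi> (x + s * a) (y + s * b) \<in> X" by (rule far[OF that(1)]) (use n in blast)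
      moreover have "\<phi> (x + s * a') (y + s * b') \<in> X" by (rule far[OF that(2)]) (use n in blast)
      moreover have "(s * a, s * b) \<in> units" "(s * a', s * b') \<in> units"
        using su that(1,2) by blast+
      moreover have "s * a \<noteq> s * a' \<or> s * b \<noteq> s * b'" using s that(3) by (elim disjE) simp_all
      ultimately have "\<phi> x y \<in> peel P c" unfolding X_def
        by - (rule peel_lattice[of "x + s * a" "y + s * b" _ _ "x + s * a'" "y + s * b'", OF _ _ _ _ _ nP],
          simp_all)
      then show False using nX by (simp add: X_def)
    qed
    have five: False
      if "\<phi> (x + 2 * s * a) (y + 2 * s * b) \<in> P" "\<phi> (x + 2 * s * a') (y + 2 * s * b') \<in> P"
        "(a, b, a', b') = (0, 1, -1, 0) \<or> (a, b, a', b') = (0, 1, 1, -1) \<or> (a, b, a', b') = (-1, 0, 1, -1)" for a b a' b'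
    proof -
      let ?Q = "{\<phi> (x + s) y, \<phi> (x - s) (y + s), \<phi> x (y - s), \<phi> (x + 2 * s * a) (y + 2 * s * b),
        \<phi> (x + 2 * s * a') (y + 2 * s * b')}"
      have "?Q \<subseteq> P" using near[of 1 0] near[of "-1" 1] near[of 0 "-1"] that(1,2) by auto
      then have "card ?Q \<le> 4" using cardP card_mono[of P ?Q] by (auto simp: P_def)
      moreover have "card ?Q = 5"
        using s that(3) by (elim disjE) (simp_all add: per lat)
      ultimately show False by simp
    qed
    show False
      using two[of 0 1 "-1" 0] two[of 0 1 1 "-1"] two[of "-1" 0 1 "-1"] five[of 0 1 "-1" 0]
        five[of 0 1 1 "-1"] five[of "-1" 0 1 "-1"] by auto
  qed
  show ?thesis
  proof (rule planI[OF c(1)])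
    show "P \<subseteq> ball (\<phi> 0 0) 10" by (auto simp: P_def intro!: in_ball_0)
    show "card P \<le> 12" using cardP by simp
    show "\<phi> x y \<in> P \<or> \<phi> x y \<in> peel P c" for x y
    proof -
      have "3 dvd x - y - 1 \<or> 3 dvd x - y + (1 - 1) \<or> 3 dvd x - y + (-1 - 1)" by presburger
      then show ?thesis using class1[of x y] other[of 1 x y] other[of "-1" x y] by (auto simp: t_def X_def)
    qed
  qed
qed

end

section \<open>The cube of a cycle\<close>

text \<open>Halmos-Vaughan induction: a nonempty proper subset with no more colours than elements is
  split off. If there is none, every other nonempty proper subset has a colour to spare and any
  choice for one element is harmless.\<close>

lemma hall:
  assumes "finite S" "\<And>i. i \<in> S \<Longrightarrow> finite (L i)" "\<And>T. T \<subseteq> S \<Longrightarrow> card T \<le> card (\<Union> (L ` T))"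
  shows "\<exists>f. inj_on f S \<and> (\<forall>i\<in>S. f i \<in> L i)"
  using assms
proof (induction S arbitrary: L rule: finite_psubset_induct)
  case (psubset S)
  note IH = psubset.IH and finL = psubset.prems(1) and H = psubset.prems(2)
  have finU: "finite (\<Union> (L ` T))" if "T \<subseteq> S" for T
    using that psubset.hyps finL by (auto intro!: finite_UN_I finite_subset[of T S])
  show ?case
  proof (cases "\<exists>T. T \<noteq> {} \<and> T \<subset> S \<and> card (\<Union> (L ` T)) \<le> card T")
    case True
    then obtain T where T: "T \<noteq> {}" "T \<subset> S" "card (\<Union> (L ` T)) \<le> card T" by blast
    let ?U = "\<Union> (L ` T)"
    have finT: "finite T" using T(2) psubset.hyps finite_subset by blast
    have "\<exists>f. inj_on f T \<and> (\<forall>i\<in>T. f i \<in> L i)"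
      by (rule IH[OF T(2)]) (use T(2) finL H in auto)
    then obtain f where f: "inj_on f T" "\<And>i. i \<in> T \<Longrightarrow> f i \<in> L i" by blast
    have "\<exists>g. inj_on g (S - T) \<and> (\<forall>i\<in>S - T. g i \<in> L i - ?U)"
    proof (rule IH)
      show "S - T \<subset> S" using T by blast
      show "finite (L i - ?U)" if "i \<in> S - T" for i using finL that by auto
      show "card W \<le> card (\<Union>i\<in>W. L i - ?U)" if W: "W \<subseteq> S - T" for W
      proof -
        have finW: "finite W" using W psubset.hyps finite_subset by blast
        have "card T + card W = card (T \<union> W)"
          using W finT finW by (intro card_Un_disjoint[symmetric]) auto
        also have "\<dots> \<le> card (\<Union> (L ` (T \<union> W)))" using W T(2) by (intro H) auto
        also have "\<Union> (L ` (T \<union> W)) = ?U \<union> (\<Union>i\<in>W. L i - ?U)" by auto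
        also have "card \<dots> \<le> card ?U + card (\<Union>i\<in>W. L i - ?U)" by (rule card_Un_le)
        finally show ?thesis using T(3) by linarith
      qed
    qed
    then obtain g where g: "inj_on g (S - T)" "\<And>i. i \<in> S - T \<Longrightarrow> g i \<in> L i - ?U" by blast
    let ?h = "\<lambda>i. if i \<in> T then f i else g i"
    have "inj_on ?h S"
    proof (rule inj_onI)
      fix i j assume ij: "i \<in> S" "j \<in> S" "?h i = ?h j"
      have "f a \<noteq> g b" if "a \<in> T" "b \<in> S - T" for a b using f(2)[OF that(1)] g(2)[OF that(2)] that by auto
      then show "i = j"
        using ij inj_onD[OF f(1), of i j] inj_onD[OF g(1), of i j] by (metis DiffI)
    qed
    moreover have "\<forall>i\<in>S. ?h i \<in> L i" using f(2) g(2) by auto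
    ultimately show ?thesis by (intro exI[of _ ?h] conjI)
  next
    case False
    show ?thesis
    proof (cases "S = {}")
      case False
      then obtain i where i: "i \<in> S" by blast
      have "card {i} \<le> card (\<Union> (L ` {i}))" using i by (intro H) auto
      then have "L i \<noteq> {}" by auto
      then obtain a where a: "a \<in> L i" by blast
      have "\<exists>g. inj_on g (S - {i}) \<and> (\<forall>j\<in>S - {i}. g j \<in> L j - {a})"
      proof (rule IH)
        show "S - {i} \<subset> S" using i by blast
        show "finite (L j - {a})" if "j \<in> S - {i}" for j using finL that by auto
        show "card W \<le> card (\<Union>j\<in>W. L j - {a})" if W: "W \<subseteq> S - {i}" for W
        proof (cases "W = {}")
          case False
          have "W \<subset> S" using W i by blast
          then have "\<not> card (\<Union> (L ` W)) \<le> card W"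
            using \<open>\<not> (\<exists>T. T \<noteq> {} \<and> T \<subset> S \<and> card (\<Union> (L ` T)) \<le> card T)\<close> False by blast
          moreover have "(\<Union>j\<in>W. L j - {a}) = \<Union> (L ` W) - {a}" by auto
          moreover have "card (\<Union> (L ` W)) - card {a} \<le> card (\<Union> (L ` W) - {a})"
            by (rule diff_card_le_card_Diff) simp
          ultimately show ?thesis by simp
        qed simp
      qed
      then obtain g where g: "inj_on g (S - {i})" "\<And>j. j \<in> S - {i} \<Longrightarrow> g j \<in> L j - {a}" by blast
      have "inj_on (g(i := a)) (insert i (S - {i}))"
        using g by (auto simp: inj_on_def)
      moreover have "\<forall>j\<in>S. (g(i := a)) j \<in> L j" using g(2) a by auto
      ultimately show ?thesis using i by (metis insert_Diff)
    qed simp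
  qed
qed

text \<open>List colouring of the complement of a path: Hall's theorem deals with the part where
  there are many colours, and where there are few, consecutive vertices share a colour.\<close>

lemma path_complement_colouring:
  fixes L :: "nat \<Rightarrow> 'c set"
  assumes "finite S" "\<And>i. i \<in> S \<Longrightarrow> finite (L i) \<and> k \<le> card (L i)" "card S \<le> 2 * k"
    and "\<And>W. W \<subseteq> S \<Longrightarrow> (\<And>i. i \<in> W \<Longrightarrow> Suc i \<notin> W) \<Longrightarrow> card W \<le> k"
  shows "\<exists>c. (\<forall>i\<in>S. c i \<in> L i) \<and> (\<forall>i\<in>S. \<forall>j\<in>S. i < j \<and> c i = c j \<longrightarrow> j = Suc i)"
  using assms
proof (induction "card S" arbitrary: S L k rule: less_induct)
  case less
  note fin = less.prems(1) and L = less.prems(2) and card2 = less.prems(3) and om = less.prems(4)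
  show ?case
  proof (cases "\<exists>T. T \<subseteq> S \<and> card (\<Union> (L ` T)) < card T")
    case False
    then have "\<exists>f. inj_on f S \<and> (\<forall>i\<in>S. f i \<in> L i)"
      using fin L by (intro hall) (auto simp: not_less)
    then obtain f where f: "inj_on f S" "\<forall>i\<in>S. f i \<in> L i" by blast
    have "\<forall>i\<in>S. \<forall>j\<in>S. i < j \<and> f i = f j \<longrightarrow> j = Suc i"
      using inj_onD[OF f(1)] by blast
    then show ?thesis using f(2) by blast
  next
    case True
    \<comment> \<open>Take a largest set that violates Hall's condition. Outside it, the colours
      foreign to it satisfy the condition, since a violation there could be added to it. Inside, its
      few colours force repetitions.\<close>
    define bad where "bad T \<longleftrightarrow> T \<subseteq> S \<and> card (\<Union> (L ` T)) < card T" for T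
    have "\<exists>T. bad T" using True by (simp add: bad_def)
    moreover have "\<forall>T. bad T \<longrightarrow> card T < Suc (card S)"
      using card_mono[OF fin] by (auto simp: bad_def less_Suc_eq_le)
    ultimately obtain T where T: "bad T" and mx: "\<And>T'. bad T' \<Longrightarrow> card T' \<le> card T"
      using ex_has_greatest_nat[of bad _ card "Suc (card S)"] by (metis less_imp_le)
    let ?U = "\<Union> (L ` T)"
    have TS: "T \<subseteq> S" and few: "card ?U < card T" using T by (auto simp: bad_def)
    have finT: "finite T" using TS fin finite_subset by blast
    have finU: "finite ?U" using finT TS L by auto
    have "\<exists>g. inj_on g (S - T) \<and> (\<forall>i\<in>S - T. g i \<in> L i - ?U)"
    proof (rule hall)
      show "finite (S - T)" "\<And>i. i \<in> S - T \<Longrightarrow> finite (L i - ?U)" using fin L by auto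
      show "card W \<le> card (\<Union>i\<in>W. L i - ?U)" if W: "W \<subseteq> S - T" for W
      proof (rule ccontr)
        assume n: "\<not> ?thesis"
        have finW: "finite W" using W fin finite_subset by blast
        have un: "card (T \<union> W) = card T + card W" using W finT finW by (intro card_Un_disjoint) auto
        have "\<Union> (L ` (T \<union> W)) = ?U \<union> (\<Union>i\<in>W. L i - ?U)" by auto
        then have "card (\<Union> (L ` (T \<union> W))) \<le> card ?U + card (\<Union>i\<in>W. L i - ?U)"
          by (metis card_Un_le)
        then have "bad (T \<union> W)" using un few n TS W by (auto simp: bad_def)
        then have "card W = 0" using mx[of "T \<union> W"] un by simp
        then show False using n by simp
      qed
    qed
    then obtain g where g: "inj_on g (S - T)" "\<And>i. i \<in> S - T \<Longrightarrow> g i \<in> L i - ?U" by blast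
    have "\<exists>c. (\<forall>i\<in>T. c i \<in> L i) \<and> (\<forall>i\<in>T. \<forall>j\<in>T. i < j \<and> c i = c j \<longrightarrow> j = Suc i)"
    proof (cases "\<exists>i. i \<in> T \<and> Suc i \<in> T")
      case False
      \<comment> \<open>Without consecutive elements the set has at most \<open>k\<close> members,
        while a single list already has \<open>k\<close> colours.\<close>
      have "card T \<le> k" using om[OF TS] False by blast
      obtain i where i: "i \<in> T" using few by fastforce
      have "card (L i) \<le> card ?U" using finU i by (intro card_mono) auto
      then show ?thesis using L[of i] i TS \<open>card T \<le> k\<close> few by fastforce
    next
      case True
      \<comment> \<open>The first consecutive pair has a common colour, since two disjoint lists
        would exceed the number of available colours. Taking the least \<open>i\<close> means that
        its predecessor is not in \<open>T\<close>: hence \<open>i\<close> can join any set without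
        consecutive elements in the rest, and the bound for the rest drops to k - 1.\<close>
      define i where "i = (LEAST i. i \<in> T \<and> Suc i \<in> T)"
      have i: "i \<in> T" "Suc i \<in> T" using LeastI_ex[OF True] by (auto simp: i_def)
      have start: "Suc j \<noteq> i" if "j \<in> T" for j
      proof
        assume j: "Suc j = i"
        then have "i \<le> j" unfolding i_def using that i(1) by (intro Least_le) (auto simp: i_def)
        then show False using j by simp
      qed
      have "L i \<inter> L (Suc i) \<noteq> {}"
      proof
        assume "L i \<inter> L (Suc i) = {}"
        then have "card (L i) + card (L (Suc i)) = card (L i \<union> L (Suc i))"
          using L i TS by (intro card_Un_disjoint[symmetric]) auto
        also have "\<dots> \<le> card ?U" using finU i by (intro card_mono) auto
        finally have "card (L i) + card (L (Suc i)) < card T" using few by linarith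
        moreover have "k \<le> card (L i)" "k \<le> card (L (Suc i))" using L i TS by auto
        moreover have "card T \<le> 2 * k" using card_mono[OF fin TS] card2 by linarith
        ultimately show False by linarith
      qed
      then obtain a where a: "a \<in> L i" "a \<in> L (Suc i)" by blast
      let ?T = "T - {i, Suc i}"
      have cT: "card ?T + 2 = card T"
        using card_Diff_subset[of "{i, Suc i}" T] card_mono[of T "{i, Suc i}"] i finT by simp
      have k: "0 < k" using L[of i] i TS a om[of "{i}"] by auto
      have "\<exists>c. (\<forall>j\<in>?T. c j \<in> L j - {a}) \<and> (\<forall>i\<in>?T. \<forall>j\<in>?T. i < j \<and> c i = c j \<longrightarrow> j = Suc i)"
      proof (rule less.hyps)
        show "card ?T < card S" using cT card_mono[OF fin TS] by linarith
        show "finite ?T" using finT by simp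
        show "finite (L j - {a}) \<and> k - 1 \<le> card (L j - {a})" if "j \<in> ?T" for j
        proof -
          have "finite (L j)" "k \<le> card (L j)" using that TS L by auto
          moreover have "card (L j) - card {a} \<le> card (L j - {a})" by (rule diff_card_le_card_Diff) simp
          ultimately show ?thesis by simp
        qed
        show "card ?T \<le> 2 * (k - 1)" using cT card_mono[OF fin TS] card2 by linarith
        show "card W \<le> k - 1" if W: "W \<subseteq> ?T" "\<And>j. j \<in> W \<Longrightarrow> Suc j \<notin> W" for W
        proof -
          have "card (insert i W) \<le> k"
          proof (rule om)
            show "insert i W \<subseteq> S" using W(1) i TS by blast
            show "Suc j \<notin> insert i W" if "j \<in> insert i W" for j
              using that W start[of j] by auto
          qed
          moreover have "card (insert i W) = Suc (card W)"
            using W(1) finT finite_subset[of W T] by (subst card_insert_disjoint) auto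
          ultimately show ?thesis by simp
        qed
      qed
      then obtain c where c: "\<And>j. j \<in> ?T \<Longrightarrow> c j \<in> L j - {a}"
        "\<And>i j. i \<in> ?T \<Longrightarrow> j \<in> ?T \<Longrightarrow> i < j \<Longrightarrow> c i = c j \<Longrightarrow> j = Suc i" by blast
      let ?c = "\<lambda>j. if j = i \<or> j = Suc i then a else c j"
      have "\<forall>j\<in>T. ?c j \<in> L j" using c(1) a by auto
      moreover have "\<forall>i\<in>T. \<forall>j\<in>T. i < j \<and> ?c i = ?c j \<longrightarrow> j = Suc i"
      proof (intro ballI impI, elim conjE)
        fix x y assume xy: "x \<in> T" "y \<in> T" "x < y" "?c x = ?c y"
        have ca: "c z \<noteq> a" if "z \<in> ?T" for z using c(1)[OF that] by blast
        show "y = Suc x"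
        proof (cases "x = i \<or> x = Suc i")
          case True
          then have "y = i \<or> y = Suc i" using ca[of y] xy by (cases "y = i \<or> y = Suc i") auto
          then show ?thesis using True xy(3) by auto
        next
          case False
          then have "y \<noteq> i \<and> y \<noteq> Suc i" using ca[of x] xy by auto
          then show ?thesis using False xy c(2)[of x y] by simp
        qed
      qed
      ultimately show ?thesis by (intro exI[of _ ?c] conjI)
    qed
    then obtain c where c: "\<And>i. i \<in> T \<Longrightarrow> c i \<in> L i"
      "\<And>i j. i \<in> T \<Longrightarrow> j \<in> T \<Longrightarrow> i < j \<Longrightarrow> c i = c j \<Longrightarrow> j = Suc i" by metis
    let ?h = "\<lambda>i. if i \<in> T then c i else g i"
    have cg: "c a \<noteq> g b" if "a \<in> T" "b \<in> S - T" for a b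
    proof
      assume "c a = g b"
      moreover have "c a \<in> ?U" using c(1)[OF that(1)] that(1) by blast
      ultimately show False using g(2)[OF that(2)] by simp
    qed
    have "\<forall>i\<in>S. \<forall>j\<in>S. i < j \<and> ?h i = ?h j \<longrightarrow> j = Suc i"
    proof (intro ballI impI, elim conjE)
      fix x y assume xy: "x \<in> S" "y \<in> S" "x < y" "?h x = ?h y"
      show "y = Suc x"
      proof (cases "x \<in> T")
        case True
        then have "y \<in> T" using cg[of x y] xy by (cases "y \<in> T") auto
        then show ?thesis using True xy c(2)[of x y] by simp
      next
        case False
        then have "y \<notin> T" using cg[of y x] xy by (cases "y \<in> T") auto
        then show ?thesis using False xy inj_onD[OF g(1), of x y] by simp
      qed
    qed
    moreover have "\<forall>i\<in>S. ?h i \<in> L i" using c(1) g(2) by auto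
    ultimately show ?thesis by (intro exI[of _ ?h] conjI)
  qed
qed

text \<open>The graph T(1,s,2): the steps 1, 2 and 3 make it the cube of a cycle, unrolled along the
  integers.\<close>

locale cycle_cube = list_graph +
  fixes \<psi> :: "int \<Rightarrow> 'a" and s :: int
  assumes V_psi: "V = range \<psi>" and s_pos: "0 < s"
    and psi_eq: "\<psi> m = \<psi> m' \<longleftrightarrow> s dvd m - m'"
    and nb_psi: "nbhd E (\<psi> m) = {\<psi> (m + 1), \<psi> (m - 1), \<psi> (m + 2), \<psi> (m - 2), \<psi> (m + 3), \<psi> (m - 3)}"
begin

lemma psi_V [simp]: "\<psi> m \<in> V" by (simp add: V_psi)

lemma adj_psi: "E (\<psi> m) (\<psi> m') \<longleftrightarrow> (\<exists>d\<in>{1, -1, 2, -2, 3, -3}. s dvd m' - m - d)"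
proof -
  have "E (\<psi> m) (\<psi> m') \<longleftrightarrow> \<psi> m' \<in> nbhd E (\<psi> m)" by (simp add: nbhd_def)
  then show ?thesis by (simp add: nb_psi psi_eq diff_diff_eq algebra_simps)
qed

lemma psi_ball: "\<bar>d\<bar> \<le> int r \<Longrightarrow> \<psi> (m + d) \<in> ball (\<psi> m) r"
proof (induction r arbitrary: d)
  case (Suc r)
  show ?case
  proof (cases "\<bar>d\<bar> \<le> int r")
    case False
    define d' where "d' = (if d > 0 then d - 1 else d + 1)"
    have "\<psi> (m + d') \<in> ball (\<psi> m) r" using Suc.prems False by (intro Suc.IH) (auto simp: d'_def)
    moreover have "E (\<psi> (m + d')) (\<psi> (m + d))" by (auto simp: adj_psi d'_def)
    ultimately show ?thesis by (auto simp: N_iff)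
  qed (use Suc.IH in simp)
qed simp

lemma psi_ball_0: "\<bar>d\<bar> \<le> 10 \<Longrightarrow> \<psi> d \<in> ball (\<psi> 0) 10"
  using psi_ball[of d 10 0] by simp

lemma psi_mod: "\<psi> (m mod s) = \<psi> m"
  unfolding psi_eq mod_eq_dvd_iff[symmetric] by simp

text \<open>The vertices 1 and 5 are common neighbours of 3 and 4 and save at both; -3 saves at 0,
  which has the neighbour 1, and the pair -2, 2 saves there again. Peeling 0, 3, 4 then releases 6,
  7 and so on. The bound 12 is what keeps -3 and 5 nonadjacent around the cycle.\<close>

lemma plan_cube_long:
  assumes s: "12 \<le> s"
  shows "plan (\<psi> 0)"
proof -
  have dv: "s dvd a \<longleftrightarrow> a = 0" if "\<bar>a\<bar> \<le> 11" for a using small_dvd[of a s] s that by simp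
  let ?P1 = "{\<psi> 5, \<psi> 1}"
  let ?P2 = "{\<psi> (-3), \<psi> 5, \<psi> 1}"
  let ?P = "{\<psi> 2, \<psi> (-2), \<psi> (-3), \<psi> 5, \<psi> 1}"
  have em: "card (avail {} c v) = 5" if "v \<in> V" for c v
    using lists[OF that] by (simp add: avail_def)
  have pe: "pcol {} c" for c by (simp add: pcol_def)
  have s1: "\<bar>s\<bar> \<noteq> 1" using s by simp
  note dec = psi_eq adj_psi dv N_iff s1
  have avail_ge: "5 - card Q \<le> card (avail P c v)" if "v \<in> V" "N v \<inter> P \<subseteq> Q" "finite Q" for v P Q c
    using card_avail_ge[OF that(1), of P c] card_mono[OF that(3,2)] by linarith
  obtain c1 where c1: "pcol ?P1 c1" "sv ?P1 c1 1 (\<psi> 3)" "sv ?P1 c1 1 (\<psi> 4)"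
    using ext_pair_two[of "{}" "\<lambda>_. 0" "\<psi> 1" "\<psi> 5" "\<psi> 3" 0 "\<psi> 4" 0]
    by (auto simp: dec em pe sv_0)
  have "N (\<psi> (-3)) \<inter> ?P1 \<subseteq> {}" by (auto simp: dec)
  then have "5 \<le> card (avail ?P1 c1 (\<psi> (-3)))" using avail_ge[of "\<psi> (-3)" ?P1 "{}" c1] by simp
  moreover have "\<psi> 1 \<in> N (\<psi> 0) \<inter> ?P1" by (auto simp: dec)
  then have "1 \<le> card (N (\<psi> 0) \<inter> ?P1)" using finite_N by (auto simp: Suc_le_eq card_gt_0_iff)
  ultimately obtain c2 where e2: "extends ?P1 c1 ?P2 c2" and c2: "pcol ?P2 c2" "sv ?P2 c2 1 (\<psi> 0)"
    using ext_single[OF c1(1), of "\<psi> (-3)" "\<psi> 0" 0] by (auto simp: dec sv_0)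
  have "N (\<psi> (-2)) \<inter> ?P2 \<subseteq> {\<psi> (-3), \<psi> 1}" "N (\<psi> 2) \<inter> ?P2 \<subseteq> {\<psi> 5, \<psi> 1}" by (auto simp: dec)
  then have "3 \<le> card (avail ?P2 c2 (\<psi> (-2)))" "3 \<le> card (avail ?P2 c2 (\<psi> 2))"
    using avail_ge[of "\<psi> (-2)" ?P2 "{\<psi> (-3), \<psi> 1}" c2] avail_ge[of "\<psi> 2" ?P2 "{\<psi> 5, \<psi> 1}" c2]
    by (auto simp: dec)
  then obtain c where e3: "extends ?P2 c2 ?P c" and c: "pcol ?P c" "sv ?P c 2 (\<psi> 0)"
    using ext_pair[OF c2(1), of "\<psi> (-2)" "\<psi> 2" "\<psi> 0" 1] c2(2) by (auto simp: dec numeral_2_eq_2)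
  have c': "sv ?P c 1 (\<psi> 3)" "sv ?P c 1 (\<psi> 4)"
    using sv_mono[OF extends_trans[OF e2 e3]] c1(2,3) by auto
  let ?X = "peel ?P c"
  have P: "\<psi> m \<notin> ?P" if "-1 \<le> m" "m \<le> s - 4" "m \<notin> {1, 2, 5}" for m
  proof -
    have z: "\<not> s dvd m - j" if "m \<noteq> j" "j \<in> {1, 2, 5}" for j
    proof -
      have "\<bar>m - j\<bar> < s" using that(2) s \<open>-1 \<le> m\<close> \<open>m \<le> s - 4\<close> by (auto simp: abs_less_iff)
      then show ?thesis using that(1) by (simp add: small_dvd)
    qed
    have z': "\<not> s dvd m + j" if "j \<in> {2, 3}" for j
      using that zdvd_imp_le[of s "m + j"] s \<open>-1 \<le> m\<close> \<open>m \<le> s - 4\<close> by auto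
    show ?thesis using z[of 1] z[of 2] z[of 5] z'[of 2] z'[of 3] that(3) by (simp add: psi_eq)
  qed
  have two: "\<psi> m \<in> ?X"
    if "\<psi> a \<in> ?X" "\<psi> b \<in> ?X" "a - m \<in> {1, -1, 2, -2, 3, -3}" "b - m \<in> {1, -1, 2, -2, 3, -3}" "a \<noteq> b"
      "-1 \<le> m" "m \<le> s - 4" "m \<notin> {1, 2, 5}" for m a b
  proof (rule peel_two[OF that(1,2) _ _ _ P[OF that(6-8)]])
    show "E (\<psi> m) (\<psi> a)" "E (\<psi> m) (\<psi> b)" using that(3,4) by (auto simp: adj_psi)
    have "\<bar>a - b\<bar> \<le> 11" using that(3,4) by auto
    then show "\<psi> a \<noteq> \<psi> b" using that(5) by (simp add: psi_eq dv)
  qed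
  have nP: "\<psi> 0 \<notin> ?P" "\<psi> 3 \<notin> ?P" "\<psi> 4 \<notin> ?P" using s by (auto simp: dec)
  have X0: "\<psi> 0 \<in> ?X" by (rule peel_none[OF _ c(2) nP(1)]) simp
  have X3: "\<psi> 3 \<in> ?X" by (rule peel_one[OF X0 _ c'(1) nP(2)]) (simp add: dec)
  have X4: "\<psi> 4 \<in> ?X" by (rule peel_one[OF X3 _ c'(2) nP(3)]) (simp add: dec)
  have X6: "\<psi> 6 \<in> ?X" by (rule two[OF X3 X4]) (use s in auto)
  have X7: "\<psi> 7 \<in> ?X" by (rule two[OF X4 X6]) (use s in auto)
  have up: "\<psi> (6 + int j) \<in> ?X \<and> (7 + int j \<le> s - 4 \<longrightarrow> \<psi> (7 + int j) \<in> ?X)" if "6 + int j \<le> s - 4" for j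
    using that
  proof (induction j)
    case (Suc j)
    then have X: "\<psi> (6 + int j) \<in> ?X" "\<psi> (7 + int j) \<in> ?X" by auto
    have "\<psi> (8 + int j) \<in> ?X" if "8 + int j \<le> s - 4" by (rule two[OF X]) (use that in auto)
    then show ?case using X by (simp add: add.commute)
  qed (use X6 X7 in simp)
  have Xm1: "\<psi> (-1) \<in> ?X"
  proof (rule two[OF X0, of "-4"])
    have "\<psi> (s - 4) \<in> ?X" using up[of "nat (s - 10)"] s by simp
    moreover have "\<psi> (s - 4) = \<psi> (-4)" by (simp add: psi_eq)
    ultimately show "\<psi> (-4) \<in> ?X" by simp
  qed (use s in auto)
  have cover: "\<psi> m \<in> ?P \<or> \<psi> m \<in> ?X" if "0 \<le> m" "m < s" for m
  proof -
    have per: "\<psi> (s + d) = \<psi> d" for d by (simp add: psi_eq)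
    have "m \<in> {0, 1, 2, 3, 4, 5} \<or> 6 \<le> m \<and> m \<le> s - 4 \<or> m = s + -3 \<or> m = s + -2 \<or> m = s + -1" using that by auto
    moreover have "\<psi> m \<in> ?X" if "6 \<le> m \<and> m \<le> s - 4" using up[of "nat (m - 6)"] that by simp
    moreover have "\<psi> m \<in> ?P \<or> \<psi> m \<in> ?X" if "m \<in> {0, 1, 2, 3, 4, 5}" using that X0 X3 X4 by auto
    moreover have "\<psi> m \<in> ?P \<or> \<psi> m \<in> ?X" if "m = s + -3 \<or> m = s + -2 \<or> m = s + -1"
      using that Xm1 per[of "-3"] per[of "-2"] per[of "-1"] by (elim disjE) simp_all
    ultimately show ?thesis by argo
  qed
  show ?thesis
    unfolding plan_def
  proof (intro exI conjI)
    show "pcol ?P c" by (rule c(1))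
    show "?P \<subseteq> ball (\<psi> 0) 10" by (auto intro!: psi_ball_0)
    show "card ?P \<le> 12" using card_length[of "[\<psi> 2, \<psi> (-2), \<psi> (-3), \<psi> 5, \<psi> 1]"] by simp
    show "V - ?P \<subseteq> ?X"
    proof
      fix v assume v: "v \<in> V - ?P"
      then obtain m where "v = \<psi> (m mod s)" by (auto simp: V_psi psi_mod)
      then show "v \<in> ?X" using cover[of "m mod s"] s_pos v by auto
    qed
  qed
qed

text \<open>The whole graph is precoloured. Steps of 4 trace a Hamilton path of the complement; for
  10 vertices they stay within one parity, so a single step of 5 joins the two halves. All edges of
  the graph thus lie in the complement of a path on at most 10 vertices, where sets without
  consecutive elements have at most 5 members.\<close>

lemma plan_cube_short:
  assumes s: "s = 9 \<or> s = 10"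
  shows "plan (\<psi> 0)"
proof -
  define a where "a i = (if s = 9 then 4 * int i else if i < 5 then 4 * int i else 4 * int i + 1)" for i
  have a_inj: "\<not> s dvd a i - a j" if "i < nat s" "j < nat s" "i \<noteq> j" for i j
  proof -
    have "i < 10" "j < 10" using that s by auto
    then have "i = 0 \<or> i = 1 \<or> i = 2 \<or> i = 3 \<or> i = 4 \<or> i = 5 \<or> i = 6 \<or> i = 7 \<or> i = 8 \<or> i = 9" "j = 0 \<or> j = 1 \<or> j = 2 \<or> j = 3 \<or> j = 4 \<or> j = 5 \<or> j = 6 \<or> j = 7 \<or> j = 8 \<or> j = 9" by presburger+
    then show ?thesis using s that by (elim disjE) (simp_all add: a_def)
  qed
  have nadj: "\<not> E (\<psi> (a i)) (\<psi> (a (Suc i)))" if "Suc i < nat s" for i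
  proof -
    have "i < 9" using that s by auto
    then have "i = 0 \<or> i = 1 \<or> i = 2 \<or> i = 3 \<or> i = 4 \<or> i = 5 \<or> i = 6 \<or> i = 7 \<or> i = 8" by presburger
    then show ?thesis using s that by (elim disjE) (simp_all add: a_def adj_psi)
  qed
  let ?S = "{..<nat s}"
  have "\<exists>c. (\<forall>i\<in>?S. c i \<in> L (\<psi> (a i))) \<and> (\<forall>i\<in>?S. \<forall>j\<in>?S. i < j \<and> c i = c j \<longrightarrow> j = Suc i)"
  proof (rule path_complement_colouring)
    show "finite ?S" by simp
    show "finite (L (\<psi> (a i))) \<and> 5 \<le> card (L (\<psi> (a i)))" if "i \<in> ?S" for i using lists by simp
    show "card ?S \<le> 2 * 5" using s by auto
    show "card W \<le> 5" if W: "W \<subseteq> ?S" "\<And>i. i \<in> W \<Longrightarrow> Suc i \<notin> W" for W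
    proof -
      have "inj_on (\<lambda>i. i div 2) W"
      proof (rule inj_onI)
        fix x y assume xy: "x \<in> W" "y \<in> W" "x div 2 = y div 2"
        then have "x = y \<or> x = Suc y \<or> y = Suc x" by presburger
        then show "x = y" using xy W(2) by blast
      qed
      moreover have "(\<lambda>i. i div 2) ` W \<subseteq> {..<5}" using W(1) s by auto
      ultimately show ?thesis using card_inj_on_le[of "\<lambda>i. i div 2" W "{..<5}"] by simp
    qed
  qed
  then obtain c where c: "\<And>i. i < nat s \<Longrightarrow> c i \<in> L (\<psi> (a i))"
    "\<And>i j. i < nat s \<Longrightarrow> j < nat s \<Longrightarrow> i < j \<Longrightarrow> c i = c j \<Longrightarrow> j = Suc i"
    by (metis lessThan_iff)
  define b where "b i = \<psi> (a i)" for i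
  have inj: "inj_on b ?S" by (rule inj_onI) (use a_inj in \<open>auto simp: b_def psi_eq\<close>)
  have cV: "card V \<le> nat s" and fV: "V = \<psi> ` {0..<s}"
  proof -
    show V: "V = \<psi> ` {0..<s}"
    proof -
      have "\<psi> m \<in> \<psi> ` {0..<s}" for m
        using s_pos by (intro image_eqI[of _ _ "m mod s"]) (auto simp: psi_mod)
      then show ?thesis by (auto simp: V_psi)
    qed
    show "card V \<le> nat s" unfolding V using card_image_le[of "{0..<s}" \<psi>] by simp
  qed
  have bV: "b ` ?S = V"
  proof (rule card_subset_eq[OF finite_V])
    show "b ` ?S \<subseteq> V" by (auto simp: b_def)
    have "card (b ` ?S) = nat s" using card_image[OF inj] by simp
    then show "card (b ` ?S) = card V" using cV card_mono[OF finite_V \<open>b ` ?S \<subseteq> V\<close>] by simp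
  qed
  define c' where "c' v = c (inv_into ?S b v)" for v
  have c': "c' (b i) = c i" if "i < nat s" for i using inj that by (simp add: c'_def)
  have "pcol V c'"
    unfolding pcol_def
  proof (intro conjI ballI impI)
    show "c' v \<in> L v" if "v \<in> V" for v
    proof -
      obtain i where "i < nat s" "v = b i" using \<open>v \<in> V\<close> bV by auto
      then show ?thesis using c(1) c' by (simp add: b_def)
    qed
    show "c' u \<noteq> c' v" if "u \<in> V" "v \<in> V" "E u v" for u v
    proof
      assume eq: "c' u = c' v"
      obtain i j where ij: "i < nat s" "u = b i" "j < nat s" "v = b j" using \<open>u \<in> V\<close> \<open>v \<in> V\<close> bV by auto
      have "i \<noteq> j" using ij \<open>E u v\<close> E_irrefl by auto
      moreover have "c i = c j" using eq ij c' by simp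
      ultimately have "j = Suc i \<or> i = Suc j" using c(2)[of i j] c(2)[of j i] ij by (cases "i < j") auto
      then show False using nadj ij \<open>E u v\<close> E_sym by (auto simp: b_def)
    qed
  qed simp
  moreover have "V \<subseteq> ball (\<psi> 0) 10" unfolding fV using s by (auto intro!: psi_ball_0)
  moreover have "card V \<le> 12" using cV s by auto
  ultimately show ?thesis unfolding plan_def by blast
qed

end

section \<open>The graphs T(r,s,t)\<close>

context based_cover
begin

lemma shift_based: "based_cover V E (\<lambda>x y. \<phi> (x + a) (y + b)) \<Lambda> w R \<tau>"
  by (simp add: based_cover_def shift based_cover_axioms_def basis R_pos w_pos)

text \<open>The reflection preserves the rows and takes the generator (\<open>\<tau>\<close>,
  \<open>R\<close>) to (- \<open>\<tau>\<close> - \<open>R\<close>, \<open>R\<close>).\<close>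

lemma mirror_based: "based_cover V E (\<lambda>x y. \<phi> (- x - y) y) (\<lambda>x y. \<Lambda> (- x - y) y) w R (- \<tau> - R)"
proof -
  have "w dvd - a - R * k - \<tau> * k \<longleftrightarrow> w dvd a - (- \<tau> - R) * k" for a k
  proof -
    have "a - (- \<tau> - R) * k = - (- a - R * k - \<tau> * k)" by (simp add: algebra_simps)
    then show ?thesis by (simp only: dvd_minus_iff)
  qed
  then have "(\<exists>k. b = R * k \<and> w dvd - a - b - \<tau> * k) \<longleftrightarrow> (\<exists>k. b = R * k \<and> w dvd a - (- \<tau> - R) * k)" for a b
    by auto
  then show ?thesis using basis R_pos w_pos mirror by (simp add: based_cover_def based_cover_axioms_def)
qed

lemma twist_mod:
  assumes "w dvd \<tau>' - \<tau>"
  shows "based_cover V E \<phi> \<Lambda> w R \<tau>'"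
proof -
  have "w dvd a - \<tau> * k \<longleftrightarrow> w dvd a - \<tau>' * k" for a k
  proof -
    have "a - \<tau> * k = (a - \<tau>' * k) + (\<tau>' - \<tau>) * k" by (simp add: algebra_simps)
    then show ?thesis using assms by (metis dvd_add_left_iff dvd_mult2)
  qed
  then show ?thesis using basis R_pos w_pos lattice_cover_axioms
    by (simp add: based_cover_def based_cover_axioms_def)
qed

lemma based_listsI: "list_graph V E L \<Longrightarrow> based_lists V E \<phi> \<Lambda> L w R \<tau>"
  using based_cover_axioms lattice_cover_axioms by (simp add: based_lists_def cover_lists_def)

end

context based_lists
begin

lemma plan_triangles_0:
  assumes R: "R = 5" and w: "w = 3" and \<tau>: "3 dvd \<tau>"
  shows "plan (\<phi> 0 0)"
proof (rule plan_triangles_5[of 0])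
  show "\<not> E (\<phi> 0 3) (\<phi> 1 (-1))"
  proof
    assume "E (\<phi> 0 3) (\<phi> 1 (-1))"
    then obtain a b where ab: "(a, b) \<in> units" "\<Lambda> (1 - a) (-4 - b)" by (auto simp: adj_iff)
    obtain k where k: "-4 - b = 5 * k" "3 dvd 1 - a - \<tau> * k" using ab(2) R w by (auto simp: basis)
    have "b = -1 \<or> b = 0 \<or> b = 1" using ab(1) by (auto simp: units_def)
    then have b: "b = 1" "k = -1" using k(1) by presburger+
    then have "a = 0 \<or> a = -1" using ab(1) by (auto simp: units_def)
    moreover have "3 dvd 1 - a + \<tau>" using k(2) b(2) by simp
    ultimately show False using \<tau> by presburger
  qed
qed (use R w in auto)

text \<open>For \<open>R\<close> = 5, row 3 is next to row 4, which is row -1 twisted. Then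
  \<open>\<kappa>\<close> = 0 suits twists divisible by 3 and \<open>\<kappa>\<close> = -1 suits the
  residue 2; the reflection turns the residue 1 into 0. For larger \<open>R\<close> the two rows do
  not touch.\<close>

lemma plan_triangles:
  assumes R: "4 \<le> R" and w: "w = 3"
  shows "plan (\<phi> 0 0)"
proof -
  consider "R = 4" | "R = 5" "3 dvd \<tau>" | "R = 5" "3 dvd \<tau> - 2" | "R = 5" "3 dvd \<tau> - 1" | "6 \<le> R"
  proof -
    have "R = 4 \<or> R = 5 \<and> (3 dvd \<tau> \<or> 3 dvd \<tau> - 2 \<or> 3 dvd \<tau> - 1) \<or> 6 \<le> R" using R by presburger
    then show ?thesis using that by blast
  qed
  then show ?thesis
  proof cases
    case 1
    then show ?thesis using plan_triangles_4 w by blast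
  next
    case 2
    then show ?thesis using plan_triangles_0 w by blast
  next
    case 3
    show ?thesis
    proof (rule plan_triangles_5[of "-1"])
      show "\<not> E (\<phi> (-1) 3) (\<phi> 1 (-1))"
      proof
        assume "E (\<phi> (-1) 3) (\<phi> 1 (-1))"
        then obtain a b where ab: "(a, b) \<in> units" "\<Lambda> (2 - a) (-4 - b)" by (auto simp: adj_iff)
        obtain k where k: "-4 - b = 5 * k" "3 dvd 2 - a - \<tau> * k" using ab(2) 3 w by (auto simp: basis)
        have "b = -1 \<or> b = 0 \<or> b = 1" using ab(1) by (auto simp: units_def)
    then have b: "b = 1" "k = -1" using k(1) by presburger+
    then have "a = 0 \<or> a = -1" using ab(1) by (auto simp: units_def)
        moreover have "3 dvd 2 - a + \<tau>" using k(2) b(2) by simp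
        ultimately show False using 3(2) by presburger
      qed
    qed (use 3 w in auto)
  next
    case 4
    interpret m: based_cover V E "\<lambda>x y. \<phi> (- x - y) y" "\<lambda>x y. \<Lambda> (- x - y) y" w R "- \<tau> - R" by (rule mirror_based)
    interpret ml: based_lists V E "\<lambda>x y. \<phi> (- x - y) y" "\<lambda>x y. \<Lambda> (- x - y) y" L w R "- \<tau> - R"
      by (rule m.based_listsI) (rule list_graph_axioms)
    have "3 dvd - \<tau> - R" using 4 by presburger
    then show ?thesis using ml.plan_triangles_0 4(1) w by simp
  next
    case 5
    show ?thesis
    proof (rule plan_triangles_5[of 0])
      show "\<not> E (\<phi> 0 3) (\<phi> 1 (-1))"
      proof
        assume "E (\<phi> 0 3) (\<phi> 1 (-1))"
        then obtain a b where ab: "(a, b) \<in> units" "\<Lambda> (1 - a) (-4 - b)" by (auto simp: adj_iff)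
        have "\<bar>-4 - b\<bar> < R" using ab(1) 5 by (auto simp: units_def)
        then have "-4 - b = 0" using ab(2) lat_short by blast
        then show False using ab(1) by (auto simp: units_def)
      qed
    qed (use 5 w in auto)
  qed
qed

lemma w_ge_3: "3 \<le> w"
proof -
  have "\<not> \<Lambda> 1 0" by (rule lat_not_unit) (simp add: units_def)
  moreover have "\<not> \<Lambda> 2 0" using lat_not_unit_diff[of 1 0 "-1" 0] by (auto simp: units_def)
  ultimately have "w \<noteq> 1" "w \<noteq> 2" using lat_row[of 1] lat_row[of 2] by auto
  then show ?thesis using w_pos by linarith
qed

lemma plan_case1: "4 \<le> R \<Longrightarrow> plan (\<phi> 0 0)"
  using plan_four_rows plan_triangles w_ge_3 by (cases "w = 3") auto

text \<open>Simplicity excludes the twists 0 and w - 2, so parity leaves 2 and the range of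
  \<open>plan_two_rows\<close>. The reflection turns the twist 2 into -4, that is w - 4, which is in
  the range once w is at least 8. For w = 6 the twist 2 gives the period (2,2) with six
  levels.\<close>

lemma plan_case3:
  assumes R: "R = 2" and \<tau>: "0 \<le> \<tau>" "\<tau> < w" "even \<tau>" "even w"
  shows "plan (\<phi> 0 0)"
proof -
  have L2: "\<Lambda> a 2 \<longleftrightarrow> w dvd a - \<tau>" for a using R by (auto simp: basis)
  have "\<not> \<Lambda> 0 2" "\<not> \<Lambda> (-2) 2"
    using lat_not_unit_diff[of 0 1 0 "-1"] lat_not_unit_diff[of "-1" 1 1 "-1"] by (auto simp: units_def)
  then have "\<not> w dvd \<tau>" "\<not> w dvd \<tau> + 2"
  proof -
    have "0 - \<tau> = - \<tau>" "-2 - \<tau> = - (\<tau> + 2)" by simp_all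
    moreover assume "\<not> \<Lambda> 0 2" "\<not> \<Lambda> (-2) 2"
    ultimately show "\<not> w dvd \<tau>" "\<not> w dvd \<tau> + 2" unfolding L2 by (metis dvd_minus_iff)+
  qed
  then have "\<tau> \<noteq> 0" "\<tau> + 2 \<noteq> w" by auto
  then have t: "2 \<le> \<tau>" "\<tau> \<le> w - 4" using \<tau> by presburger+
  consider "4 \<le> \<tau>" | "\<tau> = 2" "w = 6" | "\<tau> = 2" "8 \<le> w"
  proof -
    have "4 \<le> \<tau> \<or> \<tau> = 2 \<and> (w = 6 \<or> 8 \<le> w)" using t \<tau>(3,4) by presburger
    then show ?thesis using that by blast
  qed
  then show ?thesis
  proof cases
    case 1
    then show ?thesis using plan_two_rows[OF R] t by blast
  next
    case 2
    show ?thesis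
    proof (rule plan_levels[of 6 6 0])
      show "6 dvd a - b" if ab: "\<Lambda> a b" for a b
      proof -
        obtain k where "b = 2 * k" "6 dvd a - 2 * k" using ab R 2 by (auto simp: basis)
        then show ?thesis by simp
      qed
    qed (use 2 L2[of 2] lat_row[of 6] in auto)
  next
    case 3
    interpret m: based_cover V E "\<lambda>x y. \<phi> (- x - y) y" "\<lambda>x y. \<Lambda> (- x - y) y" w R "- \<tau> - R" by (rule mirror_based)
    interpret m': based_cover V E "\<lambda>x y. \<phi> (- x - y) y" "\<lambda>x y. \<Lambda> (- x - y) y" w R "w - 4"
      by (rule m.twist_mod) (use 3 R in auto)
    interpret ml: based_lists V E "\<lambda>x y. \<phi> (- x - y) y" "\<lambda>x y. \<Lambda> (- x - y) y" L w R "w - 4"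
      by (rule m'.based_listsI) (rule list_graph_axioms)
    show ?thesis using ml.plan_two_rows[OF R] 3 by simp
  qed
qed

end

lemma (in based_cover) plan_everywhere:
  assumes L: "list_graph V E L"
    and "\<And>\<phi>. based_lists V E \<phi> \<Lambda> L w R \<tau> \<Longrightarrow> list_graph.plan V E L (\<phi> 0 0)" and v: "v \<in> V"
  shows "list_graph.plan V E L v"
proof -
  obtain x y where xy: "v = \<phi> x y" using v V_cases by blast
  interpret s: based_cover V E "\<lambda>x' y'. \<phi> (x' + x) (y' + y)" \<Lambda> w R \<tau> by (rule shift_based)
  show ?thesis using assms(2)[OF s.based_listsI[OF L]] xy by simp
qed

section \<open>Unrolling T(r,s,t) into a lattice cover\<close>

definition offsets :: "int \<Rightarrow> int \<Rightarrow> int \<Rightarrow> (int \<times> int) multiset" where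
  "offsets r t i =
     (if r = 1 then {#(1, 1), (1, -1), (1, t), (1, -t), (1, t + 1), (1, -(t + 1))#}
      else if i = 1 then {#(1, 1), (1, -1), (2, 0), (2, -1), (r, t + 1), (r, t)#}
      else if i = r then {#(r, 1), (r, -1), (r - 1, 1), (r - 1, 0), (1, -t), (1, -t - 1)#}
      else {#(i, 1), (i, -1), (i + 1, 0), (i - 1, 0), (i + 1, -1), (i - 1, 1)#})"

lemma T_nbrs_offsets:
  assumes "1 \<le> r" "1 \<le> i" "i \<le> r"
  shows "T_nbrs r s t (wrap s (i, j)) = image_mset (\<lambda>(i', d). wrap s (i', j + d)) (offsets r t i)"
proof -
  have "T_nbrs r s t (i, k) = image_mset (\<lambda>(i', d). wrap s (i', k + d)) (offsets r t i)" for k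
    by (simp add: T_nbrs_def offsets_def algebra_simps)
  moreover have "wrap s (i', (j - 1) mod s + 1 + d) = wrap s (i', j + d)" for i' d
    using mod_add_left_eq[of "j - 1" s d] by (simp add: wrap_def algebra_simps)
  moreover have "wrap s (i, j) = (i, (j - 1) mod s + 1)" by (simp add: wrap_def)
  ultimately show ?thesis by simp
qed

locale T_graph =
  fixes V :: "'a set" and E and r s t :: int and f
  assumes graph: "simple_graph V E" and regular: "regular_graph 6 V E"
    and r: "1 \<le> r" and t: "0 \<le> t" "t \<le> s - 1"
    and bij: "bij_betw f V (T_verts r s)"
    and nbrs: "\<And>v. v \<in> V \<Longrightarrow> image_mset f (mset_set (nbhd E v)) = T_nbrs r s t (f v)"
begin

definition W :: "int \<Rightarrow> int \<Rightarrow> 'a" where "W i j = inv_into V f (wrap s (i, j))"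

lemma s_pos: "0 < s" using t by linarith

lemma wrap_verts: "1 \<le> i \<Longrightarrow> i \<le> r \<Longrightarrow> wrap s (i, j) \<in> T_verts r s"
proof -
  assume "1 \<le> i" "i \<le> r"
  moreover have "(j - 1) mod s + 1 \<le> s" using pos_mod_bound[OF s_pos, of "j - 1"] by linarith
  ultimately show ?thesis using s_pos by (simp add: wrap_def T_verts_def)
qed

lemma f_W: "1 \<le> i \<Longrightarrow> i \<le> r \<Longrightarrow> f (W i j) = wrap s (i, j)"
  unfolding W_def using wrap_verts bij by (metis bij_betw_def f_inv_into_f)

lemma W_V: "1 \<le> i \<Longrightarrow> i \<le> r \<Longrightarrow> W i j \<in> V"
  unfolding W_def using wrap_verts bij by (metis bij_betw_def inv_into_into)

lemma V_W: "v \<in> V \<Longrightarrow> \<exists>i j. 1 \<le> i \<and> i \<le> r \<and> v = W i j"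
proof -
  assume v: "v \<in> V"
  obtain i j where ij: "f v = (i, j)" by (cases "f v")
  have "(i, j) \<in> T_verts r s" using bij v ij by (metis bij_betwE)
  then have "1 \<le> i" "i \<le> r" "wrap s (i, j) = (i, j)" by (auto simp: T_verts_def wrap_def)
  moreover have "v = inv_into V f (i, j)" using v ij bij by (metis bij_betw_inv_into_left)
  ultimately show ?thesis unfolding W_def by metis
qed

lemma W_eq:
  assumes "1 \<le> i" "i \<le> r" "1 \<le> i'" "i' \<le> r"
  shows "W i j = W i' j' \<longleftrightarrow> i = i' \<and> s dvd j - j'"
proof -
  have "W i j = W i' j' \<longleftrightarrow> wrap s (i, j) = wrap s (i', j')"
    using f_W assms unfolding W_def by metis
  also have "\<dots> \<longleftrightarrow> i = i' \<and> s dvd j - j'" by (auto simp: wrap_def mod_eq_dvd_iff)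
  finally show ?thesis .
qed

lemma nbhd_W:
  assumes "1 \<le> i" "i \<le> r"
  shows "nbhd E (W i j) = (\<lambda>(i', d). W i' (j + d)) ` set_mset (offsets r t i)"
proof -
  have N: "nbhd E (W i j) \<subseteq> V" "finite (nbhd E (W i j))"
    using graph finite_subset[of "nbhd E (W i j)" V] by (auto simp: simple_graph_def nbhd_def)
  have "image_mset f (mset_set (nbhd E (W i j))) = image_mset (\<lambda>(i', d). wrap s (i', j + d)) (offsets r t i)"
    using nbrs[OF W_V[OF assms]] unfolding f_W[OF assms] T_nbrs_offsets[OF r assms] .
  then have "f ` nbhd E (W i j) = (\<lambda>(i', d). wrap s (i', j + d)) ` set_mset (offsets r t i)"
    using N(2) by (metis finite_set_mset_mset_set set_image_mset)
  then have "inv_into V f ` f ` nbhd E (W i j) = (\<lambda>(i', d). W i' (j + d)) ` set_mset (offsets r t i)"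
    by (simp add: image_image W_def case_prod_unfold)
  moreover have "inv_into V f ` f ` nbhd E (W i j) = nbhd E (W i j)"
    using bij N(1) by (simp add: bij_betw_def inv_into_image_cancel)
  ultimately show ?thesis by simp
qed

text \<open>Leaving row r upwards re-enters row 1 with the column lowered by t, so (t, r) is a
  period next to (s, 0). Dividing y - 1 by r counts how often this has happened.\<close>

lemma cover:
  assumes r2: "2 \<le> r"
  defines "\<phi> \<equiv> \<lambda>x y. W ((y - 1) mod r + 1) (x - t * ((y - 1) div r))"
  shows "based_cover V E \<phi> (\<lambda>a b. \<exists>k. b = r * k \<and> s dvd (a - t * k)) s r t"
proof -
  have rng: "1 \<le> (y - 1) mod r + 1" "(y - 1) mod r + 1 \<le> r" for y
    using r pos_mod_sign[of r "y - 1"] pos_mod_bound[of r "y - 1"] by linarith+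
  have \<phi>: "\<phi> x (r * q + i) = W i (x - t * q)" if "1 \<le> i" "i \<le> r" for x q i
  proof -
    have e: "r * q + i - 1 = (i - 1) + r * q" by simp
    have "(r * q + i - 1) div r = q" "(r * q + i - 1) mod r = i - 1" unfolding e using that by auto
    then show ?thesis unfolding \<phi>_def by simp
  qed
  have repr: "\<exists>q i. 1 \<le> i \<and> i \<le> r \<and> y = r * q + i" for y
    by (rule exI[of _ "(y - 1) div r"], rule exI[of _ "(y - 1) mod r + 1"]) (use rng[of y] in auto)
  have "lattice_cover V E \<phi> (\<lambda>a b. \<exists>k. b = r * k \<and> s dvd (a - t * k))"
  proof
    show "simple_graph V E" "regular_graph 6 V E" by (rule graph regular)+
    show "V = range (\<lambda>(x, y). \<phi> x y)"
    proof
      show "V \<subseteq> range (\<lambda>(x, y). \<phi> x y)"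
      proof
        fix v assume "v \<in> V"
        then obtain i j where "1 \<le> i" "i \<le> r" "v = W i j" using V_W by blast
        then have "v = \<phi> j i" using \<phi>[of i j 0] by simp
        then show "v \<in> range (\<lambda>(x, y). \<phi> x y)" by auto
      qed
    qed (use rng W_V in \<open>auto simp: \<phi>_def\<close>)
    show "\<phi> x y = \<phi> x' y' \<longleftrightarrow> (\<exists>k. y - y' = r * k \<and> s dvd (x - x' - t * k))" for x y x' y'
    proof -
      obtain q i where y: "1 \<le> i" "i \<le> r" "y = r * q + i" using repr by blast
      obtain q' i' where y': "1 \<le> i'" "i' \<le> r" "y' = r * q' + i'" using repr by blast
      have eq: "\<phi> x y = \<phi> x' y' \<longleftrightarrow> i = i' \<and> s dvd (x - t * q) - (x' - t * q')"
        unfolding y y' using \<phi> W_eq y y' by simp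
      have ii: "y - y' = r * k \<longleftrightarrow> i = i' \<and> k = q - q'" for k
      proof
        assume k: "y - y' = r * k"
        then have "i - i' = r * (k - (q - q'))" unfolding y y' by (simp add: algebra_simps)
        then have "r dvd i - i'" by simp
        moreover have "\<bar>i - i'\<bar> < r" using y y' by linarith
        ultimately have "i = i'" by (simp add: small_dvd)
        then have "r * (k - (q - q')) = 0" using \<open>i - i' = r * (k - (q - q'))\<close> by simp
        then show "i = i' \<and> k = q - q'" using \<open>i = i'\<close> r by simp
      next
        assume "i = i' \<and> k = q - q'"
        then have "i = i'" "k = q - q'" by simp_all
        then show "y - y' = r * k" unfolding y y' by (simp add: right_diff_distrib)
      qed
      have e: "x - x' - t * (q - q') = (x - t * q) - (x' - t * q')" by (simp add: algebra_simps)
      have "s dvd x - x' - t * (q - q') \<longleftrightarrow> s dvd (x - t * q) - (x' - t * q')" by (simp only: e)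
      then show ?thesis unfolding eq ii by blast
    qed
    show "nbhd E (\<phi> x y) = {\<phi> (x + 1) y, \<phi> (x - 1) y, \<phi> x (y + 1), \<phi> x (y - 1), \<phi> (x - 1) (y + 1), \<phi> (x + 1) (y - 1)}"
      for x y
    proof -
      obtain q i where y: "1 \<le> i" "i \<le> r" "y = r * q + i" using repr by blast
      define j where "j = x - t * q"
      have 0: "\<phi> (x + d) y = W i (j + d)" for d using \<phi>[OF y(1,2), of "x + d" q] by (simp add: y(3) j_def algebra_simps)
      have up: "\<phi> (x + d) (y + 1) = (if i = r then W 1 (j + d - t) else W (i + 1) (j + d))" for d
      proof (cases "i = r")
        case True
        have "y + 1 = r * (q + 1) + 1" using y(3) True by (simp add: algebra_simps)
        then show ?thesis using \<phi>[of 1 "x + d" "q + 1"] r True by (simp add: j_def algebra_simps)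
      next
        case False
        have "y + 1 = r * q + (i + 1)" using y(3) by simp
        then show ?thesis using \<phi>[of "i + 1" "x + d" q] y False by (simp add: j_def algebra_simps)
      qed
      have down: "\<phi> (x + d) (y - 1) = (if i = 1 then W r (j + d + t) else W (i - 1) (j + d))" for d
      proof (cases "i = 1")
        case True
        have "y - 1 = r * (q - 1) + r" using y(3) True by (simp add: algebra_simps)
        then show ?thesis using \<phi>[of r "x + d" "q - 1"] r True by (simp add: j_def algebra_simps)
      next
        case False
        have "y - 1 = r * q + (i - 1)" using y(3) by simp
        then show ?thesis using \<phi>[of "i - 1" "x + d" q] y False by (simp add: j_def algebra_simps)
      qed
      have eqs: "\<phi> x y = W i j" "\<phi> (x + 1) y = W i (j + 1)" "\<phi> (x - 1) y = W i (j - 1)"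
        "\<phi> x (y + 1) = (if i = r then W 1 (j - t) else W (i + 1) j)"
        "\<phi> x (y - 1) = (if i = 1 then W r (j + t) else W (i - 1) j)"
        "\<phi> (x - 1) (y + 1) = (if i = r then W 1 (j - t - 1) else W (i + 1) (j - 1))"
        "\<phi> (x + 1) (y - 1) = (if i = 1 then W r (j + (t + 1)) else W (i - 1) (j + 1))"
        using 0[of 0] 0[of 1] 0[of "-1"] up[of 0] up[of "-1"] down[of 0] down[of 1]
        by (simp_all add: algebra_simps)
      consider "i = 1" "i \<noteq> r" | "i = r" "i \<noteq> 1" | "i \<noteq> 1" "i \<noteq> r" using r2 by linarith
      then show ?thesis
      proof cases
        case 1
        then show ?thesis unfolding eqs nbhd_W[OF y(1,2)] using r2 by (simp add: offsets_def insert_commute)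
      next
        case 2
        have "W 1 (j + (- t - 1)) = W 1 (j - t - 1)" by (rule arg_cong) simp
        then show ?thesis unfolding eqs nbhd_W[OF y(1,2)] using r2 2 by (simp add: offsets_def insert_commute)
      next
        case 3
        then show ?thesis unfolding eqs nbhd_W[OF y(1,2)] using r2 by (simp add: offsets_def insert_commute)
      qed
    qed
  qed
  then show ?thesis using r s_pos by (simp add: based_cover_def based_cover_axioms_def)
qed

lemma cycle:
  assumes "r = 1" "t = 2" and "list_graph V E L"
  shows "cycle_cube V E L (\<lambda>m. W 1 (m + a)) s"
proof -
  interpret list_graph V E L by fact
  show ?thesis
  proof
    show "V = range (\<lambda>m. W 1 (m + a))"
    proof
      show "V \<subseteq> range (\<lambda>m. W 1 (m + a))"
      proof
        fix v assume "v \<in> V"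
        then obtain i j where "1 \<le> i" "i \<le> 1" "v = W i j" using V_W assms(1) by blast
        then have "v = W 1 ((j - a) + a)" by simp
        then show "v \<in> range (\<lambda>m. W 1 (m + a))" by blast
      qed
    qed (use W_V assms(1) in auto)
    show "W 1 (m + a) = W 1 (m' + a) \<longleftrightarrow> s dvd m - m'" for m m' using W_eq assms(1) by simp
    show "nbhd E (W 1 (m + a)) = {W 1 (m + 1 + a), W 1 (m - 1 + a), W 1 (m + 2 + a), W 1 (m - 2 + a),
      W 1 (m + 3 + a), W 1 (m - 3 + a)}" for m
    proof -
      have "m + 1 + a = m + a + 1" "m - 1 + a = m + a - 1" "m + 2 + a = m + a + 2" "m - 2 + a = m + a - 2"
        "m + 3 + a = m + a + 3" "m - 3 + a = m + a - 3" by simp_all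
      note e = this
      show ?thesis unfolding e using nbhd_W[of 1 "m + a"] assms(1,2) by (simp add: offsets_def)
    qed
  qed (rule s_pos)
qed

end

lemma iso_T_graph:
  assumes "simple_graph V E" "regular_graph 6 V E" "iso_T V E r s t"
  shows "\<exists>f. T_graph V E r s t f"
  using assms unfolding iso_T_def T_graph_def by blast

lemma case1_plan:
  assumes "case1 V E" "list_graph V E L" "v \<in> V"
  shows "list_graph.plan V E L v"
proof -
  interpret list_graph V E L by fact
  obtain r s t where r: "4 \<le> r" and "iso_T V E r s t" using assms(1) by (auto simp: case1_def)
  then obtain f where T: "T_graph V E r s t f" using iso_T_graph[OF graph regular] by metis
  have "2 \<le> r" using r by simp
  from T_graph.cover[OF T this] show ?thesis
    by (rule based_cover.plan_everywhere[OF _ assms(2) _ assms(3)]) (rule based_lists.plan_case1[OF _ r])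
qed

lemma case3_plan:
  assumes "case3 V E" "list_graph V E L" "v \<in> V"
  shows "list_graph.plan V E L v"
proof -
  interpret list_graph V E L by fact
  obtain s t where st: "even s" "even t" and "iso_T V E 2 s t" using assms(1) by (auto simp: case3_def)
  then obtain f where T: "T_graph V E 2 s t f" using iso_T_graph[OF graph regular] by metis
  have t: "0 \<le> t" "t < s" using T_graph.t[OF T] by simp_all
  have "(2 :: int) \<le> 2" by simp
  from T_graph.cover[OF T this] show ?thesis
    by (rule based_cover.plan_everywhere[OF _ assms(2) _ assms(3)])
      (rule based_lists.plan_case3[OF _ refl t st(2,1)])
qed

lemma case2_plan:
  assumes "case2 V E" "list_graph V E L" "v \<in> V"
  shows "list_graph.plan V E L v"
proof -
  interpret list_graph V E L by fact
  obtain s where s: "9 \<le> s" "s \<noteq> 11" and "iso_T V E 1 s 2" using assms(1) by (auto simp: case2_def)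
  then obtain f where T: "T_graph V E 1 s 2 f" using iso_T_graph[OF graph regular] by metis
  interpret T: T_graph V E 1 s 2 f by (rule T)
  obtain i j where "1 \<le> i" "i \<le> 1" "v = T.W i j" using T.V_W assms(3) by blast
  then have v: "v = T.W 1 (0 + j)" by simp
  interpret c: cycle_cube V E L "\<lambda>m. T.W 1 (m + j)" s by (rule T.cycle[OF refl refl assms(2)])
  have "s = 9 \<or> s = 10 \<or> 12 \<le> s" using s by linarith
  then show ?thesis using c.plan_cube_long c.plan_cube_short unfolding v by blast
qed

section \<open>The cover of a 3-chromatic triangulation\<close>

lemma inj_on_funpow_image:
  assumes "inj_on f D" "f ` D \<subseteq> D"
  shows "inj_on (f ^^ n) D \<and> (f ^^ n) ` D \<subseteq> D"
proof (induction n)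
  case (Suc n)
  have "inj_on f ((f ^^ n) ` D)" using Suc assms(1) inj_on_subset by blast
  then have "inj_on (f \<circ> (f ^^ n)) D" using Suc by (intro comp_inj_on) auto
  moreover have "(f \<circ> (f ^^ n)) ` D \<subseteq> D" using Suc assms(2) by (auto simp: image_comp[symmetric])
  ultimately show ?case by (auto simp: comp_def)
qed auto

text \<open>Injectivity makes every orbit a cycle through its starting point, so the number of its
  points is an exact period. This is applied both to the rotation at a vertex and to face
  tracing.\<close>

lemma orbit_period:
  assumes inj: "inj_on f D" and sub: "f ` D \<subseteq> D" and fin: "finite D" and d: "d \<in> D"
  defines "p \<equiv> card {(f ^^ k) d | k. True}"
  shows "0 < p" "p \<le> card D" "(f ^^ p) d = d" "inj_on (\<lambda>k. (f ^^ k) d) {..<p}"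
    "{(f ^^ k) d | k. True} = (\<lambda>k. (f ^^ k) d) ` {..<p}"
proof -
  have inD: "(f ^^ k) d \<in> D" for k
  proof -
    have "(f ^^ k) ` D \<subseteq> D" using inj_on_funpow_image[OF inj sub, of k] by (rule conjunct2)
    then show ?thesis using d by blast
  qed
  have "range (\<lambda>k. (f ^^ k) d) \<subseteq> D" using inD by blast
  then have fr: "finite (range (\<lambda>k. (f ^^ k) d))" using fin by (rule finite_subset)
  have ni: "\<not> inj (\<lambda>k. (f ^^ k) d)"
  proof
    assume "inj (\<lambda>k. (f ^^ k) d)"
    from finite_imageD[OF fr this] show False by simp
  qed
  obtain i j where ij: "i < j" "(f ^^ i) d = (f ^^ j) d"
  proof -
    obtain i j where "i \<noteq> j" "(f ^^ i) d = (f ^^ j) d" using ni unfolding inj_def by blast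
    then show ?thesis using that[of i j] that[of j i] by (cases "i < j") auto
  qed
  have "(f ^^ i) ((f ^^ (j - i)) d) = (f ^^ (i + (j - i))) d" by (simp only: funpow_add comp_apply)
  also have "\<dots> = (f ^^ i) d" using ij by simp
  finally have "(f ^^ (j - i)) d = d"
    using inj_onD[OF conjunct1[OF inj_on_funpow_image[OF inj sub, of i]]] inD d by blast
  then have ex: "\<exists>q. 0 < q \<and> (f ^^ q) d = d" using ij(1) by (intro exI[of _ "j - i"]) simp
  define q where "q = (LEAST q. 0 < q \<and> (f ^^ q) d = d)"
  have q: "0 < q" "(f ^^ q) d = d" using LeastI_ex[OF ex] by (simp_all add: q_def)
  have qmin: "\<not> (0 < l \<and> (f ^^ l) d = d)" if "l < q" for l using that unfolding q_def by (rule not_less_Least)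
  have orb: "{(f ^^ k) d | k. True} = (\<lambda>k. (f ^^ k) d) ` {..<q}"
  proof
    show "{(f ^^ k) d | k. True} \<subseteq> (\<lambda>k. (f ^^ k) d) ` {..<q}"
    proof
      fix z assume "z \<in> {(f ^^ k) d | k. True}"
      then obtain k where "z = (f ^^ k) d" by auto
      then have "z = (f ^^ (k mod q)) d" using funpow_mod_eq[OF q(2)] by simp
      then show "z \<in> (\<lambda>k. (f ^^ k) d) ` {..<q}" using q(1) by auto
    qed
  qed auto
  have injq: "inj_on (\<lambda>k. (f ^^ k) d) {..<q}"
  proof (rule linorder_inj_onI)
    fix i j assume ij: "i < j" "i \<in> {..<q}" "j \<in> {..<q}"
    show "(f ^^ i) d \<noteq> (f ^^ j) d"
    proof
      assume eq: "(f ^^ i) d = (f ^^ j) d"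
      have "(f ^^ (q - j + i)) d = (f ^^ (q - j)) ((f ^^ i) d)" by (simp add: funpow_add)
      also have "\<dots> = (f ^^ (q - j + j)) d" by (simp only: eq funpow_add comp_apply)
      also have "\<dots> = d" using ij q by simp
      finally show False using qmin[of "q - j + i"] ij by auto
    qed
  qed auto
  have pq: "p = q" unfolding p_def orb using card_image[OF injq] by simp
  show "0 < p" "(f ^^ p) d = d" "inj_on (\<lambda>k. (f ^^ k) d) {..<p}"
    "{(f ^^ k) d | k. True} = (\<lambda>k. (f ^^ k) d) ` {..<p}" unfolding pq by (fact q injq orb)+
  have "{(f ^^ k) d | k. True} \<subseteq> D" using inD by auto
  then show "p \<le> card D" unfolding p_def using fin card_mono by blast
qed

text \<open>Every period is at most card D, so the factorial is a common multiple of all of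
  them.\<close>

lemma funpow_fact:
  assumes "inj_on f D" "f ` D \<subseteq> D" "finite D" "d \<in> D"
  shows "(f ^^ fact (card D)) d = d"
proof -
  let ?p = "card {(f ^^ k) d | k. True}"
  have "?p dvd fact (card D)"
    using orbit_period(1,2)[OF assms] by (intro dvd_fact) auto
  then have "fact (card D) mod ?p = 0" by simp
  then show ?thesis using funpow_mod_eq[OF orbit_period(3)[OF assms], of "fact (card D)"] by simp
qed

lemma int_grid_induct:
  fixes P :: "int \<Rightarrow> int \<Rightarrow> bool"
  assumes "P 0 0" "\<And>x y. P x y \<Longrightarrow> P (x + 1) y" "\<And>x y. P x y \<Longrightarrow> P (x - 1) y"
    "\<And>x y. P x y \<Longrightarrow> P x (y + 1)" "\<And>x y. P x y \<Longrightarrow> P x (y - 1)"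
  shows "P x y"
proof -
  have "P x 0" by (induction x rule: int_induct[where k = 0]) (use assms in auto)
  then show ?thesis by (induction y rule: int_induct[where k = 0]) (use assms in auto)
qed

text \<open>A proper colouring with three colours, in which the colours of every triangle add up to 3.\<close>

locale coloured_rotation =
  fixes V :: "'a set" and E rot and c :: "'a \<Rightarrow> int"
  assumes graph: "simple_graph V E" and regular: "regular_graph 6 V E" and conn: "connected_graph V E"
    and rotN: "E v x \<Longrightarrow> E v (rot v x)"
    and rot6: "E v x \<Longrightarrow> (rot v ^^ 6) x = x"
    and rot_all: "E v x \<Longrightarrow> E v y \<Longrightarrow> \<exists>k<6. y = (rot v ^^ k) x"
    and rot2: "E v x \<Longrightarrow> (rot v ^^ 2) x \<noteq> x"
    and tri: "E u v \<Longrightarrow> rot (rot v u) v = u \<and> rot u (rot v u) = v"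
    and col: "E u v \<Longrightarrow> c u \<noteq> c v" "v \<in> V \<Longrightarrow> c v \<in> {0, 1, 2}"
begin

lemma E_sym: "E x y \<Longrightarrow> E y x" and E_V: "E x y \<Longrightarrow> x \<in> V \<and> y \<in> V"
  using graph by (auto simp: simple_graph_def)

lemma rotkN: "E v x \<Longrightarrow> E v ((rot v ^^ k) x)"
  by (induction k) (auto intro: rotN)

lemma rot_mod: "E v x \<Longrightarrow> (rot v ^^ (k mod 6)) x = (rot v ^^ k) x"
  by (rule funpow_mod_eq[OF rot6])

lemma rot_add: "(rot v ^^ a) ((rot v ^^ b) x) = (rot v ^^ (a + b)) x"
  by (simp add: funpow_add)

lemma rot_edge: "E v x \<Longrightarrow> E x (rot v x)"
  using tri[of x v] rotN[of "rot v x" v] rotN[of v x] E_sym by metis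

lemma col_sum:
  assumes "E v x"
  shows "c v + c x + c (rot v x) = 3"
proof -
  have "E v (rot v x)" "E x (rot v x)" using rotN rot_edge assms by blast+
  then show ?thesis using col(1)[of v x] col(1)[of v "rot v x"] col(1)[of x "rot v x"] col(2)[of v]
      col(2)[of x] col(2)[of "rot v x"] assms E_V by auto
qed

lemma col_rot: "E v x \<Longrightarrow> c ((rot v ^^ k) x) = (if even k then c x else 3 - c v - c x)"
proof (induction k)
  case (Suc k)
  then show ?case using col_sum[OF rotkN[OF Suc.prems, of k]] by auto
qed simp

text \<open>Parallel translation of the directed edge (v, u), where u marks direction 0: move in
  direction i and carry the mark along. Seen from the new vertex, v lies in direction i + 3, so the
  new mark arises from v by -(i + 3) turns; 9 - i agrees with this modulo 6 and avoids negative
  numbers.\<close>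

definition T :: "nat \<Rightarrow> 'a \<times> 'a \<Rightarrow> 'a \<times> 'a" where
  "T i = (\<lambda>(v, u). ((rot v ^^ i) u, (rot ((rot v ^^ i) u) ^^ (9 - i)) v))"

definition spin :: "'a \<times> 'a \<Rightarrow> 'a \<times> 'a" where "spin = (\<lambda>(v, u). (v, rot v u))"

definition D :: "('a \<times> 'a) set" where "D = {(v, u). E v u}"

lemma T_D: "d \<in> D \<Longrightarrow> T i d \<in> D"
  using rotkN E_sym by (fastforce simp: T_def D_def)

lemma spin_D: "d \<in> D \<Longrightarrow> spin d \<in> D"
  using rotN by (auto simp: spin_def D_def)

lemma T_back:
  assumes "d \<in> D" "i \<le> 5"
  shows "T (i + 3) (T i d) = d"
proof -
  obtain v u where d: "d = (v, u)" "E v u" using assms by (auto simp: D_def)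
  let ?w = "(rot v ^^ i) u"
  have w: "E ?w v" using rotkN[OF d(2)] E_sym by blast
  have "(rot ?w ^^ (i + 3)) ((rot ?w ^^ (9 - i)) v) = v"
    unfolding rot_add using rot_mod[OF w, of 12] assms(2) by simp
  moreover have "(rot v ^^ (9 - (i + 3))) ?w = u"
    unfolding rot_add using rot6[OF d(2)] assms(2) by simp
  ultimately show ?thesis by (simp add: T_def d)
qed

lemma T_6: "d \<in> D \<Longrightarrow> T 6 d = T 0 d"
proof -
  assume "d \<in> D"
  then obtain v u where d: "d = (v, u)" "E v u" by (auto simp: D_def)
  have "(rot u ^^ 9) v = (rot u ^^ 3) v" using rot_mod[OF E_sym[OF d(2)], of 9] by simp
  then show ?thesis using rot6[OF d(2)] by (simp add: T_def d)
qed

lemma T_spin: "d \<in> D \<Longrightarrow> i \<le> 5 \<Longrightarrow> T i (spin d) = spin (T (Suc i) d)"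
proof -
  assume "d \<in> D" and i: "i \<le> 5"
  then obtain v u where d: "d = (v, u)" "E v u" by (auto simp: D_def)
  have 1: "(rot v ^^ i) (rot v u) = (rot v ^^ Suc i) u" by (simp add: funpow_swap1)
  have "9 - i = Suc (9 - Suc i)" using i by simp
  then have 2: "(rot w ^^ (9 - i)) v = rot w ((rot w ^^ (9 - Suc i)) v)" for w by simp
  show ?thesis unfolding d spin_def T_def by (simp only: prod.case 1 2)
qed

text \<open>Going along two sides of a triangle amounts to going along the third. Together with
  \<open>T_0_2\<close> this makes the translations commute: the surface is flat because all degrees
  are 6.\<close>

lemma T_2_0:
  assumes "d \<in> D"
  shows "T 2 (T 0 d) = T 1 d"
proof -
  obtain v u where d: "d = (v, u)" "E v u" using assms by (auto simp: D_def)
  let ?x = "rot v u"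
  have t: "rot ?x v = u" "rot u ?x = v" using tri[OF E_sym[OF d(2)]] by auto
  have x: "E v ?x" by (rule rotN[OF d(2)])
  have uv: "E u v" by (rule E_sym[OF d(2)])
  have ux: "E u ?x" using rotN[OF E_sym[OF x]] t(1) E_sym by metis
  have "(rot u ^^ 2) ((rot u ^^ 9) v) = (rot u ^^ 5) v"
    unfolding rot_add using rot_mod[OF uv, of 11] by simp
  also have "\<dots> = (rot u ^^ 5) ((rot u ^^ 1) ?x)" using t(2) by simp
  also have "\<dots> = ?x" unfolding rot_add using rot6[OF ux] by simp
  finally have 1: "(rot u ^^ 2) ((rot u ^^ 9) v) = ?x" .
  have "(rot ?x ^^ 7) u = (rot ?x ^^ 7) ((rot ?x ^^ 1) v)" using t(1) by simp
  also have "\<dots> = (rot ?x ^^ 8) v" unfolding rot_add by simp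
  finally have 2: "(rot ?x ^^ 7) u = (rot ?x ^^ 8) v" .
  have "T 2 (T 0 d) = ((rot u ^^ 2) ((rot u ^^ 9) v), (rot ((rot u ^^ 2) ((rot u ^^ 9) v)) ^^ 7) u)"
    by (simp add: T_def d del: funpow.simps)
  also have "\<dots> = (?x, (rot ?x ^^ 8) v)" unfolding 1 2 ..
  also have "\<dots> = T 1 d" by (simp add: T_def d)
  finally show ?thesis .
qed

lemma T_0_2:
  assumes "d \<in> D"
  shows "T 0 (T 2 d) = T 1 d"
proof -
  obtain v u where d: "d = (v, u)" "E v u" using assms by (auto simp: D_def)
  let ?x = "rot v u" and ?y = "rot v (rot v u)"
  have x: "E v ?x" and y: "E v ?y" using rotN d(2) by blast+
  have t: "rot ?y v = ?x" "rot ?x ?y = v" using tri[OF E_sym[OF x]] by auto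
  have y2: "(rot v ^^ 2) u = ?y" by (simp add: numeral_2_eq_2)
  have 1: "(rot ?y ^^ 7) v = ?x" using rot_mod[OF E_sym[OF y], of 7] t(1) by simp
  have "(rot ?x ^^ 8) v = (rot ?x ^^ 8) ((rot ?x ^^ 1) ?y)" using t(2) by simp
  also have "\<dots> = (rot ?x ^^ 9) ?y" unfolding rot_add by simp
  finally have 2: "(rot ?x ^^ 8) v = (rot ?x ^^ 9) ?y" .
  have "T 2 d = (?y, ?x)" by (simp add: T_def d y2 1 del: funpow.simps)
  then have "T 0 (T 2 d) = (?x, (rot ?x ^^ 9) ?y)" by (simp add: T_def)
  also have "\<dots> = T 1 d" unfolding 2[symmetric] by (simp add: T_def d)
  finally show ?thesis .
qed

lemma T_comm: "d \<in> D \<Longrightarrow> T 0 (T 1 d) = T 1 (T 0 d)"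
  using T_2_0[of d] T_0_2[of "T 0 d"] T_D[of d 0] by simp

lemma finite_D: "finite D"
proof -
  have "D \<subseteq> V \<times> V" using E_V by (auto simp: D_def)
  moreover have "finite V" using graph by (simp add: simple_graph_def)
  ultimately show ?thesis using finite_subset by blast
qed

lemma inj_T: "i \<le> 5 \<Longrightarrow> inj_on (T i) D"
  using T_back by (metis inj_onI)

text \<open>A common multiple of the orders of all translations. Exponents modulo \<open>m\<close>
  give negative powers without naming inverse maps.\<close>

definition m :: int where "m = int (fact (card D))"

lemma m_pos: "0 < m" by (simp add: m_def)

lemma T_m: "i \<le> 5 \<Longrightarrow> d \<in> D \<Longrightarrow> (T i ^^ nat m) d = d"
proof -
  assume "i \<le> 5" "d \<in> D"
  moreover have "nat m = fact (card D)" unfolding m_def by (rule nat_int)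
  moreover have "T i ` D \<subseteq> D" using T_D by blast
  ultimately show ?thesis using funpow_fact[of "T i" D d] inj_T[of i] finite_D by simp
qed

lemma power_step:
  assumes "(f ^^ nat m) d = d"
  shows "(f ^^ nat ((x + 1) mod m)) d = f ((f ^^ nat (x mod m)) d)"
proof -
  have "(x + 1) mod m = (x mod m + 1) mod m" by (simp add: mod_simps)
  moreover have "nat ((x mod m + 1) mod m) = Suc (nat (x mod m)) mod nat m"
    using m_pos pos_mod_sign[OF m_pos, of x] nat_mod_distrib[of "x mod m + 1" m]
    by (simp add: nat_add_distrib)
  ultimately show ?thesis using funpow_mod_eq[OF assms, of "Suc (nat (x mod m))"] by simp
qed

context
  fixes d0 :: "'a \<times> 'a"
  assumes d0: "d0 \<in> D"
begin

definition \<Phi> :: "int \<Rightarrow> int \<Rightarrow> 'a \<times> 'a" where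
  "\<Phi> x y = (T 0 ^^ nat (x mod m)) ((T 1 ^^ nat (y mod m)) d0)"

definition \<phi> :: "int \<Rightarrow> int \<Rightarrow> 'a" where "\<phi> x y = fst (\<Phi> x y)"

lemma Tk_D: "d \<in> D \<Longrightarrow> (T i ^^ k) d \<in> D"
  by (induction k) (auto intro: T_D)

lemma \<Phi>_D: "\<Phi> x y \<in> D" using Tk_D d0 by (simp add: \<Phi>_def)

lemma \<Phi>_x: "\<Phi> (x + 1) y = T 0 (\<Phi> x y)"
  unfolding \<Phi>_def by (rule power_step) (use T_m Tk_D d0 in auto)

lemma \<Phi>_y: "\<Phi> x (y + 1) = T 1 (\<Phi> x y)"
proof -
  have comm: "(T 0 ^^ k) (T 1 d) = T 1 ((T 0 ^^ k) d)" if "d \<in> D" for k d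
    by (induction k) (use that T_comm Tk_D in auto)
  have "(T 1 ^^ nat ((y + 1) mod m)) d0 = T 1 ((T 1 ^^ nat (y mod m)) d0)"
    by (rule power_step) (use T_m d0 in auto)
  then show ?thesis using comm Tk_D d0 by (simp add: \<Phi>_def)
qed

lemma T_\<Phi>:
  "T 0 (\<Phi> x y) = \<Phi> (x + 1) y" "T 1 (\<Phi> x y) = \<Phi> x (y + 1)" "T 2 (\<Phi> x y) = \<Phi> (x - 1) (y + 1)"
  "T 3 (\<Phi> x y) = \<Phi> (x - 1) y" "T 4 (\<Phi> x y) = \<Phi> x (y - 1)" "T 5 (\<Phi> x y) = \<Phi> (x + 1) (y - 1)"
proof -
  show "T 0 (\<Phi> x y) = \<Phi> (x + 1) y" "T 1 (\<Phi> x y) = \<Phi> x (y + 1)" by (simp_all add: \<Phi>_x \<Phi>_y)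
  have 2: "T 2 (\<Phi> x y) = \<Phi> (x - 1) (y + 1)" for x y
    using T_2_0[OF \<Phi>_D, of "x - 1" y] \<Phi>_x[of "x - 1" y] \<Phi>_y[of "x - 1" y] by simp
  show "T 2 (\<Phi> x y) = \<Phi> (x - 1) (y + 1)" by (rule 2)
  show "T 3 (\<Phi> x y) = \<Phi> (x - 1) y"
    using T_back[OF \<Phi>_D, of 0 "x - 1" y] \<Phi>_x[of "x - 1" y] by simp
  show "T 4 (\<Phi> x y) = \<Phi> x (y - 1)"
    using T_back[OF \<Phi>_D, of 1 x "y - 1"] \<Phi>_y[of x "y - 1"] by simp
  show "T 5 (\<Phi> x y) = \<Phi> (x + 1) (y - 1)"
    using T_back[OF \<Phi>_D, of 2 "x + 1" "y - 1"] 2[of "x + 1" "y - 1"] by simp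
qed

lemma \<Phi>_shift:
  assumes "\<Phi> a b = \<Phi> a' b'"
  shows "\<Phi> (a + x) (b + y) = \<Phi> (a' + x) (b' + y)"
proof (induction x y rule: int_grid_induct)
  case 1
  show ?case using assms by simp
next
  case (2 x y)
  then show ?case using T_\<Phi>(1)[of "a + x" "b + y"] T_\<Phi>(1)[of "a' + x" "b' + y"] by (simp add: add.assoc)
next
  case (3 x y)
  then show ?case using T_\<Phi>(4)[of "a + x" "b + y"] T_\<Phi>(4)[of "a' + x" "b' + y"] by (simp add: algebra_simps)
next
  case (4 x y)
  then show ?case using T_\<Phi>(2)[of "a + x" "b + y"] T_\<Phi>(2)[of "a' + x" "b' + y"] by (simp add: add.assoc)
next
  case (5 x y)
  then show ?case using T_\<Phi>(5)[of "a + x" "b + y"] T_\<Phi>(5)[of "a' + x" "b' + y"] by (simp add: algebra_simps)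
qed

lemma nbhd_\<phi>:
  "nbhd E (\<phi> x y) = {\<phi> (x + 1) y, \<phi> (x - 1) y, \<phi> x (y + 1), \<phi> x (y - 1), \<phi> (x - 1) (y + 1), \<phi> (x + 1) (y - 1)}"
proof -
  obtain v u where vu: "\<Phi> x y = (v, u)" "E v u" using \<Phi>_D[of x y] by (auto simp: D_def)
  have f: "fst (T i (\<Phi> x y)) = (rot v ^^ i) u" for i by (simp add: vu T_def)
  have "nbhd E v = (\<lambda>i. (rot v ^^ i) u) ` {..<6}"
    using rot_all[OF vu(2)] rotkN[OF vu(2)] by (auto simp: nbhd_def)
  also have "{..<6} = {0, 1, 2, 3, 4, 5 :: nat}" by auto
  finally have "nbhd E v = {fst (T 0 (\<Phi> x y)), fst (T 1 (\<Phi> x y)), fst (T 2 (\<Phi> x y)),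
    fst (T 3 (\<Phi> x y)), fst (T 4 (\<Phi> x y)), fst (T 5 (\<Phi> x y))}" unfolding f by (simp del: funpow.simps)
  moreover have "\<phi> x y = v" by (simp add: \<phi>_def vu)
  ultimately show ?thesis unfolding T_\<Phi> \<phi>_def[symmetric] by (simp add: insert_commute)
qed

lemma V_\<phi>: "V = range (\<lambda>(x, y). \<phi> x y)"
proof
  have "\<phi> x y \<in> V" for x y using \<Phi>_D[of x y] E_V by (auto simp: D_def \<phi>_def)
  then show "range (\<lambda>(x, y). \<phi> x y) \<subseteq> V" by auto
  show "V \<subseteq> range (\<lambda>(x, y). \<phi> x y)"
  proof
    fix v assume v: "v \<in> V"
    have "\<phi> 0 0 \<in> V" using \<Phi>_D[of 0 0] E_V by (auto simp: D_def \<phi>_def)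
    then have "E\<^sup>*\<^sup>* (\<phi> 0 0) v" using conn v by (simp add: connected_graph_def)
    then have "\<exists>x y. v = \<phi> x y"
    proof induction
      case (step a b)
      then obtain x y where "a = \<phi> x y" by blast
      then have "b \<in> nbhd E (\<phi> x y)" using step(2) by (simp add: nbhd_def)
      then show ?case unfolding nbhd_\<phi> by blast
    qed blast
    then show "v \<in> range (\<lambda>(x, y). \<phi> x y)" by auto
  qed
qed

definition \<delta> :: int where "\<delta> = c (snd d0) - c (fst d0)"

text \<open>Colours alternate around a vertex, so a translation in direction 0 always changes the
  colour by the same \<open>\<delta>\<close> modulo 3, and one in direction 1 by its negative. The
  second conjunct keeps track of the marked neighbour so that the induction goes through.\<close>

lemma col_\<Phi>:
  "3 dvd c (fst (\<Phi> x y)) - c (fst d0) - \<delta> * (x - y) \<and> 3 dvd c (snd (\<Phi> x y)) - c (fst (\<Phi> x y)) - \<delta>"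
proof (induction x y rule: int_grid_induct)
  case 1
  show ?case by (simp add: \<Phi>_def \<delta>_def)
next
  case (2 x y)
  obtain v u where vu: "\<Phi> x y = (v, u)" "E v u" using \<Phi>_D[of x y] by (auto simp: D_def)
  define z where "z = \<delta> * (x - y)"
  have "\<delta> * (x + 1 - y) = z + \<delta>" by (simp add: z_def algebra_simps)
  moreover have "c (fst (\<Phi> (x + 1) y)) = c u" "c (snd (\<Phi> (x + 1) y)) = 3 - c u - c v"
    unfolding T_\<Phi>(1)[symmetric] vu using col_rot[OF E_sym[OF vu(2)], of 9] by (simp_all add: T_def)
  ultimately show ?case using 2[unfolded vu z_def[symmetric]] by simp presburger
next
  case (3 x y)
  obtain v u where vu: "\<Phi> x y = (v, u)" "E v u" using \<Phi>_D[of x y] by (auto simp: D_def)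
  define z where "z = \<delta> * (x - y)"
  let ?w = "(rot v ^^ 3) u"
  have w: "E v ?w" "c ?w = 3 - c v - c u" using rotkN[OF vu(2)] col_rot[OF vu(2), of 3] by simp_all
  have "\<delta> * (x - 1 - y) = z - \<delta>" by (simp add: z_def algebra_simps)
  moreover have "c (fst (\<Phi> (x - 1) y)) = 3 - c v - c u" "c (snd (\<Phi> (x - 1) y)) = c v"
    unfolding T_\<Phi>(4)[symmetric] vu using w col_rot[OF E_sym[OF w(1)], of 6] by (simp_all add: T_def)
  ultimately show ?case using 3[unfolded vu z_def[symmetric]] by simp presburger
next
  case (4 x y)
  obtain v u where vu: "\<Phi> x y = (v, u)" "E v u" using \<Phi>_D[of x y] by (auto simp: D_def)
  define z where "z = \<delta> * (x - y)"
  let ?w = "(rot v ^^ 1) u"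
  have w: "E v ?w" "c ?w = 3 - c v - c u" using rotkN[OF vu(2), of 1] col_rot[OF vu(2), of 1] by simp_all
  have "\<delta> * (x - (y + 1)) = z - \<delta>" by (simp add: z_def algebra_simps)
  moreover have "c (fst (\<Phi> x (y + 1))) = 3 - c v - c u" "c (snd (\<Phi> x (y + 1))) = c v"
    unfolding T_\<Phi>(2)[symmetric] vu using w col_rot[OF E_sym[OF w(1)], of 8] by (simp_all add: T_def)
  ultimately show ?case using 4[unfolded vu z_def[symmetric]] by simp presburger
next
  case (5 x y)
  obtain v u where vu: "\<Phi> x y = (v, u)" "E v u" using \<Phi>_D[of x y] by (auto simp: D_def)
  define z where "z = \<delta> * (x - y)"
  let ?w = "(rot v ^^ 4) u"
  have w: "E v ?w" "c ?w = c u" using rotkN[OF vu(2)] col_rot[OF vu(2), of 4] by simp_all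
  have "\<delta> * (x - (y - 1)) = z + \<delta>" by (simp add: z_def algebra_simps)
  moreover have "c (fst (\<Phi> x (y - 1))) = c u" "c (snd (\<Phi> x (y - 1))) = 3 - c u - c v"
    unfolding T_\<Phi>(5)[symmetric] vu using w col_rot[OF E_sym[OF w(1)], of 5] by (simp_all add: T_def)
  ultimately show ?case using 5[unfolded vu z_def[symmetric]] by simp presburger
qed

lemma \<delta>_cases: "\<delta> \<in> {1, -1, 2, -2}"
proof -
  obtain v u where vu: "d0 = (v, u)" "E v u" using d0 by (auto simp: D_def)
  have "\<delta> = c u - c v" unfolding \<delta>_def by (simp add: vu(1))
  then show ?thesis using col(1)[OF vu(2)] col(2)[of v] col(2)[of u] E_V[OF vu(2)] by auto
qed

lemma same_class:
  assumes "\<phi> x y = \<phi> x' y'"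
  shows "3 dvd (x - y) - (x' - y')"
proof -
  have "3 dvd (c (\<phi> x' y') - c (fst d0) - \<delta> * (x' - y')) - (c (\<phi> x y) - c (fst d0) - \<delta> * (x - y))"
    unfolding \<phi>_def by (rule dvd_diff) (rule conjunct1[OF col_\<Phi>])+
  then have "3 dvd \<delta> * ((x - y) - (x' - y'))" using assms by (simp add: algebra_simps)
  moreover have "coprime 3 \<delta>" using \<delta>_cases by auto
  ultimately show ?thesis by (simp add: coprime_dvd_mult_right_iff)
qed

text \<open>A turn by 120 degrees followed by a translation is a rotation of order three of the
  lattice. Because it respects the colour classes, its centre is a vertex and not the middle of a
  triangle. The directed edge attached to the centre would equal its own turn, against
  \<open>rot2\<close>.\<close>

lemma spin_spin: "\<Phi> x' y' \<noteq> spin (spin (\<Phi> x y))"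
proof
  assume s: "\<Phi> x' y' = spin (spin (\<Phi> x y))"
  have TS: "T i (spin (spin z)) = spin (spin (T (Suc (Suc i)) z))" if "z \<in> D" "i \<le> 4" for z i
    using that T_spin[of "spin z" i] T_spin[of z "Suc i"] spin_D by simp
  \<comment> \<open>Moving by (p, q) on the left corresponds to moving by the turned vector (- p -
    q, p) on the right.\<close>
  have G: "\<Phi> (x' + p) (y' + q) = spin (spin (\<Phi> (x - p - q) (y + p)))" for p q
  proof (induction p q rule: int_grid_induct)
    case 1
    show ?case using s by simp
  next
    case (2 p q)
    have "\<Phi> (x' + (p + 1)) (y' + q) = T 0 (\<Phi> (x' + p) (y' + q))" by (simp add: T_\<Phi> add.assoc)
    also have "\<dots> = spin (spin (T 2 (\<Phi> (x - p - q) (y + p))))" unfolding 2 using TS[OF \<Phi>_D, of 0] by (simp add: numeral_2_eq_2)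
    finally show ?case by (simp add: T_\<Phi> algebra_simps)
  next
    case (3 p q)
    have "\<Phi> (x' + (p - 1)) (y' + q) = T 3 (\<Phi> (x' + p) (y' + q))" by (simp add: T_\<Phi> algebra_simps)
    also have "\<dots> = spin (spin (T 5 (\<Phi> (x - p - q) (y + p))))" unfolding 3 using TS[OF \<Phi>_D, of 3] by simp
    finally show ?case by (simp add: T_\<Phi> algebra_simps)
  next
    case (4 p q)
    have "\<Phi> (x' + p) (y' + (q + 1)) = T 1 (\<Phi> (x' + p) (y' + q))" unfolding T_\<Phi>(2) by (simp add: add.assoc)
    also have "\<dots> = spin (spin (T 3 (\<Phi> (x - p - q) (y + p))))" unfolding 4 using TS[OF \<Phi>_D, of 1] by (simp add: numeral_3_eq_3)
    finally show ?case by (simp add: T_\<Phi> algebra_simps)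
  next
    case (5 p q)
    have "\<Phi> (x' + p) (y' + (q - 1)) = T 4 (\<Phi> (x' + p) (y' + q))" by (simp add: T_\<Phi> algebra_simps)
    also have "\<dots> = spin (spin (T 6 (\<Phi> (x - p - q) (y + p))))" unfolding 5 using TS[OF \<Phi>_D, of 4] by simp
    also have "\<dots> = spin (spin (T 0 (\<Phi> (x - p - q) (y + p))))" using T_6[OF \<Phi>_D] by simp
    finally show ?case by (simp add: T_\<Phi> algebra_simps)
  qed
  have "fst (spin (spin z)) = fst z" for z by (simp add: spin_def case_prod_unfold)
  then have "\<phi> x y = \<phi> x' y'" using s by (simp add: \<phi>_def)
  then have "3 dvd (x - x') + (y' - y)" using same_class[of x y x' y'] by (simp add: algebra_simps)
  \<comment> \<open>The fixed point equation of the rotation has determinant 3, so divisibility by 3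
    makes it solvable in integers.\<close>
  then obtain p where p: "(x - x') + (y' - y) = 3 * p" by (elim dvdE)
  define q where "q = p - (y' - y)"
  have e: "x' + p = x - p - q" "y' + q = y + p" using p by (simp_all add: q_def)
  obtain v u where vu: "\<Phi> (x - p - q) (y + p) = (v, u)" "E v u" using \<Phi>_D[of "x - p - q" "y + p"] by (auto simp: D_def)
  have "(v, u) = spin (spin (v, u))" using G[of p q] unfolding e vu .
  then show False using rot2[OF vu(2)] by (simp add: spin_def numeral_2_eq_2)
qed

text \<open>Coming back to a vertex means coming back to the same directed edge. The colour of the
  marked neighbour is determined, which leaves turns by 0, 120 and 240 degrees, and
  \<open>spin_spin\<close> excludes the last two.\<close>

lemma per_\<Phi>: "\<phi> x y = \<phi> x' y' \<longleftrightarrow> \<Phi> x y = \<Phi> x' y'"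
proof
  assume eq: "\<phi> x y = \<phi> x' y'"
  obtain v u where vu: "\<Phi> x y = (v, u)" "E v u" using \<Phi>_D[of x y] by (auto simp: D_def)
  obtain u' where u': "\<Phi> x' y' = (v, u')" "E v u'" using \<Phi>_D[of x' y'] eq vu(1) by (auto simp: D_def \<phi>_def)
  obtain k where k: "k < 6" "u' = (rot v ^^ k) u" using rot_all[OF vu(2) u'(2)] by blast
  have "3 dvd c u' - c v - \<delta>" "3 dvd c u - c v - \<delta>" using col_\<Phi>[of x y] col_\<Phi>[of x' y'] vu(1) u'(1) by simp_all
  then have "3 dvd c u - c u'" using dvd_diff[of 3 "c u - c v - \<delta>" "c u' - c v - \<delta>"] by simp
  moreover have "c u \<in> {0, 1, 2}" "c u' \<in> {0, 1, 2}" using col(2) E_V vu(2) u'(2) by blast+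
  ultimately have "c u = c u'" by auto
  moreover have "c u \<noteq> 3 - c v - c u" using col_sum[OF vu(2)] col(1)[OF rot_edge[OF vu(2)]] by linarith
  ultimately have "even k" using col_rot[OF vu(2), of k] k(2) by (auto split: if_splits)
  then have "k = 0 \<or> k = 2 \<or> k = 4" using k(1) by presburger
  then consider "k = 0" | "k = 2" | "k = 4" by blast
  then show "\<Phi> x y = \<Phi> x' y'"
  proof cases
    case 1
    then show ?thesis using vu u' k by simp
  next
    case 2
    then have "\<Phi> x' y' = spin (spin (\<Phi> x y))" using vu u' k by (simp add: spin_def numeral_2_eq_2)
    then show ?thesis using spin_spin by blast
  next
    case 3
    have "(rot v ^^ 2) u' = u" unfolding k(2) 3 rot_add using rot6[OF vu(2)] by simp
    then have "\<Phi> x y = spin (spin (\<Phi> x' y'))" using vu u' by (simp add: spin_def numeral_2_eq_2)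
    then show ?thesis using spin_spin by blast
  qed
qed (simp add: \<phi>_def)

lemma three_cover_rotation: "three_cover V E \<phi> (\<lambda>a b. \<Phi> a b = \<Phi> 0 0)"
proof
  show "simple_graph V E" "regular_graph 6 V E" by (rule graph regular)+
  show "V = range (\<lambda>(x, y). \<phi> x y)" by (rule V_\<phi>)
  show "nbhd E (\<phi> x y) = {\<phi> (x + 1) y, \<phi> (x - 1) y, \<phi> x (y + 1), \<phi> x (y - 1), \<phi> (x - 1) (y + 1), \<phi> (x + 1) (y - 1)}"
    for x y by (rule nbhd_\<phi>)
  show "\<phi> x y = \<phi> x' y' \<longleftrightarrow> \<Phi> (x - x') (y - y') = \<Phi> 0 0" for x y x' y'
    unfolding per_\<Phi> using \<Phi>_shift[of x y x' y' "- x'" "- y'"] \<Phi>_shift[of "x - x'" "y - y'" 0 0 x' y'] by auto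
  show "3 dvd a - b" if "\<Phi> a b = \<Phi> 0 0" for a b
  proof -
    have "\<phi> a b = \<phi> 0 0" using that by (simp add: \<phi>_def)
    then show ?thesis using same_class by fastforce
  qed
qed

end

end

section \<open>From a torus triangulation to its three-coloured cover\<close>

lemma three_colouring:
  assumes "finite V" "chromatic_number V E = 3" "\<And>x. \<not> E x x"
  shows "\<exists>c. proper_colouring V E c \<and> c ` V \<subseteq> {..<3}"
proof -
  obtain f :: "'a \<Rightarrow> nat" and k where f: "f ` V = {i. i < k}" "inj_on f V"
    using finite_imp_inj_to_nat_seg[OF assms(1)] by blast
  have "proper_colouring V E f \<and> f ` V \<subseteq> {..<k}"
    using f assms(3) by (auto simp: proper_colouring_def inj_on_def)
  then have "\<exists>k c. proper_colouring V E c \<and> c ` V \<subseteq> {..<k}" by blast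
  from LeastI_ex[OF this] show ?thesis using assms(2) by (simp add: chromatic_number_def)
qed

text \<open>Orbit sizes become identities: degree 6 gives the period of the rotation at a vertex,
  and faces of length 3 give the two relations in a triangle.\<close>

lemma torus_rotation:
  assumes "simple_6_regular_torus_triangulation V E"
  obtains rot where "\<And>v x. E v x \<Longrightarrow> E v (rot v x)" "\<And>v x. E v x \<Longrightarrow> (rot v ^^ 6) x = x"
    "\<And>v x y. E v x \<Longrightarrow> E v y \<Longrightarrow> \<exists>k<6. y = (rot v ^^ k) x" "\<And>v x. E v x \<Longrightarrow> (rot v ^^ 2) x \<noteq> x"
    "\<And>u v. E u v \<Longrightarrow> rot (rot v u) v = u \<and> rot u (rot v u) = v"
proof -
  have G: "simple_graph V E" "regular_graph 6 V E" using assms by (auto simp: simple_6_regular_torus_triangulation_def)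
  obtain rot where rs: "rotation_system V E rot" and F: "\<forall>f\<in>faces E rot. card f = 3"
    using assms by (auto simp: simple_6_regular_torus_triangulation_def torus_triangulation_def torus_embedding_def)
  have V: "x \<in> V \<and> y \<in> V" if "E x y" for x y using G(1) that by (auto simp: simple_graph_def)
  have sym: "E y x" if "E x y" for x y using G(1) that by (auto simp: simple_graph_def)
  have b: "bij_betw (rot v) (nbhd E v) (nbhd E v)" if "v \<in> V" for v using rs that by (simp add: rotation_system_def)
  have N: "rot v ` nbhd E v \<subseteq> nbhd E v" "inj_on (rot v) (nbhd E v)" if "v \<in> V" for v
    using b[OF that] by (auto simp: bij_betw_def)
  have fin: "finite (nbhd E v)" for v
    using G(1) finite_subset[of "nbhd E v" V] by (auto simp: simple_graph_def nbhd_def)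
  have rN: "E v (rot v x)" if "E v x" for v x using N(1)[of v] V[OF that] that by (auto simp: nbhd_def)
  have orb: "{(rot v ^^ k) x | k. True} = nbhd E v" if "E v x" for v x
  proof
    have "E v ((rot v ^^ k) x)" for k by (induction k) (use that rN in auto)
    then show "{(rot v ^^ k) x | k. True} \<subseteq> nbhd E v" by (auto simp: nbhd_def)
    show "nbhd E v \<subseteq> {(rot v ^^ k) x | k. True}"
    proof
      fix y assume y: "y \<in> nbhd E v"
      have "x \<in> nbhd E v" "v \<in> V" using that V by (auto simp: nbhd_def)
      then obtain k where "(rot v ^^ k) x = y" using rs y unfolding rotation_system_def by blast
      then show "y \<in> {(rot v ^^ k) x | k. True}" by auto
    qed
  qed
  have c6: "card (nbhd E v) = 6" if "v \<in> V" for v using G(2) that by (simp add: regular_graph_def)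
  have P: "(rot v ^^ 6) x = x" "inj_on (\<lambda>k. (rot v ^^ k) x) {..<6}" "nbhd E v = (\<lambda>k. (rot v ^^ k) x) ` {..<6}"
    if "E v x" for v x
  proof -
    have v: "v \<in> V" "x \<in> nbhd E v" using V[OF that] that by (auto simp: nbhd_def)
    note op = orbit_period[OF N(2)[OF v(1)] N(1)[OF v(1)] fin v(2), unfolded orb[OF that] c6[OF v(1)]]
    show "(rot v ^^ 6) x = x" "inj_on (\<lambda>k. (rot v ^^ k) x) {..<6}" "nbhd E v = (\<lambda>k. (rot v ^^ k) x) ` {..<6}"
      by (fact op)+
  qed
  let ?D = "{(u, v). E u v}"
  have fD: "finite ?D" using G(1) V by (intro finite_subset[of ?D "V \<times> V"]) (auto simp: simple_graph_def)
  have iD: "inj_on (face_step rot) ?D"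
  proof (rule inj_onI)
    fix p q assume pq: "p \<in> ?D" "q \<in> ?D" "face_step rot p = face_step rot q"
    obtain u v u' v' where e: "p = (u, v)" "q = (u', v')" "E u v" "E u' v'" using pq by auto
    have vv: "v = v'" using pq(3) e(1,2) by simp
    moreover have "rot v u = rot v u'" using pq(3) e(1,2) vv by simp
    moreover have "u \<in> nbhd E v" "u' \<in> nbhd E v" using e sym \<open>v = v'\<close> by (auto simp: nbhd_def)
    ultimately show "p = q" using N(2)[of v] V[OF e(3)] e by (auto dest: inj_onD)
  qed
  have sD: "face_step rot ` ?D \<subseteq> ?D" using rN sym by auto
  have tri: "rot (rot v u) v = u \<and> rot u (rot v u) = v" if "E u v" for u v
  proof -
    have d: "(u, v) \<in> ?D" using that by simp
    have "{(face_step rot ^^ k) (u, v) | k. True} \<in> faces E rot" using that unfolding faces_def by blast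
    then have c3: "card {(face_step rot ^^ k) (u, v) | k. True} = 3" using F by blast
    have "(face_step rot ^^ 3) (u, v) = (u, v)" using orbit_period(3)[OF iD sD fD d] unfolding c3 .
    then show ?thesis by (auto simp: numeral_3_eq_3)
  qed
  show ?thesis
  proof (rule that[of rot])
    fix v x assume "E v x"
    then show "(rot v ^^ 2) x \<noteq> x" using inj_onD[OF P(2), of v x 2 0] by auto
  next
    fix v x y assume "E v x" "E v y"
    then have "y \<in> (\<lambda>k. (rot v ^^ k) x) ` {..<6}" using P(3)[of v x] by (auto simp: nbhd_def)
    then show "\<exists>k<6. y = (rot v ^^ k) x" by auto
  qed (use rN P(1) tri in blast)+
qed

lemma torus_edge:
  assumes "simple_6_regular_torus_triangulation V E"
  shows "\<exists>v u. E v u"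
proof -
  obtain v where "v \<in> V" using assms
    by (auto simp: simple_6_regular_torus_triangulation_def torus_triangulation_def torus_embedding_def connected_graph_def)
  then have "card (nbhd E v) = 6" using assms by (simp add: simple_6_regular_torus_triangulation_def regular_graph_def)
  then have "nbhd E v \<noteq> {}" by force
  then show ?thesis by (auto simp: nbhd_def)
qed

lemma ex_three_cover:
  assumes T: "simple_6_regular_torus_triangulation V E" and "case4 V E"
  shows "\<exists>\<phi> \<Lambda>. three_cover V E \<phi> \<Lambda>"
proof -
  have G: "simple_graph V E" "regular_graph 6 V E" "connected_graph V E"
    using T by (auto simp: simple_6_regular_torus_triangulation_def torus_triangulation_def torus_embedding_def)
  obtain c where c: "proper_colouring V E c" "c ` V \<subseteq> {..<3}"
    using three_colouring[of V E] G(1) assms(2) by (auto simp: case4_def simple_graph_def)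
  have V: "x \<in> V \<and> y \<in> V" if "E x y" for x y using G(1) that by (auto simp: simple_graph_def)
  obtain rot where r: "\<And>v x. E v x \<Longrightarrow> E v (rot v x)" "\<And>v x. E v x \<Longrightarrow> (rot v ^^ 6) x = x"
    "\<And>v x y. E v x \<Longrightarrow> E v y \<Longrightarrow> \<exists>k<6. y = (rot v ^^ k) x" "\<And>v x. E v x \<Longrightarrow> (rot v ^^ 2) x \<noteq> x"
    "\<And>u v. E u v \<Longrightarrow> rot (rot v u) v = u \<and> rot u (rot v u) = v" using torus_rotation[OF T] by blast
  interpret coloured_rotation V E rot "\<lambda>v. int (c v)"
  proof
    show "int (c u) \<noteq> int (c v)" if "E u v" for u v using c(1) V[OF that] that by (simp add: proper_colouring_def)
    show "int (c v) \<in> {0, 1, 2}" if "v \<in> V" for v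
    proof -
      have "c v < 3" using c(2) that by auto
      then show ?thesis by auto
    qed
  qed (use G r in blast)+
  obtain v u where "E v u" using torus_edge[OF T] by blast
  then have "(v, u) \<in> D" by (simp add: D_def)
  from three_cover_rotation[OF this] show ?thesis by blast
qed

section \<open>Short periods of a three-coloured cover\<close>

context three_cover
begin

lemma three_cover_rotate: "three_cover V E (\<lambda>x y. \<phi> (- y) (x + y)) (\<lambda>x y. \<Lambda> (- y) (x + y))"
proof -
  have "3 dvd a - b" if "\<Lambda> (- b) (a + b)" for a b
  proof -
    have "3 dvd - b - (a + b)" using three[OF that] .
    then show ?thesis by presburger
  qed
  then show ?thesis using rotate by (simp add: three_cover_def three_cover_axioms_def)
qed

lemma three_cover_shift: "three_cover V E (\<lambda>x y. \<phi> (x + a) (y + b)) \<Lambda>"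
  using shift three by (simp add: three_cover_def three_cover_axioms_def)

lemma short_excluded: "\<not> \<Lambda> 1 1" "\<not> \<Lambda> (-1) 2" "\<not> \<Lambda> 2 (-1)"
  using lat_not_unit_diff[of 1 0 0 "-1"] lat_not_unit_diff[of 0 1 1 "-1"] lat_not_unit_diff[of 1 0 "-1" 1]
  by (auto simp: units_def)

text \<open>With fewer than three rows, the congruence between twist and height would make (1,1) or
  (-1,2) a period, which simplicity forbids.\<close>

lemma triangle_rows:
  assumes "\<Lambda> 3 0"
  shows "\<exists>R \<tau>. based_cover V E \<phi> \<Lambda> 3 R \<tau> \<and> 3 \<le> R"
proof -
  obtain w R \<tau> where b: "based_cover V E \<phi> \<Lambda> w R \<tau>" using based by blast
  interpret based_cover V E \<phi> \<Lambda> w R \<tau> by (rule b)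
  have "\<not> \<Lambda> 1 0" by (rule lat_not_unit) (simp add: units_def)
  then have "w \<noteq> 1" using lat_row[of 1] by auto
  moreover have "w dvd 3" using assms lat_row by simp
  moreover have "w = 1 \<or> w = 3"
  proof -
    have "w \<le> 3" using \<open>w dvd 3\<close> zdvd_imp_le by fastforce
    then have "w = 1 \<or> w = 2 \<or> w = 3" using w_pos by linarith
    then show ?thesis using \<open>w dvd 3\<close> by auto
  qed
  ultimately have w: "w = 3" by blast
  have L: "\<Lambda> \<tau> R" unfolding basis by (rule exI[of _ 1]) simp
  have d: "3 dvd \<tau> - R" using three[OF L] .
  have row: "\<Lambda> a R" if "3 dvd a - \<tau>" for a
    unfolding basis by (rule exI[of _ 1]) (use that w in simp)
  have "R \<noteq> 1"
  proof
    assume R: "R = 1"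
    have "3 dvd 1 - \<tau>" using d R by presburger
    then show False using row[of 1] short_excluded(1) R by simp
  qed
  moreover have "R \<noteq> 2"
  proof
    assume R: "R = 2"
    have "3 dvd (-1) - \<tau>" using d R by presburger
    then show False using row[of "-1"] short_excluded(2) R by simp
  qed
  ultimately have "3 \<le> R" using R_pos by linarith
  then show ?thesis using b w by blast
qed

text \<open>\<open>H\<close> generates the levels a - b of the periods and is a multiple of 3. If it
  were 3, subtracting multiples of (2,2) would produce the period (3,0) or (2,-1).\<close>

lemma level_period:
  assumes two: "\<Lambda> 2 2" and no3: "\<not> \<Lambda> 3 0"
  shows "\<exists>H ha hb. (\<forall>a b. \<Lambda> a b \<longrightarrow> H dvd a - b) \<and> \<Lambda> ha hb \<and> ha - hb = H \<and> 3 dvd H \<and> 6 \<le> H"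
proof -
  define P where "P k \<longleftrightarrow> 0 < k \<and> (\<exists>a b. \<Lambda> a b \<and> a - b = int k)" for k
  obtain n where n: "0 < n" "\<Lambda> n 0" using ex_axes by blast
  have "P (nat n)" unfolding P_def using n by (intro conjI exI[of _ n] exI[of _ 0]) auto
  then have PL: "P (LEAST k. P k)" by (rule LeastI)
  define H where "H = int (LEAST k. P k)"
  obtain ha hb where h: "0 < H" "\<Lambda> ha hb" "ha - hb = H" using PL unfolding P_def H_def by auto
  have dvd: "H dvd a - b" if ab: "\<Lambda> a b" for a b
  proof -
    define q where "q = (a - b) div H"
    have l: "\<Lambda> (a - q * ha) (b - q * hb)" using lat_diff[OF ab lat_mult[OF h(2)]] .
    have "(a - q * ha) - (b - q * hb) = (a - b) - q * (ha - hb)" by (simp add: algebra_simps)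
    also have "\<dots> = (a - b) mod H" unfolding h(3) q_def by (simp add: minus_div_mult_eq_mod)
    finally have e: "(a - q * ha) - (b - q * hb) = (a - b) mod H" .
    have bd: "0 \<le> (a - b) mod H" "(a - b) mod H < H" using h(1) by simp_all
    have "(a - b) mod H = 0"
    proof (rule ccontr)
      assume "(a - b) mod H \<noteq> 0"
      then have "P (nat ((a - b) mod H))" using l e bd unfolding P_def by (intro conjI exI) auto
      then have "(LEAST k. P k) \<le> nat ((a - b) mod H)" by (rule Least_le)
      then show False using bd by (simp add: H_def)
    qed
    then show ?thesis by auto
  qed
  have H3: "3 dvd H" using three[OF h(2)] h(3) by simp
  have "H \<noteq> 3"
  proof
    assume "H = 3"
    then have ha: "ha = hb + 3" using h(3) by simp
    show False
    proof (cases "even hb")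
      case True
      then obtain k where "hb = 2 * k" by blast
      then have "\<Lambda> (ha - k * 2) (hb - k * 2)" using lat_diff[OF h(2) lat_mult[OF two]] by blast
      then show False using no3 ha \<open>hb = 2 * k\<close> by simp
    next
      case False
      then obtain k where k: "hb = 2 * k + 1" by (auto elim: oddE)
      have l: "\<Lambda> (ha - (k + 1) * 2) (hb - (k + 1) * 2)" using lat_diff[OF h(2) lat_mult[OF two]] by blast
      have e: "ha - (k + 1) * 2 = 2" "hb - (k + 1) * 2 = -1" using ha k by simp_all
      show False using l short_excluded(3) unfolding e by blast
    qed
  qed
  then have "6 \<le> H" using H3 h(1) by presburger
  then show ?thesis using dvd h H3 by blast
qed

text \<open>Sorted by the shortest periods: (3,0) or (2,2), each up to rotation by 60 or 120
  degrees, or none of these six.\<close>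

lemma plan_origin:
  assumes L: "list_graph V E L"
  shows "list_graph.plan V E L (\<phi> 0 0)"
proof -
  have three_rows: "list_graph.plan V E L (\<psi> 0 0)" if c: "three_cover V E \<psi> \<Gamma>" and g: "\<Gamma> 3 0" for \<psi> \<Gamma>
  proof -
    interpret c: three_cover V E \<psi> \<Gamma> by (rule c)
    obtain R \<tau> where b: "based_cover V E \<psi> \<Gamma> 3 R \<tau>" "3 \<le> R" using c.triangle_rows g by blast
    interpret b: based_cover V E \<psi> \<Gamma> 3 R \<tau> by (rule b(1))
    interpret l: based_lists V E \<psi> \<Gamma> L 3 R \<tau> by (rule b.based_listsI[OF L])
    show ?thesis
    proof (cases "R = 3")
      case True
      have "\<Gamma> \<tau> R" unfolding b.basis by (rule exI[of _ 1]) simp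
      then have "3 dvd \<tau> - R" by (rule c.three)
      then have "3 dvd \<tau>" using True by presburger
      then show ?thesis using l.plan_K333 True by simp
    next
      case False
      then show ?thesis using l.plan_case1 b(2) by simp
    qed
  qed
  have levels: "list_graph.plan V E L (\<psi> 0 0)" if c: "three_cover V E \<psi> \<Gamma>" and g: "\<Gamma> 2 2" "\<not> \<Gamma> 3 0" for \<psi> \<Gamma>
  proof -
    interpret c: three_cover V E \<psi> \<Gamma> by (rule c)
    interpret l: cover_lists V E \<psi> \<Gamma> L using L c.lattice_cover_axioms by (simp add: cover_lists_def)
    obtain H ha hb where h: "\<And>a b. \<Gamma> a b \<Longrightarrow> H dvd a - b" "\<Gamma> ha hb" "ha - hb = H" "3 dvd H" "6 \<le> H"
      using c.level_period[OF g] by blast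
    have "H = 6 \<or> 9 \<le> H" using h(4,5) by presburger
    then show ?thesis using l.plan_levels[OF g(1) h(1) h(2,3)] by blast
  qed
  interpret r: three_cover V E "\<lambda>x y. \<phi> (- y) (x + y)" "\<lambda>x y. \<Lambda> (- y) (x + y)" by (rule three_cover_rotate)
  have rr: "three_cover V E (\<lambda>x y. \<phi> (- (x + y)) (- y + (x + y))) (\<lambda>x y. \<Lambda> (- (x + y)) (- y + (x + y)))"
    by (rule r.three_cover_rotate)
  interpret l: three_cover_lists V E \<phi> \<Lambda> L
    using L three_cover_axioms lattice_cover_axioms by (simp add: three_cover_lists_def cover_lists_def)
  have m: "\<Lambda> (-3) 3 = \<Lambda> 3 (-3)" "\<Lambda> (-4) 2 = \<Lambda> 4 (-2)" using lat_uminus[of 3 "-3"] lat_uminus[of 4 "-2"] by simp_all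
  consider "\<Lambda> 3 0" | "\<Lambda> 0 3" | "\<Lambda> 3 (-3)" | "\<not> \<Lambda> 3 0" "\<Lambda> 2 2" | "\<not> \<Lambda> 0 3" "\<Lambda> (-2) 4" | "\<not> \<Lambda> 3 (-3)" "\<Lambda> 4 (-2)"
    | "\<not> \<Lambda> 3 0" "\<not> \<Lambda> 0 3" "\<not> \<Lambda> 3 (-3)" "\<not> \<Lambda> 2 2" "\<not> \<Lambda> (-2) 4" "\<not> \<Lambda> 4 (-2)" by blast
  then show ?thesis
  proof cases
    case 1
    then show ?thesis using three_rows[OF three_cover_axioms] by blast
  next
    case 2
    then show ?thesis using three_rows[OF three_cover_rotate] by simp
  next
    case 3
    then show ?thesis using three_rows[OF rr] m by simp
  next
    case 4
    then show ?thesis using levels[OF three_cover_axioms] by blast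
  next
    case 5
    then show ?thesis using levels[OF three_cover_rotate] by simp
  next
    case 6
    then show ?thesis using levels[OF rr] m by simp
  next
    case 7
    then show ?thesis using l.plan_generic by blast
  qed
qed

end

lemma three_cover_plan:
  assumes "three_cover V E \<phi> \<Lambda>" "list_graph V E L" "v \<in> V"
  shows "list_graph.plan V E L v"
proof -
  interpret three_cover V E \<phi> \<Lambda> by fact
  obtain x y where v: "v = \<phi> x y" using assms(3) V_cases by blast
  interpret s: three_cover V E "\<lambda>x' y'. \<phi> (x' + x) (y' + y)" \<Lambda> by (rule three_cover_shift)
  show ?thesis using s.plan_origin[OF assms(2)] v by simp
qed

section \<open>Lists of size 3\<close>

text \<open>Lists may be prescribed on the lattice as long as they respect the periods; a colouring
  of the quotient is then pulled back and refuted there.\<close>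

lemma (in lattice_cover) not_choosableI:
  assumes inv: "\<And>x y x' y'. \<Lambda> (x - x') (y - y') \<Longrightarrow> F x y = F x' y'"
    and card: "\<And>x y. card (F x y) = 3"
    and no: "\<And>C :: int \<Rightarrow> int \<Rightarrow> nat. (\<And>x y. C x y \<in> F x y) \<Longrightarrow>
      (\<And>x y x' y'. (x' - x, y' - y) \<in> units \<Longrightarrow> C x y \<noteq> C x' y') \<Longrightarrow>
      (\<And>x y x' y'. \<Lambda> (x - x') (y - y') \<Longrightarrow> C x y = C x' y') \<Longrightarrow> False"
  shows "\<not> choosable 3 V E"
proof
  assume ch: "choosable 3 V E"
  define pos where "pos v = (SOME p. v = \<phi> (fst p) (snd p))" for v
  define L where "L v = F (fst (pos v)) (snd (pos v))" for v
  have L: "L (\<phi> x y) = F x y" for x y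
  proof -
    have "\<phi> x y = \<phi> (fst (pos (\<phi> x y))) (snd (pos (\<phi> x y)))"
      unfolding pos_def by (rule someI[of _ "(x, y)"]) simp
    then have "\<Lambda> (x - fst (pos (\<phi> x y))) (y - snd (pos (\<phi> x y)))" by (rule iffD1[OF per])
    then show ?thesis unfolding L_def by (rule inv[symmetric])
  qed
  have "3 \<le> card (L v)" for v unfolding L_def card by simp
  then obtain c where c: "list_colouring V E L c" using ch unfolding choosable_def by blast
  define C where "C x y = c (\<phi> x y)" for x y
  have 1: "C x y \<in> F x y" for x y
  proof -
    have "\<forall>v\<in>V. c v \<in> L v" using c by (simp add: list_colouring_def)
    from bspec[OF this in_V[of x y]] show ?thesis unfolding L C_def .
  qed
  have 2: "C x y \<noteq> C x' y'" if u: "(x' - x, y' - y) \<in> units" for x y x' y'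
  proof -
    have "\<forall>u\<in>V. \<forall>v\<in>V. E u v \<longrightarrow> c u \<noteq> c v" using c by (simp add: list_colouring_def proper_colouring_def)
    from bspec[OF bspec[OF this in_V[of x y]] in_V[of x' y']]
    have "E (\<phi> x y) (\<phi> x' y') \<longrightarrow> c (\<phi> x y) \<noteq> c (\<phi> x' y')" .
    then show ?thesis unfolding C_def using adj_unit[OF u] by (rule mp)
  qed
  have 3: "C x y = C x' y'" if l: "\<Lambda> (x - x') (y - y')" for x y x' y'
  proof -
    have "\<phi> x y = \<phi> x' y'" using l unfolding per .
    then show ?thesis by (simp only: C_def)
  qed
  show False
  proof (rule no)
    show "C x y \<in> F x y" for x y by (rule 1)
    show "C x y \<noteq> C x' y'" if "(x' - x, y' - y) \<in> units" for x y x' y' using that by (rule 2)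
    show "C x y = C x' y'" if "\<Lambda> (x - x') (y - y')" for x y x' y' using that by (rule 3)
  qed
qed

lemma less_three: "(a :: nat) < 3 \<Longrightarrow> a = 0 \<or> a = 1 \<or> a = 2"
  by linarith

lemma sum_three:
  fixes a b c :: nat
  assumes "a < 3" "b < 3" "c < 3" "a \<noteq> b" "b \<noteq> c" "a \<noteq> c"
  shows "a + b + c = 3"
  using less_three[OF assms(1)] less_three[OF assms(2)] less_three[OF assms(3)] assms(4-)
  by (elim disjE) simp_all

lemma only_third:
  fixes d u v w :: nat
  assumes "d < 3" "u < 3" "v < 3" "w < 3" "d \<noteq> v" "d \<noteq> w" "u \<noteq> v" "v \<noteq> w" "u \<noteq> w"
  shows "d = u"
  using less_three[OF assms(1)] less_three[OF assms(2)] less_three[OF assms(3)] less_three[OF assms(4)] assms(5-)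
  by (elim disjE) simp_all

section \<open>Bad lists for the three shapes of the period lattice\<close>

context three_cover
begin

text \<open>Rows 2 to R - 1 have lists {0, 1, 2} and are rigid: each repeats the row below, moved by
  one. The lists of row 1 lack 1 and those of row R, which is row 0, lack 0, so each of these rows
  contains a vertex forced to take 3. Their places depend on where 1 and 0 stand in row 2; as these
  places differ, the two vertices are adjacent.\<close>

lemma not_choosable_rows:
  assumes "\<Lambda> 3 0"
  shows "\<not> choosable 3 V E"
proof -
  obtain R \<tau> where b: "based_cover V E \<phi> \<Lambda> 3 R \<tau>" and R: "3 \<le> R" using triangle_rows[OF assms] by blast
  interpret based_cover V E \<phi> \<Lambda> 3 R \<tau> by (rule b)
  define F :: "int \<Rightarrow> int \<Rightarrow> nat set" where
    "F x y = (if R dvd y then {1, 2, 3} else if R dvd y - 1 then {0, 2, 3} else {0, 1, 2})" for x y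
  show ?thesis
  proof (rule not_choosableI[of F])
    show "F x y = F x' y'" if l: "\<Lambda> (x - x') (y - y')" for x y x' y'
    proof -
      have d: "R dvd y - y'" using l by (auto simp: basis)
      have "R dvd y \<longleftrightarrow> R dvd y'" using dvd_add_right_iff[OF d, of y'] by simp
      moreover have "R dvd y - 1 \<longleftrightarrow> R dvd y' - 1" using dvd_add_right_iff[OF d, of "y' - 1"] by simp
      ultimately show ?thesis by (simp add: F_def)
    qed
    show "card (F x y) = 3" for x y by (simp add: F_def)
    fix C :: "int \<Rightarrow> int \<Rightarrow> nat"
    assume CF: "\<And>x y. C x y \<in> F x y"
      and adj: "\<And>x y x' y'. (x' - x, y' - y) \<in> units \<Longrightarrow> C x y \<noteq> C x' y'"
      and per: "\<And>x y x' y'. \<Lambda> (x - x') (y - y') \<Longrightarrow> C x y = C x' y'"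
    have p3: "C (x + 3) y = C x y" for x y by (rule per) (simp add: assms)
    have low: "C x y < 3" if y: "2 \<le> y" "y \<le> R - 1" for x y
    proof -
      have "\<not> R dvd y" "\<not> R dvd y - 1" using y zdvd_not_zless[of y R] zdvd_not_zless[of "y - 1" R] by auto
      then show ?thesis using CF[of x y] by (auto simp: F_def)
    qed
    have row: "C x y \<noteq> C (x + 1) y" "C (x + 1) y \<noteq> C (x + 2) y" "C x y \<noteq> C (x + 2) y" for x y
    proof -
      show "C x y \<noteq> C (x + 1) y" "C (x + 1) y \<noteq> C (x + 2) y" by (rule adj; simp add: units_def)+
      have "C (x + 2) y \<noteq> C (x + 3) y" by (rule adj) (simp add: units_def)
      then show "C x y \<noteq> C (x + 2) y" using p3[of x y] by simp
    qed
    have sum: "C x y + C (x + 1) y + C (x + 2) y = 3" if "2 \<le> y" "y \<le> R - 1" for x y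
      by (rule sum_three) (use low that row in auto)
    have up: "C (x + 1) (y + 1) = C x y" if y: "2 \<le> y" "y + 1 \<le> R - 1" for x y
    proof -
      have "C x y = C (x - 1 + 2) (y + 1)"
      proof (rule only_third)
        show "C x y < 3" by (rule low) (use y in auto)
        show "C x y \<noteq> C (x - 1) (y + 1)" by (rule adj) (simp add: units_def)
        show "C x y \<noteq> C (x - 1 + 1) (y + 1)" by (rule adj) (simp add: units_def)
        show "C (x - 1 + 2) (y + 1) \<noteq> C (x - 1) (y + 1)" using row(3)[of "x - 1" "y + 1"] by (rule not_sym)
        show "C (x - 1 + 2) (y + 1) \<noteq> C (x - 1 + 1) (y + 1)" using row(2)[of "x - 1" "y + 1"] by (rule not_sym)
        show "C (x - 1) (y + 1) \<noteq> C (x - 1 + 1) (y + 1)" by (rule row)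
      qed (use low y in auto)
      moreover have "x - 1 + 2 = x + 1" by simp
      ultimately show ?thesis by simp
    qed
    have ups: "int k \<le> R - 3 \<longrightarrow> C (x + int k) (2 + int k) = C x 2" for x k
    proof (induction k)
      case (Suc k)
      show ?case
      proof
        assume k: "int (Suc k) \<le> R - 3"
        have e: "x + int (Suc k) = x + int k + 1" "2 + int (Suc k) = 2 + int k + 1" by simp_all
        show "C (x + int (Suc k)) (2 + int (Suc k)) = C x 2"
          unfolding e using up[of "2 + int k" "x + int k"] Suc k by simp
      qed
    qed simp
    have two: "C x 2 < 3" for x by (rule low) (use R in auto)
    have s2: "C 0 2 + C 1 2 + C 2 2 = 3" using sum[of 2 0] R by simp
    have d2: "C 0 2 \<noteq> C 1 2" "C 1 2 \<noteq> C 2 2" "C 0 2 \<noteq> C 2 2" using row[of 0 2] by simp_all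
    have ex: "C 0 2 = v \<or> C 1 2 = v \<or> C 2 2 = v" if "v < 3" for v
      using less_three[OF that] less_three[OF two[of 0]] less_three[OF two[of 1]] less_three[OF two[of 2]] d2
      by (elim disjE) simp_all
    obtain a where a: "C a 2 = 0" using ex[of 0] by auto
    obtain b where b: "C b 2 = 1" using ex[of 1] by auto
    \<comment> \<open>The two neighbours in row 2 carry the two colours of {0, 1, 2} other than 1,
      and the list lacks 1.\<close>
    have "C (b - 1) 1 = 3"
    proof -
      have "\<not> R dvd 1" using zdvd_not_zless[of 1 R] R by simp
      then have "C (b - 1) 1 \<in> {0, 2, 3}" using CF[of "b - 1" 1] by (simp add: F_def)
      moreover have "C (b - 1) 1 \<noteq> C (b - 1) 2" "C (b - 1) 1 \<noteq> C (b - 2) 2"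
        by (rule adj; simp add: units_def)+
      moreover have "C (b - 2) 2 + C (b - 1) 2 + C b 2 = 3" using sum[of 2 "b - 2"] R by simp
      moreover have "C (b - 2) 2 \<noteq> C (b - 1) 2" using row(1)[of "b - 2" 2] by simp
      ultimately show ?thesis using b by auto
    qed
    then have no3: "C (b - 1) 0 \<noteq> 3" "C b 0 \<noteq> 3"
      using adj[of "b - 1" "b - 1" 1 0] adj[of "b - 1" b 1 0] by (auto simp: units_def)
    define x where "x = a + (R - 3)"
    have x0: "C x (R - 1) = 0" using ups[of "nat (R - 3)" a] a R by (simp add: x_def)
    \<comment> \<open>The same from the other side: the two neighbours in row R - 1 carry 1 and 2,
      and the list lacks 0.\<close>
    have "C (x + 1) R = 3"
    proof -
      have "C (x + 1) R \<in> {1, 2, 3}" using CF[of "x + 1" R] by (simp add: F_def)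
      moreover have "C (x + 1) R \<noteq> C (x + 1) (R - 1)" "C (x + 1) R \<noteq> C (x + 2) (R - 1)"
        by (rule adj; simp add: units_def)+
      moreover have "C x (R - 1) + C (x + 1) (R - 1) + C (x + 2) (R - 1) = 3" by (rule sum) (use R in auto)
      moreover have "C (x + 1) (R - 1) \<noteq> C (x + 2) (R - 1)" "C x (R - 1) \<noteq> C (x + 1) (R - 1)"
        "C x (R - 1) \<noteq> C (x + 2) (R - 1)" by (rule row)+
      ultimately show ?thesis using x0 by auto
    qed
    moreover have L: "\<Lambda> \<tau> R" unfolding basis by (rule exI[of _ 1]) simp
    then have "C (x + 1) R = C (x + 1 - \<tau>) 0" by (intro per) simp
    ultimately have z: "C (x + 1 - \<tau>) 0 = 3" by simp
    have row0: "C u 0 = C v 0" if "3 dvd u - v" for u v by (rule per) (use that lat_row in simp)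
    have "\<not> 3 dvd a - b"
    proof
      assume "3 dvd a - b"
      then have "C a 2 = C b 2" by (intro per) (use lat_row in simp)
      then show False using a b by simp
    qed
    moreover have "3 dvd \<tau> - R" by (rule three[OF L])
    \<comment> \<open>Modulo 3 the forced vertex of row 0 stands at a + 1, while the forced one of
      row 1 touches the places b - 1 and b. Only a = b modulo 3 would keep them apart.\<close>
    ultimately have "3 dvd (x + 1 - \<tau>) - (b - 1) \<or> 3 dvd (x + 1 - \<tau>) - b" unfolding x_def by presburger
    then show False using row0 z no3 by metis
  qed
qed

text \<open>\<open>n1\<close> to \<open>n6\<close> run around a hexagon. Those with odd index can
  take only b or 3, those with even index only c or 3, and each of 0, 1, 2 is missing exactly at two
  opposite places. So one odd place lacking b and one even place lacking c are forced to 3; they are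
  not opposite because b and c differ, hence they are adjacent.\<close>

lemma link_contradiction:
  fixes a b c :: nat
  assumes "a < 3" "b < 3" "c < 3" "a \<noteq> b" "b \<noteq> c" "a \<noteq> c"
    and "n1 \<in> {1, 2, 3}" "n2 \<in> {0, 1, 3}" "n3 \<in> {0, 2, 3}" "n4 \<in> {1, 2, 3}" "n5 \<in> {0, 1, 3}" "n6 \<in> {0, 2, 3}"
    and "n1 \<noteq> a" "n1 \<noteq> c" "n3 \<noteq> a" "n3 \<noteq> c" "n5 \<noteq> a" "n5 \<noteq> c"
    and "n2 \<noteq> a" "n2 \<noteq> b" "n4 \<noteq> a" "n4 \<noteq> b" "n6 \<noteq> a" "n6 \<noteq> b"
    and "n1 \<noteq> n2" "n2 \<noteq> n3" "n3 \<noteq> n4" "n4 \<noteq> n5" "n5 \<noteq> n6" "n6 \<noteq> n1"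
  shows False
proof -
  have "a = 0 \<and> b = 1 \<and> c = 2 \<or> a = 0 \<and> b = 2 \<and> c = 1 \<or> a = 1 \<and> b = 0 \<and> c = 2 \<or> a = 1 \<and> b = 2 \<and> c = 0 \<or>
    a = 2 \<and> b = 0 \<and> c = 1 \<or> a = 2 \<and> b = 1 \<and> c = 0" 
    using less_three[OF assms(1)] less_three[OF assms(2)] less_three[OF assms(3)] assms(4-6)
    by (elim disjE) simp_all
  then show False by (elim disjE conjE) (use assms(7-) in simp_all)
qed

lemma not_choosable_generic:
  assumes no3: "\<not> \<Lambda> 3 0" "\<not> \<Lambda> 0 3" "\<not> \<Lambda> 3 (-3)"
    and no2: "\<not> \<Lambda> 2 2" "\<not> \<Lambda> (-2) 4" "\<not> \<Lambda> 4 (-2)"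
  shows "\<not> choosable 3 V E"
proof -
  have ns: "\<Lambda> a b \<longleftrightarrow> a = 0 \<and> b = 0" if "\<bar>a\<bar> \<le> 4" "\<bar>b\<bar> \<le> 4" "\<bar>a + b\<bar> \<le> 4" for a b
    using lat_short_norm[OF no3 no2 _ that] by auto
  define F :: "int \<Rightarrow> int \<Rightarrow> nat set" where
    "F x y = (if \<Lambda> (x - 1) y \<or> \<Lambda> (x + 1) y then {1, 2, 3} else if \<Lambda> x (y - 1) \<or> \<Lambda> x (y + 1) then {0, 1, 3}
      else if \<Lambda> (x + 1) (y - 1) \<or> \<Lambda> (x - 1) (y + 1) then {0, 2, 3} else {0, 1, 2})" for x y
  show ?thesis
  proof (rule not_choosableI[of F])
    show "F x y = F x' y'" if l: "\<Lambda> (x - x') (y - y')" for x y x' y'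
    proof -
      have c: "\<Lambda> (x + a) (y + b) = \<Lambda> (x' + a) (y' + b)" for a b
      proof
        assume "\<Lambda> (x + a) (y + b)"
        from lat_diff[OF this l] show "\<Lambda> (x' + a) (y' + b)" by (simp add: algebra_simps)
      next
        assume "\<Lambda> (x' + a) (y' + b)"
        from lat_add[OF l this] show "\<Lambda> (x + a) (y + b)" by (simp add: algebra_simps)
      qed
      have "\<Lambda> (x - 1) y = \<Lambda> (x' - 1) y'" "\<Lambda> (x + 1) y = \<Lambda> (x' + 1) y'" "\<Lambda> x (y - 1) = \<Lambda> x' (y' - 1)"
        "\<Lambda> x (y + 1) = \<Lambda> x' (y' + 1)" "\<Lambda> (x + 1) (y - 1) = \<Lambda> (x' + 1) (y' - 1)"
        "\<Lambda> (x - 1) (y + 1) = \<Lambda> (x' - 1) (y' + 1)"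
        using c[of "-1" 0] c[of 1 0] c[of 0 "-1"] c[of 0 1] c[of 1 "-1"] c[of "-1" 1] by simp_all
      then show ?thesis by (simp only: F_def)
    qed
    show "card (F x y) = 3" for x y by (simp add: F_def)
    fix C :: "int \<Rightarrow> int \<Rightarrow> nat"
    assume CF: "\<And>x y. C x y \<in> F x y"
      and adj: "\<And>x y x' y'. (x' - x, y' - y) \<in> units \<Longrightarrow> C x y \<noteq> C x' y'"
    \<comment> \<open>The ring of vertices at hexagonal distance 2 or 3 from the origin. Its 30
      triangles force a 3-colouring that is unique up to permutation.\<close>
    define S :: "(int \<times> int) set" where "S = {(-3, 0), (-3, 1), (-3, 2), (-3, 3), (-2, -1), (-2, 0), (-2, 1), (-2, 2), (-2, 3), (-1, -2), (-1, -1), (-1, 2), (-1, 3), (0, -3), (0, -2), (0, 2), (0, 3), (1, -3), (1, -2), (1, 1), (1, 2), (2, -3), (2, -2), (2, -1), (2, 0), (2, 1), (3, -3), (3, -2), (3, -1), (3, 0)}"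
    have low: "C x y < 3" if "(x, y) \<in> S" for x y
    proof -
      have "F x y = {0, 1, 2}" using that unfolding S_def by (elim insertE emptyE) (simp_all add: F_def ns)
      then show ?thesis using CF[of x y] by auto
    qed
    have sum: "C x y + C x' y' + C x'' y'' = 3" if "(x, y) \<in> S" "(x', y') \<in> S" "(x'', y'') \<in> S"
      "(x' - x, y' - y) \<in> units" "(x'' - x', y'' - y') \<in> units" "(x'' - x, y'' - y) \<in> units" for x y x' y' x'' y''
      by (rule sum_three) (use that low adj in auto)
    have sums:
    "C 2 0 + C 1 1 + C 2 1 = 3"
    "C 1 1 + C 2 1 + C 1 2 = 3"
    "C 1 1 + C 1 2 + C 0 2 = 3"
    "C 0 2 + C 1 2 + C 0 3 = 3"
    "C 0 2 + C 0 3 + C (-1) 3 = 3"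
    "C 0 2 + C (-1) 2 + C (-1) 3 = 3"
    "C (-1) 2 + C (-1) 3 + C (-2) 3 = 3"
    "C (-1) 2 + C (-2) 3 + C (-2) 2 = 3"
    "C (-2) 2 + C (-2) 3 + C (-3) 3 = 3"
    "C (-2) 2 + C (-3) 3 + C (-3) 2 = 3"
    "C (-2) 2 + C (-2) 1 + C (-3) 2 = 3"
    "C (-2) 1 + C (-3) 2 + C (-3) 1 = 3"
    "C (-2) 1 + C (-3) 1 + C (-2) 0 = 3"
    "C (-2) 0 + C (-3) 1 + C (-3) 0 = 3"
    "C (-2) 0 + C (-3) 0 + C (-2) (-1) = 3"
    "C (-2) 0 + C (-1) (-1) + C (-2) (-1) = 3"
    "C (-1) (-1) + C (-2) (-1) + C (-1) (-2) = 3"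
    "C (-1) (-1) + C (-1) (-2) + C 0 (-2) = 3"
    "C 0 (-2) + C (-1) (-2) + C 0 (-3) = 3"
    "C 0 (-2) + C 0 (-3) + C 1 (-3) = 3"
    "C 0 (-2) + C 1 (-2) + C 1 (-3) = 3"
    "C 1 (-2) + C 1 (-3) + C 2 (-3) = 3"
    "C 1 (-2) + C 2 (-3) + C 2 (-2) = 3"
    "C 2 (-2) + C 2 (-3) + C 3 (-3) = 3"
    "C 2 (-2) + C 3 (-3) + C 3 (-2) = 3"
    "C 2 (-2) + C 2 (-1) + C 3 (-2) = 3"
    "C 2 (-1) + C 3 (-2) + C 3 (-1) = 3"
    "C 2 (-1) + C 3 (-1) + C 2 0 = 3"
    "C 2 0 + C 3 (-1) + C 3 0 = 3"
    "C 2 0 + C 3 0 + C 2 1 = 3"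
      by (rule sum; simp add: S_def units_def)+
    have c: "C (-2) 2 = C 2 0" "C 0 (-2) = C 2 0" using sums by linarith+
    have b: "C (-2) 0 = C 0 2" "C 2 (-2) = C 0 2" using sums by linarith+
    have a: "C (-1) 2 = C 1 1" "C (-2) 1 = C 1 1" "C 1 (-2) = C 1 1" "C 2 (-1) = C 1 1" using sums by linarith+
    have "C 2 1 = C 0 2" using sums by linarith
    moreover have "C 1 1 \<noteq> C 0 2" "C 2 1 \<noteq> C 2 0" "C 1 1 \<noteq> C 2 0" by (rule adj; simp add: units_def)+
    ultimately have abc: "C 1 1 \<noteq> C 0 2" "C 0 2 \<noteq> C 2 0" "C 1 1 \<noteq> C 2 0" by simp_all
    have F: "F 1 0 = {1, 2, 3}" "F 0 1 = {0, 1, 3}" "F (-1) 1 = {0, 2, 3}" "F (-1) 0 = {1, 2, 3}"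
      "F 0 (-1) = {0, 1, 3}" "F 1 (-1) = {0, 2, 3}" by (simp_all add: F_def ns)
    show False
    proof (rule link_contradiction)
      show "C 1 1 < 3" "C 0 2 < 3" "C 2 0 < 3" by (rule low; simp add: S_def)+
      show "C 1 0 \<in> {1, 2, 3}" using CF[of 1 0] unfolding F .
      show "C 0 1 \<in> {0, 1, 3}" using CF[of 0 1] unfolding F .
      show "C (-1) 1 \<in> {0, 2, 3}" using CF[of "-1" 1] unfolding F .
      show "C (-1) 0 \<in> {1, 2, 3}" using CF[of "-1" 0] unfolding F .
      show "C 0 (-1) \<in> {0, 1, 3}" using CF[of 0 "-1"] unfolding F .
      show "C 1 (-1) \<in> {0, 2, 3}" using CF[of 1 "-1"] unfolding F .
      show "C 1 0 \<noteq> C 1 1" "C 1 0 \<noteq> C 2 0" "C 0 1 \<noteq> C 1 1" "C 0 1 \<noteq> C 0 2" by (rule adj; simp add: units_def)+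
      show "C (-1) 1 \<noteq> C 1 1" unfolding a(1)[symmetric] by (rule adj) (simp add: units_def)
      show "C (-1) 1 \<noteq> C 2 0" unfolding c(1)[symmetric] by (rule adj) (simp add: units_def)
      show "C 0 (-1) \<noteq> C 1 1" unfolding a(3)[symmetric] by (rule adj) (simp add: units_def)
      show "C 0 (-1) \<noteq> C 2 0" unfolding c(2)[symmetric] by (rule adj) (simp add: units_def)
      show "C (-1) 0 \<noteq> C 1 1" unfolding a(2)[symmetric] by (rule adj) (simp add: units_def)
      show "C (-1) 0 \<noteq> C 0 2" unfolding b(1)[symmetric] by (rule adj) (simp add: units_def)
      show "C 1 (-1) \<noteq> C 1 1" unfolding a(4)[symmetric] by (rule adj) (simp add: units_def)
      show "C 1 (-1) \<noteq> C 0 2" unfolding b(2)[symmetric] by (rule adj) (simp add: units_def)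
      show "C 1 0 \<noteq> C 0 1" "C 0 1 \<noteq> C (-1) 1" "C (-1) 1 \<noteq> C (-1) 0" "C (-1) 0 \<noteq> C 0 (-1)"
        "C 0 (-1) \<noteq> C 1 (-1)" "C 1 (-1) \<noteq> C 1 0" by (rule adj; simp add: units_def)+
    qed (fact abc)+
  qed
qed

text \<open>The levels 0, 1, 2 can take only p, z, t, respectively, or 3. On the level whose regular
  colour is 0 the vertex of the \<open>a\<close> kind is forced to 3, on the level with 1 the one of
  the \<open>b\<close> kind. The levels are different and the kinds too, so these two vertices are
  adjacent.\<close>

lemma level_contradiction:
  fixes p z t :: nat
  assumes "p < 3" "z < 3" "t < 3" "p \<noteq> z" "z \<noteq> t" "p \<noteq> t"
    and "a0 \<in> {1, 2, 3}" "a1 \<in> {1, 2, 3}" "a2 \<in> {1, 2, 3}" "b0 \<in> {0, 2, 3}" "b1 \<in> {0, 2, 3}" "b2 \<in> {0, 2, 3}"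
    and "a0 \<noteq> t" "a0 \<noteq> z" "b0 \<noteq> t" "b0 \<noteq> z" "a1 \<noteq> t" "a1 \<noteq> p" "b1 \<noteq> t" "b1 \<noteq> p"
    and "a2 \<noteq> p" "a2 \<noteq> z" "b2 \<noteq> p" "b2 \<noteq> z"
    and "a0 \<noteq> b1" "b0 \<noteq> a1" "a1 \<noteq> b2" "b1 \<noteq> a2" "a0 \<noteq> b2" "b0 \<noteq> a2"
  shows False
proof -
  have "p = 0 \<and> z = 1 \<and> t = 2 \<or> p = 0 \<and> z = 2 \<and> t = 1 \<or> p = 1 \<and> z = 0 \<and> t = 2 \<or> p = 1 \<and> z = 2 \<and> t = 0 \<or>
    p = 2 \<and> z = 0 \<and> t = 1 \<or> p = 2 \<and> z = 1 \<and> t = 0" 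
    using less_three[OF assms(1)] less_three[OF assms(2)] less_three[OF assms(3)] assms(4-6)
    by (elim disjE) simp_all
  then show False by (elim disjE conjE) (use assms(7-) in simp_all)
qed

lemma not_choosable_levels:
  assumes two: "\<Lambda> 2 2" and no3: "\<not> \<Lambda> 3 0"
  shows "\<not> choosable 3 V E"
proof -
  obtain H ha hb where lev: "\<And>a b. \<Lambda> a b \<Longrightarrow> H dvd a - b" and hh: "\<Lambda> ha hb" "ha - hb = H" "3 dvd H" "6 \<le> H"
    using level_period[OF assms] by blast
  \<comment> \<open>Only levels 0, 1, 2 modulo \<open>H\<close> get unusual lists. Going round once
    moves y by \<open>hb\<close>, so the parity that tells the two vertices of a level apart is
    corrected by the number of rounds.\<close>
  define F :: "int \<Rightarrow> int \<Rightarrow> nat set" where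
    "F x y = (if (x - y) mod H \<le> 2 then if even (y - (x - y) div H * hb) then {1, 2, 3} else {0, 2, 3} else {0, 1, 2})" for x y
  show ?thesis
  proof (rule not_choosableI[of F])
    show "F x y = F x' y'" if l: "\<Lambda> (x - x') (y - y')" for x y x' y'
    proof -
      obtain k where k: "(x - x') - (y - y') = H * k" using lev[OF l] by (elim dvdE)
      have e: "x - y = (x' - y') + H * k" using k by simp
      have m: "(x - y) mod H = (x' - y') mod H" "(x - y) div H = (x' - y') div H + k" unfolding e using hh(4) by simp_all
      have z: "\<Lambda> (x - x' - k * ha) (y - y' - k * hb)" using lat_diff[OF l lat_mult[OF hh(1)]] .
      have "k * ha = k * hb + H * k" unfolding hh(2)[symmetric] by (simp add: algebra_simps)
      then have xz: "x - x' - k * ha = y - y' - k * hb" using k by simp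
      have "even (y - y' - k * hb)"
      proof (rule ccontr)
        assume "odd (y - y' - k * hb)"
        then obtain j where j: "y - y' - k * hb = 2 * j + 1" by (elim oddE)
        have "\<Lambda> (2 * j + 1 - j * 2) (2 * j + 1 - j * 2)"
          by (rule lat_diff[OF _ lat_mult[OF two]]) (use z xz j in simp)
        then show False using short_excluded(1) by simp
      qed
      moreover have "y - (x - y) div H * hb = (y - y' - k * hb) + (y' - (x' - y') div H * hb)"
        unfolding m(2) by (simp add: algebra_simps)
      ultimately have "even (y - (x - y) div H * hb) \<longleftrightarrow> even (y' - (x' - y') div H * hb)"
        by (simp only: even_add simp_thms)
      then show ?thesis using m(1) by (simp add: F_def)
    qed
    show "card (F x y) = 3" for x y by (simp add: F_def)
    fix C :: "int \<Rightarrow> int \<Rightarrow> nat"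
    assume CF: "\<And>x y. C x y \<in> F x y"
      and adj: "\<And>x y x' y'. (x' - x, y' - y) \<in> units \<Longrightarrow> C x y \<noteq> C x' y'"
      and per: "\<And>x y x' y'. \<Lambda> (x - x') (y - y') \<Longrightarrow> C x y = C x' y'"
    define A where "A h = C h 0" for h
    define B where "B h = C (h + 1) 1" for h
    have CA: "C h 0 = A h" "C (h + 1) 1 = B h" "C (h + 2) 2 = A h" for h
      using per[of "h + 2" h 2 0] two by (simp_all add: A_def B_def)
    have n1: "A h \<noteq> A (h + 1)" "B h \<noteq> B (h + 1)" "A (h + 1) \<noteq> B h" "B (h + 1) \<noteq> A h" for h
    proof -
      show "A h \<noteq> A (h + 1)" "B h \<noteq> B (h + 1)" unfolding A_def B_def by (rule adj; simp add: units_def)+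
      show "A (h + 1) \<noteq> B h" unfolding A_def B_def by (rule adj) (simp add: units_def)
      show "B (h + 1) \<noteq> A h" unfolding CA(3)[symmetric] B_def by (rule adj) (simp add: units_def)
    qed
    have n2: "A (h + 2) \<noteq> B h" "B (h + 2) \<noteq> A h" for h
    proof -
      show "A (h + 2) \<noteq> B h" unfolding A_def B_def by (rule adj) (simp add: units_def)
      show "B (h + 2) \<noteq> A h" unfolding CA(3)[symmetric] B_def by (rule adj) (simp add: units_def)
    qed
    \<comment> \<open>Going round once may exchange the two vertices of a level, hence only
      membership in the pair.\<close>
    have shift: "A h \<in> {A (h + H), B (h + H)} \<and> B h \<in> {A (h + H), B (h + H)}" for h
    proof -
      have e2: "C (x + 2 * j) (y + 2 * j) = C x y" for x y j
        using per[of "x + 2 * j" x "y + 2 * j" y] lat_mult[OF two, of j] by (simp add: mult.commute)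
      have ha: "ha = hb + H" using hh(2) by simp
      have A': "A h = C (h + H + hb) hb"
        unfolding A_def by (rule per) (use hh(1) ha lat_uminus[of ha hb] in \<open>simp add: algebra_simps\<close>)
      have B': "B h = C (h + H + 1 + hb) (1 + hb)"
        unfolding B_def by (rule per) (use hh(1) ha lat_uminus[of ha hb] in \<open>simp add: algebra_simps\<close>)
      show ?thesis
      proof (cases "even hb")
        case True
        then obtain j where j: "hb = 2 * j" by blast
        have "A h = C (h + H + 2 * j) (0 + 2 * j)" using A' j by simp
        also have "\<dots> = A (h + H)" unfolding e2 A_def ..
        finally have "A h = A (h + H)" .
        moreover have "B h = C (h + H + 1 + 2 * j) (1 + 2 * j)" using B' j by simp
        then have "B h = B (h + H)" unfolding e2 by (simp add: B_def)
        ultimately show ?thesis by simp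
      next
        case False
        then obtain j where j: "hb = 2 * j + 1" by (elim oddE)
        have 1: "h + H + hb = h + H + 1 + 2 * j" "hb = 1 + 2 * j" using j by simp_all
        have "A h = B (h + H)" using A' unfolding 1(1) unfolding 1(2) e2 by (simp add: B_def)
        moreover have 2: "h + H + 1 + hb = h + H + 2 * (j + 1)" "1 + hb = 0 + 2 * (j + 1)" using j by simp_all
        have "B h = A (h + H)" using B' unfolding 2 e2 by (simp add: A_def)
        ultimately show ?thesis by simp
      qed
    qed
    have low: "A h < 3" "B h < 3" if h: "3 \<le> h" "h < H" for h
    proof -
      have "h mod H = h" using h by simp
      then have "F h 0 = {0, 1, 2}" "F (h + 1) 1 = {0, 1, 2}" using h by (simp_all add: F_def)
      then show "A h < 3" "B h < 3" using CF[of h 0] CF[of "h + 1" 1] by (auto simp: A_def B_def)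
    qed
    have top: "A h \<in> {1, 2, 3}" "B h \<in> {0, 2, 3}" if h: "0 \<le> h" "h \<le> 2" for h
    proof -
      have "h mod H = h" "h div H = 0" using h hh(4) by simp_all
      then have "F h 0 = {1, 2, 3}" "F (h + 1) 1 = {0, 2, 3}" using h by (simp_all add: F_def)
      then show "A h \<in> {1, 2, 3}" "B h \<in> {0, 2, 3}" using CF[of h 0] CF[of "h + 1" 1] by (simp_all add: A_def B_def)
    qed
    have l3: "A 3 < 3" "B 3 < 3" "A 4 < 3" "B 4 < 3" "A 5 < 3" "B 5 < 3" using low hh(4) by auto
    have n34: "A 3 \<noteq> A 4" "B 3 \<noteq> B 4" "A 4 \<noteq> B 3" "B 4 \<noteq> A 3" using n1[of 3] by simp_all
    have n45: "A 4 \<noteq> A 5" "B 4 \<noteq> B 5" "A 5 \<noteq> B 4" "B 5 \<noteq> A 4" using n1[of 4] by simp_all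
    have n56: "A 5 \<noteq> A 6" "B 5 \<noteq> B 6" "A 6 \<noteq> B 5" "B 6 \<noteq> A 5" using n1[of 5] by simp_all
    have n35: "A 5 \<noteq> B 3" "B 5 \<noteq> A 3" "A 6 \<noteq> B 4" "B 6 \<noteq> A 4" "A 4 \<noteq> B 2" "B 4 \<noteq> A 2" "A 2 \<noteq> B 0"
      "A 3 \<noteq> B 1" "B 3 \<noteq> A 1" "B 2 \<noteq> A 0" "A 1 \<noteq> B (-1)" "B 1 \<noteq> A (-1)" "A 0 \<noteq> B (-2)" "B 0 \<noteq> A (-2)"
      using n2[of 3] n2[of 4] n2[of 2] n2[of 0] n2[of 1] n2[of "-1"] n2[of "-2"] by simp_all
    have n23: "A 2 \<noteq> A 3" "B 2 \<noteq> B 3" "A 3 \<noteq> B 2" "B 3 \<noteq> A 2" using n1[of 2] by simp_all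
    \<comment> \<open>With two colours on level 4, all of levels 3 and 5 would have the third
      colour, although there are edges between these levels.\<close>
    have c4: "A 4 = B 4"
    proof (rule ccontr)
      assume "A 4 \<noteq> B 4"
      then have "A 5 = B 3" by (intro only_third[of "A 5" "B 3" "A 4" "B 4"]) (use l3 n34 n45 in simp_all)
      then show False using n35(1) by blast
    qed
    \<comment> \<open>If level 3 shows two colours, level 5 repeats them and level 6 has no ordinary
      colour left. So level 6 is level 0 and \<open>B 0\<close> is 3. By the same reasoning
      downwards \<open>A 2\<close> is 3, and these two vertices are adjacent.\<close>
    have c3: "A 3 = B 3"
    proof (rule ccontr)
      assume ne: "A 3 \<noteq> B 3"
      have a5: "A 5 = A 3" by (rule only_third[of "A 5" "A 3" "A 4" "B 3"]) (use ne l3 n34 n45 n35(1) in simp_all)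
      have b5: "B 5 = B 3" by (rule only_third[of "B 5" "B 3" "B 4" "A 3"]) (use ne l3 n34 n45 n35(2) in simp_all)
      have A6: "\<not> A 6 < 3"
      proof
        assume "A 6 < 3"
        then have "A 6 = A 4"
        proof (rule only_third)
          show "A 6 \<noteq> A 3" using n56(1) a5 by simp
          show "A 6 \<noteq> B 3" using n56(3) b5 by simp
        qed (use l3 n34 ne in simp_all)
        then show False using n35(3) c4 by simp
      qed
      have B6: "\<not> B 6 < 3"
      proof
        assume "B 6 < 3"
        then have "B 6 = A 4"
        proof (rule only_third)
          show "B 6 \<noteq> A 3" using n56(4) a5 by simp
          show "B 6 \<noteq> B 3" using n56(2) b5 by simp
        qed (use l3 n34 ne in simp_all)
        then show False using n35(4) by simp
      qed
      have not6: "3 \<le> A 6" "3 \<le> B 6" using A6 B6 by linarith+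
      then have "\<not> 6 < H" using low(1)[of 6] by auto
      then have H: "H = 6" using hh(4) by simp
      have "3 \<le> B 0" using shift[of 0] not6 H by auto
      then have "B 0 = 3" using top(2)[of 0] by auto
      moreover have "\<not> A 2 < 3"
      proof
        assume "A 2 < 3"
        then have "A 2 = A 4"
        proof (rule only_third)
          show "A 2 \<noteq> A 3" by (rule n23(1))
          show "A 2 \<noteq> B 3" using n23(4) by simp
        qed (use l3 n34 ne in simp_all)
        then show False using n35(6) c4 by simp
      qed
      then have "A 2 = 3" using top(1)[of 2] by auto
      ultimately show False using n35(7) by simp
    qed
    define p z t where "p = A 3" and "z = A 4" and "t = A 5"
    have pzt: "p < 3" "z < 3" "t < 3" "p \<noteq> z" "z \<noteq> t" "p \<noteq> t"
      using l3 n34 n45 n35(1) c3 by (simp_all add: p_def z_def t_def)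
    have "A 5 \<noteq> A 3" using n35(1) c3 by simp
    then have t5: "B 5 = t" unfolding t_def
      by (intro only_third[of "B 5" "A 5" "A 3" "A 4"]) (use l3 n34 n45 n35(2) in simp_all)
    \<comment> \<open>From level 3 on, the two vertices of a level agree and the colours repeat with
      period three; this carries the pattern to the levels just below 0.\<close>
    have run: "5 + 3 * int k < H \<longrightarrow> A (3 + 3 * int k) = p \<and> B (3 + 3 * int k) = p \<and> A (4 + 3 * int k) = z \<and>
      B (4 + 3 * int k) = z \<and> A (5 + 3 * int k) = t \<and> B (5 + 3 * int k) = t" for k
    proof (induction k)
      case 0
      show ?case using c3 c4 t5 by (simp add: p_def z_def t_def)
    next
      case (Suc k)
      show ?case
      proof
        assume k: "5 + 3 * int (Suc k) < H"
        define i where "i = 3 * int k"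
        have ih: "A (4 + i) = z" "B (4 + i) = z" "A (5 + i) = t" "B (5 + i) = t" using Suc k by (simp_all add: i_def)
        have i: "0 \<le> i" "i + 8 < H" using k by (simp_all add: i_def)
        have e: "4 + i + 2 = 6 + i" "5 + i + 1 = 6 + i" "5 + i + 2 = 7 + i" "6 + i + 1 = 7 + i" "6 + i + 2 = 8 + i" "7 + i + 1 = 8 + i"
          by simp_all
        have l6: "A (6 + i) < 3" "B (6 + i) < 3" by (rule low; use i in simp)+
        have m6: "A (6 + i) \<noteq> t" "B (6 + i) \<noteq> t" using n1(3,4)[of "5 + i"] unfolding e ih by simp_all
        have k6: "A (6 + i) \<noteq> z" "B (6 + i) \<noteq> z" using n2[of "4 + i"] unfolding e ih by simp_all
        have s6: "A (6 + i) = p" "B (6 + i) = p"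
          by (rule only_third[of _ _ t z]; use pzt l6 m6 k6 in simp)+
        have l7: "A (7 + i) < 3" "B (7 + i) < 3" by (rule low; use i in simp)+
        have m7: "A (7 + i) \<noteq> p" "B (7 + i) \<noteq> p" using n1(3,4)[of "6 + i"] unfolding e s6 by simp_all
        have k7: "A (7 + i) \<noteq> t" "B (7 + i) \<noteq> t" using n2[of "5 + i"] unfolding e ih by simp_all
        have s7: "A (7 + i) = z" "B (7 + i) = z"
          by (rule only_third[of _ _ p t]; use pzt l7 m7 k7 in simp)+
        have l8: "A (8 + i) < 3" "B (8 + i) < 3" by (rule low; use i in simp)+
        have m8: "A (8 + i) \<noteq> z" "B (8 + i) \<noteq> z" using n1(3,4)[of "7 + i"] unfolding e s7 by simp_all
        have k8: "A (8 + i) \<noteq> p" "B (8 + i) \<noteq> p" using n2[of "6 + i"] unfolding e s6 by simp_all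
        have s8: "A (8 + i) = t" "B (8 + i) = t"
          by (rule only_third[of _ _ z p]; use pzt l8 m8 k8 in simp)+
        have "3 + 3 * int (Suc k) = 6 + i" "4 + 3 * int (Suc k) = 7 + i" "5 + 3 * int (Suc k) = 8 + i"
          by (simp_all add: i_def)
        then show "A (3 + 3 * int (Suc k)) = p \<and> B (3 + 3 * int (Suc k)) = p \<and> A (4 + 3 * int (Suc k)) = z \<and>
          B (4 + 3 * int (Suc k)) = z \<and> A (5 + 3 * int (Suc k)) = t \<and> B (5 + 3 * int (Suc k)) = t"
          using s6 s7 s8 by simp
      qed
    qed
    obtain M where M: "H = 3 * M" using hh(3) by blast
    have "3 * int (nat (M - 2)) = H - 6" using M hh(4) by simp
    then have "A (H - 1) = t" "B (H - 1) = t" "A (H - 2) = z" "B (H - 2) = z" using run[of "nat (M - 2)"] by simp_all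
    then have bk: "A (-1) = t" "B (-1) = t" "A (-2) = z" "B (-2) = z" using shift[of "-1"] shift[of "-2"] by simp_all
    have q: "A 3 = p" "B 3 = p" "A 4 = z" "B 4 = z" using c3 c4 by (simp_all add: p_def z_def)
    have n01: "A (-1) \<noteq> A 0" "B (-1) \<noteq> B 0" "A 0 \<noteq> A 1" "B 0 \<noteq> B 1" "A 1 \<noteq> B 0" "B 1 \<noteq> A 0" "A 2 \<noteq> B 1" "B 2 \<noteq> A 1"
      using n1[of "-1"] n1[of 0] n1[of 1] by simp_all
    show False
    proof (rule level_contradiction[of p z t "A 0" "A 1" "A 2" "B 0" "B 1" "B 2"])
      show "A 0 \<in> {1, 2, 3}" "A 1 \<in> {1, 2, 3}" "A 2 \<in> {1, 2, 3}" by (rule top; simp)+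
      show "B 0 \<in> {0, 2, 3}" "B 1 \<in> {0, 2, 3}" "B 2 \<in> {0, 2, 3}" by (rule top; simp)+
      show "p < 3" "z < 3" "t < 3" "p \<noteq> z" "z \<noteq> t" "p \<noteq> t" by (fact pzt)+
    qed ((use n01[unfolded bk] n35[unfolded bk q] n23[unfolded q] in simp)+)
  qed
qed

end

lemma three_cover_not_choosable:
  assumes "three_cover V E \<phi> \<Lambda>"
  shows "\<not> choosable 3 V E"
proof -
  interpret three_cover V E \<phi> \<Lambda> by fact
  interpret r: three_cover V E "\<lambda>x y. \<phi> (- y) (x + y)" "\<lambda>x y. \<Lambda> (- y) (x + y)" by (rule three_cover_rotate)
  have rr: "three_cover V E (\<lambda>x y. \<phi> (- (x + y)) (- y + (x + y))) (\<lambda>x y. \<Lambda> (- (x + y)) (- y + (x + y)))"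
    by (rule r.three_cover_rotate)
  have m: "\<Lambda> (-3) 3 = \<Lambda> 3 (-3)" "\<Lambda> (-4) 2 = \<Lambda> 4 (-2)" using lat_uminus[of 3 "-3"] lat_uminus[of 4 "-2"] by simp_all
  consider "\<Lambda> 3 0" | "\<Lambda> 0 3" | "\<Lambda> 3 (-3)" | "\<not> \<Lambda> 3 0" "\<Lambda> 2 2" | "\<not> \<Lambda> 0 3" "\<Lambda> (-2) 4" | "\<not> \<Lambda> 3 (-3)" "\<Lambda> 4 (-2)"
    | "\<not> \<Lambda> 3 0" "\<not> \<Lambda> 0 3" "\<not> \<Lambda> 3 (-3)" "\<not> \<Lambda> 2 2" "\<not> \<Lambda> (-2) 4" "\<not> \<Lambda> 4 (-2)" by blast
  then show ?thesis
  proof cases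
    case 1
    then show ?thesis by (rule not_choosable_rows)
  next
    case 2
    then show ?thesis using r.not_choosable_rows by simp
  next
    case 3
    then show ?thesis using three_cover.not_choosable_rows[OF rr] m by simp
  next
    case 4
    then show ?thesis using not_choosable_levels by blast
  next
    case 5
    then show ?thesis using r.not_choosable_levels by simp
  next
    case 6
    then show ?thesis using three_cover.not_choosable_levels[OF rr] m by simp
  next
    case 7
    then show ?thesis by (rule not_choosable_generic)
  qed
qed

section \<open>The algorithm\<close>

primrec loop_free :: "com \<Rightarrow> bool" where
  "loop_free Skip \<longleftrightarrow> True"
| "loop_free (Assign a i x) \<longleftrightarrow> True"
| "loop_free (Seq p q) \<longleftrightarrow> loop_free p \<and> loop_free q"
| "loop_free (Cond b p q) \<longleftrightarrow> loop_free p \<and> loop_free q"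
| "loop_free (While b p) \<longleftrightarrow> False"

text \<open>The effect of loop-free code as a function; the clause for \<open>While\<close> is a
  default value.\<close>

primrec run :: "com \<Rightarrow> memory \<Rightarrow> memory" where
  "run Skip m = m"
| "run (Assign a i x) m = m(a := (m a)(aval i m := aval x m))"
| "run (Seq p q) m = run q (run p m)"
| "run (Cond b p q) m = (if bval b m then run p m else run q m)"
| "run (While b p) m = m"

text \<open>An upper bound for loop-free code: both branches of a conditional are charged.\<close>

primrec cost :: "com \<Rightarrow> nat" where
  "cost Skip = 1"
| "cost (Assign a i x) = 1"
| "cost (Seq p q) = cost p + cost q"
| "cost (Cond b p q) = cost p + cost q + 1"
| "cost (While b p) = 0"

primrec written :: "com \<Rightarrow> string set" where
  "written Skip = {}"
| "written (Assign a i x) = {a}"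
| "written (Seq p q) = written p \<union> written q"
| "written (Cond b p q) = written p \<union> written q"
| "written (While b p) = written p"

definition runs :: "com \<Rightarrow> memory \<Rightarrow> nat \<Rightarrow> memory \<Rightarrow> bool" where
  "runs p m k m' \<longleftrightarrow> (\<exists>j\<le>k. exec p m j m')"

lemma runs_mono: "runs p m k m' \<Longrightarrow> k \<le> k' \<Longrightarrow> runs p m k' m'"
  unfolding runs_def by (meson order_trans)

lemma runs_Seq: "runs p m k m' \<Longrightarrow> runs q m' l m'' \<Longrightarrow> runs (Seq p q) m (k + l) m''"
  unfolding runs_def by (meson add_mono exec_Seq)

lemma runs_loop_free: "loop_free p \<Longrightarrow> runs p m (cost p) (run p m)"
proof (induction p arbitrary: m)
  case (Cond b p q)
  show ?case
  proof (cases "bval b m")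
    case True
    obtain j where "j \<le> cost p" "exec p m j (run p m)" using Cond by (auto simp: runs_def)
    then show ?thesis using exec_Cond_True[OF True, of p j "run p m" q] True
      by (auto simp: runs_def intro!: exI[of _ "j + 1"])
  next
    case False
    obtain j where "j \<le> cost q" "exec q m j (run q m)" using Cond by (auto simp: runs_def)
    then show ?thesis using exec_Cond_False[OF False, of q j "run q m" p] False
      by (auto simp: runs_def intro!: exI[of _ "j + 1"])
  qed
next
  case (Assign a i x)
  show ?case unfolding runs_def run.simps cost.simps using exec_Assign[of a i x m] by blast
next
  case Skip
  show ?case unfolding runs_def run.simps cost.simps using exec_Skip[of m] by blast
qed (auto intro: runs_Seq)

lemma run_unwritten: "a \<notin> written p \<Longrightarrow> run p m a = m a"
  by (induction p arbitrary: m) auto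

abbreviation var :: "string \<Rightarrow> aexp" where "var v \<equiv> Cell v (Const 0)"

definition for_loop :: "string \<Rightarrow> aexp \<Rightarrow> com \<Rightarrow> com" where
  "for_loop v N p = Seq (Assign v (Const 0) (Const 0))
     (While (Less (var v) N) (Seq p (Assign v (Const 0) (Plus (var v) (Const 1)))))"

text \<open>All loops of the program have this form. The bound depends only on the array
  \<open>size\<close>, which the body leaves alone, so termination and linear time hold whatever
  values the body computes; correctness is carried separately by \<open>I\<close>.\<close>

lemma runs_for:
  assumes lf: "loop_free p" and v: "v \<notin> written p" "v \<noteq> ''size''" "''size'' \<notin> written p"
    and N: "\<And>m m'. m ''size'' = m' ''size'' \<Longrightarrow> aval N m = aval N m'"
    and init: "I 0 (m(v := (m v)(0 := 0)))"
    and step: "\<And>i m'. i < aval N m \<Longrightarrow> m' v 0 = i \<Longrightarrow> I i m' \<Longrightarrow>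
      I (Suc i) ((run p m')(v := (run p m' v)(0 := Suc i)))"
  shows "\<exists>m'. runs (for_loop v N p) m (aval N m * (cost p + 2) + 2) m' \<and> I (aval N m) m' \<and>
    m' ''size'' = m ''size''"
proof -
  let ?q = "Seq p (Assign v (Const 0) (Plus (var v) (Const 1)))"
  let ?b = "Less (var v) N"
  have main: "\<exists>m''. runs (While ?b ?q) m' (j * (cost p + 2) + 1) m'' \<and> I (aval N m) m'' \<and> m'' ''size'' = m ''size''"
    if "m' ''size'' = m ''size''" "m' v 0 + j = aval N m" "I (m' v 0) m'" for m' j
    using that
  proof (induction j arbitrary: m')
    case 0
    then have "\<not> bval ?b m'" using N[of m' m] by simp
    then show ?case using 0 exec_While_False[of ?b m' ?q] by (auto simp: runs_def)
  next
    case (Suc j)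
    then have b: "bval ?b m'" using N[of m' m] by simp
    define m1 where "m1 = run ?q m'"
    have v1: "m1 v 0 = Suc (m' v 0)" using run_unwritten[OF v(1)] by (simp add: m1_def)
    have s1: "m1 ''size'' = m ''size''" using run_unwritten[OF v(3)] v(2) Suc.prems(1) by (simp add: m1_def)
    have "m1 = (run p m')(v := (run p m' v)(0 := Suc (m' v 0)))" using run_unwritten[OF v(1)] by (simp add: m1_def)
    then have "I (Suc (m' v 0)) m1" using step[of "m' v 0" m'] Suc.prems by simp
    then obtain m'' where m'': "runs (While ?b ?q) m1 (j * (cost p + 2) + 1) m''" "I (aval N m) m''"
      "m'' ''size'' = m ''size''"
      using Suc.IH[of m1] s1 v1 Suc.prems(2) by auto
    obtain k where k: "k \<le> cost ?q" "exec ?q m' k m1"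
      using runs_loop_free[of ?q m'] lf unfolding m1_def runs_def by auto
    obtain l where l: "l \<le> j * (cost p + 2) + 1" "exec (While ?b ?q) m1 l m''"
      using m''(1) by (auto simp: runs_def)
    have "exec (While ?b ?q) m' (k + l + 1) m''" by (rule exec_While_True[OF b k(2) l(2)])
    moreover have "k + l + 1 \<le> Suc j * (cost p + 2) + 1" using k(1) l(1) by simp
    ultimately show ?case using m''(2,3) unfolding runs_def by blast
  qed
  let ?m0 = "m(v := (m v)(0 := 0))"
  obtain m'' where m'': "runs (While ?b ?q) ?m0 (aval N m * (cost p + 2) + 1) m''" "I (aval N m) m''"
    "m'' ''size'' = m ''size''"
    using main[of ?m0 "aval N m"] init v(2) by auto
  have "runs (Assign v (Const 0) (Const 0)) m 1 ?m0"
    using runs_loop_free[of "Assign v (Const 0) (Const 0)" m] by simp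
  from runs_Seq[OF this m''(1)] have "runs (for_loop v N p) m (aval N m * (cost p + 2) + 2) m''"
    by (simp add: for_loop_def)
  then show ?thesis using m'' by blast
qed

fun seqs :: "com list \<Rightarrow> com" where
  "seqs [] = Skip"
| "seqs (p # ps) = Seq p (seqs ps)"

lemma loop_free_seqs [simp]: "loop_free (seqs ps) \<longleftrightarrow> (\<forall>p\<in>set ps. loop_free p)"
  by (induction ps) auto

lemma written_seqs [simp]: "written (seqs ps) = \<Union> (written ` set ps)"
  by (induction ps) auto

lemma run_seqs_append [simp]: "run (seqs (ps @ qs)) m = run (seqs qs) (run (seqs ps) m)"
  by (induction ps arbitrary: m) auto

lemma run_seqs_Suc: "run (seqs (map f [0..<Suc K])) m = run (f K) (run (seqs (map f [0..<K])) m)"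
  by simp

section \<open>Building blocks of the program\<close>

abbreviation setv :: "string \<Rightarrow> nat \<Rightarrow> memory \<Rightarrow> memory" where
  "setv v x m \<equiv> m(v := (m v)(0 := x))"

definition count_loop :: "string \<Rightarrow> nat \<Rightarrow> (nat \<Rightarrow> bexp) \<Rightarrow> com" where
  "count_loop v K test =
     seqs (map (\<lambda>k. Cond (test k) (Assign v (Const 0) (Plus (var v) (Const 1))) Skip) [0..<K])"

definition flag_loop :: "string \<Rightarrow> nat \<Rightarrow> (nat \<Rightarrow> bexp) \<Rightarrow> com" where
  "flag_loop v K test = seqs (map (\<lambda>k. Cond (test k) (Assign v (Const 0) (Const 1)) Skip) [0..<K])"

lemma card_less_Suc: "card {k. k < Suc K \<and> P k} = card {k. k < K \<and> P k} + (if P K then 1 else 0)"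
proof -
  have "{k. k < Suc K \<and> P k} = {k. k < K \<and> P k} \<union> (if P K then {K} else {})" by (auto simp: less_Suc_eq)
  then show ?thesis by simp
qed

lemma run_count_loop:
  assumes "\<And>k x. k < K \<Longrightarrow> bval (test k) (setv v x m) = bval (test k) m"
  shows "run (count_loop v K test) m = setv v (m v 0 + card {k. k < K \<and> bval (test k) m}) m"
  using assms unfolding count_loop_def
  by (induction K) (simp_all add: card_less_Suc fun_upd_idem)

lemma run_flag_loop:
  assumes "\<And>k x. k < K \<Longrightarrow> bval (test k) (setv v x m) = bval (test k) m"
  shows "run (flag_loop v K test) m = (if \<exists>k<K. bval (test k) m then setv v 1 m else m)"
  using assms unfolding flag_loop_def
  by (induction K) (auto simp: less_Suc_eq)

lemma six: "x + x + (x + x) + (x + x) = 6 * (x :: nat)" and five: "x + x + (x + x) + x = 5 * (x :: nat)"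
  by simp_all

text \<open>The machine cannot multiply, so array offsets are computed by repeated addition.\<close>

abbreviation times6 :: "aexp \<Rightarrow> aexp" where
  "times6 x \<equiv> Plus (Plus (Plus x x) (Plus x x)) (Plus x x)"

abbreviation times5 :: "aexp \<Rightarrow> aexp" where
  "times5 x \<equiv> Plus (Plus (Plus x x) (Plus x x)) x"

abbreviation nb_cell :: "nat \<Rightarrow> aexp" where
  "nb_cell k \<equiv> Cell ''nbr'' (Plus (times6 (var ''y'')) (Const k))"

abbreviation col_cell :: "nat \<Rightarrow> aexp" where
  "col_cell k \<equiv> Cell ''col'' (Plus (times5 (var ''y'')) (Const k))"

definition nbm :: "memory \<Rightarrow> nat \<Rightarrow> nat \<Rightarrow> nat" where "nbm m i k = m ''nbr'' (6 * i + k)"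
definition colm :: "memory \<Rightarrow> nat \<Rightarrow> nat \<Rightarrow> nat" where "colm m i k = m ''col'' (5 * i + k)"

text \<open>The state \<open>st\<close> of a vertex is 0 at first, 1 if it is coloured and 2 if it has been peeled.\<close>

definition clash :: "memory \<Rightarrow> nat \<Rightarrow> nat \<Rightarrow> bool" where
  "clash m y k \<longleftrightarrow> (\<exists>l<6. m ''st'' (nbm m y l) = 1 \<and> m ''out'' (nbm m y l) = colm m y k)"

definition clash_code :: "nat \<Rightarrow> com" where
  "clash_code k = Seq (Assign ''f'' (Const 0) (Const 0))
     (flag_loop ''f'' 6 (\<lambda>l. Conj (Equal (Cell ''st'' (nb_cell l)) (Const 1))
        (Equal (Cell ''out'' (nb_cell l)) (col_cell k))))"

lemma run_clash_code: "run (clash_code k) m = setv ''f'' (if clash m (m ''y'' 0) k then 1 else 0) m"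
proof -
  let ?t = "\<lambda>l. Conj (Equal (Cell ''st'' (nb_cell l)) (Const 1))
        (Equal (Cell ''out'' (nb_cell l)) (col_cell k))"
  have "run (flag_loop ''f'' 6 ?t) (setv ''f'' 0 m) =
      (if \<exists>k<6. bval (?t k) (setv ''f'' 0 m) then setv ''f'' 1 (setv ''f'' 0 m) else setv ''f'' 0 m)"
    by (rule run_flag_loop) simp
  moreover have "(\<exists>k<6. bval (?t k) (setv ''f'' 0 m)) \<longleftrightarrow> clash m (m ''y'' 0) k"
    by (simp add: clash_def nbm_def colm_def six five)
  ultimately show ?thesis by (simp add: clash_code_def)
qed

definition free_count :: com where
  "free_count = Seq (Assign ''b'' (Const 0) (Const 0)) (seqs (map (\<lambda>k. Seq (clash_code k)
     (Cond (Equal (var ''f'') (Const 0)) (Assign ''b'' (Const 0) (Plus (var ''b'') (Const 1))) Skip)) [0..<5]))"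

lemma run_free_count:
  "\<exists>fv. run free_count m = setv ''f'' fv (setv ''b'' (card {k. k < 5 \<and> \<not> clash m (m ''y'' 0) k}) m)"
proof -
  let ?p = "\<lambda>k. Seq (clash_code k)
     (Cond (Equal (var ''f'') (Const 0)) (Assign ''b'' (Const 0) (Plus (var ''b'') (Const 1))) Skip)"
  have cl: "clash (m(''b'' := B, ''f'' := F)) y k = clash m y k" for B F y k
    by (simp add: clash_def nbm_def colm_def)
  have "\<exists>fv. run (seqs (map ?p [0..<K])) (setv ''b'' 0 m) =
      setv ''f'' fv (setv ''b'' (card {k. k < K \<and> \<not> clash m (m ''y'' 0) k}) m)" for K
  proof (induction K)
    case 0
    show ?case by (intro exI[of _ "m ''f'' 0"]) (simp add: fun_upd_idem)
  next
    case (Suc K)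
    then obtain fv where fv: "run (seqs (map ?p [0..<K])) (setv ''b'' 0 m) =
      setv ''f'' fv (setv ''b'' (card {k. k < K \<and> \<not> clash m (m ''y'' 0) k}) m)" by blast
    let ?n = "card {k. k < K \<and> \<not> clash m (m ''y'' 0) k}"
    have "run (?p K) (setv ''f'' fv (setv ''b'' ?n m)) = setv ''f'' (if clash m (m ''y'' 0) K then 1 else 0)
        (setv ''b'' (card {k. k < Suc K \<and> \<not> clash m (m ''y'' 0) k}) m)"
      by (auto simp: run_clash_code card_less_Suc cl fun_eq_iff)
    then show ?case unfolding run_seqs_Suc fv by blast
  qed
  then show ?thesis by (simp add: free_count_def)
qed

definition pick :: com where
  "pick = seqs (map (\<lambda>k. Seq (clash_code k)
     (Cond (Equal (var ''f'') (Const 0)) (Assign ''out'' (var ''y'') (col_cell k)) Skip)) [0..<5])"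

text \<open>The last suitable colour wins. Overwriting the own cell of \<open>out\<close> cannot
  disturb the later tests, because they read only the neighbours.\<close>

lemma run_pick:
  assumes own: "\<And>l. l < 6 \<Longrightarrow> nbm m (m ''y'' 0) l \<noteq> m ''y'' 0"
    and ex: "\<exists>k<5. \<not> clash m (m ''y'' 0) k"
  shows "\<exists>fv. \<exists>k<5. \<not> clash m (m ''y'' 0) k \<and>
    run pick m = setv ''f'' fv (m(''out'' := (m ''out'')(m ''y'' 0 := colm m (m ''y'' 0) k)))"
proof -
  let ?y = "m ''y'' 0"
  let ?p = "\<lambda>k. Seq (clash_code k)
     (Cond (Equal (var ''f'') (Const 0)) (Assign ''out'' (var ''y'') (col_cell k)) Skip)"
  let ?r = "\<lambda>fv z. setv ''f'' fv (m(''out'' := (m ''out'')(?y := z)))"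
  have cl: "clash (m(''out'' := (m ''out'')(?y := z), ''f'' := F)) ?y k = clash m ?y k" for F z k
    using own by (auto simp: clash_def nbm_def colm_def)
  have "\<exists>fv z. run (seqs (map ?p [0..<K])) m = ?r fv z \<and>
      ((\<exists>k<K. \<not> clash m ?y k) \<longrightarrow> (\<exists>k<K. \<not> clash m ?y k \<and> z = colm m ?y k))" if "K \<le> 5" for K
    using that
  proof (induction K)
    case 0
    show ?case by (intro exI[of _ "m ''f'' 0"] exI[of _ "m ''out'' ?y"]) (simp add: fun_upd_idem)
  next
    case (Suc K)
    then obtain fv z where fv: "run (seqs (map ?p [0..<K])) m = ?r fv z"
      "(\<exists>k<K. \<not> clash m ?y k) \<longrightarrow> (\<exists>k<K. \<not> clash m ?y k \<and> z = colm m ?y k)"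
      using Suc_leD by blast
    show ?case
    proof (cases "clash m ?y K")
      case True
      have "run (seqs (map ?p [0..<Suc K])) m = ?r 1 z"
        unfolding run_seqs_Suc fv(1) using True by (simp add: run_clash_code cl)
      moreover have "(\<exists>k<Suc K. \<not> clash m ?y k) \<longrightarrow> (\<exists>k<Suc K. \<not> clash m ?y k \<and> z = colm m ?y k)"
        using fv(2) True less_Suc_eq by metis
      ultimately show ?thesis by blast
    next
      case False
      have "run (seqs (map ?p [0..<Suc K])) m = ?r 0 (colm m ?y K)"
        unfolding run_seqs_Suc fv(1) using False by (auto simp: run_clash_code colm_def five cl fun_eq_iff)
      then show ?thesis using False by blast
    qed
  qed
  from this[of 5] obtain fv z where "run pick m = ?r fv z"
    "(\<exists>k<5. \<not> clash m ?y k) \<longrightarrow> (\<exists>k<5. \<not> clash m ?y k \<and> z = colm m ?y k)"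
    by (auto simp: pick_def)
  then show ?thesis using ex by blast
qed

definition push :: com where
  "push = seqs (map (\<lambda>k. Assign ''q'' (Plus (var ''t'') (Const k)) (nb_cell k)) [0..<6])"

lemma run_push:
  "run push m = m(''q'' := (\<lambda>j. if m ''t'' 0 \<le> j \<and> j < m ''t'' 0 + 6
     then nbm m (m ''y'' 0) (j - m ''t'' 0) else m ''q'' j))"
proof -
  have "run (seqs (map (\<lambda>k. Assign ''q'' (Plus (var ''t'') (Const k)) (nb_cell k)) [0..<K])) m =
    m(''q'' := (\<lambda>j. if m ''t'' 0 \<le> j \<and> j < m ''t'' 0 + K
     then nbm m (m ''y'' 0) (j - m ''t'' 0) else m ''q'' j))" for K
    by (induction K) (auto simp: nbm_def six fun_eq_iff)
  then show ?thesis by (simp add: push_def)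
qed

text \<open>Processes one queue entry; \<open>a\<close> counts the untouched neighbours and
  \<open>b\<close> the free colours. Vertices may be queued repeatedly. All six neighbours of a
  peeled vertex are appended without any test, so the queue length is exactly n + 6 * cnt.\<close>

definition peel_body :: com where
  "peel_body = Cond (Less (var ''h'') (var ''t''))
     (seqs [Assign ''y'' (Const 0) (Cell ''q'' (var ''h'')),
        Assign ''a'' (Const 0) (Const 0),
        count_loop ''a'' 6 (\<lambda>k. Equal (Cell ''st'' (nb_cell k)) (Const 0)),
        free_count,
        Cond (Conj (Equal (Cell ''st'' (var ''y'')) (Const 0)) (Less (var ''a'') (var ''b'')))
          (seqs [Assign ''st'' (var ''y'') (Const 2),
             Assign ''ord'' (var ''cnt'') (var ''y''),
             Assign ''cnt'' (Const 0) (Plus (var ''cnt'') (Const 1)),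
             push,
             Assign ''t'' (Const 0) (Plus (var ''t'') (Const 6))])
          Skip])
     Skip"

definition colour_body :: com where
  "colour_body = Cond (Less (Const 0) (var ''cnt''))
     (seqs [Assign ''cnt'' (Const 0) (Minus (var ''cnt'') (Const 1)),
        Assign ''y'' (Const 0) (Cell ''ord'' (var ''cnt'')),
        pick,
        Assign ''st'' (var ''y'') (Const 1)])
     Skip"

definition init_body :: com where
  "init_body = Seq (Assign ''st'' (var ''i'') (Const 0)) (Assign ''q'' (var ''i'') (var ''i''))"

definition check_body :: com where
  "check_body = seqs [Assign ''y'' (Const 0) (var ''i''),
     Assign ''f'' (Const 0) (Const 0),
     flag_loop ''f'' 5 (\<lambda>k. Equal (Cell ''out'' (var ''y'')) (col_cell k)),
     Cond (Equal (var ''f'') (Const 0)) (Assign ''ok'' (Const 0) (Const 0)) Skip,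
     Assign ''f'' (Const 0) (Const 0),
     flag_loop ''f'' 6 (\<lambda>k. Equal (Cell ''out'' (var ''y'')) (Cell ''out'' (nb_cell k))),
     Cond (Equal (var ''f'') (Const 1)) (Assign ''ok'' (Const 0) (Const 0)) Skip]"

definition walk_code :: "nat list \<Rightarrow> com" where
  "walk_code ks = Seq (Assign ''y'' (Const 0) (Const 0))
     (seqs (map (\<lambda>k. Assign ''y'' (Const 0) (nb_cell k)) ks))"

fun walk :: "memory \<Rightarrow> nat \<Rightarrow> nat list \<Rightarrow> nat" where
  "walk m i [] = i"
| "walk m i (k # ks) = walk m (nbm m i k) ks"

lemma run_walk_code: "run (walk_code ks) m = setv ''y'' (walk m 0 ks) m"
proof -
  have "run (seqs (map (\<lambda>k. Assign ''y'' (Const 0) (nb_cell k)) ks)) (setv ''y'' i m) = setv ''y'' (walk m i ks) m" for i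
    by (induction ks arbitrary: i) (simp_all add: nbm_def six)
  then show ?thesis by (simp add: walk_code_def)
qed

text \<open>A vertex is named by a walk from vertex 0 through positions in adjacency lists, and its
  colour by a position in its list. Such descriptions do not mention the graph, so finitely many
  serve for all.\<close>

type_synonym recipe = "(nat list \<times> nat) list"

definition recipe_code :: "recipe \<Rightarrow> com" where
  "recipe_code ps = seqs (map (\<lambda>(ks, k). seqs [walk_code ks, Assign ''st'' (var ''y'') (Const 1),
     Assign ''out'' (var ''y'') (col_cell k)]) ps)"

text \<open>The peeling loop makes 7 n rounds: n initial queue entries and 6 for each vertex peeled.
  The final check makes an attempt with an unsuitable recipe harmless.\<close>

definition attempt :: "recipe \<Rightarrow> com" where
  "attempt ps = seqs [for_loop ''i'' (var ''size'') init_body,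
     Assign ''t'' (Const 0) (var ''size''),
     Assign ''cnt'' (Const 0) (Const 0),
     recipe_code ps,
     for_loop ''h'' (Plus (times6 (var ''size'')) (var ''size'')) peel_body,
     for_loop ''i'' (var ''size'') colour_body,
     Assign ''ok'' (Const 0) (Const 1),
     for_loop ''i'' (var ''size'') check_body]"

definition main_code :: "recipe list \<Rightarrow> com" where
  "main_code pss = seqs (map (\<lambda>ps. Cond (Equal (var ''ok'') (Const 0)) (attempt ps) Skip) pss)"

lemma loop_free_codes [simp]:
  "loop_free init_body" "loop_free peel_body" "loop_free colour_body" "loop_free check_body"
  "loop_free (recipe_code ps)"
  by (auto simp: init_body_def peel_body_def colour_body_def check_body_def recipe_code_def
    count_loop_def flag_loop_def free_count_def clash_code_def pick_def push_def walk_code_def)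

lemma written_codes:
  "written init_body \<subseteq> {''st'', ''q''}"
  "written peel_body \<subseteq> {''y'', ''a'', ''b'', ''f'', ''st'', ''ord'', ''cnt'', ''q'', ''t''}"
  "written colour_body \<subseteq> {''cnt'', ''y'', ''f'', ''out'', ''st''}"
  "written check_body \<subseteq> {''y'', ''f'', ''ok''}"
  "written (recipe_code ps) \<subseteq> {''y'', ''st'', ''out''}"
  by (auto simp: init_body_def peel_body_def colour_body_def check_body_def recipe_code_def
    count_loop_def flag_loop_def free_count_def clash_code_def pick_def push_def walk_code_def split: if_splits)

lemma run_check_body:
  "run check_body m ''ok'' 0 =
    (if (\<exists>k<5. m ''out'' (m ''i'' 0) = colm m (m ''i'' 0) k) \<and>
        \<not> (\<exists>k<6. m ''out'' (m ''i'' 0) = m ''out'' (nbm m (m ''i'' 0) k)) then m ''ok'' 0 else 0)"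
  by (auto simp: check_body_def run_flag_loop nbm_def colm_def six five)

lemma run_init_body: "run init_body m = m(''st'' := (m ''st'')(m ''i'' 0 := 0), ''q'' := (m ''q'')(m ''i'' 0 := m ''i'' 0))"
  by (simp add: init_body_def)

lemma run_colour_body:
  assumes cnt: "m ''cnt'' 0 = Suc j" and y: "y = m ''ord'' j"
    and own: "\<And>l. l < 6 \<Longrightarrow> nbm m y l \<noteq> y" and ex: "\<exists>k<5. \<not> clash m y k"
  shows "\<exists>k<5. \<not> clash m y k \<and> run colour_body m ''out'' = (m ''out'')(y := colm m y k) \<and>
    run colour_body m ''st'' = (m ''st'')(y := 1) \<and> run colour_body m ''cnt'' 0 = j"
proof -
  let ?m = "(m(''cnt'' := (m ''cnt'')(0 := j)))(''y'' := (m ''y'')(0 := y))"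
  have cl: "clash ?m z k = clash m z k" for z k by (simp add: clash_def nbm_def colm_def)
  have "\<exists>fv. \<exists>k<5. \<not> clash ?m (?m ''y'' 0) k \<and>
    run pick ?m = setv ''f'' fv (?m(''out'' := (?m ''out'')(?m ''y'' 0 := colm ?m (?m ''y'' 0) k)))"
    by (rule run_pick) (use own ex cl in \<open>simp_all add: nbm_def\<close>)
  then obtain fv k where k: "k < 5" "\<not> clash m y k"
    "run pick ?m = setv ''f'' fv (?m(''out'' := (?m ''out'')(y := colm ?m y k)))"
    using cl by auto
  have "run colour_body m = (run pick ?m)(''st'' := (run pick ?m ''st'')(run pick ?m ''y'' 0 := 1))"
    using cnt y by (simp add: colour_body_def)
  then show ?thesis using k by (intro exI[of _ k]) (simp add: colm_def)
qed

lemma run_peel_body: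
  assumes h: "m ''h'' 0 < m ''t'' 0" and y: "y = m ''q'' (m ''h'' 0)"
    and a: "a = card {k. k < 6 \<and> m ''st'' (nbm m y k) = 0}"
    and b: "b = card {k. k < 5 \<and> \<not> clash m y k}"
  shows "if m ''st'' y = 0 \<and> a < b
    then run peel_body m ''st'' = (m ''st'')(y := 2) \<and> run peel_body m ''ord'' = (m ''ord'')(m ''cnt'' 0 := y) \<and>
      run peel_body m ''cnt'' 0 = Suc (m ''cnt'' 0) \<and> run peel_body m ''t'' 0 = m ''t'' 0 + 6 \<and>
      run peel_body m ''q'' = (\<lambda>j. if m ''t'' 0 \<le> j \<and> j < m ''t'' 0 + 6 then nbm m y (j - m ''t'' 0) else m ''q'' j)
    else run peel_body m ''st'' = m ''st'' \<and> run peel_body m ''ord'' = m ''ord'' \<and>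
      run peel_body m ''cnt'' 0 = m ''cnt'' 0 \<and> run peel_body m ''t'' 0 = m ''t'' 0 \<and>
      run peel_body m ''q'' = m ''q''"
proof -
  let ?t = "\<lambda>k. Equal (Cell ''st'' (nb_cell k)) (Const 0)"
  let ?c = "Conj (Equal (Cell ''st'' (var ''y'')) (Const 0)) (Less (var ''a'') (var ''b''))"
  let ?p = "seqs [Assign ''st'' (var ''y'') (Const 2),
             Assign ''ord'' (var ''cnt'') (var ''y''),
             Assign ''cnt'' (Const 0) (Plus (var ''cnt'') (Const 1)),
             push,
             Assign ''t'' (Const 0) (Plus (var ''t'') (Const 6))]"
  let ?m0 = "setv ''a'' 0 (setv ''y'' y m)"
  let ?m1 = "setv ''a'' a (setv ''y'' y m)"
  have "run (count_loop ''a'' 6 ?t) ?m0 = setv ''a'' (?m0 ''a'' 0 + card {k. k < 6 \<and> bval (?t k) ?m0}) ?m0"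
    by (rule run_count_loop) simp
  moreover have "{k. k < 6 \<and> bval (?t k) ?m0} = {k. k < 6 \<and> m ''st'' (nbm m y k) = 0}"
    by (simp add: nbm_def six)
  ultimately have 1: "run (count_loop ''a'' 6 ?t) ?m0 = ?m1" using a by simp
  have cl: "clash ?m1 z k = clash m z k" for z k by (simp add: clash_def nbm_def colm_def)
  have y1: "?m1 ''y'' 0 = y" by simp
  obtain fv where 2: "run free_count ?m1 = setv ''f'' fv (setv ''b'' b ?m1)"
    using run_free_count[of ?m1] unfolding y1 cl b[symmetric] by blast
  let ?m2 = "setv ''f'' fv (setv ''b'' b ?m1)"
  have start: "run peel_body m = run (Cond ?c ?p Skip) ?m2"
  proof -
    have "run peel_body m = run (Seq free_count (Seq (Cond ?c ?p Skip) Skip)) (run (count_loop ''a'' 6 ?t) ?m0)"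
      using h by (simp add: peel_body_def y)
    then show ?thesis unfolding 1 run.simps(3) 2 by simp
  qed
  have test: "bval ?c ?m2 \<longleftrightarrow> m ''st'' y = 0 \<and> a < b" by simp
  show ?thesis
  proof (cases "m ''st'' y = 0 \<and> a < b")
    case True
    have eq: "run (Cond ?c ?p Skip) ?m2 = run ?p ?m2"
      using iffD2[OF test True] by (simp only: run.simps if_True)
    have gen: "run ?p M ''st'' = (M ''st'')(M ''y'' 0 := 2) \<and>
      run ?p M ''ord'' = (M ''ord'')(M ''cnt'' 0 := M ''y'' 0) \<and>
      run ?p M ''cnt'' 0 = Suc (M ''cnt'' 0) \<and> run ?p M ''t'' 0 = M ''t'' 0 + 6 \<and>
      run ?p M ''q'' = (\<lambda>j. if M ''t'' 0 \<le> j \<and> j < M ''t'' 0 + 6 then nbm M (M ''y'' 0) (j - M ''t'' 0) else M ''q'' j)"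
      for M by (simp add: run_push nbm_def cong: if_cong)
    have v: "?m2 ''st'' = m ''st''" "?m2 ''ord'' = m ''ord''" "?m2 ''cnt'' = m ''cnt''" "?m2 ''q'' = m ''q''"
      "?m2 ''t'' = m ''t''" "?m2 ''y'' 0 = y" "nbm ?m2 = nbm m"
      by (simp_all add: nbm_def fun_eq_iff)
    show ?thesis unfolding if_P[OF True] start eq using gen[of ?m2] unfolding v .
  next
    case False
    have "run (Cond ?c ?p Skip) ?m2 = ?m2" using False unfolding test[symmetric] by (simp only: run.simps if_False)
    then show ?thesis unfolding if_not_P[OF False] start by simp
  qed
qed

lemma run_peel_body_idle: "\<not> m ''h'' 0 < m ''t'' 0 \<Longrightarrow> run peel_body m = m"
  by (simp add: peel_body_def)

section \<open>Correctness and running time of one attempt\<close>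

locale encoded = list_graph V E L for V :: "'a set" and E L +
  fixes e :: "nat \<Rightarrow> 'a" and m0 :: memory
  assumes enc: "encodes e V E L m0" and ne: "V \<noteq> {}"
begin

abbreviation n :: nat where "n \<equiv> card V"
abbreviation nb :: "nat \<Rightarrow> nat \<Rightarrow> nat" where "nb \<equiv> nbm m0"
abbreviation cl :: "nat \<Rightarrow> nat \<Rightarrow> nat" where "cl \<equiv> colm m0"

lemma bij_e: "bij_betw e {..<n} V" using enc by (simp add: encodes_def)
lemma e_V: "i < n \<Longrightarrow> e i \<in> V" using bij_e by (auto simp: bij_betw_def)
lemma e_inj: "i < n \<Longrightarrow> j < n \<Longrightarrow> e i = e j \<longleftrightarrow> i = j"
  using bij_e by (auto simp: bij_betw_def inj_on_def)
lemma e_surj: "v \<in> V \<Longrightarrow> \<exists>i<n. v = e i" using bij_e by (auto simp: bij_betw_def)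
lemma bij_nb: "i < n \<Longrightarrow> bij_betw (\<lambda>k. e (nb i k)) {..<6} (N (e i))"
  using enc by (simp add: encodes_def nbm_def)
lemma nb_less: "i < n \<Longrightarrow> k < 6 \<Longrightarrow> nb i k < n" using enc by (simp add: encodes_def nbm_def)
lemma bij_cl: "i < n \<Longrightarrow> bij_betw (cl i) {..<5} (L (e i))"
proof -
  have "cl i = (\<lambda>k. m0 ''col'' (5 * i + k))" by (simp add: colm_def fun_eq_iff)
  then show "i < n \<Longrightarrow> bij_betw (cl i) {..<5} (L (e i))" using enc by (simp add: encodes_def)
qed

lemma N_nb: "i < n \<Longrightarrow> N (e i) = (\<lambda>k. e (nb i k)) ` {..<6}"
  using bij_nb by (simp add: bij_betw_def)

lemma nb_own: "i < n \<Longrightarrow> k < 6 \<Longrightarrow> nb i k \<noteq> i"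
proof
  assume "i < n" "k < 6" "nb i k = i"
  then have "e i \<in> N (e i)" using N_nb[of i] by force
  then show False using E_irrefl by (simp add: N_iff)
qed

lemma card_nb:
  assumes "i < n" "\<And>k. k < 6 \<Longrightarrow> P (nb i k) \<longleftrightarrow> e (nb i k) \<in> Q"
  shows "card {k. k < 6 \<and> P (nb i k)} = card (N (e i) \<inter> Q)"
proof -
  have "inj_on (\<lambda>k. e (nb i k)) {k. k < 6 \<and> P (nb i k)}"
    using bij_nb[OF assms(1)] by (auto simp: bij_betw_def intro: inj_on_subset)
  moreover have "(\<lambda>k. e (nb i k)) ` {k. k < 6 \<and> P (nb i k)} = N (e i) \<inter> Q"
    using assms(2) by (auto simp: N_nb[OF assms(1)])
  ultimately show ?thesis using card_image by fastforce
qed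

definition fr :: "memory \<Rightarrow> bool" where
  "fr m \<longleftrightarrow> m ''nbr'' = m0 ''nbr'' \<and> m ''col'' = m0 ''col'' \<and> m ''size'' = m0 ''size''"

lemma fr_simps: "fr m \<Longrightarrow> nbm m = nb" "fr m \<Longrightarrow> colm m = cl" "fr m \<Longrightarrow> m ''size'' 0 = n"
  using enc by (auto simp: fr_def nbm_def colm_def encodes_def fun_eq_iff)

lemma fr_run:
  assumes "fr m" "written p \<inter> {''nbr'', ''col'', ''size''} = {}"
  shows "fr (run p m)"
  using assms run_unwritten[of _ p m] by (auto simp: fr_def)

lemma fr_upd: "fr m \<Longrightarrow> v \<notin> {''nbr'', ''col'', ''size''} \<Longrightarrow> fr (m(v := x))"
  by (auto simp: fr_def)

lemma clash_iff:
  assumes "fr m" "i < n" "\<And>j. j < n \<Longrightarrow> m ''st'' j = 1 \<longleftrightarrow> e j \<in> C"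
    and "\<And>j. j < n \<Longrightarrow> e j \<in> C \<Longrightarrow> m ''out'' j = c (e j)"
  shows "clash m i k \<longleftrightarrow> cl i k \<in> c ` (N (e i) \<inter> C)"
proof -
  have "clash m i k \<longleftrightarrow> (\<exists>l<6. e (nb i l) \<in> C \<and> c (e (nb i l)) = cl i k)"
    using assms nb_less[OF assms(2)] by (auto simp: clash_def fr_simps)
  also have "\<dots> \<longleftrightarrow> (\<exists>x\<in>(\<lambda>l. e (nb i l)) ` {..<6}. x \<in> C \<and> c x = cl i k)" by auto
  also have "(\<exists>x\<in>S. x \<in> C \<and> c x = z) \<longleftrightarrow> z \<in> c ` (S \<inter> C)" for S z by auto
  finally show ?thesis unfolding N_nb[OF assms(2)] .
qed

lemma card_free:
  assumes "fr m" "i < n" "\<And>j. j < n \<Longrightarrow> m ''st'' j = 1 \<longleftrightarrow> e j \<in> C"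
    and "\<And>j. j < n \<Longrightarrow> e j \<in> C \<Longrightarrow> m ''out'' j = c (e j)"
  shows "card {k. k < 5 \<and> \<not> clash m i k} = card (avail C c (e i))"
proof -
  have "inj_on (cl i) {k. k < 5 \<and> \<not> clash m i k}"
    using bij_cl[OF assms(2)] by (auto simp: bij_betw_def intro: inj_on_subset)
  moreover have "cl i ` {k. k < 5 \<and> \<not> clash m i k} = avail C c (e i)"
    using bij_cl[OF assms(2)] clash_iff[OF assms] by (auto simp: bij_betw_def avail_def)
  ultimately show ?thesis using card_image by fastforce
qed

definition valid :: "memory \<Rightarrow> bool" where
  "valid m \<longleftrightarrow> (\<forall>i<n. m ''out'' i \<in> L (e i) \<and> (\<forall>k<6. m ''out'' i \<noteq> m ''out'' (nb i k)))"

lemma valid_colouring: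
  assumes "valid m"
  shows "\<exists>c. list_colouring V E L c \<and> (\<forall>i<n. m ''out'' i = c (e i))"
proof -
  define c where "c v = m ''out'' (inv_into {..<n} e v)" for v
  have c: "c (e i) = m ''out'' i" if "i < n" for i
    using that bij_e by (simp add: c_def bij_betw_def inv_into_f_f)
  have "list_colouring V E L c"
    unfolding list_colouring_def proper_colouring_def
  proof (intro conjI ballI impI)
    show "c v \<in> L v" if "v \<in> V" for v
      using e_surj[OF that] c assms by (auto simp: valid_def)
    show "c u \<noteq> c v" if uv: "u \<in> V" "v \<in> V" "E u v" for u v
    proof -
      obtain i where i: "i < n" "u = e i" using e_surj[OF uv(1)] by blast
      have "v \<in> N (e i)" using uv(3) i by (simp add: N_iff)
      then obtain k where "k < 6" "v = e (nb i k)" unfolding N_nb[OF i(1)] by auto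
      then show ?thesis using i c nb_less assms by (auto simp: valid_def)
    qed
  qed
  then show ?thesis using c by metis
qed

definition recipe_for :: "recipe \<Rightarrow> 'a set \<Rightarrow> ('a \<Rightarrow> nat) \<Rightarrow> bool" where
  "recipe_for ps P c \<longleftrightarrow> (\<forall>(ks, k)\<in>set ps. walk m0 0 ks < n \<and> k < 5 \<and> cl (walk m0 0 ks) k = c (e (walk m0 0 ks))) \<and>
     P = (\<lambda>(ks, k). e (walk m0 0 ks)) ` set ps"

lemma walk_fr: "fr m \<Longrightarrow> walk m i ks = walk m0 i ks"
  by (induction ks arbitrary: i) (simp_all add: fr_simps)

lemma run_recipe:
  assumes "fr m" "recipe_for ps P c" "\<And>i. i < n \<Longrightarrow> m ''st'' i = 0"
  shows "\<forall>i<n. run (recipe_code ps) m ''st'' i = (if e i \<in> P then 1 else 0) \<and>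
    (e i \<in> P \<longrightarrow> run (recipe_code ps) m ''out'' i = c (e i))"
proof -
  \<comment> \<open>Generalized to a set \<open>A\<close> of vertices coloured before, for the
    induction along the recipe.\<close>
  have "\<forall>i<n. run (recipe_code ps) m ''st'' i = (if e i \<in> P \<union> A then 1 else 0) \<and>
    (e i \<in> P \<union> A \<longrightarrow> run (recipe_code ps) m ''out'' i = c (e i))"
    if "recipe_for ps P c" "fr m" "\<forall>i<n. m ''st'' i = (if e i \<in> A then 1 else 0) \<and> (e i \<in> A \<longrightarrow> m ''out'' i = c (e i))"
    for A P m
    using that
  proof (induction ps arbitrary: A P m)
    case Nil
    then show ?case by (auto simp: recipe_for_def recipe_code_def)
  next
    case (Cons p ps)
    obtain ks k where p: "p = (ks, k)" by (cases p)
    let ?w = "walk m0 0 ks"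
    let ?m = "m(''y'' := (m ''y'')(0 := ?w), ''st'' := (m ''st'')(?w := 1), ''out'' := (m ''out'')(?w := cl ?w k))"
    let ?P = "(\<lambda>(ks, k). e (walk m0 0 ks)) ` set ps"
    have w: "?w < n" "cl ?w k = c (e ?w)" using Cons.prems(1) by (auto simp: p recipe_for_def)
    have "m ''col'' = m0 ''col''" using Cons.prems(2) by (simp add: fr_def)
    then have "run (seqs [walk_code ks, Assign ''st'' (var ''y'') (Const 1),
        Assign ''out'' (var ''y'') (col_cell k)]) m = ?m"
      using walk_fr[OF Cons.prems(2), of 0 ks] by (simp add: run_walk_code colm_def five)
    then have "run (recipe_code (p # ps)) m = run (recipe_code ps) ?m"
      by (simp add: recipe_code_def p)
    moreover have "\<forall>i<n. run (recipe_code ps) ?m ''st'' i = (if e i \<in> ?P \<union> insert (e ?w) A then 1 else 0) \<and>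
      (e i \<in> ?P \<union> insert (e ?w) A \<longrightarrow> run (recipe_code ps) ?m ''out'' i = c (e i))"
    proof (rule Cons.IH)
      show "recipe_for ps ?P c" using Cons.prems(1) by (auto simp: recipe_for_def)
      show "fr ?m" using Cons.prems(2) by (simp add: fr_def)
      show "\<forall>i<n. ?m ''st'' i = (if e i \<in> insert (e ?w) A then 1 else 0) \<and>
        (e i \<in> insert (e ?w) A \<longrightarrow> ?m ''out'' i = c (e i))"
      proof (intro allI impI)
        fix i assume i: "i < n"
        show "?m ''st'' i = (if e i \<in> insert (e ?w) A then 1 else 0) \<and>
          (e i \<in> insert (e ?w) A \<longrightarrow> ?m ''out'' i = c (e i))"
          using Cons.prems(3) w(2) i e_inj[OF i w(1)] by (cases "i = ?w") simp_all
      qed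
    qed
    moreover have "P \<union> A = ?P \<union> insert (e ?w) A" using Cons.prems(1) by (simp add: recipe_for_def p)
    ultimately show ?case by metis
  qed
  moreover have "\<forall>i<n. m ''st'' i = (if e i \<in> {} then 1 else 0) \<and> (e i \<in> {} \<longrightarrow> m ''out'' i = c (e i))"
    using assms(3) by simp
  ultimately have "\<forall>i<n. run (recipe_code ps) m ''st'' i = (if e i \<in> P \<union> {} then 1 else 0) \<and>
    (e i \<in> P \<union> {} \<longrightarrow> run (recipe_code ps) m ''out'' i = c (e i))"
    using assms(1,2) by blast
  then show ?thesis by simp
qed

end

text \<open>A total correctness judgement with a time bound; sequences compose by adding the
  bounds.\<close>

definition phase :: "memory \<Rightarrow> com \<Rightarrow> nat \<Rightarrow> (memory \<Rightarrow> bool) \<Rightarrow> bool" where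
  "phase m p k Q \<longleftrightarrow> (\<exists>m'. runs p m k m' \<and> Q m')"

lemma phase_loop_free: "loop_free p \<Longrightarrow> Q (run p m) \<Longrightarrow> phase m p (cost p) Q"
  unfolding phase_def using runs_loop_free by blast

lemma phase_Seq: "phase m p k P \<Longrightarrow> (\<And>m'. P m' \<Longrightarrow> phase m' q l Q) \<Longrightarrow> phase m (Seq p q) (k + l) Q"
  unfolding phase_def using runs_Seq by metis

lemma phase_seqs_Nil: "Q m \<Longrightarrow> phase m (seqs []) 1 Q"
  using phase_loop_free[of Skip Q m] by simp

lemma phase_seqs_Cons:
  "phase m p k P \<Longrightarrow> (\<And>m'. P m' \<Longrightarrow> phase m' (seqs ps) l Q) \<Longrightarrow> phase m (seqs (p # ps)) (k + l) Q"
  unfolding seqs.simps by (rule phase_Seq)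

text \<open>The factor of n in the bound for one attempt; constant costs are charged to the
  vertices, of which there is at least one.\<close>

definition steps :: "recipe \<Rightarrow> nat" where
  "steps ps = (cost init_body + 2) + 2 + 1 + 1 + cost (recipe_code ps) + 7 * (cost peel_body + 2) + 2 +
    (cost colour_body + 2) + 2 + 1 + (cost check_body + 2) + 2 + 1"

context encoded
begin

lemma phase_for:
  assumes "loop_free p" "v \<notin> written p" "v \<notin> {''size'', ''nbr'', ''col''}"
    and p: "written p \<inter> {''nbr'', ''col'', ''size''} = {}"
    and B: "B = var ''size'' \<and> K = n \<or> B = Plus (times6 (var ''size'')) (var ''size'') \<and> K = 7 * n"
    and m: "fr m" and init: "I 0 (m(v := (m v)(0 := 0)))"
    and step: "\<And>i m'. i < K \<Longrightarrow> m' v 0 = i \<Longrightarrow> fr m' \<Longrightarrow> I i m' \<Longrightarrow>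
      I (Suc i) ((run p m')(v := (run p m' v)(0 := Suc i)))"
  shows "phase m (for_loop v B p) (K * (cost p + 2) + 2) (\<lambda>m'. fr m' \<and> I K m')"
proof -
  have K: "aval B m = K" using B fr_simps(3)[OF m] by auto
  have "\<exists>m'. runs (for_loop v B p) m (aval B m * (cost p + 2) + 2) m' \<and> (fr m' \<and> I (aval B m) m') \<and>
    m' ''size'' = m ''size''"
  proof (rule runs_for)
    show "aval B m1 = aval B m2" if "m1 ''size'' = m2 ''size''" for m1 m2 using B that by auto
    show "fr (m(v := (m v)(0 := 0))) \<and> I 0 (m(v := (m v)(0 := 0)))"
      using fr_upd[OF m] init assms(3) by auto
    show "fr ((run p m')(v := (run p m' v)(0 := Suc i))) \<and> I (Suc i) ((run p m')(v := (run p m' v)(0 := Suc i)))"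
      if "i < aval B m" "m' v 0 = i" "fr m' \<and> I i m'" for i m'
      using step[of i m'] that fr_upd[OF fr_run[OF _ p]] assms(3) by (auto simp: K)
  qed (use assms in auto)
  then show ?thesis unfolding K phase_def by blast
qed

lemma phase_init:
  assumes "fr m"
  shows "phase m (for_loop ''i'' (var ''size'') init_body) (n * (cost init_body + 2) + 2)
    (\<lambda>m'. fr m' \<and> (\<forall>j<n. m' ''st'' j = 0 \<and> m' ''q'' j = j))"
  by (rule phase_for) (use assms in \<open>auto simp: run_init_body less_Suc_eq init_body_def\<close>)

text \<open>\<open>D\<close> is the set peeled so far, in the order \<open>ord\<close>, and
  \<open>h\<close> is the reading position of the queue. The last clause matters most: whatever is
  peelable now still stands at an unread place.\<close>

definition peel_inv :: "'a set \<Rightarrow> ('a \<Rightarrow> nat) \<Rightarrow> nat \<Rightarrow> memory \<Rightarrow> bool" where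
  "peel_inv P c h m \<longleftrightarrow> (let k = m ''cnt'' 0; D = m ''ord'' ` {..<k} in
    inj_on (m ''ord'') {..<k} \<and> D \<subseteq> {..<n} \<and> (\<forall>j\<in>D. e j \<notin> P) \<and>
    (\<forall>j<n. m ''st'' j = (if e j \<in> P then 1 else if j \<in> D then 2 else 0) \<and> (e j \<in> P \<longrightarrow> m ''out'' j = c (e j))) \<and>
    m ''t'' 0 = n + 6 * k \<and> (\<forall>l < m ''t'' 0. m ''q'' l < n) \<and>
    (\<forall>s<k. card (N (e (m ''ord'' s)) - P - e ` m ''ord'' ` {..<s}) < card (avail P c (e (m ''ord'' s)))) \<and>
    (\<forall>j<n. e j \<notin> P \<longrightarrow> j \<notin> D \<longrightarrow> card (N (e j) - P - e ` D) < card (avail P c (e j)) \<longrightarrow>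
      (\<exists>l. h \<le> l \<and> l < m ''t'' 0 \<and> m ''q'' l = j)))"

lemma peel_inv_cong:
  assumes "\<And>v. v \<in> {''st'', ''ord'', ''q'', ''out''} \<Longrightarrow> m' v = m v" "m' ''cnt'' 0 = m ''cnt'' 0" "m' ''t'' 0 = m ''t'' 0"
  shows "peel_inv P c h m' = peel_inv P c h m"
proof -
  have "m' ''st'' = m ''st''" "m' ''ord'' = m ''ord''" "m' ''q'' = m ''q''" "m' ''out'' = m ''out''"
    using assms(1) by simp_all
  then show ?thesis unfolding peel_inv_def assms(2,3) by simp
qed

text \<open>Peeling \<open>y\<close> can make only neighbours of \<open>y\<close> peelable, and they
  are appended. A vertex that is rejected can become peelable only when another of its neighbours is
  peeled, and then it is queued again.\<close>

lemma peel_step: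
  assumes fr: "fr m" and h: "m ''h'' 0 = h" and inv: "peel_inv P c h m"
  shows "peel_inv P c (Suc h) (run peel_body m)"
proof -
  define k where "k = m ''cnt'' 0"
  define D where "D = m ''ord'' ` {..<k}"
  note I = inv[unfolded peel_inv_def Let_def, folded k_def, folded D_def]
  have out: "run peel_body m ''out'' = m ''out''" using written_codes(2) by (intro run_unwritten) auto
  show ?thesis
  proof (cases "h < m ''t'' 0")
    case False
    then have "\<not> m ''h'' 0 < m ''t'' 0" using h by simp
    then have "run peel_body m = m" by (rule run_peel_body_idle)
    moreover have "\<forall>j<n. e j \<notin> P \<longrightarrow> j \<notin> D \<longrightarrow> card (N (e j) - P - e ` D) < card (avail P c (e j)) \<longrightarrow>
      (\<exists>l. Suc h \<le> l \<and> l < m ''t'' 0 \<and> m ''q'' l = j)"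
    proof (intro allI impI)
      fix j assume "j < n" "e j \<notin> P" "j \<notin> D" "card (N (e j) - P - e ` D) < card (avail P c (e j))"
      then obtain l where "h \<le> l" "l < m ''t'' 0" using I by blast
      then show "\<exists>l. Suc h \<le> l \<and> l < m ''t'' 0 \<and> m ''q'' l = j" using False by linarith
    qed
    then have "peel_inv P c (Suc h) m"
      unfolding peel_inv_def Let_def k_def[symmetric] D_def[symmetric]
      using I by (elim conjE, intro conjI) assumption+
    ultimately show ?thesis by simp
  next
    case True
    define y where "y = m ''q'' h"
    have y: "y < n" "y = m ''q'' (m ''h'' 0)" using I True by (auto simp: y_def h)
    have less: "m ''h'' 0 < m ''t'' 0" using True h by simp
    have s1: "m ''st'' j = 1 \<longleftrightarrow> e j \<in> P" "m ''st'' j = 0 \<longleftrightarrow> e j \<notin> P \<and> j \<notin> D" if "j < n" for j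
      using I that by auto
    have eD: "e j \<in> e ` D \<longleftrightarrow> j \<in> D" if "j < n" for j
      using I e_inj that by (auto simp: subset_iff)
    define a where "a = card {l. l < 6 \<and> m ''st'' (nbm m y l) = 0}"
    define b where "b = card {l. l < 5 \<and> \<not> clash m y l}"
    have "a = card (N (e y) \<inter> (- P - e ` D))"
      unfolding a_def fr_simps(1)[OF fr]
      by (rule card_nb[OF y(1)]) (use s1 eD nb_less[OF y(1)] in auto)
    moreover have "N (e y) \<inter> (- P - e ` D) = N (e y) - P - e ` D" by auto
    ultimately have a: "a = card (N (e y) - P - e ` D)" by simp
    have b: "b = card (avail P c (e y))"
      unfolding b_def by (rule card_free[OF fr y(1)]) (use s1 I in auto)
    have B: "if m ''st'' y = 0 \<and> a < b
    then run peel_body m ''st'' = (m ''st'')(y := 2) \<and> run peel_body m ''ord'' = (m ''ord'')(k := y) \<and>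
      run peel_body m ''cnt'' 0 = Suc k \<and> run peel_body m ''t'' 0 = m ''t'' 0 + 6 \<and>
      run peel_body m ''q'' = (\<lambda>j. if m ''t'' 0 \<le> j \<and> j < m ''t'' 0 + 6 then nb y (j - m ''t'' 0) else m ''q'' j)
    else run peel_body m ''st'' = m ''st'' \<and> run peel_body m ''ord'' = m ''ord'' \<and>
      run peel_body m ''cnt'' 0 = k \<and> run peel_body m ''t'' 0 = m ''t'' 0 \<and>
      run peel_body m ''q'' = m ''q''"
      using run_peel_body[OF less y(2) a_def b_def] unfolding fr_simps(1)[OF fr] k_def .
    have test: "m ''st'' y = 0 \<and> a < b \<longleftrightarrow>
      e y \<notin> P \<and> y \<notin> D \<and> card (N (e y) - P - e ` D) < card (avail P c (e y))"
      using s1[OF y(1)] a b by simp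
    show ?thesis
    proof (cases "m ''st'' y = 0 \<and> a < b")
      case False
      then have r: "run peel_body m ''st'' = m ''st''" "run peel_body m ''ord'' = m ''ord''"
        "run peel_body m ''cnt'' 0 = m ''cnt'' 0" "run peel_body m ''t'' 0 = m ''t'' 0"
        "run peel_body m ''q'' = m ''q''" using B by (auto simp: k_def)
      have "\<exists>l. Suc h \<le> l \<and> l < m ''t'' 0 \<and> m ''q'' l = j"
        if j: "j < n" "e j \<notin> P" "j \<notin> D" "card (N (e j) - P - e ` D) < card (avail P c (e j))" for j
      proof -
        have "y \<noteq> j" using j False test by auto
        moreover obtain l where "h \<le> l" "l < m ''t'' 0" "m ''q'' l = j" using I j by blast
        ultimately show ?thesis unfolding y_def by (metis Suc_leI le_neq_implies_less)
      qed
      then have "\<forall>j<n. e j \<notin> P \<longrightarrow> j \<notin> D \<longrightarrow> card (N (e j) - P - e ` D) < card (avail P c (e j)) \<longrightarrow>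
        (\<exists>l. Suc h \<le> l \<and> l < m ''t'' 0 \<and> m ''q'' l = j)" by simp
      then have "peel_inv P c (Suc h) m"
        unfolding peel_inv_def Let_def k_def[symmetric] D_def[symmetric]
        using I by (elim conjE, intro conjI) assumption+
      moreover have "peel_inv P c (Suc h) (run peel_body m) = peel_inv P c (Suc h) m"
        by (rule peel_inv_cong) (use r out in auto)
      ultimately show ?thesis by simp
    next
      case True
      let ?m = "run peel_body m"
      let ?D = "insert y D"
      have ty: "e y \<notin> P" "y \<notin> D" "card (N (e y) - P - e ` D) < card (avail P c (e y))" using True test by auto
      have r: "?m ''st'' = (m ''st'')(y := 2)" "?m ''ord'' = (m ''ord'')(k := y)"
        "?m ''cnt'' 0 = Suc k" "?m ''t'' 0 = m ''t'' 0 + 6"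
        "?m ''q'' = (\<lambda>j. if m ''t'' 0 \<le> j \<and> j < m ''t'' 0 + 6 then nb y (j - m ''t'' 0) else m ''q'' j)"
        using B True by auto
      have im: "(m ''ord'')(k := y) ` {..<s} = m ''ord'' ` {..<s}" if "s \<le> k" for s
        using that by (intro image_cong) auto
      have D': "?m ''ord'' ` {..<Suc k} = ?D"
        unfolding lessThan_Suc image_insert r(2) im[OF order_refl] D_def by simp
      have c1: "inj_on (?m ''ord'') {..<Suc k}"
      proof -
        have "inj_on ((m ''ord'')(k := y)) {..<k}" using I by (auto simp: inj_on_def)
        moreover have "y \<notin> (m ''ord'')(k := y) ` {..<k}" using ty(2) im[of k] by (simp add: D_def)
        ultimately show ?thesis unfolding r(2) lessThan_Suc by (simp add: D_def)
      qed
      have c2: "\<forall>j<n. ?m ''st'' j = (if e j \<in> P then 1 else if j \<in> ?D then 2 else 0) \<and>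
        (e j \<in> P \<longrightarrow> ?m ''out'' j = c (e j))" using I ty(1) unfolding r out by auto
      have c3: "\<forall>l < ?m ''t'' 0. ?m ''q'' l < n"
        using I nb_less[OF y(1)] unfolding r by auto
      have c4: "card (N (e (?m ''ord'' s)) - P - e ` ?m ''ord'' ` {..<s}) < card (avail P c (e (?m ''ord'' s)))"
        if "s < Suc k" for s
      proof (cases "s = k")
        case True
        then show ?thesis using ty(3) unfolding r(2) im[OF order_refl] by (simp add: D_def im)
      next
        case False
        then have "s < k" using that by simp
        then show ?thesis using I im[of s] unfolding r(2) by auto
      qed
      have c5: "\<exists>l. Suc h \<le> l \<and> l < ?m ''t'' 0 \<and> ?m ''q'' l = j"
        if j: "j < n" "e j \<notin> P" "j \<notin> ?D" "card (N (e j) - P - e ` ?D) < card (avail P c (e j))" for j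
      proof (cases "e y \<in> N (e j)")
        case True
        then have "e j \<in> N (e y)" using E_sym by (simp add: N_iff)
        then obtain l where l: "l < 6" "e j = e (nb y l)" unfolding N_nb[OF y(1)] by auto
        then have "nb y l = j" using e_inj[OF j(1) nb_less[OF y(1) l(1)]] by simp
        then show ?thesis using l(1) \<open>h < m ''t'' 0\<close> unfolding r by (intro exI[of _ "m ''t'' 0 + l"]) auto
      next
        case False
        then have "N (e j) - P - e ` ?D = N (e j) - P - e ` D" by auto
        then obtain l where l: "h \<le> l" "l < m ''t'' 0" "m ''q'' l = j" using I j by auto
        have "l \<noteq> h" using l(3) j(3) y_def by auto
        then show ?thesis using l unfolding r by (intro exI[of _ l]) auto
      qed
      have "?D \<subseteq> {..<n}" "\<forall>j\<in>?D. e j \<notin> P" "?m ''t'' 0 = n + 6 * Suc k" using I y(1) ty(1) r(4) by auto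
      then show ?thesis unfolding peel_inv_def Let_def r(3) D'
        using c1 c2 c3 c4 c5 by blast
    qed
  qed
qed

text \<open>The queue length n + 6 k is at most 7 n, so all entries have been read and nothing
  peelable is left outside \<open>D\<close>. Induction over \<open>peel\<close> then puts every
  abstractly peelable vertex into \<open>D\<close>.\<close>

lemma peel_done:
  assumes inv: "peel_inv P c (7 * n) m" and all: "V - P \<subseteq> peel P c"
  shows "e ` m ''ord'' ` {..<m ''cnt'' 0} = V - P" "m ''cnt'' 0 \<le> n"
proof -
  define k where "k = m ''cnt'' 0"
  define D where "D = m ''ord'' ` {..<k}"
  note I = inv[unfolded peel_inv_def Let_def, folded k_def, folded D_def]
  have "card D = k" using I by (simp add: D_def card_image)
  moreover have "card D \<le> card {..<n}" using I by (intro card_mono) auto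
  ultimately show k: "m ''cnt'' 0 \<le> n" by (simp add: k_def)
  have no: "\<not> card (N (e j) - P - e ` D) < card (avail P c (e j))" if j: "j < n" "e j \<notin> P" "j \<notin> D" for j
  proof
    assume "card (N (e j) - P - e ` D) < card (avail P c (e j))"
    then obtain l where "7 * n \<le> l" "l < m ''t'' 0" using I j by blast
    moreover have "m ''t'' 0 = n + 6 * k" using I by blast
    ultimately show False using k by (simp add: k_def)
  qed
  have "v \<in> e ` D" if "v \<in> peel P c" for v
    using that
  proof induction
    case (peelI v Q)
    obtain j where j: "j < n" "v = e j" using e_surj[OF peelI.hyps(1)] by blast
    have fN: "finite (N v - P - Q)" using finite_N by simp
    have "N v - P - e ` D \<subseteq> N v - P - Q" using peelI.IH by auto
    then have "card (N v - P - e ` D) \<le> card (N v - P - Q)" using fN card_mono by blast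
    then show ?case using no[OF j(1)] peelI.hyps j(2) by fastforce
  qed
  moreover have "e ` D \<subseteq> V - P" using I e_V by auto
  ultimately show "e ` m ''ord'' ` {..<m ''cnt'' 0} = V - P" using all by (auto simp: k_def D_def)
qed

definition colour_inv :: "'a set \<Rightarrow> ('a \<Rightarrow> nat) \<Rightarrow> (nat \<Rightarrow> nat) \<Rightarrow> nat \<Rightarrow> nat \<Rightarrow> memory \<Rightarrow> bool" where
  "colour_inv P c ord k i m \<longleftrightarrow> m ''ord'' = ord \<and> m ''cnt'' 0 = k - i \<and>
    (\<exists>c'. pcol (P \<union> e ` ord ` {k - i..<k}) c' \<and> (\<forall>v\<in>P. c' v = c v) \<and>
      (\<forall>j<n. (m ''st'' j = 1 \<longleftrightarrow> e j \<in> P \<union> e ` ord ` {k - i..<k}) \<and>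
        (e j \<in> P \<union> e ` ord ` {k - i..<k} \<longrightarrow> m ''out'' j = c' (e j))))"

text \<open>Vertices are taken from \<open>ord\<close> backwards. The neighbours coloured since the
  precolouring are among those not peeled before the vertex, and these were fewer than its free
  colours when it was peeled. So a colour is left.\<close>

lemma colour_step:
  assumes fr: "fr m" and inv: "colour_inv P c ord k i m"
    and inj: "inj_on ord {..<k}" and D: "ord ` {..<k} \<subseteq> {..<n}" and P: "\<forall>j\<in>ord ` {..<k}. e j \<notin> P"
    and peel: "\<forall>s<k. card (N (e (ord s)) - P - e ` ord ` {..<s}) < card (avail P c (e (ord s)))"
  shows "colour_inv P c ord k (Suc i) (run colour_body m)"
proof (cases "k - i")
  case 0
  then have "run colour_body m = m" using inv by (simp add: colour_body_def colour_inv_def)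
  moreover have "k - Suc i = k - i" using 0 by simp
  ultimately show ?thesis using inv by (simp add: colour_inv_def)
next
  case (Suc j)
  define C where "C = P \<union> e ` ord ` {k - i..<k}"
  define y where "y = ord j"
  have j: "j < k" "k - Suc i = j" "k - i = Suc j" using Suc by auto
  have "\<exists>c'. pcol C c' \<and> (\<forall>v\<in>P. c' v = c v) \<and>
      (\<forall>j<n. (m ''st'' j = 1 \<longleftrightarrow> e j \<in> C) \<and> (e j \<in> C \<longrightarrow> m ''out'' j = c' (e j)))"
    using inv unfolding colour_inv_def C_def by (elim conjE)
  then obtain c' where c': "pcol C c'" "\<forall>v\<in>P. c' v = c v"
    and c'j: "\<forall>j<n. (m ''st'' j = 1 \<longleftrightarrow> e j \<in> C) \<and> (e j \<in> C \<longrightarrow> m ''out'' j = c' (e j))"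
    by (elim exE conjE)
  have c'st: "m ''st'' j = 1 \<longleftrightarrow> e j \<in> C" if "j < n" for j using c'j that by simp
  have c'out: "m ''out'' j = c' (e j)" if "j < n" "e j \<in> C" for j using c'j that by simp
  have y: "y < n" "e y \<notin> P" "e y \<in> V" using D P j(1) e_V by (auto simp: y_def)
  have inje: "e (ord s) = e (ord s') \<longleftrightarrow> s = s'" if s: "s < k" "s' < k" for s s'
  proof -
    have "ord s < n" "ord s' < n" using D s by auto
    then show ?thesis using inj_on_eq_iff[OF inj] s by (simp add: e_inj)
  qed
  have yC: "e y \<notin> C" using y(2) inje j by (auto simp: C_def y_def)
  have cnt: "m ''cnt'' 0 = Suc j" and ord: "m ''ord'' = ord" using inv j by (auto simp: colour_inv_def)
  have cf: "card {k. k < 5 \<and> \<not> clash m y k} = card (avail C c' (e y))"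
    by (rule card_free[OF fr y(1) c'st c'out])
  let ?W = "N (e y) \<inter> (C - P)"
  have "c' ` (N (e y) \<inter> C) \<subseteq> c ` (N (e y) \<inter> P) \<union> c' ` ?W" using c'(2) by auto
  then have "avail P c (e y) - c' ` ?W \<subseteq> avail C c' (e y)" by (auto simp: avail_def)
  then have "card (avail P c (e y) - c' ` ?W) \<le> card (avail C c' (e y))"
    using finite_avail[OF y(3)] card_mono by blast
  moreover have "card (avail P c (e y)) - card (c' ` ?W) \<le> card (avail P c (e y) - c' ` ?W)"
    using finite_N by (intro diff_card_le_card_Diff) simp
  moreover have "card (c' ` ?W) \<le> card ?W" using finite_N by (intro card_image_le) simp
  moreover have "?W \<subseteq> N (e y) - P - e ` ord ` {..<j}" using inje j by (auto simp: C_def)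
  then have "card ?W \<le> card (N (e y) - P - e ` ord ` {..<j})" using finite_N by (intro card_mono) simp_all
  moreover have "card (N (e y) - P - e ` ord ` {..<j}) < card (avail P c (e y))" using peel j(1) by (simp add: y_def)
  ultimately have "0 < card (avail C c' (e y))" by linarith
  then have "0 < card {k. k < 5 \<and> \<not> clash m y k}" unfolding cf .
  then have ex: "\<exists>k<5. \<not> clash m y k" by (metis (mono_tags, lifting) card_gt_0_iff empty_Collect_eq)
  have own: "nbm m y l \<noteq> y" if "l < 6" for l using nb_own[OF y(1) that] fr_simps(1)[OF fr] by simp
  obtain z where z: "z < 5" "\<not> clash m y z" "run colour_body m ''out'' = (m ''out'')(y := colm m y z)"
    "run colour_body m ''st'' = (m ''st'')(y := 1)" "run colour_body m ''cnt'' 0 = j"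
    using run_colour_body[OF cnt _ own ex] ord by (auto simp: y_def)
  have zf: "colm m y z = cl y z" using fr_simps(2)[OF fr] by simp
  have "cl y z \<in> avail C c' (e y)"
    using clash_iff[OF fr y(1) c'st c'out] z(1,2) bij_cl[OF y(1)] by (auto simp: avail_def bij_betw_def)
  then have pc: "pcol (insert (e y) C) (c'(e y := cl y z))"
    using pcol_upd[OF c'(1) y(3) yC] by blast
  have "{k - Suc i..<k} = insert j {k - i..<k}" using j by auto
  then have ins: "P \<union> e ` ord ` {k - Suc i..<k} = insert (e y) C" by (auto simp: C_def y_def)
  have o: "run colour_body m ''ord'' = ord" using run_unwritten[of "''ord''" colour_body m] written_codes(3) ord by auto
  show ?thesis unfolding colour_inv_def ins
  proof (intro conjI exI[of _ "c'(e y := cl y z)"])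
    show "\<forall>v\<in>P. (c'(e y := cl y z)) v = c v" using c'(2) y(2) by auto
    show "\<forall>j<n. (run colour_body m ''st'' j = 1 \<longleftrightarrow> e j \<in> insert (e y) C) \<and>
      (e j \<in> insert (e y) C \<longrightarrow> run colour_body m ''out'' j = (c'(e y := cl y z)) (e j))"
      using c'st c'out e_inj y(1) unfolding z(3,4) zf by auto
  qed (use o z(5) j pc in auto)
qed

definition good :: "recipe \<Rightarrow> 'a set \<Rightarrow> ('a \<Rightarrow> nat) \<Rightarrow> bool" where
  "good ps P c \<longleftrightarrow> recipe_for ps P c \<and> pcol P c \<and> V - P \<subseteq> peel P c"

lemma phase_check:
  assumes "fr m" "m ''ok'' 0 = 1"
  shows "phase m (for_loop ''i'' (var ''size'') check_body) (n * (cost check_body + 2) + 2)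
    (\<lambda>m'. fr m' \<and> m' ''out'' = m ''out'' \<and> m' ''ok'' 0 = (if valid m then 1 else 0))"
proof -
  define ok where "ok i \<longleftrightarrow> (\<exists>k<5. m ''out'' i = cl i k) \<and> \<not> (\<exists>k<6. m ''out'' i = m ''out'' (nb i k))" for i
  have "phase m (for_loop ''i'' (var ''size'') check_body) (n * (cost check_body + 2) + 2)
    (\<lambda>m'. fr m' \<and> (m' ''out'' = m ''out'' \<and> m' ''ok'' 0 = (if \<forall>j<n. ok j then 1 else 0)))"
  proof (rule phase_for)
    fix i m' assume h: "m' ''i'' 0 = i" "fr m'"
      "m' ''out'' = m ''out'' \<and> m' ''ok'' 0 = (if \<forall>j<i. ok j then 1 else 0)"
    let ?m = "(run check_body m')(''i'' := (run check_body m' ''i'')(0 := Suc i))"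
    have "?m ''out'' = m ''out''" using run_unwritten[of "''out''" check_body m'] written_codes(4) h(3) by auto
    moreover have "?m ''ok'' 0 = (if ok i then m' ''ok'' 0 else 0)"
      using h unfolding ok_def by (simp add: run_check_body fr_simps[OF h(2)])
    ultimately show "?m ''out'' = m ''out'' \<and> ?m ''ok'' 0 = (if \<forall>j<Suc i. ok j then 1 else 0)"
      using h(3) by (auto simp: less_Suc_eq)
  qed (use assms written_codes(4) in auto)
  moreover have "(\<forall>j<n. ok j) \<longleftrightarrow> valid m"
  proof -
    have "(\<exists>k<5. z = cl i k) \<longleftrightarrow> z \<in> L (e i)" if "i < n" for i z
    proof -
      have "L (e i) = cl i ` {..<5}" using bij_cl[OF that] by (simp add: bij_betw_def)
      then show ?thesis by auto
    qed
    then show ?thesis by (auto simp: ok_def valid_def)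
  qed
  ultimately show ?thesis by simp
qed

text \<open>Two claims at once: the flag \<open>ok\<close> is truthful for every recipe, thanks to
  the final check, and it is set whenever the recipe describes a successful precolouring.\<close>

lemma phase_attempt:
  assumes m: "fr m"
  shows "phase m (attempt ps) (n * steps ps)
    (\<lambda>m'. fr m' \<and> (m' ''ok'' 0 = 0 \<or> m' ''ok'' 0 = 1 \<and> valid m') \<and> (good ps P c \<longrightarrow> m' ''ok'' 0 = 1))"
    (is "phase m _ _ ?Q")
proof -
  let ?J3 = "\<lambda>h m. good ps P c \<longrightarrow> peel_inv P c h m"
  have "phase m (attempt ps) ((n * (cost init_body + 2) + 2) + (1 + (1 + (cost (recipe_code ps) +
      ((7 * n * (cost peel_body + 2) + 2) + ((n * (cost colour_body + 2) + 2) + (1 +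
      ((n * (cost check_body + 2) + 2) + 1)))))))) ?Q"
    unfolding attempt_def
  proof (rule phase_seqs_Cons[OF phase_init[OF m]])
    fix m1 assume m1: "fr m1 \<and> (\<forall>j<n. m1 ''st'' j = 0 \<and> m1 ''q'' j = j)"
    show "phase m1 (seqs [Assign ''t'' (Const 0) (var ''size''), Assign ''cnt'' (Const 0) (Const 0), recipe_code ps,
     for_loop ''h'' (Plus (times6 (var ''size'')) (var ''size'')) peel_body,
     for_loop ''i'' (var ''size'') colour_body, Assign ''ok'' (Const 0) (Const 1),
     for_loop ''i'' (var ''size'') check_body]) (1 + (1 + (cost (recipe_code ps) +
      ((7 * n * (cost peel_body + 2) + 2) + ((n * (cost colour_body + 2) + 2) + (1 +
      ((n * (cost check_body + 2) + 2) + 1))))))) ?Q"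
    proof (rule phase_seqs_Cons[where P = "\<lambda>m2. m2 = setv ''t'' n m1"])
      show "phase m1 (Assign ''t'' (Const 0) (var ''size'')) 1 (\<lambda>m2. m2 = setv ''t'' n m1)"
        using phase_loop_free[of "Assign ''t'' (Const 0) (var ''size'')" "\<lambda>m2. m2 = setv ''t'' n m1" m1]
          fr_simps(3)[of m1] m1 by simp
      fix m2 assume m2: "m2 = setv ''t'' n m1"
      let ?m3 = "setv ''cnt'' 0 m2"
      show "phase m2 (seqs [Assign ''cnt'' (Const 0) (Const 0), recipe_code ps,
         for_loop ''h'' (Plus (times6 (var ''size'')) (var ''size'')) peel_body,
         for_loop ''i'' (var ''size'') colour_body, Assign ''ok'' (Const 0) (Const 1),
         for_loop ''i'' (var ''size'') check_body]) (1 + (cost (recipe_code ps) +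
          ((7 * n * (cost peel_body + 2) + 2) + ((n * (cost colour_body + 2) + 2) + (1 +
          ((n * (cost check_body + 2) + 2) + 1)))))) ?Q"
      proof (rule phase_seqs_Cons[where P = "\<lambda>m3. m3 = ?m3"])
        show "phase m2 (Assign ''cnt'' (Const 0) (Const 0)) 1 (\<lambda>m3. m3 = ?m3)"
          using phase_loop_free[of "Assign ''cnt'' (Const 0) (Const 0)" "\<lambda>m3. m3 = ?m3" m2] by simp
        fix m3 assume "m3 = ?m3"
        then have m3: "fr m3" "m3 ''t'' 0 = n" "m3 ''cnt'' 0 = 0" "\<And>j. j < n \<Longrightarrow> m3 ''st'' j = 0 \<and> m3 ''q'' j = j"
          using m1 m2 by (auto simp: fr_def)
        show "phase m3 (seqs [recipe_code ps,
         for_loop ''h'' (Plus (times6 (var ''size'')) (var ''size'')) peel_body,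
         for_loop ''i'' (var ''size'') colour_body, Assign ''ok'' (Const 0) (Const 1),
         for_loop ''i'' (var ''size'') check_body]) (cost (recipe_code ps) +
          ((7 * n * (cost peel_body + 2) + 2) + ((n * (cost colour_body + 2) + 2) + (1 +
          ((n * (cost check_body + 2) + 2) + 1))))) ?Q"
        proof (rule phase_seqs_Cons[where P = "\<lambda>m4. fr m4 \<and> ?J3 0 m4"])
          let ?m4 = "run (recipe_code ps) m3"
          have "fr ?m4" using fr_run[OF m3(1)] written_codes(5)[of ps] by auto
          moreover have "peel_inv P c 0 ?m4" if "good ps P c"
          proof -
            have u: "?m4 ''t'' = m3 ''t''" "?m4 ''cnt'' = m3 ''cnt''" "?m4 ''q'' = m3 ''q''"
              by (rule run_unwritten; use written_codes(5)[of ps] in auto)+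
            have "\<forall>i<n. ?m4 ''st'' i = (if e i \<in> P then 1 else 0) \<and> (e i \<in> P \<longrightarrow> ?m4 ''out'' i = c (e i))"
              using run_recipe[OF m3(1), of ps P c] m3(4) that by (simp add: good_def)
            then show ?thesis unfolding peel_inv_def Let_def u m3(2,3) using m3(4) by auto
          qed
          ultimately show "phase m3 (recipe_code ps) (cost (recipe_code ps)) (\<lambda>m4. fr m4 \<and> ?J3 0 m4)"
            by (intro phase_loop_free) auto
          fix m4 assume m4: "fr m4 \<and> ?J3 0 m4"
          show "phase m4 (seqs [for_loop ''h'' (Plus (times6 (var ''size'')) (var ''size'')) peel_body,
             for_loop ''i'' (var ''size'') colour_body, Assign ''ok'' (Const 0) (Const 1),
             for_loop ''i'' (var ''size'') check_body])
              ((7 * n * (cost peel_body + 2) + 2) + ((n * (cost colour_body + 2) + 2) + (1 +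
              ((n * (cost check_body + 2) + 2) + 1)))) ?Q"
          proof (rule phase_seqs_Cons[where P = "\<lambda>m5. fr m5 \<and> ?J3 (7 * n) m5"])
            show "phase m4 (for_loop ''h'' (Plus (times6 (var ''size'')) (var ''size'')) peel_body)
              (7 * n * (cost peel_body + 2) + 2) (\<lambda>m5. fr m5 \<and> ?J3 (7 * n) m5)"
            proof (rule phase_for)
              show "good ps P c \<longrightarrow> peel_inv P c 0 (setv ''h'' 0 m4)"
              proof -
                have "peel_inv P c 0 (setv ''h'' 0 m4) = peel_inv P c 0 m4" by (rule peel_inv_cong) auto
                then show ?thesis using m4 by simp
              qed
              fix i m' assume h: "m' ''h'' 0 = i" "fr m'" "good ps P c \<longrightarrow> peel_inv P c i m'"
              show "good ps P c \<longrightarrow> peel_inv P c (Suc i) (setv ''h'' (Suc i) (run peel_body m'))"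
              proof
                assume g: "good ps P c"
                have "peel_inv P c (Suc i) (run peel_body m')" using peel_step[OF h(2,1)] h(3) g by blast
                moreover have "peel_inv P c (Suc i) (setv ''h'' (Suc i) (run peel_body m')) =
                  peel_inv P c (Suc i) (run peel_body m')" by (rule peel_inv_cong) auto
                ultimately show "peel_inv P c (Suc i) (setv ''h'' (Suc i) (run peel_body m'))" by simp
              qed
            qed (use m4 written_codes(2) in auto)
            fix m5 assume m5: "fr m5 \<and> ?J3 (7 * n) m5"
            show "phase m5 (seqs [for_loop ''i'' (var ''size'') colour_body, Assign ''ok'' (Const 0) (Const 1),
              for_loop ''i'' (var ''size'') check_body]) ((n * (cost colour_body + 2) + 2) + (1 +
              ((n * (cost check_body + 2) + 2) + 1))) ?Q"
            proof (rule phase_seqs_Cons[where P = "\<lambda>m6. fr m6 \<and> (good ps P c \<longrightarrow> valid m6)"])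
              let ?I = "colour_inv P c (m5 ''ord'') (m5 ''cnt'' 0)"
              have "phase m5 (for_loop ''i'' (var ''size'') colour_body) (n * (cost colour_body + 2) + 2)
                (\<lambda>m6. fr m6 \<and> (good ps P c \<longrightarrow> ?I n m6))"
              proof (rule phase_for)
                show "good ps P c \<longrightarrow> ?I 0 (setv ''i'' 0 m5)"
                proof
                  assume g: "good ps P c"
                  then have I: "peel_inv P c (7 * n) m5" using m5 by blast
                  have "\<forall>j<n. (m5 ''st'' j = 1 \<longleftrightarrow> e j \<in> P) \<and> (e j \<in> P \<longrightarrow> m5 ''out'' j = c (e j))"
                    using I unfolding peel_inv_def Let_def by auto
                  then show "?I 0 (setv ''i'' 0 m5)" using g by (auto simp: colour_inv_def good_def)
                qed
                fix i m' assume h: "m' ''i'' 0 = i" "fr m'" "good ps P c \<longrightarrow> ?I i m'"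
                show "good ps P c \<longrightarrow> ?I (Suc i) (setv ''i'' (Suc i) (run colour_body m'))"
                proof
                  assume g: "good ps P c"
                  then have I: "peel_inv P c (7 * n) m5" using m5 by blast
                  have "?I (Suc i) (run colour_body m')"
                    by (rule colour_step[OF h(2)]) (use h(3) g I in \<open>auto simp: peel_inv_def Let_def\<close>)
                  then show "?I (Suc i) (setv ''i'' (Suc i) (run colour_body m'))" by (simp add: colour_inv_def)
                qed
              qed (use m5 written_codes(3) in auto)
              moreover have "valid m6" if g: "good ps P c" and I6: "?I n m6" for m6
              proof -
                have I: "peel_inv P c (7 * n) m5" "V - P \<subseteq> peel P c" using m5 g by (auto simp: good_def)
                have z: "m5 ''cnt'' 0 - n = 0" using peel_done(2)[OF I] by simp
                have PV: "P \<union> e ` m5 ''ord'' ` {0..<m5 ''cnt'' 0} = V"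
                  using peel_done(1)[OF I] g by (auto simp: good_def pcol_def atLeast0LessThan)
                obtain c' where "pcol V c'" "\<forall>j<n. e j \<in> V \<longrightarrow> m6 ''out'' j = c' (e j)"
                  using I6 unfolding colour_inv_def z PV by blast
                then have "\<forall>j<n. m6 ''out'' j = c' (e j)" "\<forall>v\<in>V. c' v \<in> L v" "\<forall>u\<in>V. \<forall>v\<in>V. E u v \<longrightarrow> c' u \<noteq> c' v"
                  using e_V by (auto simp: pcol_def)
                moreover have "E (e j) (e (nb j k))" if "j < n" "k < 6" for j k
                  using N_nb[OF that(1)] that(2) by (auto simp: nbhd_def)
                ultimately show ?thesis using e_V nb_less by (simp add: valid_def)
              qed
              ultimately show "phase m5 (for_loop ''i'' (var ''size'') colour_body) (n * (cost colour_body + 2) + 2)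
                (\<lambda>m6. fr m6 \<and> (good ps P c \<longrightarrow> valid m6))" unfolding phase_def by blast
              fix m6 assume m6: "fr m6 \<and> (good ps P c \<longrightarrow> valid m6)"
              let ?m7 = "setv ''ok'' 1 m6"
              show "phase m6 (seqs [Assign ''ok'' (Const 0) (Const 1),
                for_loop ''i'' (var ''size'') check_body]) (1 + ((n * (cost check_body + 2) + 2) + 1)) ?Q"
              proof (rule phase_seqs_Cons[where P = "\<lambda>m7. m7 = ?m7"])
                show "phase m6 (Assign ''ok'' (Const 0) (Const 1)) 1 (\<lambda>m7. m7 = ?m7)"
                  using phase_loop_free[of "Assign ''ok'' (Const 0) (Const 1)" "\<lambda>m7. m7 = ?m7" m6] by simp
                fix m7 assume m7: "m7 = ?m7"
                then have f7: "fr m7" "m7 ''ok'' 0 = 1" "valid m7 = valid m6" using m6 by (auto simp: fr_def valid_def)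
                show "phase m7 (seqs [for_loop ''i'' (var ''size'') check_body])
                  ((n * (cost check_body + 2) + 2) + 1) ?Q"
                proof (rule phase_seqs_Cons[OF phase_check[OF f7(1,2)] phase_seqs_Nil])
                  fix m8 assume m8: "fr m8 \<and> m8 ''out'' = m7 ''out'' \<and> m8 ''ok'' 0 = (if valid m7 then 1 else 0)"
                  then have "valid m8 = valid m7" by (simp add: valid_def)
                  then show "?Q m8" using m8 f7(3) m6 by auto
                qed
              qed
            qed
          qed
        qed
      qed
    qed
  qed
  moreover have "1 \<le> n" using ne finite_V by (simp add: Suc_le_eq card_gt_0_iff)
  then have le: "x \<le> n * x" for x by simp
  have "(n * (cost init_body + 2) + 2) + (1 + (1 + (cost (recipe_code ps) +
      ((7 * n * (cost peel_body + 2) + 2) + ((n * (cost colour_body + 2) + 2) + (1 +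
      ((n * (cost check_body + 2) + 2) + 1))))))) \<le> n * steps ps"
    unfolding steps_def add_mult_distrib2
    using le[of "12 + cost (recipe_code ps)"] by (simp add: mult.left_commute mult.assoc add_mult_distrib2)
  ultimately show ?thesis unfolding phase_def using runs_mono by blast
qed

end

section \<open>Trying all recipes\<close>

lemma phase_Cond:
  assumes "bval b m \<Longrightarrow> phase m p k Q" "\<not> bval b m \<Longrightarrow> phase m q k Q"
  shows "phase m (Cond b p q) (k + 1) Q"
proof (cases "bval b m")
  case True
  then show ?thesis using assms(1) exec_Cond_True[OF True] unfolding phase_def runs_def
    by (meson add_le_mono1)
next
  case False
  then show ?thesis using assms(2) exec_Cond_False[OF False] unfolding phase_def runs_def
    by (meson add_le_mono1)
qed

lemma phase_mono: "phase m p k Q \<Longrightarrow> k \<le> k' \<Longrightarrow> phase m p k' Q"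
  unfolding phase_def using runs_mono by blast

text \<open>Any enumeration of this finite set will do; the bounds are those of \<open>plan\<close>,
  so neither the program nor its constant depends on the graph.\<close>

definition recipes :: "recipe list" where
  "recipes = (SOME pss. set pss = {ps. set ps \<subseteq> {ks. set ks \<subseteq> {..<6} \<and> length ks \<le> 10} \<times> {..<5} \<and> length ps \<le> 12})"

lemma set_recipes:
  "set recipes = {ps. set ps \<subseteq> {ks. set ks \<subseteq> {..<6} \<and> length ks \<le> 10} \<times> {..<5} \<and> length ps \<le> 12}"
proof -
  have "finite {ps :: recipe. set ps \<subseteq> {ks. set ks \<subseteq> {..<6} \<and> length ks \<le> 10} \<times> {..<5} \<and> length ps \<le> 12}"
    by (intro finite_lists_length_le finite_cartesian_product) auto
  then show ?thesis unfolding recipes_def by (rule someI_ex[OF finite_list])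
qed

context encoded
begin

text \<open>After a success the remaining attempts are skipped, so the valid colouring in
  \<open>out\<close> is not overwritten.\<close>

lemma phase_main:
  assumes "fr m" "m ''ok'' 0 = 0 \<or> m ''ok'' 0 = 1 \<and> valid m"
  shows "phase m (main_code pss) (n * (sum_list (map (\<lambda>ps. steps ps + 2) pss) + 1))
    (\<lambda>m'. (m' ''ok'' 0 = 0 \<or> m' ''ok'' 0 = 1 \<and> valid m') \<and>
      (m ''ok'' 0 = 1 \<or> (\<exists>ps\<in>set pss. good ps P c) \<longrightarrow> m' ''ok'' 0 = 1))"
  using assms
proof (induction pss arbitrary: m)
  case Nil
  have "1 \<le> n" using ne finite_V by (simp add: Suc_le_eq card_gt_0_iff)
  then show ?case using Nil unfolding main_code_def list.map by (intro phase_mono[OF phase_seqs_Nil]) auto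
next
  case (Cons ps pss)
  have n: "1 \<le> n" using ne finite_V by (simp add: Suc_le_eq card_gt_0_iff)
  let ?Q = "\<lambda>m'. fr m' \<and> (m' ''ok'' 0 = 0 \<or> m' ''ok'' 0 = 1 \<and> valid m') \<and>
    (m ''ok'' 0 = 1 \<or> good ps P c \<longrightarrow> m' ''ok'' 0 = 1)"
  have first: "phase m (Cond (Equal (var ''ok'') (Const 0)) (attempt ps) Skip) (n * (steps ps + 2)) ?Q"
  proof (rule phase_mono[OF phase_Cond])
    show "phase m (attempt ps) (n * steps ps + 1) ?Q" if b: "bval (Equal (var ''ok'') (Const 0)) m"
    proof -
      have "m ''ok'' 0 = 0" using b by simp
      then show ?thesis using phase_mono[OF phase_attempt[OF Cons.prems(1), of ps P c], of "n * steps ps + 1"] by simp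
    qed
    show "phase m Skip (n * steps ps + 1) ?Q" if b: "\<not> bval (Equal (var ''ok'') (Const 0)) m"
      by (rule phase_mono[OF phase_loop_free]) (use b Cons.prems in auto)
    show "n * steps ps + 1 + 1 \<le> n * (steps ps + 2)" using n by (simp add: add_mult_distrib2)
  qed
  have "main_code (ps # pss) = Seq (Cond (Equal (var ''ok'') (Const 0)) (attempt ps) Skip) (main_code pss)"
    by (simp add: main_code_def)
  moreover have "phase m (Seq (Cond (Equal (var ''ok'') (Const 0)) (attempt ps) Skip) (main_code pss))
    (n * (steps ps + 2) + n * (sum_list (map (\<lambda>ps. steps ps + 2) pss) + 1))
    (\<lambda>m'. (m' ''ok'' 0 = 0 \<or> m' ''ok'' 0 = 1 \<and> valid m') \<and>
      (m ''ok'' 0 = 1 \<or> (\<exists>ps\<in>set (ps # pss). good ps P c) \<longrightarrow> m' ''ok'' 0 = 1))"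
  proof (rule phase_Seq[OF first])
    fix m1 assume m1: "?Q m1"
    obtain m2 where "runs (main_code pss) m1 (n * (sum_list (map (\<lambda>ps. steps ps + 2) pss) + 1)) m2"
      "m2 ''ok'' 0 = 0 \<or> m2 ''ok'' 0 = 1 \<and> valid m2"
      "m1 ''ok'' 0 = 1 \<or> (\<exists>ps\<in>set pss. good ps P c) \<longrightarrow> m2 ''ok'' 0 = 1"
      using Cons.IH[of m1] m1 unfolding phase_def by blast
    then show "phase m1 (main_code pss) (n * (sum_list (map (\<lambda>ps. steps ps + 2) pss) + 1))
      (\<lambda>m'. (m' ''ok'' 0 = 0 \<or> m' ''ok'' 0 = 1 \<and> valid m') \<and>
      (m ''ok'' 0 = 1 \<or> (\<exists>ps\<in>set (ps # pss). good ps P c) \<longrightarrow> m' ''ok'' 0 = 1))"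
      unfolding phase_def using m1 by (intro exI[of _ m2]) auto
  qed
  ultimately show ?case by (simp add: add_mult_distrib2 algebra_simps)
qed

lemma walk_append: "walk m i (ks @ [k]) = nbm m (walk m i ks) k"
  by (induction ks arbitrary: i) auto

lemma ball_walk:
  assumes "v \<in> ball (e 0) r"
  shows "\<exists>ks. set ks \<subseteq> {..<6} \<and> length ks \<le> r \<and> walk m0 0 ks < n \<and> e (walk m0 0 ks) = v"
  using assms
proof (induction r arbitrary: v)
  case 0
  then show ?case using ne finite_V by (intro exI[of _ "[]"]) (auto simp: card_gt_0_iff)
next
  case (Suc r)
  then consider "v \<in> ball (e 0) r" | u where "u \<in> ball (e 0) r" "v \<in> N u" by auto
  then show ?case
  proof cases
    case 1
    then show ?thesis using Suc.IH[of v] le_SucI by blast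
  next
    case 2
    obtain ks where ks: "set ks \<subseteq> {..<6}" "length ks \<le> r" "walk m0 0 ks < n" "e (walk m0 0 ks) = u"
      using Suc.IH[OF 2(1)] by blast
    obtain k where k: "k < 6" "v = e (nb (walk m0 0 ks) k)"
      using 2(2) N_nb[OF ks(3)] unfolding ks(4) by auto
    show ?thesis using ks k nb_less by (intro exI[of _ "ks @ [k]"]) (auto simp: walk_append)
  qed
qed

text \<open>A plan is known only to exist. Its vertices are within reach of walks of length 10 and
  its colours have positions in their lists, so one of the enumerated recipes realizes it.\<close>

lemma plan_recipe:
  assumes "plan (e 0)"
  shows "\<exists>ps\<in>set recipes. \<exists>P c. good ps P c"
proof -
  obtain P c where P: "pcol P c" "P \<subseteq> ball (e 0) 10" "card P \<le> 12" "V - P \<subseteq> peel P c"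
    using assms unfolding plan_def by blast
  have fP: "finite P" using P(1) finite_V finite_subset by (auto simp: pcol_def)
  obtain vs where vs: "set vs = P" "distinct vs" using finite_distinct_list[OF fP] by blast
  have "\<forall>v\<in>P. \<exists>ks. set ks \<subseteq> {..<6} \<and> length ks \<le> 10 \<and> walk m0 0 ks < n \<and> e (walk m0 0 ks) = v"
    using ball_walk P(2) by blast
  then obtain ks where ks: "\<forall>v\<in>P. set (ks v) \<subseteq> {..<6} \<and> length (ks v) \<le> 10 \<and> walk m0 0 (ks v) < n \<and>
    e (walk m0 0 (ks v)) = v" by metis
  have "\<forall>v\<in>P. \<exists>k<5. cl (walk m0 0 (ks v)) k = c v"
  proof
    fix v assume v: "v \<in> P"
    have "c v \<in> L (e (walk m0 0 (ks v)))" using P(1) ks v by (simp add: pcol_def)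
    also have "L (e (walk m0 0 (ks v))) = cl (walk m0 0 (ks v)) ` {..<5}"
      using bij_cl ks v by (auto simp: bij_betw_def)
    finally show "\<exists>k<5. cl (walk m0 0 (ks v)) k = c v" by auto
  qed
  then obtain k where k: "\<forall>v\<in>P. k v < 5 \<and> cl (walk m0 0 (ks v)) (k v) = c v" by metis
  let ?ps = "map (\<lambda>v. (ks v, k v)) vs"
  have "length ?ps \<le> 12" using P(3) vs distinct_card by fastforce
  then have "?ps \<in> set recipes" unfolding set_recipes using ks k vs(1) by auto
  moreover have "recipe_for ?ps P c" using ks k vs(1) by (auto simp: recipe_for_def image_image)
  ultimately show ?thesis using P by (auto simp: good_def)
qed

lemma main_correct:
  assumes "plan (e 0)"
  shows "\<exists>k m' c. exec (main_code recipes) m0 k m' \<and> k \<le> (sum_list (map (\<lambda>ps. steps ps + 2) recipes) + 1) * n \<and>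
    list_colouring V E L c \<and> (\<forall>i<n. m' ''out'' i = c (e i))"
proof -
  obtain ps P c where g: "ps \<in> set recipes" "good ps P c" using plan_recipe[OF assms] by blast
  have "fr m0" by (simp add: fr_def)
  moreover have "m0 ''ok'' 0 = 0" using enc by (simp add: encodes_def)
  ultimately obtain m' where "runs (main_code recipes) m0 (n * (sum_list (map (\<lambda>ps. steps ps + 2) recipes) + 1)) m'"
    "valid m'" using phase_main[of m0 recipes P c] g unfolding phase_def by auto
  then show ?thesis using valid_colouring unfolding runs_def by (metis mult.commute)
qed

end

text \<open>The plan is required at every vertex because the numbering, and with it the vertex
  number 0 where all walks start, is arbitrary.\<close>

lemma linear_time:
  assumes "\<And>V E L. K V E \<Longrightarrow> list_graph V E L \<Longrightarrow> V \<noteq> {} \<and> (\<forall>x\<in>V. list_graph.plan V E L x)"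
    and "\<And>V E. K V E \<Longrightarrow> simple_graph V E \<and> regular_graph 6 V E"
  shows "linear_time_5_list_colouring K"
  unfolding linear_time_5_list_colouring_def
proof (rule exI[of _ "main_code recipes"], rule exI[of _ "sum_list (map (\<lambda>ps. steps ps + 2) recipes) + 1"],
    intro allI impI)
  fix V E L e m
  assume h: "K V E \<and> (\<forall>v\<in>V. finite (L v) \<and> card (L v) = 5) \<and> encodes e V E L m"
  have lg: "list_graph V E L" using h assms(2)[of V E] by (simp add: list_graph_def)
  then have p: "V \<noteq> {}" "\<forall>x\<in>V. list_graph.plan V E L x" using assms(1)[of V E L] h by blast+
  interpret encoded V E L e m
    using lg p(1) h by (simp add: encoded_def encoded_axioms_def)
  have "e 0 \<in> V" using e_V p(1) finite_V by (simp add: card_gt_0_iff)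
  then show "\<exists>k m' c. exec (main_code recipes) m k m' \<and>
    k \<le> (sum_list (map (\<lambda>ps. steps ps + 2) recipes) + 1) * card V \<and>
    list_colouring V E L c \<and> (\<forall>i<card V. m' ''out'' i = c (e i))" using main_correct p(2) by blast
qed

section \<open>From the algorithm to the choice number\<close>

lemma ex_encoding:
  assumes "list_graph V E L"
  shows "\<exists>e m. encodes e V E L m"
proof -
  interpret list_graph V E L by fact
  obtain e where e: "bij_betw e {..<card V} V"
    using ex_bij_betw_nat_finite[OF finite_V] by (auto simp: atLeast0LessThan)
  have eV: "e i \<in> V" if "i < card V" for i using e that by (auto simp: bij_betw_def)
  have "\<exists>g. bij_betw g {..<6 :: nat} (N v)" if "v \<in> V" for v
    using ex_bij_betw_nat_finite[OF finite_N, of v] card_N[OF that] by (auto simp: atLeast0LessThan)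
  then obtain g where g: "\<And>v. v \<in> V \<Longrightarrow> bij_betw (g v) {..<6 :: nat} (N v)" by metis
  have "\<exists>h. bij_betw h {..<5 :: nat} (L v)" if "v \<in> V" for v
    using ex_bij_betw_nat_finite[of "L v"] lists[OF that] by (auto simp: atLeast0LessThan)
  then obtain h where h: "\<And>v. v \<in> V \<Longrightarrow> bij_betw (h v) {..<5 :: nat} (L v)" by metis
  define ix where "ix v = inv_into {..<card V} e v" for v
  have ix: "e (ix v) = v" "ix v < card V" if "v \<in> V" for v
    using that e inv_into_into[of v e "{..<card V}"] f_inv_into_f[of v e "{..<card V}"]
    by (auto simp: bij_betw_def ix_def)
  define m :: memory where "m a i = (if a = ''size'' \<and> i = 0 then card V
    else if a = ''nbr'' \<and> i < 6 * card V then ix (g (e (i div 6)) (i mod 6))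
    else if a = ''col'' \<and> i < 5 * card V then h (e (i div 5)) (i mod 5) else 0)" for a i
  have nbr: "m ''nbr'' (6 * i + k) = ix (g (e i) k)" if "i < card V" "k < 6" for i k
    using that by (simp add: m_def)
  have col: "m ''col'' (5 * i + k) = h (e i) k" if "i < card V" "k < 5" for i k
    using that by (simp add: m_def)
  have gV: "g (e i) k \<in> V" if "i < card V" "k < 6" for i k
    using g[OF eV[OF that(1)]] that(2) N_subset by (auto simp: bij_betw_def)
  have "bij_betw (\<lambda>k. e (m ''nbr'' (6 * i + k))) {..<6} (N (e i))" if i: "i < card V" for i
  proof -
    have "bij_betw (\<lambda>k. e (m ''nbr'' (6 * i + k))) {..<6} (N (e i)) = bij_betw (g (e i)) {..<6} (N (e i))"
      by (rule bij_betw_cong) (simp add: nbr i ix gV)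
    then show ?thesis using g eV i by simp
  qed
  moreover have "bij_betw (\<lambda>k. m ''col'' (5 * i + k)) {..<5} (L (e i))" if i: "i < card V" for i
  proof -
    have "bij_betw (\<lambda>k. m ''col'' (5 * i + k)) {..<5} (L (e i)) = bij_betw (h (e i)) {..<5} (L (e i))"
      by (rule bij_betw_cong) (simp add: col i)
    then show ?thesis using h eV i by simp
  qed
  moreover have "m ''nbr'' (6 * i + k) < card V" if "i < card V" "k < 6" for i k
    using nbr ix gV that by simp
  moreover have "m ''size'' 0 = card V" "\<forall>a i. a \<notin> {''size'', ''nbr'', ''col''} \<longrightarrow> m a i = 0"
    "\<forall>i\<ge>1. m ''size'' i = 0" "\<forall>i\<ge>6 * card V. m ''nbr'' i = 0" "\<forall>i\<ge>5 * card V. m ''col'' i = 0"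
    by (auto simp: m_def)
  ultimately have "encodes e V E L m" using e unfolding encodes_def by blast
  then show ?thesis by blast
qed

text \<open>The colouring is the output of the algorithm on some encoding, after every list has been
  cut down to exactly five colours.\<close>

lemma choosable_5:
  assumes "linear_time_5_list_colouring K" "K V E" "simple_graph V E" "regular_graph 6 V E"
  shows "choosable 5 V E"
  unfolding choosable_def
proof (intro allI impI)
  fix L :: "'a \<Rightarrow> nat set"
  assume L: "\<forall>v\<in>V. infinite (L v) \<or> 5 \<le> card (L v)"
  have "\<forall>v\<in>V. \<exists>A. A \<subseteq> L v \<and> finite A \<and> card A = 5"
  proof
    fix v assume "v \<in> V"
    then have "infinite (L v) \<or> 5 \<le> card (L v)" using L by blast
    then show "\<exists>A. A \<subseteq> L v \<and> finite A \<and> card A = 5"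
      using infinite_arbitrarily_large obtain_subset_with_card_n by metis
  qed
  then obtain A where A: "\<forall>v\<in>V. A v \<subseteq> L v \<and> finite (A v) \<and> card (A v) = 5" by metis
  then have "list_graph V E A" using assms by (simp add: list_graph_def)
  then obtain e m where "encodes e V E A m" using ex_encoding by blast
  then obtain c where "list_colouring V E A c"
    using assms(1,2) A unfolding linear_time_5_list_colouring_def by metis
  then show "\<exists>c. list_colouring V E L c" using A by (auto simp: list_colouring_def)
qed

text \<open>Constant lists turn 3-choosability into a 3-colouring, and a face needs three colours.
  So the graph would be 3-chromatic, and the cover built for such triangulations yields the
  contradiction in all four cases.\<close>

lemma torus_not_choosable_3:
  fixes E :: "'a \<Rightarrow> 'a \<Rightarrow> bool"
  assumes T: "simple_6_regular_torus_triangulation V E"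
  shows "\<not> choosable 3 V E"
proof
  assume ch: "choosable 3 V E"
  obtain c where c: "list_colouring V E (\<lambda>_. {0, 1, 2}) c"
    using ch[unfolded choosable_def, rule_format, of "\<lambda>_. {0, 1, 2}"] by auto
  have "chromatic_number V E = 3"
    unfolding chromatic_number_def
  proof (rule Least_equality)
    show "\<exists>c. proper_colouring V E c \<and> c ` V \<subseteq> {..<3}"
      using c by (intro exI[of _ c]) (force simp: list_colouring_def)
    fix k
    assume "\<exists>c. proper_colouring V E c \<and> c ` V \<subseteq> {..<k}"
    then obtain d where d: "proper_colouring V E d" "d ` V \<subseteq> {..<k}" by blast
    obtain rot where rot: "\<And>v x. E v x \<Longrightarrow> E v (rot v x)"
      "\<And>u v. E u v \<Longrightarrow> rot (rot v u) v = u \<and> rot u (rot v u) = v" using torus_rotation[OF T] by metis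
    have G: "E x y \<Longrightarrow> x \<in> V \<and> y \<in> V \<and> E y x" for x y
      using T by (auto simp: simple_6_regular_torus_triangulation_def simple_graph_def)
    obtain v u where vu: "E v u" using torus_edge[OF T] by blast
    let ?w = "rot v u"
    have vw: "E v ?w" by (rule rot(1)[OF vu])
    have "E ?w (rot ?w v)" using rot(1) vw G by blast
    then have wu: "E ?w u" using rot(2)[of u v] vu G by simp
    have V: "v \<in> V" "u \<in> V" "?w \<in> V" using G vu vw by blast+
    have "d v \<noteq> d u" "d v \<noteq> d ?w" "d ?w \<noteq> d u" using d(1) V vu vw wu by (auto simp: proper_colouring_def)
    moreover have "d v < k" "d u < k" "d ?w < k" using d(2) V by auto
    ultimately show "3 \<le> k" by linarith
  qed
  then obtain \<phi> \<Lambda> where "three_cover V E \<phi> \<Lambda>" using ex_three_cover[OF T] by (auto simp: case4_def)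
  then show False using three_cover_not_choosable ch by blast
qed

lemma choosable_mono: "choosable k V E \<Longrightarrow> k \<le> k' \<Longrightarrow> choosable k' V E"
  unfolding choosable_def by (meson le_trans)

lemma choice_number_4_5:
  assumes "choosable 5 V E" "\<not> choosable 3 V E"
  shows "choice_number V E \<in> {4, 5}"
proof -
  have "choosable (choice_number V E) V E" unfolding choice_number_def by (rule LeastI) (rule assms(1))
  then have "\<not> choice_number V E \<le> 3" using assms(2) choosable_mono by blast
  moreover have "choice_number V E \<le> 5" unfolding choice_number_def by (rule Least_le) (rule assms(1))
  ultimately show ?thesis by auto
qed

lemma class_plan:
  assumes T: "simple_6_regular_torus_triangulation V E" and K: "K \<in> {case1, case2, case3, case4}" "K V E"
    and L: "list_graph V E L" and v: "v \<in> V"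
  shows "list_graph.plan V E L v"
proof -
  consider "case1 V E" | "case2 V E" | "case3 V E" | "case4 V E" using K by auto
  then show ?thesis
  proof cases
    case 1
    then show ?thesis using L v by (rule case1_plan)
  next
    case 2
    then show ?thesis using L v by (rule case2_plan)
  next
    case 3
    then show ?thesis using L v by (rule case3_plan)
  next
    case 4
    then obtain \<phi> \<Lambda> where "three_cover V E \<phi> \<Lambda>" using ex_three_cover[OF T] by blast
    then show ?thesis using L v by (rule three_cover_plan)
  qed
qed

lemma class_linear_time:
  assumes K: "K \<in> {case1, case2, case3, case4}"
  shows "linear_time_5_list_colouring (\<lambda>V E. simple_6_regular_torus_triangulation V E \<and> K V E)"
proof (rule linear_time)
  fix V :: "'a set" and E L
  assume h: "simple_6_regular_torus_triangulation V E \<and> K V E"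
  then show "simple_graph V E \<and> regular_graph 6 V E" by (simp add: simple_6_regular_torus_triangulation_def)
  assume L: "list_graph V E L"
  have "V \<noteq> {}" using h by (auto simp: simple_6_regular_torus_triangulation_def torus_triangulation_def
      torus_embedding_def connected_graph_def)
  then show "V \<noteq> {} \<and> (\<forall>x\<in>V. list_graph.plan V E L x)" using class_plan[OF _ K _ L] h by blast
qed

theorem theorem1:
  shows "(\<forall>(V :: 'a set) E.
            simple_6_regular_torus_triangulation V E \<and>
            (case1 V E \<or> case2 V E \<or> case3 V E \<or> case4 V E) \<longrightarrow>
            choosable 5 V E \<and> \<not> choosable 3 V E \<and> choice_number V E \<in> {4, 5})
       \<and> (\<forall>K \<in> {case1, case2, case3, case4}.
            linear_time_5_list_colouring
              (\<lambda>(V :: 'a set) E. simple_6_regular_torus_triangulation V E \<and> K V E))"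
proof (intro conjI ballI)
  show "linear_time_5_list_colouring (\<lambda>(V :: 'a set) E. simple_6_regular_torus_triangulation V E \<and> K V E)"
    if "K \<in> {case1, case2, case3, case4}" for K using that by (rule class_linear_time)
  show "\<forall>(V :: 'a set) E. simple_6_regular_torus_triangulation V E \<and>
      (case1 V E \<or> case2 V E \<or> case3 V E \<or> case4 V E) \<longrightarrow>
      choosable 5 V E \<and> \<not> choosable 3 V E \<and> choice_number V E \<in> {4, 5}"
  proof (intro allI impI)
    fix V :: "'a set" and E
    assume h: "simple_6_regular_torus_triangulation V E \<and> (case1 V E \<or> case2 V E \<or> case3 V E \<or> case4 V E)"
    then obtain K where K: "K \<in> {case1, case2, case3, case4}" "K V E" by blast
    have G: "simple_graph V E" "regular_graph 6 V E" using h by (simp_all add: simple_6_regular_torus_triangulation_def)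
    have "choosable 5 V E" by (rule choosable_5[OF class_linear_time[OF K(1)] _ G]) (use h K(2) in blast)
    moreover have "\<not> choosable 3 V E" using h torus_not_choosable_3 by blast
    ultimately show "choosable 5 V E \<and> \<not> choosable 3 V E \<and> choice_number V E \<in> {4, 5}"
      using choice_number_4_5 by blast
  qed
qed

end
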